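(* Let $C$ be an $n$-dimensional connected complex manifold holomorphically embedded in a complex manifold $M$ of dimension $n+d$. Suppose that the normal bundle $N_{C/M}$ admits transition functions that are locally constant unitary matrices (i.e. $N_{C/M}$ is Hermitian flat). Assume that there exists a connected finite étale Galois cover $p:\hat C\to C$ of complex manifolds such that the germ of neighborhood of $\hat C$ in the induced neighborhood $\hat M$ associated with $p$ is biholomorphic to a neighborhood of the zero section in the normal bundle $N_{\hat C/\hat M}$. Assume that $$H^0(\hat C, T_{\hat C}\otimes \mathrm{Sym}^l N^*_{\hat C/\hat M})=H^1(\hat C, T_{\hat C}\otimes \mathrm{Sym}^l N^*_{\hat C/\hat M})=0\quad\text{for all } l\ge 1,$$ $$H^0(\hat C, N_{\hat C/\hat M}\otimes \mathrm{Sym}^l N^*_{\hat C/\hat M})=H^1(\hat C, N_{\hat C/\hat M}\otimes \mathrm{Sym}^l N^*_{\hat C/\hat M})=0\quad\text{for all } l\ge 2.$$ Then a neighborhood of $C$ in $M$ is biholomorphic to a neighborhood of the zero section in the normal bundle $N_{C/M}$.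
   Context: Biholomorphism of neighborhoods: $(M_1,C)$ and $(M_2,C)$, with $C$ a complex submanifold of both, have biholomorphic (equivalent) neighborhoods of $C$ if there are open neighborhoods $U_i\subset M_i$ of $C$ and a biholomorphism $\Phi:U_1\to U_2$ with $\Phi|_C=\mathrm{id}_C$. In the total space of the normal bundle $N_{C/M}$, $C$ is embedded as the zero section (similarly for $\hat C$ in $N_{\hat C/\hat M}$). Induced neighborhood: given a finite étale Galois cover $p:\hat C\to C$, after shrinking $M$ around $C$ there is a smooth retraction $\pi:M\to C$ with $\pi|_C=\mathrm{id}_C$. Set $\hat M:=M\times_C\hat C$ (fiber product via $\pi$ and $p$), with projection $\hat p:\hat M\to M$, which is a covering. Endow $\hat M$ with the unique complex structure making $\hat p$ locally biholomorphic. Then $\hat C$ is holomorphically embedded in $\hat M$ via $x\mapsto (p(x),x)$, and $\hat p$ is a holomorphic covering that restricts to $p$ on $\hat C$. The germ of $\hat M$ along $\hat C$ is called the induced neighborhood associated with $p$. One has $N_{\hat C/\hat M}= p^*N_{C/M}$. $N^*$ denotes the dual (conormal) bundle and cohomology is that of sheaves of holomorphic sections. *)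

theory Defs
  imports "HOL-Analysis.Analysis" "HOL-Library.Function_Algebras"
begin

section \<open>Holomorphic and smooth maps between open sets of coordinate spaces\<close>

text \<open>A function of several complex variables on an open set is holomorphic if it is
  differentiable at each point with complex linear derivative.\<close>

definition holo_on :: "(complex^'k) set \<Rightarrow> (complex^'k \<Rightarrow> complex) \<Rightarrow> bool" where
  "holo_on S f \<longleftrightarrow> (\<forall>z\<in>S. \<exists>D. (f has_derivative D) (at z) \<and> (\<forall>c v. D (c *s v) = c * D v))"

definition holo_vec_on :: "(complex^'k) set \<Rightarrow> (complex^'k \<Rightarrow> complex^'l) \<Rightarrow> bool" where
  "holo_vec_on S f \<longleftrightarrow> (\<forall>i. holo_on S (\<lambda>z. f z $ i))"

text \<open>Real \<open>C\<^sup>k\<close>-maps on an open set: the last clause asks all directional derivatives to be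
  \<open>C\<^sup>k\<close>, which in finite dimensions says that the derivative is.\<close>

primrec Ck_on :: "nat \<Rightarrow> 'a::real_normed_vector set \<Rightarrow> ('a \<Rightarrow> 'b::real_normed_vector) \<Rightarrow> bool" where
  "Ck_on 0 S f \<longleftrightarrow> continuous_on S f"
| "Ck_on (Suc k) S f \<longleftrightarrow>
     (\<exists>f'. (\<forall>x\<in>S. (f has_derivative f' x) (at x)) \<and> (\<forall>v. Ck_on k S (\<lambda>x. f' x v)))"

definition smooth_on :: "'a::real_normed_vector set \<Rightarrow> ('a \<Rightarrow> 'b::real_normed_vector) \<Rightarrow> bool" where
  "smooth_on S f \<longleftrightarrow> (\<forall>k. Ck_on k S f)"

definition complex_jacobian :: "(complex^'k \<Rightarrow> complex^'l) \<Rightarrow> complex^'k \<Rightarrow> complex^'k^'l" where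
  "complex_jacobian f z = matrix (frechet_derivative f (at z))"

section \<open>Complex manifolds\<close>

text \<open>A chart is a domain together with a coordinate map; the values of the coordinate map
  outside the domain are irrelevant. The complex dimension is \<open>CARD('k)\<close>.\<close>

type_synonym ('a, 'k) chart = "'a set \<times> ('a \<Rightarrow> complex^'k)"

record ('a, 'k) cmfd =
  mtop :: "'a topology"
  atlas :: "('a, 'k::finite) chart set"

abbreviation chart_inv :: "('a, 'k::finite) chart \<Rightarrow> complex^'k \<Rightarrow> 'a" where
  "chart_inv c \<equiv> inv_into (fst c) (snd c)"

definition is_chart :: "'a topology \<Rightarrow> ('a, 'k::finite) chart \<Rightarrow> bool" where
  "is_chart X c \<longleftrightarrow> openin X (fst c) \<and> open (snd c ` fst c) \<and>
     homeomorphic_map (subtopology X (fst c)) (top_of_set (snd c ` fst c)) (snd c)"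

definition transition :: "('a, 'k::finite) chart \<Rightarrow> ('a, 'k) chart \<Rightarrow> complex^'k \<Rightarrow> complex^'k" where
  "transition c c' = snd c' \<circ> chart_inv c"

definition compatible :: "('a, 'k::finite) chart \<Rightarrow> ('a, 'k) chart \<Rightarrow> bool" where
  "compatible c c' \<longleftrightarrow>
     holo_vec_on (snd c ` (fst c \<inter> fst c')) (transition c c') \<and>
     holo_vec_on (snd c' ` (fst c \<inter> fst c')) (transition c' c)"

definition complex_manifold :: "('a, 'k::finite) cmfd \<Rightarrow> bool" where
  "complex_manifold X \<longleftrightarrow> Hausdorff_space (mtop X) \<and> second_countable (mtop X) \<and>
     (\<forall>c\<in>atlas X. is_chart (mtop X) c) \<and>
     (\<Union>c\<in>atlas X. fst c) = topspace (mtop X) \<and>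
     (\<forall>c\<in>atlas X. \<forall>c'\<in>atlas X. compatible c c')"

definition max_atlas :: "('a, 'k::finite) cmfd \<Rightarrow> ('a, 'k) chart set" where
  "max_atlas X = {c. is_chart (mtop X) c \<and> (\<forall>c'\<in>atlas X. compatible c c')}"

definition open_submfd :: "('a, 'k::finite) cmfd \<Rightarrow> 'a set \<Rightarrow> ('a, 'k) cmfd" where
  "open_submfd X W = \<lparr>mtop = subtopology (mtop X) W, atlas = (\<lambda>c. (fst c \<inter> W, snd c)) ` atlas X\<rparr>"

definition local_rep ::
  "('a \<Rightarrow> 'b) \<Rightarrow> ('a, 'k::finite) chart \<Rightarrow> ('b, 'l::finite) chart \<Rightarrow> complex^'k \<Rightarrow> complex^'l" where
  "local_rep f c c' = snd c' \<circ> f \<circ> chart_inv c"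

definition local_dom ::
  "('a \<Rightarrow> 'b) \<Rightarrow> ('a, 'k::finite) chart \<Rightarrow> ('b, 'l::finite) chart \<Rightarrow> (complex^'k) set" where
  "local_dom f c c' = snd c ` {x \<in> fst c. f x \<in> fst c'}"

definition holomorphic_map :: "('a, 'k::finite) cmfd \<Rightarrow> ('b, 'l::finite) cmfd \<Rightarrow> ('a \<Rightarrow> 'b) \<Rightarrow> bool" where
  "holomorphic_map X Y f \<longleftrightarrow> continuous_map (mtop X) (mtop Y) f \<and>
     (\<forall>c\<in>atlas X. \<forall>c'\<in>atlas Y. holo_vec_on (local_dom f c c') (local_rep f c c'))"

definition smooth_map :: "('a, 'k::finite) cmfd \<Rightarrow> ('b, 'l::finite) cmfd \<Rightarrow> ('a \<Rightarrow> 'b) \<Rightarrow> bool" where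
  "smooth_map X Y f \<longleftrightarrow> continuous_map (mtop X) (mtop Y) f \<and>
     (\<forall>c\<in>atlas X. \<forall>c'\<in>atlas Y. smooth_on (local_dom f c c') (local_rep f c c'))"

definition holomorphic_fun :: "('a, 'k::finite) cmfd \<Rightarrow> 'a set \<Rightarrow> ('a \<Rightarrow> complex) \<Rightarrow> bool" where
  "holomorphic_fun X W h \<longleftrightarrow>
     (\<forall>c\<in>atlas X. holo_on (snd c ` (fst c \<inter> W)) (h \<circ> chart_inv c))"

definition biholomorphism :: "('a, 'k::finite) cmfd \<Rightarrow> ('b, 'l::finite) cmfd \<Rightarrow> ('a \<Rightarrow> 'b) \<Rightarrow> bool" where
  "biholomorphism X Y f \<longleftrightarrow> holomorphic_map X Y f \<and>
     (\<exists>g. holomorphic_map Y X g \<and>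
          (\<forall>x\<in>topspace (mtop X). g (f x) = x) \<and> (\<forall>y\<in>topspace (mtop Y). f (g y) = y))"

definition immersion :: "('a, 'k::finite) cmfd \<Rightarrow> ('b, 'l::finite) cmfd \<Rightarrow> ('a \<Rightarrow> 'b) \<Rightarrow> bool" where
  "immersion X Y f \<longleftrightarrow>
     (\<forall>c\<in>atlas X. \<forall>c'\<in>atlas Y. \<forall>x\<in>fst c. f x \<in> fst c' \<longrightarrow>
        inj (frechet_derivative (local_rep f c c') (at (snd c x))))"

definition holomorphic_embedding :: "('a, 'k::finite) cmfd \<Rightarrow> ('b, 'l::finite) cmfd \<Rightarrow> ('a \<Rightarrow> 'b) \<Rightarrow> bool" where
  "holomorphic_embedding X Y f \<longleftrightarrow>
     holomorphic_map X Y f \<and> immersion X Y f \<and> embedding_map (mtop X) (mtop Y) f"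

text \<open>Two embeddings of the same manifold \<open>C\<close> have biholomorphic neighborhoods, by a
  biholomorphism which is the identity on \<open>C\<close>.\<close>

definition biholomorphic_nbhds ::
  "('c, 'n::finite) cmfd \<Rightarrow> ('a, 'k::finite) cmfd \<Rightarrow> ('c \<Rightarrow> 'a) \<Rightarrow> ('b, 'l::finite) cmfd \<Rightarrow> ('c \<Rightarrow> 'b) \<Rightarrow> bool" where
  "biholomorphic_nbhds C M\<^sub>1 \<iota>\<^sub>1 M\<^sub>2 \<iota>\<^sub>2 \<longleftrightarrow>
     (\<exists>U\<^sub>1 U\<^sub>2 \<Phi>.
        openin (mtop M\<^sub>1) U\<^sub>1 \<and> \<iota>\<^sub>1 ` topspace (mtop C) \<subseteq> U\<^sub>1 \<and>
        openin (mtop M\<^sub>2) U\<^sub>2 \<and> \<iota>\<^sub>2 ` topspace (mtop C) \<subseteq> U\<^sub>2 \<and>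
        biholomorphism (open_submfd M\<^sub>1 U\<^sub>1) (open_submfd M\<^sub>2 U\<^sub>2) \<Phi> \<and>
        (\<forall>x\<in>topspace (mtop C). \<Phi> (\<iota>\<^sub>1 x) = \<iota>\<^sub>2 x))"

section \<open>Holomorphic vector bundles\<close>

text \<open>A bundle of rank \<open>CARD('r)\<close> is given by trivializing sets indexed by \<open>bindex\<close> and
  transition matrices; \<open>btrans E i j x\<close> turns the \<open>j\<close>-coordinates of a vector over \<open>x\<close> into its
  \<open>i\<close>-coordinates. A vector over \<open>x\<close> is the family of all its coordinates, extended by \<open>0\<close> to
  the indices whose trivializing set does not contain \<open>x\<close>; the linear structure of the fibre is
  the pointwise one.\<close>

record ('c, 'i, 'r) vbundle =
  bindex :: "'i set"
  bdom :: "'i \<Rightarrow> 'c set"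
  btrans :: "'i \<Rightarrow> 'i \<Rightarrow> 'c \<Rightarrow> complex^'r^('r::finite)"

definition bat :: "('c, 'i, 'r::finite) vbundle \<Rightarrow> 'c \<Rightarrow> 'i set" where
  "bat E x = {i \<in> bindex E. x \<in> bdom E i}"

definition fibre :: "('c, 'i, 'r::finite) vbundle \<Rightarrow> 'c \<Rightarrow> ('i \<Rightarrow> complex^'r) set" where
  "fibre E x = {v. (\<forall>i. i \<notin> bat E x \<longrightarrow> v i = 0) \<and>
                   (\<forall>i\<in>bat E x. \<forall>j\<in>bat E x. v i = btrans E i j x *v v j)}"

definition total_chart ::
  "('c, 'i, 'r::finite) vbundle \<Rightarrow> ('c, 'k::finite) chart \<Rightarrow> 'i \<Rightarrow> ('c \<times> ('i \<Rightarrow> complex^'r), 'k + 'r) chart" where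
  "total_chart E c i =
     ({(x, v). x \<in> fst c \<inter> bdom E i \<and> v \<in> fibre E x},
      \<lambda>(x, v). \<chi> a. case a of Inl k \<Rightarrow> snd c x $ k | Inr r \<Rightarrow> v i $ r)"

text \<open>The total space carries the topology in which the charts above are homeomorphisms onto
  open sets.\<close>

definition total_space ::
  "('c, 'k::finite) cmfd \<Rightarrow> ('c, 'i, 'r::finite) vbundle \<Rightarrow> ('c \<times> ('i \<Rightarrow> complex^'r), 'k + 'r) cmfd" where
  "total_space X E =
     (let A = {total_chart E c i | c i. c \<in> atlas X \<and> i \<in> bindex E}
      in \<lparr>mtop = topology_generated_by {{e \<in> fst t. snd t e \<in> S} | t S. t \<in> A \<and> open S}, atlas = A\<rparr>)"

definition zero_section :: "'c \<Rightarrow> 'c \<times> ('i \<Rightarrow> complex^'r)" where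
  "zero_section x = (x, \<lambda>i. 0)"

definition tangent_bundle :: "('c, 'k::finite) cmfd \<Rightarrow> ('c, ('c, 'k) chart, 'k) vbundle" where
  "tangent_bundle X =
     \<lparr>bindex = max_atlas X,
      bdom = fst,
      btrans = (\<lambda>c c' x. complex_jacobian (transition c' c) (snd c' x))\<rparr>"

text \<open>The normal bundle is the quotient of \<open>TM\<close> restricted to \<open>C\<close> by \<open>TC\<close>. It is trivialized by
  the charts of \<open>M\<close> in which \<open>C\<close> is cut out by the vanishing of the coordinates indexed by \<open>'d\<close>:
  the class of a tangent vector of \<open>M\<close> is determined by its \<open>'d\<close>-components, and these transform
  by the corresponding diagonal block of the Jacobian matrix.\<close>

definition adapted_charts ::
  "('c, 'n::finite) cmfd \<Rightarrow> ('m, 'n + 'd::finite) cmfd \<Rightarrow> ('c \<Rightarrow> 'm) \<Rightarrow> ('m, 'n + 'd) chart set" where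
  "adapted_charts C M \<iota> =
     {c \<in> max_atlas M. \<forall>m\<in>fst c. m \<in> \<iota> ` topspace (mtop C) \<longleftrightarrow> (\<forall>j. snd c m $ Inr j = 0)}"

definition normal_bundle ::
  "('c, 'n::finite) cmfd \<Rightarrow> ('m, 'n + 'd::finite) cmfd \<Rightarrow> ('c \<Rightarrow> 'm) \<Rightarrow> ('c, ('m, 'n + 'd) chart, 'd) vbundle" where
  "normal_bundle C M \<iota> =
     \<lparr>bindex = adapted_charts C M \<iota>,
      bdom = (\<lambda>c. {x \<in> topspace (mtop C). \<iota> x \<in> fst c}),
      btrans = (\<lambda>c c' x. \<chi> a b. complex_jacobian (transition c' c) (snd c' (\<iota> x)) $ Inr a $ Inr b)\<rparr>"

section \<open>Hermitian flat bundles\<close>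

definition unitary_matrix :: "complex^'r^('r::finite) \<Rightarrow> bool" where
  "unitary_matrix A \<longleftrightarrow> A ** transpose (map_matrix cnj A) = mat 1"

text \<open>A holomorphic trivialization over an open set \<open>V\<close>: \<open>a i x\<close> turns the \<open>i\<close>-coordinates of a
  vector over \<open>x\<close> into its coordinates in the trivialization.\<close>

definition holo_trivialization ::
  "('c, 'k::finite) cmfd \<Rightarrow> ('c, 'i, 'r::finite) vbundle \<Rightarrow> 'c set \<times> ('i \<Rightarrow> 'c \<Rightarrow> complex^'r^'r) \<Rightarrow> bool" where
  "holo_trivialization X E t \<longleftrightarrow> (case t of (V, a) \<Rightarrow>
     openin (mtop X) V \<and>
     (\<forall>i\<in>bindex E. \<forall>p q. holomorphic_fun X (V \<inter> bdom E i) (\<lambda>x. a i x $ p $ q)) \<and>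
     (\<forall>x\<in>V. \<forall>i\<in>bat E x. invertible (a i x) \<and> (\<forall>j\<in>bat E x. a j x = a i x ** btrans E i j x)))"

definition locally_constant_on :: "'c topology \<Rightarrow> 'c set \<Rightarrow> ('c \<Rightarrow> 'b) \<Rightarrow> bool" where
  "locally_constant_on X W g \<longleftrightarrow>
     (\<forall>x\<in>W. \<exists>N. openin X N \<and> x \<in> N \<and> N \<subseteq> W \<and> (\<forall>y\<in>N. g y = g x))"

definition hermitian_flat :: "('c, 'k::finite) cmfd \<Rightarrow> ('c, 'i, 'r::finite) vbundle \<Rightarrow> bool" where
  "hermitian_flat X E \<longleftrightarrow>
     (\<exists>T. (\<forall>t\<in>T. holo_trivialization X E t) \<and> (\<Union>t\<in>T. fst t) = topspace (mtop X) \<and>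
        (\<forall>(V, a)\<in>T. \<forall>(W, b)\<in>T. \<exists>g.
           locally_constant_on (mtop X) (V \<inter> W) g \<and>
           (\<forall>x\<in>V \<inter> W. unitary_matrix (g x) \<and> (\<forall>i\<in>bat E x. b i x = g x ** a i x))))"

section \<open>Sheaves of sections and their cohomology\<close>

definition homogeneous_poly :: "nat \<Rightarrow> (complex^'q::finite \<Rightarrow> complex^'r::finite) \<Rightarrow> bool" where
  "homogeneous_poly l P \<longleftrightarrow>
     (\<exists>c :: ('q \<Rightarrow> nat) \<Rightarrow> complex^'r.
        P = (\<lambda>v. \<Sum>\<alpha> | (\<Sum>k\<in>UNIV. \<alpha> k) = l. (\<Prod>k\<in>UNIV. (v $ k) ^ \<alpha> k) *s c \<alpha>))"

text \<open>The fibre over \<open>x\<close> of the tensor product of \<open>E\<close> with the \<open>l\<close>-th symmetric power of the dual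
  of \<open>F\<close> consists of the \<open>E\<^sub>x\<close>-valued homogeneous polynomials of degree \<open>l\<close> on \<open>F\<^sub>x\<close>. As for vectors,
  such a polynomial is represented by the family of its coordinate expressions, with respect to
  the \<open>i\<close>-th trivialization of \<open>E\<close> and the \<open>j\<close>-th trivialization of \<open>F\<close>.\<close>

definition sym_fibre ::
  "('c, 'i, 'r::finite) vbundle \<Rightarrow> ('c, 'j, 'q::finite) vbundle \<Rightarrow> nat \<Rightarrow> 'c \<Rightarrow>
   ('i \<Rightarrow> 'j \<Rightarrow> complex^'q \<Rightarrow> complex^'r) set" where
  "sym_fibre E F l x =
     {P. (\<forall>i j. i \<notin> bat E x \<or> j \<notin> bat F x \<longrightarrow> P i j = 0) \<and>
         (\<forall>i\<in>bat E x. \<forall>j\<in>bat F x. homogeneous_poly l (P i j)) \<and>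
         (\<forall>i\<in>bat E x. \<forall>i'\<in>bat E x. \<forall>j\<in>bat F x. \<forall>j'\<in>bat F x. \<forall>v.
            P i' j' v = btrans E i' i x *v P i j (btrans F j j' x *v v))}"

text \<open>Sections over \<open>W\<close> are extended by \<open>0\<close> outside \<open>W\<close>, so that equality of sections is
  equality of functions.\<close>

definition sym_sections ::
  "('c, 'k::finite) cmfd \<Rightarrow> ('c, 'i, 'r::finite) vbundle \<Rightarrow> ('c, 'j, 'q::finite) vbundle \<Rightarrow> nat \<Rightarrow>
   'c set \<Rightarrow> ('c \<Rightarrow> 'i \<Rightarrow> 'j \<Rightarrow> complex^'q \<Rightarrow> complex^'r) set" where
  "sym_sections X E F l W =
     {s. (\<forall>x\<in>W. s x \<in> sym_fibre E F l x) \<and> (\<forall>x. x \<notin> W \<longrightarrow> s x = 0) \<and>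
         (\<forall>i\<in>bindex E. \<forall>j\<in>bindex F. \<forall>v a.
            holomorphic_fun X (W \<inter> bdom E i \<inter> bdom F j) (\<lambda>x. s x i j v $ a))}"

definition open_cover :: "'c topology \<Rightarrow> 'c set set \<Rightarrow> bool" where
  "open_cover X \<U> \<longleftrightarrow> (\<forall>U\<in>\<U>. openin X U) \<and> \<Union>\<U> = topspace X"

definition cech_cocycle ::
  "('c set \<Rightarrow> ('c \<Rightarrow> 'f::ab_group_add) set) \<Rightarrow> 'c set set \<Rightarrow> ('c set \<Rightarrow> 'c set \<Rightarrow> 'c \<Rightarrow> 'f) \<Rightarrow> bool" where
  "cech_cocycle \<S> \<U> g \<longleftrightarrow>
     (\<forall>U\<in>\<U>. \<forall>V\<in>\<U>. g U V \<in> \<S> (U \<inter> V)) \<and>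
     (\<forall>U\<in>\<U>. \<forall>V\<in>\<U>. \<forall>W\<in>\<U>. \<forall>x\<in>U \<inter> V \<inter> W. g V W x - g U W x + g U V x = 0)"

definition cech_coboundary ::
  "('c set \<Rightarrow> ('c \<Rightarrow> 'f::ab_group_add) set) \<Rightarrow> 'c set set \<Rightarrow> ('c set \<Rightarrow> 'c set \<Rightarrow> 'c \<Rightarrow> 'f) \<Rightarrow> bool" where
  "cech_coboundary \<S> \<U> g \<longleftrightarrow>
     (\<exists>h. (\<forall>U\<in>\<U>. h U \<in> \<S> U) \<and> (\<forall>U\<in>\<U>. \<forall>V\<in>\<U>. \<forall>x\<in>U \<inter> V. g U V x = h V x - h U x))"

definition H0_vanishes :: "'c topology \<Rightarrow> ('c set \<Rightarrow> ('c \<Rightarrow> 'f::ab_group_add) set) \<Rightarrow> bool" where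
  "H0_vanishes X \<S> \<longleftrightarrow> \<S> (topspace X) = {0}"

text \<open>\<open>H\<^sup>1\<close> is the direct limit over the open covers of the first Cech cohomology groups, which
  agrees with sheaf cohomology on every space. It vanishes if and only if each cocycle becomes
  a coboundary on some refinement.\<close>

definition H1_vanishes :: "'c topology \<Rightarrow> ('c set \<Rightarrow> ('c \<Rightarrow> 'f::ab_group_add) set) \<Rightarrow> bool" where
  "H1_vanishes X \<S> \<longleftrightarrow>
     (\<forall>\<U> g. open_cover X \<U> \<and> cech_cocycle \<S> \<U> g \<longrightarrow>
        (\<exists>\<V> \<tau>. open_cover X \<V> \<and> (\<forall>V\<in>\<V>. \<tau> V \<in> \<U> \<and> V \<subseteq> \<tau> V) \<and>
           cech_coboundary \<S> \<V> (\<lambda>V V' x. if x \<in> V \<inter> V' then g (\<tau> V) (\<tau> V') x else 0)))"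

section \<open>Coverings and induced neighborhoods\<close>

definition finite_etale_cover :: "('h, 'k::finite) cmfd \<Rightarrow> ('c, 'k) cmfd \<Rightarrow> ('h \<Rightarrow> 'c) \<Rightarrow> bool" where
  "finite_etale_cover Y X p \<longleftrightarrow> holomorphic_map Y X p \<and>
     p ` topspace (mtop Y) = topspace (mtop X) \<and>
     (\<forall>x\<in>topspace (mtop X). \<exists>V \<W>.
        openin (mtop X) V \<and> x \<in> V \<and> finite \<W> \<and> disjoint \<W> \<and>
        \<Union>\<W> = {y \<in> topspace (mtop Y). p y \<in> V} \<and>
        (\<forall>W\<in>\<W>. openin (mtop Y) W \<and> biholomorphism (open_submfd Y W) (open_submfd X V) p))"

definition deck_transformation ::
  "('h, 'k::finite) cmfd \<Rightarrow> ('h \<Rightarrow> 'c) \<Rightarrow> ('h \<Rightarrow> 'h) \<Rightarrow> bool" where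
  "deck_transformation Y p \<sigma> \<longleftrightarrow>
     biholomorphism Y Y \<sigma> \<and> (\<forall>y\<in>topspace (mtop Y). p (\<sigma> y) = p y)"

definition finite_galois_cover :: "('h, 'k::finite) cmfd \<Rightarrow> ('c, 'k) cmfd \<Rightarrow> ('h \<Rightarrow> 'c) \<Rightarrow> bool" where
  "finite_galois_cover Y X p \<longleftrightarrow> finite_etale_cover Y X p \<and>
     (\<forall>y\<in>topspace (mtop Y). \<forall>y'\<in>topspace (mtop Y). p y = p y' \<longrightarrow>
        (\<exists>\<sigma>. deck_transformation Y p \<sigma> \<and> \<sigma> y = y'))"

definition smooth_retraction ::
  "('c, 'n::finite) cmfd \<Rightarrow> ('m, 'k::finite) cmfd \<Rightarrow> ('c \<Rightarrow> 'm) \<Rightarrow> ('m \<Rightarrow> 'c) \<Rightarrow> bool" where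
  "smooth_retraction C M \<iota> \<pi> \<longleftrightarrow> smooth_map M C \<pi> \<and> (\<forall>x\<in>topspace (mtop C). \<pi> (\<iota> x) = x)"

definition fibre_product :: "'m topology \<Rightarrow> 'h topology \<Rightarrow> ('m \<Rightarrow> 'c) \<Rightarrow> ('h \<Rightarrow> 'c) \<Rightarrow> ('m \<times> 'h) topology" where
  "fibre_product M Y \<pi> p = subtopology (prod_topology M Y) {(m, y). \<pi> m = p y}"

text \<open>The complex structure on the fibre product of \<open>\<pi>\<close> and \<open>p\<close> which makes the projection to \<open>M\<close>
  locally biholomorphic: its charts are charts of \<open>M\<close> composed with local homeomorphic branches
  of the projection. It is not the product complex structure, since \<open>\<pi>\<close> is only smooth.\<close>

definition induced_nbhd ::
  "('m, 'k::finite) cmfd \<Rightarrow> ('h, 'n::finite) cmfd \<Rightarrow> ('m \<Rightarrow> 'c) \<Rightarrow> ('h \<Rightarrow> 'c) \<Rightarrow> ('m \<times> 'h, 'k) cmfd" where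
  "induced_nbhd M Y \<pi> p =
     (let T = fibre_product (mtop M) (mtop Y) \<pi> p
      in \<lparr>mtop = T,
          atlas = {(V, snd c \<circ> fst) | V c. c \<in> atlas M \<and> openin T V \<and>
             fst ` V \<subseteq> fst c \<and> openin (mtop M) (fst ` V) \<and>
             homeomorphic_map (subtopology T V) (subtopology (mtop M) (fst ` V)) fst}\<rparr>)"

definition induced_embedding :: "('c \<Rightarrow> 'm) \<Rightarrow> ('h \<Rightarrow> 'c) \<Rightarrow> 'h \<Rightarrow> 'm \<times> 'h" where
  "induced_embedding \<iota> p y = (\<iota> (p y), y)"

end

theory Submission
  imports Defs "HOL-Complex_Analysis.Cauchy_Integral_Formula"
begin

text \<open>A linearization of a neighborhood of \<open>C\<close> amounts to a holomorphic retraction \<open>\<rho>\<close> onto \<open>C\<close>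
  together with a function \<open>w\<close>, where \<open>w m\<close> lies in the fibre of the normal bundle at \<open>\<rho> m\<close>; composing
  with a bundle automorphism one may assume that the normal derivative of \<open>w\<close> along \<open>C\<close> is the identity.
  If \<open>(\<rho>, w)\<close> and \<open>(\<rho>', w')\<close> are two such normalized pairs, then the lowest order term of \<open>\<rho> - \<rho>'\<close> along
  \<open>C\<close> is a section of \<open>TC \<otimes> Sym\<^sup>l N\<^sup>*\<close> with \<open>l \<ge> 1\<close>, so \<open>\<rho> = \<rho>'\<close>; after that the lowest order term of
  \<open>w - w'\<close> is a section of \<open>N \<otimes> Sym\<^sup>l N\<^sup>*\<close> with \<open>l \<ge> 2\<close>, so \<open>w = w'\<close>. Hence on the covering the normalized
  pair is invariant under the deck transformations, which form a finite group, and the map to the normal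
  bundle of \<open>C\<close> which it induces descends to a neighborhood of \<open>C\<close> in \<open>M\<close>. The descended map is locally
  biholomorphic by the inverse function theorem, and it is injective because the cover is Galois.\<close>

section \<open>Holomorphic functions of several variables\<close>

text \<open>The normalization is forced: in degree 1 the sections of \<open>N\<close> tensored with
  its own dual contain the identity, so no vanishing can be asked there, and the linear term has to
  be removed by prescribing the normal derivative. The obstacle is that higher derivatives of chart
  expressions transform badly and that two retractions can be subtracted only inside a chart of
  \<open>C\<close>. It is met by never differentiating a change of chart more than once: the
  coefficient of order \<open>l\<close> is read off as the limit of \<open>u (m t)\<close> divided
  by \<open>t ^ l\<close> along curves \<open>m\<close> that tend to a point of \<open>C\<close>. A
  curve that is a ray in one chart is an arbitrary curve in the others, and such limits pass through
  a change of chart by strict differentiability alone. Once all coefficients vanish, the identity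
  theorem on complex lines transversal to \<open>C\<close> gives equality near each point. The
  neighborhoods so obtained depend on the deck transformation; finiteness of the cover keeps their
  intersection open.\<close>

lemma norm_smult_vec [simp]: "norm (c *s v) = cmod c * norm (v :: complex^'k)"
  by (simp add: norm_vec_def norm_mult L2_set_right_distrib)

lemma bounded_linear_smult_left: "bounded_linear (\<lambda>t. t *s (v :: complex^'k))"
  by (rule bounded_linear_intro[of _ "norm v"])
     (simp_all add: vec_eq_iff algebra_simps scaleR_conv_of_real[where 'a=complex])

lemmas has_derivative_smult_left = bounded_linear.has_derivative[OF bounded_linear_smult_left]

lemma bounded_bilinear_smult: "bounded_bilinear (\<lambda>t (v :: complex^'k). t *s v)"
proof
  show "\<exists>K. \<forall>a (b :: complex^'k). norm (a *s b) \<le> norm a * norm b * K"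
    by (intro exI[of _ 1]) simp
qed (simp_all add: vec_eq_iff algebra_simps scaleR_conv_of_real[where 'a=complex])

lemma continuous_on_smult [continuous_intros]:
  "continuous_on S f \<Longrightarrow> continuous_on S g \<Longrightarrow> continuous_on S (\<lambda>x. f x *s (g x :: complex^'k))"
  by (rule bounded_bilinear.continuous_on[OF bounded_bilinear_smult])

lemma tendsto_smult [tendsto_intros]:
  "(f \<longlongrightarrow> a) F \<Longrightarrow> (g \<longlongrightarrow> b) F \<Longrightarrow> ((\<lambda>x. f x *s (g x :: complex^'k)) \<longlongrightarrow> a *s b) F"
  by (rule bounded_bilinear.tendsto[OF bounded_bilinear_smult])

text \<open>Total in \<open>f\<close> and \<open>z\<close>, so that it can be iterated; it has
  content only where \<open>f\<close> is differentiable.\<close>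

definition ddir :: "complex^'k \<Rightarrow> (complex^'k \<Rightarrow> complex) \<Rightarrow> complex^'k \<Rightarrow> complex" where
  "ddir e f z = frechet_derivative f (at z) e"

lemma holo_on_has_derivative:
  assumes "holo_on S f" "z \<in> S"
  shows "(f has_derivative (\<lambda>e. ddir e f z)) (at z)"
  using assms unfolding holo_on_def ddir_def
  by (metis frechet_derivative_at)

lemma ddir_smult:
  assumes "holo_on S f" "z \<in> S"
  shows "ddir (c *s e) f z = c * ddir e f z"
  using assms unfolding holo_on_def ddir_def
  by (metis frechet_derivative_at)

lemma ddir_unique: "(f has_derivative D) (at z) \<Longrightarrow> ddir e f z = D e"
  unfolding ddir_def by (metis frechet_derivative_at)

lemma ddir_cong:
  assumes "open S" "z \<in> S" "\<And>x. x \<in> S \<Longrightarrow> f x = g x"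
  shows "ddir e f z = ddir e g z"
proof -
  have "\<And>D. (f has_derivative D) (at z) \<longleftrightarrow> (g has_derivative D) (at z)"
    using has_derivative_transform_within_open[OF _ assms(1,2)] assms(3) by metis
  then show ?thesis unfolding ddir_def frechet_derivative_def by simp
qed

lemma holo_on_subset: "holo_on S f \<Longrightarrow> T \<subseteq> S \<Longrightarrow> holo_on T f"
  unfolding holo_on_def by blast

lemma holo_on_imp_continuous_on: "holo_on S f \<Longrightarrow> continuous_on S f"
  unfolding holo_on_def
  by (metis continuous_at_imp_continuous_on has_derivative_continuous)

lemma holo_on_cong:
  assumes "open S" "\<And>x. x \<in> S \<Longrightarrow> f x = g x" "holo_on S f"
  shows "holo_on S g"
  using assms unfolding holo_on_def by (metis has_derivative_transform_within_open)

text \<open>A complex linear derivative restricted to a complex line is multiplication by a number.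
  One-variable theory is brought in through this reduction.\<close>

lemma has_field_derivative_slice:
  assumes "holo_on S f" "z + t *s e \<in> S"
  shows "((\<lambda>\<tau>. f (z + \<tau> *s e)) has_field_derivative ddir e f (z + t *s e)) (at t)"
proof -
  have "((\<lambda>\<tau>. z + \<tau> *s e) has_derivative (\<lambda>h. h *s e)) (at t)"
    by (auto intro!: derivative_eq_intros has_derivative_smult_left)
  from has_derivative_compose[OF this, of f] holo_on_has_derivative[OF assms]
  have "((\<lambda>\<tau>. f (z + \<tau> *s e)) has_derivative (\<lambda>h. ddir (h *s e) f (z + t *s e))) (at t)"
    by blast
  then show ?thesis
    by (simp add: has_field_derivative_def ddir_smult[OF assms] mult.commute[of _ "ddir e f (z + t *s e)"])
qed

section \<open>Cauchy integrals on complex lines\<close>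

definition circ :: "real \<Rightarrow> real \<Rightarrow> complex" where
  "circ r \<theta> = of_real r * exp (2 * of_real pi * \<i> * of_real \<theta>)"

lemma norm_circ [simp]: "r \<ge> 0 \<Longrightarrow> cmod (circ r \<theta>) = r"
  by (simp add: circ_def norm_mult)

lemma circ_nonzero [simp]: "r > 0 \<Longrightarrow> circ r \<theta> \<noteq> 0"
  by (simp add: circ_def)

lemma continuous_on_circ [continuous_intros]:
  "continuous_on S f \<Longrightarrow> continuous_on S (\<lambda>x. circ r (f x))"
  unfolding circ_def by (intro continuous_intros)

text \<open>The derivative of the circle path is 2 pi i times the path itself, which cancels the
  prefactor in Cauchy's formulas. Passing from contour integrals to integrals over
  \<open>{0..1}\<close> makes continuity and differentiation under the integral sign
  available.\<close>

lemma circ_has_integral: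
  assumes "(f has_contour_integral (2 * of_real pi * \<i>) * I) (circlepath 0 r)"
  shows "((\<lambda>\<theta>. f (circ r \<theta>) * circ r \<theta>) has_integral I) {0..1}"
proof -
  have "((\<lambda>x. f (circlepath 0 r x) * vector_derivative (circlepath 0 r) (at x within {0..1}))
      has_integral (2 * of_real pi * \<i>) * I) {0..1}"
    using assms by (simp add: has_contour_integral_def)
  then have "((\<lambda>x. inverse (2 * of_real pi * \<i>) * (f (circlepath 0 r x) *
       vector_derivative (circlepath 0 r) (at x within {0..1})))
      has_integral inverse (2 * of_real pi * \<i>) * ((2 * of_real pi * \<i>) * I)) {0..1}"
    by (rule has_integral_mult_right)
  moreover have "inverse (2 * of_real pi * \<i>) * (f (circlepath 0 r x) *
       vector_derivative (circlepath 0 r) (at x within {0..1})) = f (circ r x) * circ r x"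
    if "x \<in> {0..1}" for x
  proof -
    have "circlepath 0 r x = circ r x" by (simp add: circlepath circ_def)
    moreover have "vector_derivative (circlepath 0 r) (at x within {0..1}) = 2 * of_real pi * \<i> * circ r x"
      using that by (simp add: vector_derivative_circlepath01 circ_def)
    ultimately show ?thesis by (simp add: field_simps)
  qed
  ultimately have "((\<lambda>\<theta>. f (circ r \<theta>) * circ r \<theta>) has_integral
      inverse (2 * of_real pi * \<i>) * ((2 * of_real pi * \<i>) * I)) {0..1}"
    by (metis (no_types, lifting) has_integral_cong)
  moreover have "inverse (2 * of_real pi * \<i>) * ((2 * of_real pi * \<i>) * I) = I"
    by (subst mult.assoc[symmetric], subst left_inverse) auto
  ultimately show ?thesis by metis
qed

lemma cauchy_mean:
  assumes "h holomorphic_on cball 0 r" "cmod t < r"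
  shows "h t = integral {0..1} (\<lambda>\<theta>. h (circ r \<theta>) / (circ r \<theta> - t) * circ r \<theta>)"
  using circ_has_integral[OF Cauchy_integral_circlepath_simple[of h 0 r t]] assms
  by (metis (no_types, lifting) diff_zero integral_unique)

lemma cauchy_mean_deriv:
  assumes "h holomorphic_on cball 0 r" "r > 0"
  shows "deriv h 0 = integral {0..1} (\<lambda>\<theta>. h (circ r \<theta>) / circ r \<theta>)"
proof -
  have "((\<lambda>u. h u / (u - 0) ^ Suc 1) has_contour_integral ((2 * pi) * \<i> / (fact 1)) * (deriv ^^ 1) h 0)
           (circlepath 0 r)"
    using assms by (intro Cauchy_has_contour_integral_higher_derivative_circlepath)
      (auto intro: holomorphic_on_imp_continuous_on holomorphic_on_subset)
  then have "((\<lambda>\<theta>. h (circ r \<theta>) / (circ r \<theta>)^2 * circ r \<theta>) has_integral deriv h 0) {0..1}"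
    by (intro circ_has_integral) (simp add: power2_eq_square)
  then have "deriv h 0 = integral {0..1} (\<lambda>\<theta>. h (circ r \<theta>) / (circ r \<theta>)^2 * circ r \<theta>)"
    by (simp add: integral_unique)
  also have "\<dots> = integral {0..1} (\<lambda>\<theta>. h (circ r \<theta>) / circ r \<theta>)"
    using assms(2) by (simp add: power2_eq_square)
  finally show ?thesis .
qed

text \<open>The derivative is recovered from values of \<open>f\<close> alone. Since
  \<open>holo_on\<close> asks only for pointwise differentiability, this formula is the source of
  the continuity and differentiability of derivatives.\<close>

lemma ddir_integral:
  assumes "holo_on S f" "r > 0" "\<And>t. cmod t \<le> r \<Longrightarrow> z + t *s e \<in> S"
  shows "ddir e f z = integral {0..1} (\<lambda>\<theta>. f (z + circ r \<theta> *s e) / circ r \<theta>)"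
proof -
  have hol: "(\<lambda>t. f (z + t *s e)) holomorphic_on cball 0 r"
    using has_field_derivative_slice[OF assms(1)] assms(3)
    unfolding holomorphic_on_def field_differentiable_def
    by (metis has_field_derivative_at_within mem_cball_0)
  have "deriv (\<lambda>t. f (z + t *s e)) 0 = ddir e f (z + 0 *s e)"
    using has_field_derivative_slice[OF assms(1,3), of 0] assms(2) by (intro DERIV_imp_deriv) simp
  then show ?thesis
    using cauchy_mean_deriv[OF hol assms(2)] by simp
qed

text \<open>Convexity of \<open>U\<close> is there for the theorem on differentiation under the
  integral sign.\<close>

lemma tube_exists:
  assumes "open S" "z0 \<in> S"
  obtains U r where "open U" "convex U" "z0 \<in> U" "U \<subseteq> S" "r > 0"
    "\<And>z t. z \<in> U \<Longrightarrow> cmod t \<le> r \<Longrightarrow> z + t *s e \<in> S"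
proof -
  obtain \<delta> where \<delta>: "\<delta> > 0" "ball z0 \<delta> \<subseteq> S" using assms openE by blast
  \<comment> \<open>The radius is shared equally between the base point and the displacement
    \<open>t *s e\<close>. Adding 1 keeps the denominator positive when
    \<open>e = 0\<close>.\<close>
  define r where "r = \<delta> / 2 / (norm e + 1)"
  have r: "r > 0" "r * norm e \<le> \<delta> / 2"
  proof -
    have "norm e + 1 > 0" using norm_ge_zero[of e] by linarith
    then show "r > 0" "r * norm e \<le> \<delta> / 2"
      using \<delta> by (auto simp: r_def field_simps)
  qed
  have "z + t *s e \<in> S" if "z \<in> ball z0 (\<delta>/2)" "cmod t \<le> r" for z t
  proof -
    have "norm (t *s e) \<le> \<delta> / 2"
      using r(2) that(2) mult_right_mono[of "cmod t" r "norm e"] by simp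
    then have "dist z0 (z + t *s e) < \<delta>"
      using that(1) norm_triangle_ineq4[of "z0 - z" "t *s e"]
      by (simp add: dist_norm algebra_simps)
    then show ?thesis using \<delta> by auto
  qed
  moreover have "ball z0 (\<delta>/2) \<subseteq> S" using \<delta> by auto
  ultimately show ?thesis using that[of "ball z0 (\<delta>/2)" r] \<delta> r by auto
qed

lemma continuous_on_ddir:
  assumes "open S" "holo_on S f"
  shows "continuous_on S (ddir e f)"
proof -
  have "\<exists>U. open U \<and> z0 \<in> U \<and> continuous_on U (ddir e f)" if z0: "z0 \<in> S" for z0
  proof -
    obtain U r where U: "open U" "z0 \<in> U" "U \<subseteq> S" "r > 0"
      "\<And>z t. z \<in> U \<Longrightarrow> cmod t \<le> r \<Longrightarrow> z + t *s e \<in> S"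
      using tube_exists[OF assms(1) z0, of e] by metis
    have "continuous_on (U \<times> cbox 0 1) (\<lambda>x. f (fst x + circ r (snd x) *s e) / circ r (snd x))"
      by (intro continuous_intros continuous_on_compose2[OF holo_on_imp_continuous_on[OF assms(2)]])
         (use U(4,5) in auto)
    then have "continuous_on U (\<lambda>z. integral (cbox 0 1) (\<lambda>\<theta>. f (z + circ r \<theta> *s e) / circ r \<theta>))"
      by (intro integral_continuous_on_param) (simp add: case_prod_beta)
    then have "continuous_on U (ddir e f)"
      by (subst continuous_on_cong[OF refl ddir_integral[OF assms(2) U(4)]]) (use U(5) in auto)
    then show ?thesis using U by blast
  qed
  then show ?thesis
    by (metis assms(1) continuous_on_eq_continuous_at continuous_at_imp_continuous_on)
qed

text \<open>The whole derivative as an element of the Banach space of bounded linear maps, the form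
  in which the Leibniz rule for parameter integrals expects it.\<close>

definition dblin :: "(complex^'k \<Rightarrow> complex) \<Rightarrow> complex^'k \<Rightarrow> ((complex^'k) \<Rightarrow>\<^sub>L complex)" where
  "dblin f z = Blinfun (\<lambda>e. ddir e f z)"

lemma dblin_apply:
  assumes "holo_on S f" "z \<in> S"
  shows "blinfun_apply (dblin f z) e = ddir e f z"
  unfolding dblin_def
  by (subst bounded_linear_Blinfun_apply)
     (use holo_on_has_derivative[OF assms] has_derivative_bounded_linear in auto)

lemma continuous_on_dblin:
  assumes "open S" "holo_on S f"
  shows "continuous_on S (dblin f)"
proof (rule continuous_on_blinfun_componentwise)
  fix e :: "complex^'a"
  show "continuous_on S (\<lambda>x. blinfun_apply (dblin f x) e)"
    by (subst continuous_on_cong[OF refl dblin_apply[OF assms(2)]])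
       (auto intro: continuous_on_ddir assms)
qed

text \<open>Differentiation under the integral sign in \<open>ddir_integral\<close>; complex
  linearity of the derivative survives because it holds for the integrand at every angle.\<close>

lemma holo_on_ddir:
  assumes "open S" "holo_on S f"
  shows "holo_on S (ddir e f)"
  unfolding holo_on_def
proof
  fix z0 assume z0: "z0 \<in> S"
  obtain U r where U: "open U" "convex U" "z0 \<in> U" "U \<subseteq> S" "r > 0"
    "\<And>z t. z \<in> U \<Longrightarrow> cmod t \<le> r \<Longrightarrow> z + t *s e \<in> S"
    using tube_exists[OF assms(1) z0, of e] by metis
  have inS: "z + circ r t *s e \<in> S" if "z \<in> U" for z t
    using U that by auto
  define F where "F z \<theta> = f (z + circ r \<theta> *s e) / circ r \<theta>" for z \<theta>
  define F' where "F' z \<theta> = blinfun_mult_right (inverse (circ r \<theta>)) o\<^sub>L dblin f (z + circ r \<theta> *s e)" for z \<theta>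
  have circ0: "circ r t \<noteq> 0" for t using U(5) by (simp add: circ_def)
  have d: "((\<lambda>z. F z \<theta>) has_derivative blinfun_apply (F' z \<theta>)) (at z within U)" if "z \<in> U" for z \<theta>
  proof -
    have "((\<lambda>z. z + circ r \<theta> *s e) has_derivative (\<lambda>v. v)) (at z within U)"
      by (auto intro!: derivative_eq_intros)
    from has_derivative_compose[OF this, of f] holo_on_has_derivative[OF assms(2) inS[OF that]]
    have "((\<lambda>z. f (z + circ r \<theta> *s e)) has_derivative (\<lambda>v. ddir v f (z + circ r \<theta> *s e))) (at z within U)"
      by blast
    then have "((\<lambda>z. inverse (circ r \<theta>) * f (z + circ r \<theta> *s e)) has_derivative
        (\<lambda>v. inverse (circ r \<theta>) * ddir v f (z + circ r \<theta> *s e))) (at z within U)"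
      by (rule has_derivative_mult_right)
    moreover have "blinfun_apply (F' z \<theta>) = (\<lambda>v. inverse (circ r \<theta>) * ddir v f (z + circ r \<theta> *s e))"
      by (auto simp: F'_def dblin_apply[OF assms(2) inS[OF that]])
    ultimately show ?thesis by (simp add: F_def[abs_def] field_simps)
  qed
  have cF: "continuous_on (U \<times> cbox 0 1) (\<lambda>x. F (fst x) (snd x))"
    unfolding F_def
    by (intro continuous_intros continuous_on_compose2[OF holo_on_imp_continuous_on[OF assms(2)]])
       (use inS circ0 in auto)
  have cF': "continuous_on (U \<times> cbox 0 1) (\<lambda>(x,t). F' x t)"
    unfolding F'_def case_prod_beta
    by (intro continuous_intros bounded_linear.continuous_on[OF bounded_linear_blinfun_mult_right]
          continuous_on_compose2[OF continuous_on_dblin[OF assms]])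
       (use inS circ0 in auto)
  have int: "F z integrable_on cbox 0 1" if "z \<in> U" for z
  proof (rule integrable_continuous)
    have "continuous_on (cbox 0 1) (\<lambda>t. (z, t))" by (intro continuous_intros)
    from continuous_on_compose2[OF cF this] that
    show "continuous_on (cbox 0 1) (F z)" by auto
  qed
  have intF': "F' z integrable_on cbox 0 1" if "z \<in> U" for z
  proof (rule integrable_continuous)
    have "continuous_on (cbox 0 1) (\<lambda>t. (z, t))" by (intro continuous_intros)
    from continuous_on_compose2[OF cF' this] that
    show "continuous_on (cbox 0 1) (F' z)" by auto
  qed
  have "((\<lambda>x. integral (cbox 0 1) (F x)) has_derivative integral (cbox 0 1) (F' z0)) (at z0 within U)"
    by (rule leibniz_rule[OF d int cF' U(3,2)])
  then have "((\<lambda>x. integral (cbox 0 1) (F x)) has_derivative integral (cbox 0 1) (F' z0)) (at z0)"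
    unfolding at_within_open[OF U(3,1)] .
  moreover have "integral (cbox 0 1) (F z) = ddir e f z" if "z \<in> U" for z
    unfolding F_def cbox_interval using U(6)[OF that] by (intro ddir_integral[OF assms(2) U(5), symmetric])
  ultimately have 1: "(ddir e f has_derivative integral (cbox 0 1) (F' z0)) (at z0)"
    using has_derivative_transform_within_open[OF _ U(1,3)] by blast
  have "blinfun_apply (F' z0 \<theta>) (c *s v) = c * blinfun_apply (F' z0 \<theta>) v" for \<theta> c v
    by (simp add: F'_def dblin_apply[OF assms(2) inS[OF U(3)]] ddir_smult[OF assms(2) inS[OF U(3)]])
  then have "blinfun_apply (integral (cbox 0 1) (F' z0)) (c *s v) = c * blinfun_apply (integral (cbox 0 1) (F' z0)) v" for c v
    by (simp only: blinfun_apply_integral[OF intF'[OF U(3)]]) simp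
  with 1 show "\<exists>D. (ddir e f has_derivative D) (at z0) \<and> (\<forall>c v. D (c *s v) = c * D v)"
    by blast
qed

section \<open>Vector-valued holomorphic maps\<close>

lemma vec_expand: "x = (\<Sum>i\<in>UNIV. (x $ i) *s axis i (1::complex))"
  by (simp add: vec_eq_iff axis_def if_distrib[of "\<lambda>y. _ * y"] cong: if_cong)

lemma has_derivative_vec:
  fixes f :: "'a::real_normed_vector \<Rightarrow> complex^'l"
  assumes "\<And>i. ((\<lambda>x. f x $ i) has_derivative (\<lambda>v. D v $ i)) F"
  shows "(f has_derivative D) F"
proof -
  have "((\<lambda>x. \<Sum>i\<in>UNIV. (f x $ i) *s axis i (1::complex)) has_derivative
      (\<lambda>v. \<Sum>i\<in>UNIV. (D v $ i) *s axis i (1::complex))) F"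
    by (intro has_derivative_sum has_derivative_smult_left assms)
  then show ?thesis by (simp flip: vec_expand)
qed

lemma has_derivative_nth:
  "(f has_derivative D) F \<Longrightarrow> ((\<lambda>x. f x $ i) has_derivative (\<lambda>v. D v $ i)) F"
  by (rule bounded_linear.has_derivative[OF bounded_linear_vec_nth])

definition vder :: "(complex^'k \<Rightarrow> complex^'l) \<Rightarrow> complex^'k \<Rightarrow> complex^'k \<Rightarrow> complex^'l" where
  "vder F z v = (\<chi> i. ddir v (\<lambda>z. F z $ i) z)"

lemma holo_vec_on_has_derivative:
  assumes "holo_vec_on S F" "z \<in> S"
  shows "(F has_derivative vder F z) (at z)"
  by (rule has_derivative_vec)
     (use assms in \<open>auto simp: vder_def holo_vec_on_def intro: holo_on_has_derivative\<close>)

lemma vder_smult: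
  assumes "holo_vec_on S F" "z \<in> S"
  shows "vder F z (c *s v) = c *s vder F z v"
  using assms by (simp add: vder_def vec_eq_iff holo_vec_on_def ddir_smult[where S=S])

lemma vder_unique: "(F has_derivative D) (at z) \<Longrightarrow> vder F z = D"
  by (rule ext) (simp add: vder_def vec_eq_iff ddir_unique[OF has_derivative_nth])

lemma holo_vec_onI:
  assumes "\<And>z. z \<in> S \<Longrightarrow> \<exists>D. (F has_derivative D) (at z) \<and> (\<forall>c v. D (c *s v) = c *s D v)"
  shows "holo_vec_on S F"
  unfolding holo_vec_on_def holo_on_def
proof safe
  fix i z assume "z \<in> S"
  then obtain D where "(F has_derivative D) (at z)" "\<forall>c v. D (c *s v) = c *s D v"
    using assms by blast
  then show "\<exists>D. ((\<lambda>z. F z $ i) has_derivative D) (at z) \<and> (\<forall>c v. D (c *s v) = c * D v)"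
    using has_derivative_nth by (intro exI[of _ "\<lambda>v. D v $ i"]) auto
qed

lemma holo_vec_on_subset: "holo_vec_on S f \<Longrightarrow> T \<subseteq> S \<Longrightarrow> holo_vec_on T f"
  unfolding holo_vec_on_def using holo_on_subset by blast

lemma holo_vec_on_imp_continuous_on: "holo_vec_on S f \<Longrightarrow> continuous_on S f"
  using holo_vec_on_has_derivative has_derivative_continuous
  by (metis continuous_at_imp_continuous_on)

lemma holo_vec_on_cong:
  assumes "open S" "\<And>x. x \<in> S \<Longrightarrow> f x = g x" "holo_vec_on S f"
  shows "holo_vec_on S g"
  using assms unfolding holo_vec_on_def
  by (metis (no_types, lifting) holo_on_cong)

lemma holo_on_compose:
  assumes "holo_on T g" "holo_vec_on S f" "f ` S \<subseteq> T"
  shows "holo_on S (\<lambda>z. g (f z))"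
  unfolding holo_on_def
proof
  fix z assume z: "z \<in> S"
  then have "f z \<in> T" using assms by auto
  from has_derivative_compose[OF holo_vec_on_has_derivative[OF assms(2) z], OF holo_on_has_derivative[OF assms(1) this]]
  show "\<exists>D. ((\<lambda>z. g (f z)) has_derivative D) (at z) \<and> (\<forall>c v. D (c *s v) = c * D v)"
    using vder_smult[OF assms(2) z] ddir_smult[OF assms(1) \<open>f z \<in> T\<close>] by (metis (no_types, lifting))
qed

lemma holo_vec_on_compose:
  assumes "holo_vec_on T g" "holo_vec_on S f" "f ` S \<subseteq> T"
  shows "holo_vec_on S (\<lambda>z. g (f z))"
  using assms holo_on_compose unfolding holo_vec_on_def[of T] holo_vec_on_def[of S "\<lambda>z. g (f z)"] by blast

lemma holo_on_const: "holo_on S (\<lambda>z. c)"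
  unfolding holo_on_def by (metis has_derivative_const mult_zero_right)

lemma holo_on_nth: "holo_on S (\<lambda>z. z $ k)"
  unfolding holo_on_def
  by (metis bounded_linear_imp_has_derivative bounded_linear_vec_nth vector_smult_component)

lemma holo_on_add:
  assumes "holo_on S f" "holo_on S g"
  shows "holo_on S (\<lambda>z. f z + g z)"
  unfolding holo_on_def
proof
  fix z assume z: "z \<in> S"
  show "\<exists>D. ((\<lambda>z. f z + g z) has_derivative D) (at z) \<and> (\<forall>c v. D (c *s v) = c * D v)"
    by (rule exI, rule conjI, rule has_derivative_add[OF holo_on_has_derivative[OF assms(1) z] holo_on_has_derivative[OF assms(2) z]])
       (simp add: ddir_smult[OF assms(1) z] ddir_smult[OF assms(2) z] algebra_simps)
qed

lemma holo_on_mult: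
  assumes "holo_on S f" "holo_on S g"
  shows "holo_on S (\<lambda>z. f z * g z)"
  unfolding holo_on_def
proof
  fix z assume z: "z \<in> S"
  show "\<exists>D. ((\<lambda>z. f z * g z) has_derivative D) (at z) \<and> (\<forall>c v. D (c *s v) = c * D v)"
    by (rule exI, rule conjI, rule has_derivative_mult[OF holo_on_has_derivative[OF assms(1) z] holo_on_has_derivative[OF assms(2) z]])
       (simp add: ddir_smult[OF assms(1) z] ddir_smult[OF assms(2) z] algebra_simps)
qed

lemma holo_on_diff:
  assumes "holo_on S f" "holo_on S g"
  shows "holo_on S (\<lambda>z. f z - g z)"
  using holo_on_add[OF assms(1) holo_on_mult[OF holo_on_const[of S "-1"] assms(2)]] by simp

lemma holo_vec_on_id: "holo_vec_on S (\<lambda>z. z)"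
  by (simp add: holo_vec_on_def holo_on_nth)

lemma ddir_sum:
  assumes "holo_on S f" "z \<in> S"
  shows "ddir (\<Sum>k\<in>A. c k *s e k) f z = (\<Sum>k\<in>A. c k * ddir (e k) f z)"
proof -
  have "linear (\<lambda>e. ddir e f z)"
    using holo_on_has_derivative[OF assms] has_derivative_linear by blast
  then show ?thesis
    by (subst linear_sum[where f="\<lambda>e. ddir e f z"]) (auto simp: ddir_smult[OF assms])
qed

section \<open>Iterated directional derivatives and Taylor quotients\<close>

definition iter_ddir :: "nat \<Rightarrow> complex^'k \<Rightarrow> (complex^'k \<Rightarrow> complex) \<Rightarrow> complex^'k \<Rightarrow> complex" where
  "iter_ddir l e f = (ddir e ^^ l) f"

lemma iter_ddir_0 [simp]: "iter_ddir 0 e f = f"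
  by (simp add: iter_ddir_def)

lemma iter_ddir_Suc: "iter_ddir (Suc l) e f = ddir e (iter_ddir l e f)"
  by (simp add: iter_ddir_def)

lemma iter_ddir_Suc2: "iter_ddir (Suc l) e f = iter_ddir l e (ddir e f)"
  by (simp add: iter_ddir_def funpow_swap1)

lemma holo_on_iter_ddir: "open S \<Longrightarrow> holo_on S f \<Longrightarrow> holo_on S (iter_ddir l e f)"
  by (induction l) (auto simp: iter_ddir_Suc intro: holo_on_ddir)

lemma iter_ddir_cong:
  assumes "open S" "\<And>x. x \<in> S \<Longrightarrow> f x = g x" "z \<in> S"
  shows "iter_ddir l e f z = iter_ddir l e g z"
  using assms(3)
proof (induction l arbitrary: z)
  case (Suc l)
  then show ?case unfolding iter_ddir_Suc using ddir_cong[OF assms(1)] by blast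
qed (use assms in auto)

lemma iter_ddir_linear:
  assumes "open S" "\<And>k. k \<in> A \<Longrightarrow> holo_on S (f k)" "z \<in> S"
  shows "iter_ddir l e (\<lambda>z. \<Sum>k\<in>A. c k * f k z) z = (\<Sum>k\<in>A. c k * iter_ddir l e (f k) z)"
  using assms(3)
proof (induction l arbitrary: z)
  case (Suc l)
  have "iter_ddir (Suc l) e (\<lambda>z. \<Sum>k\<in>A. c k * f k z) z = ddir e (\<lambda>z. \<Sum>k\<in>A. c k * iter_ddir l e (f k) z) z"
    unfolding iter_ddir_Suc by (rule ddir_cong[OF assms(1) Suc.prems Suc.IH])
  also have "((\<lambda>z. \<Sum>k\<in>A. c k * iter_ddir l e (f k) z) has_derivative (\<lambda>e'. \<Sum>k\<in>A. c k * ddir e' (iter_ddir l e (f k)) z)) (at z)"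
    by (intro has_derivative_sum has_derivative_mult_right holo_on_has_derivative[OF holo_on_iter_ddir[OF assms(1,2)]] Suc.prems)
  then have "ddir e (\<lambda>z. \<Sum>k\<in>A. c k * iter_ddir l e (f k) z) z = (\<Sum>k\<in>A. c k * iter_ddir (Suc l) e (f k) z)"
    using ddir_unique by (simp add: iter_ddir_Suc)
  finally show ?case .
qed simp

lemma slice_open: "open S \<Longrightarrow> open {t. z + t *s (e :: complex^'k) \<in> S}"
proof -
  assume "open S"
  moreover have "continuous_on UNIV (\<lambda>t. z + t *s e)"
    by (intro continuous_intros)
  ultimately show ?thesis
    using open_vimage[of S "\<lambda>t. z + t *s e"] by (simp add: vimage_def)
qed

text \<open>The induction step differentiates the previous identity, which therefore has to hold for
  all parameters near \<open>t\<close>; hence \<open>t\<close> is arbitrary and not just 0.\<close>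

lemma deriv_slice:
  assumes "open S" "holo_on S f" "z + t *s e \<in> S"
  shows "(deriv ^^ l) (\<lambda>\<tau>. f (z + \<tau> *s e)) t = iter_ddir l e f (z + t *s e)"
  using assms(3)
proof (induction l arbitrary: t)
  case (Suc l)
  have ev: "\<forall>\<^sub>F \<tau> in nhds t. (deriv ^^ l) (\<lambda>\<tau>. f (z + \<tau> *s e)) \<tau> = iter_ddir l e f (z + \<tau> *s e)"
    using eventually_nhds_in_open[OF slice_open[OF assms(1), of z e], of t] Suc
    by (auto elim!: eventually_mono)
  have "(deriv ^^ Suc l) (\<lambda>\<tau>. f (z + \<tau> *s e)) t = deriv (\<lambda>\<tau>. iter_ddir l e f (z + \<tau> *s e)) t"
    using deriv_cong_ev[OF ev refl] by simp
  also have "\<dots> = iter_ddir (Suc l) e f (z + t *s e)"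
    unfolding iter_ddir_Suc
    by (intro DERIV_imp_deriv has_field_derivative_slice[OF holo_on_iter_ddir[OF assms(1,2)] Suc.prems])
  finally show ?case .
qed simp

lemma slice_holomorphic:
  assumes "holo_on S f" "\<And>t. t \<in> T \<Longrightarrow> z + t *s e \<in> S"
  shows "(\<lambda>t. f (z + t *s e)) holomorphic_on T"
  using has_field_derivative_slice[OF assms(1)] assms(2)
  unfolding holomorphic_on_def field_differentiable_def
  by (metis has_field_derivative_at_within)

text \<open>The identity theorem is applied on one disc of one complex line. The radius 2 leaves
  room around the parameter 1, at which \<open>z + e\<close> is reached.\<close>

lemma vanishing_ray:
  assumes "open S" "holo_on S f" "\<And>t. cmod t < 2 \<Longrightarrow> z + t *s e \<in> S" "\<And>k. iter_ddir k e f z = 0"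
  shows "f (z + e) = 0"
proof -
  have "(\<lambda>t. f (z + t *s e)) 1 = 0"
  proof (rule holomorphic_fun_eq_0_on_ball[of "\<lambda>t. f (z + t *s e)" 0 2 1])
    show "(\<lambda>t. f (z + t *s e)) holomorphic_on ball 0 2"
      using assms(3) by (intro slice_holomorphic[OF assms(2)]) auto
    show "(deriv ^^ n) (\<lambda>t. f (z + t *s e)) 0 = 0" for n
      using deriv_slice[OF assms(1,2,3), of 0 n] assms(4) by simp
  qed simp
  then show ?thesis by simp
qed

text \<open>Unlike \<open>tube_exists\<close> this is uniform in the direction too, because the
  Taylor quotients below are taken in a direction that varies.\<close>

lemma tube_exists_direction:
  assumes "open S" "z0 \<in> S"
  obtains \<delta> r where "\<delta> > 0" "r > 0"
    "\<And>z e t. z \<in> ball z0 \<delta> \<Longrightarrow> e \<in> ball (e0 :: complex^'k) 1 \<Longrightarrow> cmod t < 2 * r \<Longrightarrow> z + t *s e \<in> S"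
proof -
  obtain \<delta> where \<delta>: "\<delta> > 0" "ball z0 \<delta> \<subseteq> S" using assms openE by blast
  \<comment> \<open>Directions in the unit ball about \<open>e0\<close> have norm at most
    \<open>norm e0 + 1\<close> and parameters stay below \<open>2 * r\<close>, so the displacement
    is at most half of \<delta>.\<close>
  define r where "r = \<delta> / 4 / (norm e0 + 1)"
  have ne: "norm e0 + 1 > 0" using norm_ge_zero[of e0] by linarith
  then have "r * (norm e0 + 1) = \<delta> / 4"
    unfolding r_def by (intro nonzero_eq_divide_eq[THEN iffD1]) simp_all
  then have r: "r > 0" "2 * r * (norm e0 + 1) = \<delta> / 2"
    using \<delta> ne by (simp add: r_def, linarith)
  have "z + t *s e \<in> S" if "z \<in> ball z0 (\<delta>/2)" "e \<in> ball e0 1" "cmod t < 2 * r" for z e t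
  proof -
    have "norm e \<le> norm e0 + 1"
      using that(2) norm_triangle_ineq2[of e e0] by (auto simp: dist_norm norm_minus_commute)
    then have "norm (t *s e) \<le> \<delta> / 2"
      using r(2) that(3) mult_mono[of "cmod t" "2*r" "norm e" "norm e0 + 1"] r(1) by auto
    then have "dist z0 (z + t *s e) < \<delta>"
      using that(1) norm_triangle_ineq4[of "z0 - z" "t *s e"]
      by (simp add: dist_norm algebra_simps)
    then show ?thesis using \<delta> by auto
  qed
  then show ?thesis using that[of "\<delta>/2" r] \<delta> r by auto
qed

text \<open>Dividing by the power shifts the coefficients of the power series; the vanishing ones
  are exactly those that would have become negative powers.\<close>

lemma quotient_holomorphic:
  assumes "g holomorphic_on ball 0 r" "\<And>k. k < l \<Longrightarrow> (deriv ^^ k) g 0 = 0"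
  shows "(\<lambda>t. if t = 0 then (deriv ^^ l) g 0 / fact l else g t / t ^ l) holomorphic_on ball 0 r"
proof (rule power_series_holomorphic)
  fix w :: complex assume w: "w \<in> ball 0 r"
  let ?a = "\<lambda>n. (deriv ^^ n) g 0 / fact n"
  show "(\<lambda>n. ?a (n + l) * (w - 0) ^ n) sums (if w = 0 then (deriv ^^ l) g 0 / fact l else g w / w ^ l)"
  proof (cases "w = 0")
    case True
    then show ?thesis using powser_sums_zero[of "\<lambda>n. ?a (n + l)"] by simp
  next
    case False
    have "(\<lambda>n. ?a n * (w - 0) ^ n) sums g w"
      by (rule holomorphic_power_series[OF assms(1) w])
    then have "(\<lambda>n. ?a (n + l) * w ^ (n + l)) sums g w"
      using assms(2) by (subst sums_zero_iff_shift) auto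
    then have "(\<lambda>n. ?a (n + l) * w ^ (n + l) / w ^ l) sums (g w / w ^ l)"
      by (rule sums_divide)
    then show ?thesis using False by (simp add: power_add)
  qed
qed

text \<open>The Cauchy integral expresses the quotient and its limit by one continuous function of the
  base point, the direction and the parameter.\<close>

lemma taylor_limit:
  fixes f :: "complex^'k \<Rightarrow> complex" and t :: "'x \<Rightarrow> complex"
  assumes S: "open S" and f: "holo_on S f" and z0: "z0 \<in> S"
    and lim: "(y \<longlongrightarrow> z0) F" "(e \<longlongrightarrow> e0) F" "(t \<longlongrightarrow> 0) F"
    and ev: "\<forall>\<^sub>F x in F. t x \<noteq> 0" "\<forall>\<^sub>F x in F. \<forall>k<l. iter_ddir k (e x) f (y x) = 0"
    and v0: "\<And>k. k < l \<Longrightarrow> iter_ddir k e0 f z0 = 0"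
  shows "((\<lambda>x. f (y x + t x *s e x) / t x ^ l) \<longlongrightarrow> iter_ddir l e0 f z0 / fact l) F"
proof -
  obtain \<delta> r where \<delta>: "\<delta> > 0" "r > 0" and
    inS: "\<And>z e t. z \<in> ball z0 \<delta> \<Longrightarrow> e \<in> ball e0 1 \<Longrightarrow> cmod t < 2 * r \<Longrightarrow> z + t *s e \<in> S"
    using tube_exists_direction[OF S z0, of e0] by metis
  define W where "W = ball z0 \<delta> \<times> ball e0 1 \<times> ball (0::complex) r"
  \<comment> \<open>The Cauchy kernel of the quotient by the \<open>l\<close>-th power. On the
    circle the variable is nonzero, so the division is harmless and \<open>k\<close> is continuous
    even where the parameter is 0.\<close>
  define k where "k w \<theta> = f (fst w + circ r \<theta> *s fst (snd w)) / circ r \<theta> ^ l /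
      (circ r \<theta> - snd (snd w)) * circ r \<theta>" for w \<theta>
  define K where "K w = integral (cbox 0 1) (k w)" for w
  have circ_neq: "circ r \<theta> \<noteq> t" if "cmod t < r" for \<theta> t
    using that \<delta>(2) norm_circ[of r \<theta>] by auto
  have "continuous_on (W \<times> cbox 0 1) (\<lambda>x. k (fst x) (snd x))"
    unfolding k_def
    by (intro continuous_intros continuous_on_compose2[OF holo_on_imp_continuous_on[OF f]])
       (use \<delta> in \<open>auto simp: W_def circ_neq intro!: inS\<close>)
  then have "continuous_on W K"
    unfolding K_def by (intro integral_continuous_on_param) (simp add: case_prod_beta)
  moreover have W: "open W" "(z0, e0, 0) \<in> W"
    using \<delta> by (auto simp: W_def intro!: open_Times)
  ultimately have "isCont K (z0, e0, 0)"
    using continuous_on_eq_continuous_at by blast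
  moreover have l2: "((\<lambda>x. (y x, e x, t x)) \<longlongrightarrow> (z0, e0, 0)) F"
    by (intro tendsto_intros lim)
  ultimately have limK: "((\<lambda>x. K (y x, e x, t x)) \<longlongrightarrow> K (z0, e0, 0)) F"
    by (rule isCont_tendsto_compose)
  have K: "K (z, d, \<tau>) = (if \<tau> = 0 then iter_ddir l d f z / fact l else f (z + \<tau> *s d) / \<tau> ^ l)"
    if "(z, d, \<tau>) \<in> W" "\<forall>k<l. iter_ddir k d f z = 0" for z d \<tau>
  proof -
    let ?g = "\<lambda>\<tau>. f (z + \<tau> *s d)"
    have g: "?g holomorphic_on ball 0 (2*r)"
      by (rule slice_holomorphic[OF f]) (use that inS in \<open>auto simp: W_def\<close>)
    have dg: "(deriv ^^ k) ?g 0 = iter_ddir k d f z" for k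
      using deriv_slice[OF S f, of z 0 d k] inS[of z d 0] that \<delta> by (auto simp: W_def)
    define h where "h \<tau> = (if \<tau> = 0 then (deriv ^^ l) ?g 0 / fact l else ?g \<tau> / \<tau> ^ l)" for \<tau>
    have "h holomorphic_on ball 0 (2*r)"
      unfolding h_def by (rule quotient_holomorphic[OF g]) (use that dg in auto)
    then have "h holomorphic_on cball 0 r"
      by (rule holomorphic_on_subset) (use \<delta> in auto)
    then have "h \<tau> = integral {0..1} (\<lambda>\<theta>. h (circ r \<theta>) / (circ r \<theta> - \<tau>) * circ r \<theta>)"
      by (rule cauchy_mean) (use that in \<open>auto simp: W_def\<close>)
    also have "\<dots> = K (z, d, \<tau>)"
      unfolding K_def k_def cbox_interval by (rule integral_cong) (use \<delta> in \<open>simp add: h_def\<close>)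
    finally have "h \<tau> = K (z, d, \<tau>)" .
    then show ?thesis unfolding h_def dg by simp
  qed
  have K0: "K (z0, e0, 0) = iter_ddir l e0 f z0 / fact l"
    using K[OF W(2)] v0 by simp
  have "\<forall>\<^sub>F x in F. (y x, e x, t x) \<in> W"
    using topological_tendstoD[OF l2 W] .
  then have "\<forall>\<^sub>F x in F. K (y x, e x, t x) = f (y x + t x *s e x) / t x ^ l"
    using ev by eventually_elim (use K in presburger)
  then show ?thesis
    by (rule Lim_transform_eventually[OF limK[unfolded K0]])
qed

section \<open>Homogeneous polynomials\<close>

definition scalar_poly :: "nat \<Rightarrow> (complex^'q \<Rightarrow> complex) \<Rightarrow> bool" where
  "scalar_poly l P \<longleftrightarrow> (\<exists>c :: ('q \<Rightarrow> nat) \<Rightarrow> complex.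
     P = (\<lambda>v. \<Sum>\<alpha> | (\<Sum>k\<in>UNIV. \<alpha> k) = l. (\<Prod>k\<in>UNIV. (v $ k) ^ \<alpha> k) * c \<alpha>))"

lemma finite_multi_indices: "finite {\<alpha> :: 'q::finite \<Rightarrow> nat. (\<Sum>k\<in>UNIV. \<alpha> k) = l}"
proof (rule finite_subset)
  show "{\<alpha> :: 'q \<Rightarrow> nat. (\<Sum>k\<in>UNIV. \<alpha> k) = l} \<subseteq> (\<Pi>\<^sub>E k\<in>UNIV. {..l})"
  proof
    fix \<alpha> :: "'q \<Rightarrow> nat" assume "\<alpha> \<in> {\<alpha>. (\<Sum>k\<in>UNIV. \<alpha> k) = l}"
    then have "\<alpha> k \<le> l" for k using member_le_sum[of k UNIV \<alpha>] by simp
    then show "\<alpha> \<in> (\<Pi>\<^sub>E k\<in>UNIV. {..l})" by (auto simp: PiE_def)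
  qed
qed (auto intro: finite_PiE)

lemma homogeneous_polyI:
  assumes "\<And>a. scalar_poly l (\<lambda>v. P v $ a)"
  shows "homogeneous_poly l P"
proof -
  have "\<forall>a. \<exists>c. (\<lambda>v. P v $ a) = (\<lambda>v. \<Sum>\<alpha> | (\<Sum>k\<in>UNIV. \<alpha> k) = l. (\<Prod>k\<in>UNIV. (v $ k) ^ \<alpha> k) * c \<alpha>)"
    using assms unfolding scalar_poly_def by blast
  from choice[OF this] obtain c where c: "\<And>a. (\<lambda>v. P v $ a) = (\<lambda>v. \<Sum>\<alpha> | (\<Sum>k\<in>UNIV. \<alpha> k) = l. (\<Prod>k\<in>UNIV. (v $ k) ^ \<alpha> k) * c a \<alpha>)"
    by blast
  show ?thesis unfolding homogeneous_poly_def
  proof (rule exI[of _ "\<lambda>\<alpha>. \<chi> a. c a \<alpha>"], rule ext, simp only: vec_eq_iff, rule allI)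
    fix v a
    show "P v $ a = (\<Sum>\<alpha> | (\<Sum>k\<in>UNIV. \<alpha> k) = l. (\<Prod>k\<in>UNIV. (v $ k) ^ \<alpha> k) *s (\<chi> a. c a \<alpha>)) $ a"
      unfolding sum_component vector_smult_component vec_lambda_beta by (rule fun_cong[OF c])
  qed
qed

lemma scalar_poly_const: "scalar_poly 0 (\<lambda>v :: complex^'q. a)"
  unfolding scalar_poly_def
proof
  have "{\<alpha> :: 'q \<Rightarrow> nat. \<forall>k. \<alpha> k = 0} = {\<lambda>_. 0}"
    by (auto simp: fun_eq_iff)
  then show "(\<lambda>v :: complex^'q. a) = (\<lambda>v. \<Sum>\<alpha> | (\<Sum>k\<in>UNIV. \<alpha> k) = 0. (\<Prod>k\<in>UNIV. (v $ k) ^ \<alpha> k) * (\<lambda>_. a) \<alpha>)"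
    by simp
qed

lemma scalar_poly_zero: "scalar_poly l (\<lambda>v. 0)"
  unfolding scalar_poly_def by (rule exI[of _ "\<lambda>_. 0"]) simp

lemma scalar_poly_add:
  assumes "scalar_poly l P" "scalar_poly l Q"
  shows "scalar_poly l (\<lambda>v. P v + Q v)"
proof -
  obtain c d where "P = (\<lambda>v. \<Sum>\<alpha> | (\<Sum>k\<in>UNIV. \<alpha> k) = l. (\<Prod>k\<in>UNIV. (v $ k) ^ \<alpha> k) * c \<alpha>)"
    "Q = (\<lambda>v. \<Sum>\<alpha> | (\<Sum>k\<in>UNIV. \<alpha> k) = l. (\<Prod>k\<in>UNIV. (v $ k) ^ \<alpha> k) * d \<alpha>)"
    using assms unfolding scalar_poly_def by blast
  then show ?thesis unfolding scalar_poly_def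
    by (intro exI[of _ "\<lambda>\<alpha>. c \<alpha> + d \<alpha>"]) (simp add: sum.distrib algebra_simps)
qed

lemma scalar_poly_sum: "(\<And>i. i \<in> A \<Longrightarrow> scalar_poly l (P i)) \<Longrightarrow> scalar_poly l (\<lambda>v. \<Sum>i\<in>A. P i v)"
  by (induction A rule: infinite_finite_induct) (auto intro: scalar_poly_zero scalar_poly_add)

lemma scalar_poly_mult_const:
  assumes "scalar_poly l P"
  shows "scalar_poly l (\<lambda>v. P v * a)"
proof -
  obtain c where "P = (\<lambda>v. \<Sum>\<alpha> | (\<Sum>k\<in>UNIV. \<alpha> k) = l. (\<Prod>k\<in>UNIV. (v $ k) ^ \<alpha> k) * c \<alpha>)"
    using assms unfolding scalar_poly_def by blast
  then show ?thesis unfolding scalar_poly_def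
    by (intro exI[of _ "\<lambda>\<alpha>. c \<alpha> * a"]) (simp add: sum_distrib_right mult.assoc)
qed

text \<open>Multiplication by a coordinate raises one exponent, which injects the multi-indices of
  degree \<open>l\<close> into those of degree \<open>Suc l\<close>.\<close>

lemma scalar_poly_mult_coord:
  fixes P :: "complex^'q \<Rightarrow> complex"
  assumes "scalar_poly l P"
  shows "scalar_poly (Suc l) (\<lambda>v. v $ k * P v)"
proof -
  obtain c where c: "P = (\<lambda>v. \<Sum>\<alpha> | (\<Sum>k\<in>UNIV. \<alpha> k) = l. (\<Prod>k\<in>UNIV. (v $ k) ^ \<alpha> k) * c \<alpha>)"
    using assms unfolding scalar_poly_def by blast
  let ?up = "\<lambda>\<alpha> :: 'q \<Rightarrow> nat. \<alpha>(k := Suc (\<alpha> k))"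
  let ?dn = "\<lambda>\<alpha> :: 'q \<Rightarrow> nat. \<alpha>(k := \<alpha> k - 1)"
  have sum_split: "(\<Sum>i\<in>UNIV. \<alpha> i) = \<alpha> k + (\<Sum>i\<in>UNIV - {k}. \<alpha> i)" for \<alpha> :: "'q \<Rightarrow> nat"
    by (simp add: sum.remove)
  have up: "(\<Sum>i\<in>UNIV. ?up \<alpha> i) = Suc (\<Sum>i\<in>UNIV. \<alpha> i)" for \<alpha>
    by (simp add: sum_split)
  have prod_up: "(\<Prod>i\<in>UNIV. (v $ i) ^ ?up \<alpha> i) = v $ k * (\<Prod>i\<in>UNIV. (v $ i) ^ \<alpha> i)" for v :: "complex^'q" and \<alpha>
    by (simp add: prod.remove[of UNIV k])
  \<comment> \<open>Multi-indices with exponent 0 at \<open>k\<close> are not in the image of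
    \<open>?up\<close>; they get the coefficient 0, so the truncated subtraction in
    \<open>?dn\<close> does no harm.\<close>
  define c' where "c' \<alpha> = (if \<alpha> k = 0 then 0 else c (?dn \<alpha>))" for \<alpha>
  have "v $ k * P v = (\<Sum>\<alpha> | (\<Sum>k\<in>UNIV. \<alpha> k) = Suc l. (\<Prod>k\<in>UNIV. (v $ k) ^ \<alpha> k) * c' \<alpha>)" for v
  proof -
    let ?A = "{\<alpha> :: 'q \<Rightarrow> nat. (\<Sum>k\<in>UNIV. \<alpha> k) = l}"
    let ?B = "{\<alpha> :: 'q \<Rightarrow> nat. (\<Sum>k\<in>UNIV. \<alpha> k) = Suc l}"
    have inj: "inj_on ?up ?A"
    proof (rule inj_onI)
      fix \<alpha> \<beta> assume "?up \<alpha> = ?up \<beta>"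
      then have "?dn (?up \<alpha>) = ?dn (?up \<beta>)" by simp
      then show "\<alpha> = \<beta>" by simp
    qed
    have sub: "?up ` ?A \<subseteq> ?B" using up by auto
    have zero: "c' \<alpha> = 0" if "\<alpha> \<in> ?B - ?up ` ?A" for \<alpha>
    proof (rule ccontr)
      assume "c' \<alpha> \<noteq> 0"
      then have "\<alpha> k \<noteq> 0" by (auto simp: c'_def split: if_splits)
      then have "\<alpha> = ?up (?dn \<alpha>)" by (auto simp: fun_eq_iff)
      moreover from this have "?dn \<alpha> \<in> ?A" using up[of "?dn \<alpha>"] that by auto
      ultimately show False using that by blast
    qed
    have "(\<Sum>\<alpha>\<in>?B. (\<Prod>k\<in>UNIV. (v $ k) ^ \<alpha> k) * c' \<alpha>) = (\<Sum>\<alpha>\<in>?up ` ?A. (\<Prod>k\<in>UNIV. (v $ k) ^ \<alpha> k) * c' \<alpha>)"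
      by (rule sum.mono_neutral_right[OF finite_multi_indices sub]) (use zero in auto)
    also have "\<dots> = (\<Sum>\<alpha>\<in>?A. (\<Prod>k\<in>UNIV. (v $ k) ^ ?up \<alpha> k) * c' (?up \<alpha>))"
      by (subst sum.reindex[OF inj]) (simp only: comp_def)
    also have "\<dots> = v $ k * P v"
      by (simp only: prod_up c sum_distrib_left) (simp add: c'_def mult.assoc)
    finally show ?thesis by simp
  qed
  then show ?thesis unfolding scalar_poly_def by blast
qed

text \<open>Only the innermost derivative is expanded by linearity. This leaves the functions
  \<open>ddir (b k) f\<close> under derivatives in the same direction, which is why \<open>f\<close>
  is generalized in the induction; mixed partial derivatives are never interchanged.\<close>

lemma scalar_poly_iter_ddir:
  fixes b :: "'q::finite \<Rightarrow> complex^'k"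
  assumes "open S" "holo_on S f" "z \<in> S"
  shows "scalar_poly l (\<lambda>v :: complex^'q. iter_ddir l (\<Sum>k\<in>UNIV. (v $ k) *s b k) f z)"
  using assms(2)
proof (induction l arbitrary: f)
  case 0
  then show ?case by (simp add: scalar_poly_const)
next
  case (Suc l)
  have "iter_ddir (Suc l) (\<Sum>k\<in>UNIV. (v $ k) *s b k) f z =
     (\<Sum>k\<in>UNIV. v $ k * iter_ddir l (\<Sum>k\<in>UNIV. (v $ k) *s b k) (ddir (b k) f) z)" for v :: "complex^'q"
    unfolding iter_ddir_Suc2
    by (subst iter_ddir_cong[OF assms(1) ddir_sum[OF Suc.prems] assms(3)], assumption)
       (rule iter_ddir_linear[OF assms(1) holo_on_ddir[OF assms(1) Suc.prems] assms(3)])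
  then show ?case
    by (auto intro!: scalar_poly_sum scalar_poly_mult_coord Suc.IH holo_on_ddir Suc.prems assms(1))
qed

section \<open>Tangential and normal blocks of coordinates\<close>

definition inl :: "complex^'a \<Rightarrow> complex^('a::finite + 'b::finite)" where
  "inl v = (\<chi> i. case i of Inl a \<Rightarrow> v $ a | Inr b \<Rightarrow> 0)"

definition inr :: "complex^'b \<Rightarrow> complex^('a::finite + 'b::finite)" where
  "inr v = (\<chi> i. case i of Inl a \<Rightarrow> 0 | Inr b \<Rightarrow> v $ b)"

definition prl :: "complex^('a::finite + 'b::finite) \<Rightarrow> complex^'a" where
  "prl z = (\<chi> a. z $ Inl a)"

definition prr :: "complex^('a::finite + 'b::finite) \<Rightarrow> complex^'b" where
  "prr z = (\<chi> b. z $ Inr b)"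

lemma block_simps [simp]:
  "inl v $ Inl a = v $ a" "inl v $ Inr b = 0" "inr w $ Inl a = 0" "inr w $ Inr b = w $ b"
  "prl z $ a = z $ Inl a" "prr z $ b = z $ Inr b"
  by (simp_all add: inl_def inr_def prl_def prr_def)

lemma vec_sum_eq_iff: "(x :: 'c^('a::finite + 'b::finite)) = y \<longleftrightarrow> (\<forall>a. x $ Inl a = y $ Inl a) \<and> (\<forall>b. x $ Inr b = y $ Inr b)"
  unfolding vec_eq_iff by (metis sum.exhaust)

lemma block_simps2 [simp]:
  fixes v :: "complex^('a::finite)" and w :: "complex^('b::finite)" and z :: "complex^('a + 'b)"
  shows
  "prl (inl v :: complex^('a + 'b)) = v" "prr (inl v :: complex^('a + 'b)) = 0"
  "prl (inr w :: complex^('a + 'b)) = 0" "prr (inr w :: complex^('a + 'b)) = w"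
  "inl (prl z) + inr (prr z) = z" "inl (0 :: complex^'a) = (0 :: complex^('a + 'b))" "inr (0 :: complex^'b) = (0 :: complex^('a + 'b))"
  "prl (0 :: complex^('a + 'b)) = 0" "prr (0 :: complex^('a + 'b)) = 0"
  by (simp_all add: vec_sum_eq_iff vec_eq_iff[where 'b='a] vec_eq_iff[where 'b='b])

lemma block_linear [simp]:
  fixes v w :: "complex^('a::finite)" and v' w' :: "complex^('b::finite)" and x y :: "complex^('a + 'b)"
  shows
  "prl (x + y) = prl x + prl y" "prr (x + y) = prr x + prr y"
  "prl (x - y) = prl x - prl y" "prr (x - y) = prr x - prr y"
  "prl (c *s x) = c *s prl x" "prr (c *s x) = c *s prr x"
  "(inl (v + w) :: complex^('a + 'b)) = inl v + inl w" "(inr (v' + w') :: complex^('a + 'b)) = inr v' + inr w'"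
  "(inl (v - w) :: complex^('a + 'b)) = inl v - inl w" "(inr (v' - w') :: complex^('a + 'b)) = inr v' - inr w'"
  "(inl (c *s v) :: complex^('a + 'b)) = c *s inl v" "(inr (c *s v') :: complex^('a + 'b)) = c *s inr v'"
  by (simp_all add: vec_sum_eq_iff vec_eq_iff[where 'b='a] vec_eq_iff[where 'b='b])

lemma inr_expand: "(inr v :: complex^('a::finite + 'b::finite)) = (\<Sum>k\<in>UNIV. (v $ k) *s inr (axis k 1))"
proof -
  have "(inr (\<Sum>k\<in>A. (v $ k) *s axis k 1) :: complex^('a + 'b)) = (\<Sum>k\<in>A. (v $ k) *s inr (axis k 1))" for A :: "'b set"
    by (induction A rule: infinite_finite_induct) auto
  from this[of UNIV] show ?thesis by (simp flip: vec_expand)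
qed

lemma block_holo:
  "holo_vec_on S (inl :: complex^'a \<Rightarrow> complex^('a::finite + 'b::finite))"
  "holo_vec_on S' (inr :: complex^'b \<Rightarrow> complex^('a::finite + 'b::finite))"
  "holo_vec_on S'' (prl :: complex^('a::finite + 'b::finite) \<Rightarrow> complex^'a)"
  "holo_vec_on S'' (prr :: complex^('a::finite + 'b::finite) \<Rightarrow> complex^'b)"
proof -
  have "holo_on S (\<lambda>z :: complex^'a. inl z $ i)" "holo_on S' (\<lambda>z :: complex^'b. inr z $ i)" for i :: "'a + 'b"
    by (cases i; simp add: holo_on_nth holo_on_const)+
  then show "holo_vec_on S (inl :: complex^'a \<Rightarrow> complex^('a + 'b))" "holo_vec_on S' (inr :: complex^'b \<Rightarrow> complex^('a + 'b))"
    unfolding holo_vec_on_def by blast+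
qed (auto simp: holo_vec_on_def holo_on_nth)

lemma norm_block:
  fixes z :: "complex^('a::finite + 'b::finite)"
  shows "norm (inr (prr z) :: complex^('a + 'b)) \<le> norm z" "norm (inl (prl z) :: complex^('a + 'b)) \<le> norm z"
proof -
  have "cmod (inr (prr z) $ i) \<le> cmod (z $ i)" "cmod (inl (prl z) $ i) \<le> cmod (z $ i)" for i :: "'a + 'b"
    by (cases i; simp)+
  then show "norm (inr (prr z) :: complex^('a + 'b)) \<le> norm z" "norm (inl (prl z) :: complex^('a + 'b)) \<le> norm z"
    unfolding norm_vec_def by (auto intro!: L2_set_mono)
qed

lemma block_bounded_linear:
  "bounded_linear (inl :: complex^'a \<Rightarrow> complex^('a::finite + 'b::finite))"
  "bounded_linear (inr :: complex^'b \<Rightarrow> complex^('a::finite + 'b::finite))"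
  "bounded_linear (prl :: complex^('a::finite + 'b::finite) \<Rightarrow> complex^'a)"
  "bounded_linear (prr :: complex^('a::finite + 'b::finite) \<Rightarrow> complex^'b)"
  unfolding linear_conv_bounded_linear[symmetric]
  by (auto intro!: linearI simp: vec_sum_eq_iff vec_eq_iff[where 'b='a] vec_eq_iff[where 'b='b])

lemma scalar_poly_iter_ddir_inr:
  assumes "open S" "holo_on S f" "z \<in> S"
  shows "scalar_poly l (\<lambda>v. iter_ddir l (inr v) f z)"
  using scalar_poly_iter_ddir[OF assms, of l "\<lambda>k. inr (axis k 1)"] by (simp flip: inr_expand)

section \<open>Strict differentiability and the inverse function theorem\<close>

lemma vder_linear:
  assumes "holo_vec_on S F" "z \<in> S"
  shows "bounded_linear (vder F z)"
  using holo_vec_on_has_derivative[OF assms] has_derivative_bounded_linear by blast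

lemma continuous_on_vder:
  assumes "open S" "holo_vec_on S F"
  shows "continuous_on S (\<lambda>z. Blinfun (vder F z))"
proof (rule continuous_on_blinfun_componentwise)
  fix e :: "complex^'a"
  have "continuous_on S (\<lambda>z. vder F z e)"
    unfolding vder_def
    by (intro continuous_on_vec_lambda continuous_on_ddir assms(1)) (use assms(2) in \<open>auto simp: holo_vec_on_def\<close>)
  then show "continuous_on S (\<lambda>x. blinfun_apply (Blinfun (vder F x)) e)"
    by (rule continuous_on_eq) (simp add: bounded_linear_Blinfun_apply[OF vder_linear[OF assms(2)]])
qed

text \<open>Both endpoints may move, which is what allows two maps with the same limit to be
  compared after a change of chart. It is the mean value inequality for \<open>F\<close> minus its
  derivative at \<open>z0\<close>; the derivative of that difference is small by continuity of
  \<open>vder F\<close>.\<close>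

lemma strict_derivative:
  fixes F :: "complex^'k \<Rightarrow> complex^'l"
  assumes S: "open S" "holo_vec_on S F" "z0 \<in> S" and \<epsilon>: "\<epsilon> > 0"
  obtains \<delta> where "\<delta> > 0" "ball z0 \<delta> \<subseteq> S"
    "\<And>x y. x \<in> ball z0 \<delta> \<Longrightarrow> y \<in> ball z0 \<delta> \<Longrightarrow> norm (F y - F x - vder F z0 (y - x)) \<le> \<epsilon> * norm (y - x)"
proof -
  let ?D = "\<lambda>z. Blinfun (vder F z)"
  have ap: "blinfun_apply (?D z) = vder F z" if "z \<in> S" for z
    by (rule bounded_linear_Blinfun_apply[OF vder_linear[OF S(2) that]])
  have "isCont ?D z0"
    using continuous_on_vder[OF S(1,2)] S continuous_on_eq_continuous_at by blast
  then obtain d where d: "d > 0" "\<And>z. dist z z0 < d \<Longrightarrow> dist (?D z) (?D z0) < \<epsilon>"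
    using \<epsilon> unfolding continuous_at_eps_delta by metis
  obtain d' where d': "d' > 0" "ball z0 d' \<subseteq> S" using S(1,3) openE by blast
  define \<delta> where "\<delta> = min d d'"
  have \<delta>: "\<delta> > 0" "ball z0 \<delta> \<subseteq> S" "\<delta> \<le> d" using d d' by (auto simp: \<delta>_def)
  show thesis
  proof (rule that[OF \<delta>(1,2)])
    fix x y assume xy: "x \<in> ball z0 \<delta>" "y \<in> ball z0 \<delta>"
    have "norm (F y - F x - vder F z0 (y - x)) \<le> norm (y - x) * \<epsilon>"
    proof (rule differentiable_bound_linearization[where S="ball z0 \<delta>"])
      show "x + t *\<^sub>R (y - x) \<in> ball z0 \<delta>" if "t \<in> {0..1}" for t
        using convex_ball[of z0 \<delta>] xy that convexD_alt[of "ball z0 \<delta>" x y t]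
        by (simp add: algebra_simps)
      show "(F has_derivative vder F z) (at z within ball z0 \<delta>)" if "z \<in> ball z0 \<delta>" for z
        using holo_vec_on_has_derivative[OF S(2)] \<delta>(2) that has_derivative_at_withinI by blast
      show "onorm (vder F z - vder F z0) \<le> \<epsilon>" if "z \<in> ball z0 \<delta>" for z
      proof -
        have "norm (?D z - ?D z0) < \<epsilon>" using d(2)[of z] that \<delta>(3) by (auto simp: dist_norm norm_minus_commute)
        then have "onorm (blinfun_apply (?D z - ?D z0)) < \<epsilon>" by (simp add: norm_blinfun.rep_eq)
        moreover have "blinfun_apply (?D z - ?D z0) = vder F z - vder F z0"
          using that \<delta>(2) S(3) by (auto simp: minus_blinfun.rep_eq ap fun_eq_iff)
        ultimately show ?thesis by simp
      qed
    qed (use \<delta> in auto)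
    then show "norm (F y - F x - vder F z0 (y - x)) \<le> \<epsilon> * norm (y - x)" by (simp add: mult.commute)
  qed
qed

text \<open>The real inverse function theorem provides \<open>G\<close>; its derivative is the
  inverse of a complex linear bijection and hence complex linear.\<close>

lemma holo_inverse_function:
  fixes F :: "complex^'k \<Rightarrow> complex^'k"
  assumes S: "open S" "holo_vec_on S F" "z0 \<in> S" and inj: "\<And>v. vder F z0 v = 0 \<Longrightarrow> v = 0"
  obtains U V G where "open U" "U \<subseteq> S" "z0 \<in> U" "open V" "F ` U = V" "G ` V = U"
    "\<And>x. x \<in> U \<Longrightarrow> G (F x) = x" "\<And>y. y \<in> V \<Longrightarrow> F (G y) = y" "holo_vec_on V G"
proof -
  let ?D = "\<lambda>z. Blinfun (vder F z)"
  have ap: "blinfun_apply (?D z) = vder F z" if "z \<in> S" for z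
    by (rule bounded_linear_Blinfun_apply[OF vder_linear[OF S(2) that]])
  have lin: "linear (vder F z0)"
    using vder_linear[OF S(2,3)] bounded_linear.linear by blast
  have "inj (vder F z0)"
    using inj linear_injective_0[OF lin] by blast
  then obtain g where g: "linear g" "\<And>x. g (vder F z0 x) = x"
    using linear_injective_left_inverse[OF lin] by (metis comp_apply id_apply)
  have "Blinfun g o\<^sub>L ?D z0 = id_blinfun"
    using g by (intro blinfun_eqI) (simp add: ap[OF S(3)] bounded_linear_Blinfun_apply linear_conv_bounded_linear)
  moreover have "(F has_derivative blinfun_apply (?D x)) (at x)" if "x \<in> S" for x
    using holo_vec_on_has_derivative[OF S(2) that] ap[OF that] by simp
  ultimately obtain U V G G' where *: "open U" "U \<subseteq> S" "z0 \<in> U" "open V" "F z0 \<in> V" "homeomorphism U V F G"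
      "\<And>y. y \<in> V \<Longrightarrow> (G has_derivative (G' y)) (at y)"
      "\<And>y. y \<in> V \<Longrightarrow> G' y = inv (blinfun_apply (?D (G y)))"
      "\<And>y. y \<in> V \<Longrightarrow> bij (blinfun_apply (?D (G y)))"
    using inverse_function_theorem[OF S(1) _ continuous_on_vder[OF S(1,2)] S(3)] by blast
  have "holo_vec_on V G"
  proof (rule holo_vec_onI)
    fix y assume y: "y \<in> V"
    then have Gy: "G y \<in> S" using * by (auto simp: homeomorphism_def)
    have b: "bij (vder F (G y))" using *(9)[OF y] ap[OF Gy] by simp
    have G': "G' y = inv (vder F (G y))" using *(8)[OF y] ap[OF Gy] by simp
    have "G' y (c *s v) = c *s G' y v" for c v
    proof -
      have "vder F (G y) (c *s G' y v) = c *s v"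
        using vder_smult[OF S(2) Gy] b by (simp add: G' bij_is_surj surj_f_inv_f)
      then show ?thesis unfolding G' using b by (metis bij_inv_eq_iff)
    qed
    then show "\<exists>D. (G has_derivative D) (at y) \<and> (\<forall>c v. D (c *s v) = c *s D v)"
      using *(7)[OF y] by blast
  qed
  moreover have "F ` U = V" "G ` V = U" "\<And>x. x \<in> U \<Longrightarrow> G (F x) = x" "\<And>y. y \<in> V \<Longrightarrow> F (G y) = y"
    using *(6) by (auto simp: homeomorphism_def)
  ultimately show thesis using that[OF *(1-4)] by blast
qed

text \<open>Sound for any set \<open>T\<close> containing \<open>z\<close>, because
  \<open>holo_on\<close> refers to the full derivative at a point and not to one relative to the
  set.\<close>

lemma holo_vec_on_local: "(\<And>z. z \<in> S \<Longrightarrow> \<exists>T. z \<in> T \<and> holo_vec_on T f) \<Longrightarrow> holo_vec_on S f"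
  unfolding holo_vec_on_def holo_on_def by blast

section \<open>Charts and holomorphic maps\<close>

text \<open>The part of being a complex manifold that concerns charts. Total spaces and the fibre
  product are shown to have it from their charts alone.\<close>

definition charted :: "('a, 'k::finite) cmfd \<Rightarrow> bool" where
  "charted X \<longleftrightarrow> (\<forall>c\<in>atlas X. is_chart (mtop X) c) \<and> (\<Union>c\<in>atlas X. fst c) = topspace (mtop X) \<and>
     (\<forall>c\<in>atlas X. \<forall>c'\<in>atlas X. compatible c c')"

lemma complex_manifold_charted: "complex_manifold X \<Longrightarrow> charted X"
  by (simp add: complex_manifold_def charted_def)

lemma is_chart_facts:
  assumes "is_chart X c"
  shows chart_open: "openin X (fst c)" and chart_image_open: "open (snd c ` fst c)"
    and chart_inj: "inj_on (snd c) (fst c)"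
    and chart_inv_left: "\<And>x. x \<in> fst c \<Longrightarrow> chart_inv c (snd c x) = x"
    and chart_open_map: "\<And>V. openin X V \<Longrightarrow> V \<subseteq> fst c \<Longrightarrow> open (snd c ` V)"
    and chart_continuous: "\<And>T. open T \<Longrightarrow> openin X {x \<in> fst c. snd c x \<in> T}"
proof -
  show o: "openin X (fst c)" and oi: "open (snd c ` fst c)" using assms by (auto simp: is_chart_def)
  have h: "homeomorphic_map (subtopology X (fst c)) (top_of_set (snd c ` fst c)) (snd c)"
    using assms by (auto simp: is_chart_def)
  have ts: "topspace (subtopology X (fst c)) = fst c"
    using openin_subset[OF o] by (simp add: Int_absorb1)
  show inj: "inj_on (snd c) (fst c)"
    using homeomorphic_imp_injective_map[OF h] ts by simp
  then show "\<And>x. x \<in> fst c \<Longrightarrow> chart_inv c (snd c x) = x" by (simp add: inv_into_f_f)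
  fix V assume V: "openin X V" "V \<subseteq> fst c"
  then have "openin (subtopology X (fst c)) V" using o by (simp add: openin_open_subtopology)
  then have "openin (top_of_set (snd c ` fst c)) (snd c ` V)"
    using homeomorphic_imp_open_map[OF h] by (simp add: open_map_def)
  then show "open (snd c ` V)" using oi openin_open_eq by blast
next
  fix T :: "(complex^'b) set" assume T: "open T"
  have o: "openin X (fst c)" using assms by (auto simp: is_chart_def)
  have h: "homeomorphic_map (subtopology X (fst c)) (top_of_set (snd c ` fst c)) (snd c)"
    using assms by (auto simp: is_chart_def)
  have ts: "topspace (subtopology X (fst c)) = fst c"
    using openin_subset[OF o] by (simp add: Int_absorb1)
  have "openin (top_of_set (snd c ` fst c)) (snd c ` fst c \<inter> T)" using T by (simp add: openin_open_Int)
  then have "openin (subtopology X (fst c)) {x \<in> topspace (subtopology X (fst c)). snd c x \<in> snd c ` fst c \<inter> T}"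
    using homeomorphic_imp_continuous_map[OF h] openin_continuous_map_preimage by blast
  moreover have "{x \<in> topspace (subtopology X (fst c)). snd c x \<in> snd c ` fst c \<inter> T} = {x \<in> fst c. snd c x \<in> T}"
    unfolding ts by auto
  ultimately show "openin X {x \<in> fst c. snd c x \<in> T}" using o by (simp add: openin_open_subtopology)
qed

lemma is_chartI:
  assumes o: "openin X (fst c)" and inj: "inj_on (snd c) (fst c)"
    and om: "\<And>V. openin X V \<Longrightarrow> V \<subseteq> fst c \<Longrightarrow> open (snd c ` V)"
    and cont: "\<And>T. open T \<Longrightarrow> openin X {x \<in> fst c. snd c x \<in> T}"
  shows "is_chart X c"
proof -
  have ts: "topspace (subtopology X (fst c)) = fst c"
    using openin_subset[OF o] by (simp add: Int_absorb1)
  have oi: "open (snd c ` fst c)" using om[OF o] by simp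
  have "homeomorphic_map (subtopology X (fst c)) (top_of_set (snd c ` fst c)) (snd c)"
  proof (rule bijective_open_imp_homeomorphic_map)
    show "continuous_map (subtopology X (fst c)) (top_of_set (snd c ` fst c)) (snd c)"
      unfolding continuous_map_def
    proof (intro conjI allI impI)
      fix U assume "openin (top_of_set (snd c ` fst c)) U"
      then have "open U" using oi openin_open_eq by blast
      then show "openin (subtopology X (fst c)) {x \<in> topspace (subtopology X (fst c)). snd c x \<in> U}"
        using cont o unfolding ts by (simp add: openin_open_subtopology)
    qed (use ts in auto)
    show "open_map (subtopology X (fst c)) (top_of_set (snd c ` fst c)) (snd c)"
      unfolding open_map_def using om o oi by (auto simp: openin_open_subtopology openin_open_eq)
  qed (use ts inj in auto)
  then show ?thesis using o oi by (simp add: is_chart_def)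
qed

lemma chart_inv_right: "z \<in> snd c ` fst c \<Longrightarrow> snd c (chart_inv c z) = z"
  by (rule f_inv_into_f)

lemma chart_inv_in: "z \<in> snd c ` fst c \<Longrightarrow> chart_inv c z \<in> fst c"
  by (rule inv_into_into)

lemma chart_inv_image_subset:
  assumes "is_chart X c" "V \<subseteq> fst c" "\<And>x. x \<in> V \<Longrightarrow> f x \<in> T"
  shows "(\<lambda>z. f (chart_inv c z)) ` snd c ` V \<subseteq> T"
  unfolding image_image
proof (rule image_subsetI)
  fix x assume "x \<in> V"
  then show "f (chart_inv c (snd c x)) \<in> T" using assms chart_inv_left[OF assms(1), of x] by auto
qed

lemma is_chart_restrict:
  assumes "is_chart X c" "openin X V" "V \<subseteq> fst c" "\<And>x. x \<in> V \<Longrightarrow> g x = snd c x"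
  shows "is_chart X (V, g)"
proof (rule is_chartI)
  fix T :: "(complex^'b) set" assume "open T"
  then have "openin X (V \<inter> {x \<in> fst c. snd c x \<in> T})"
    using chart_continuous[OF assms(1)] assms(2) by blast
  moreover have "V \<inter> {x \<in> fst c. snd c x \<in> T} = {x \<in> V. g x \<in> T}" using assms by auto
  ultimately show "openin X {x \<in> fst (V, g). snd (V, g) x \<in> T}" by simp
next
  fix W assume W: "openin X W" "W \<subseteq> fst (V, g)"
  then have "snd (V, g) ` W = snd c ` W" using assms(4) by (intro image_cong) auto
  then show "open (snd (V, g) ` W)" using chart_open_map[OF assms(1) W(1)] W assms(3) by auto
qed (use assms chart_inj[OF assms(1)] in \<open>auto simp: inj_on_def\<close>)

lemma max_atlas_is_chart: "c \<in> max_atlas X \<Longrightarrow> is_chart (mtop X) c"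
  by (simp add: max_atlas_def)

lemma atlas_subset_max_atlas: "charted X \<Longrightarrow> c \<in> atlas X \<Longrightarrow> c \<in> max_atlas X"
  by (simp add: charted_def max_atlas_def)

text \<open>Near a point the two charts are compared through a chart of the atlas, since
  compatibility with the atlas is all that \<open>max_atlas\<close> provides by definition.\<close>

lemma max_atlas_compatible:
  assumes "charted X" "c \<in> max_atlas X" "c' \<in> max_atlas X"
  shows "holo_vec_on (snd c ` (fst c \<inter> fst c')) (\<lambda>z. snd c' (chart_inv c z))"
proof (rule holo_vec_on_local)
  fix z assume "z \<in> snd c ` (fst c \<inter> fst c')"
  then obtain x where x: "x \<in> fst c" "x \<in> fst c'" "z = snd c x" by auto
  have ch: "is_chart (mtop X) c" "is_chart (mtop X) c'"
    using assms by (simp_all add: max_atlas_def)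
  have "x \<in> topspace (mtop X)" using openin_subset[OF chart_open[OF ch(1)]] x by auto
  then obtain c0 where c0: "c0 \<in> atlas X" "x \<in> fst c0" using assms(1) unfolding charted_def by blast
  have ch0: "is_chart (mtop X) c0" using c0 assms(1) by (auto simp: charted_def)
  let ?V = "fst c \<inter> fst c' \<inter> fst c0"
  have oV: "open (snd c ` ?V)"
    using chart_open_map[OF ch(1), of ?V] chart_open[OF ch(1)] chart_open[OF ch(2)] chart_open[OF ch0]
    by (simp add: openin_Int le_infI1)
  have 1: "holo_vec_on (snd c ` (fst c \<inter> fst c0)) (transition c c0)"
    "holo_vec_on (snd c0 ` (fst c' \<inter> fst c0)) (transition c0 c')"
    using assms(2,3) c0 by (auto simp: max_atlas_def compatible_def)
  have "holo_vec_on (snd c ` ?V) (\<lambda>z. transition c0 c' (transition c c0 z))"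
  proof (rule holo_vec_on_compose[OF 1(2) holo_vec_on_subset[OF 1(1)]])
    show "transition c c0 ` snd c ` ?V \<subseteq> snd c0 ` (fst c' \<inter> fst c0)"
    proof (unfold image_image, rule image_subsetI)
      fix y assume "y \<in> ?V"
      then show "transition c c0 (snd c y) \<in> snd c0 ` (fst c' \<inter> fst c0)"
        by (simp add: transition_def chart_inv_left[OF ch(1)])
    qed
  qed blast
  then have "holo_vec_on (snd c ` ?V) (\<lambda>z. snd c' (chart_inv c z))"
  proof (rule holo_vec_on_cong[OF oV, rotated])
    fix z assume "z \<in> snd c ` ?V"
    then obtain y where y: "y \<in> fst c" "y \<in> fst c0" "z = snd c y" by blast
    then have "chart_inv c z = y" "chart_inv c0 (snd c0 y) = y"
      using chart_inv_left[OF ch(1)] chart_inv_left[OF ch0] by blast+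
    then show "transition c0 c' (transition c c0 z) = snd c' (chart_inv c z)"
      unfolding transition_def comp_def by simp
  qed
  moreover have "z \<in> snd c ` ?V" using x c0 by blast
  ultimately show "\<exists>T. z \<in> T \<and> holo_vec_on T (\<lambda>z. snd c' (chart_inv c z))" by (intro exI conjI)
qed

lemma max_atlasI:
  assumes "charted X" "is_chart (mtop X) c"
    "\<And>x c'. x \<in> fst c \<Longrightarrow> c' \<in> atlas X \<Longrightarrow> x \<in> fst c' \<Longrightarrow>
       (\<exists>T. snd c x \<in> T \<and> holo_vec_on T (\<lambda>z. snd c' (chart_inv c z))) \<and>
       (\<exists>T. snd c' x \<in> T \<and> holo_vec_on T (\<lambda>z. snd c (chart_inv c' z)))"
  shows "c \<in> max_atlas X"
  unfolding max_atlas_def compatible_def transition_def comp_def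
  by (intro CollectI conjI ballI holo_vec_on_local) (use assms in blast)+

text \<open>Values of a coordinate map off its domain carry no information, so \<open>g\<close> is
  free outside \<open>V\<close>. But \<open>inv_into\<close> depends on the domain and the map, so
  the inverse has to be identified anew.\<close>

lemma max_atlas_restrict:
  assumes X: "charted X" and c: "c \<in> max_atlas X" and V: "openin (mtop X) V" "V \<subseteq> fst c"
    and g: "\<And>x. x \<in> V \<Longrightarrow> g x = snd c x"
  shows "(V, g) \<in> max_atlas X"
proof (rule max_atlasI[OF X is_chart_restrict[OF max_atlas_is_chart[OF c] V g]])
  fix x c' assume x: "x \<in> fst (V, g)" and c': "c' \<in> atlas X" "x \<in> fst c'"
  have ch: "is_chart (mtop X) c" "is_chart (mtop X) c'" "c' \<in> max_atlas X"
    using c c' X max_atlas_is_chart atlas_subset_max_atlas by blast+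
  have ch': "is_chart (mtop X) (V, g)" by (rule is_chart_restrict[OF ch(1) V g])
  let ?W = "V \<inter> fst c'"
  have oW: "openin (mtop X) ?W" using V(1) chart_open[OF ch(2)] by blast
  have eq: "snd c ` ?W = g ` ?W" using g by force
  have inv: "chart_inv (V, g) (g x) = x" "chart_inv c (g x) = x" if "x \<in> V" for x
    using chart_inv_left[OF ch', of x] chart_inv_left[OF ch(1), of x] that V(2) g by auto
  have "holo_vec_on (g ` ?W) (\<lambda>z. snd c' (chart_inv (V, g) z))"
  proof (rule holo_vec_on_cong[rotated 2])
    show "holo_vec_on (g ` ?W) (\<lambda>z. snd c' (chart_inv c z))"
      unfolding eq[symmetric]
      by (rule holo_vec_on_subset[OF max_atlas_compatible[OF X c ch(3)]]) (use V(2) in blast)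
    show "open (g ` ?W)" unfolding eq[symmetric] using V(2) by (intro chart_open_map[OF ch(1) oW]) auto
  qed (use inv in auto)
  moreover have "holo_vec_on (snd c' ` ?W) (\<lambda>z. g (chart_inv c' z))"
  proof (rule holo_vec_on_cong[rotated 2])
    show "holo_vec_on (snd c' ` ?W) (\<lambda>z. snd c (chart_inv c' z))"
      by (rule holo_vec_on_subset[OF max_atlas_compatible[OF X ch(3) c]]) (use V(2) in blast)
    show "open (snd c' ` ?W)" by (intro chart_open_map[OF ch(2) oW]) auto
  qed (use g chart_inv_left[OF ch(2)] in auto)
  ultimately show "(\<exists>T. snd (V, g) x \<in> T \<and> holo_vec_on T (\<lambda>z. snd c' (chart_inv (V, g) z))) \<and>
       (\<exists>T. snd c' x \<in> T \<and> holo_vec_on T (\<lambda>z. snd (V, g) (chart_inv c' z)))"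
    using x c' by (intro conjI exI) auto
qed

section \<open>Germs of holomorphic maps between manifolds\<close>

definition hol_near :: "('a, 'k::finite) cmfd \<Rightarrow> ('b, 'l::finite) cmfd \<Rightarrow> ('a \<Rightarrow> 'b) \<Rightarrow> 'a \<Rightarrow> bool" where
  "hol_near X Y f x \<longleftrightarrow> (\<exists>c\<in>max_atlas X. \<exists>c'\<in>max_atlas Y. \<exists>V. openin (mtop X) V \<and> x \<in> V \<and> V \<subseteq> fst c \<and>
     f ` V \<subseteq> fst c' \<and> holo_vec_on (snd c ` V) (\<lambda>z. snd c' (f (chart_inv c z))))"

text \<open>A germ is defined by some pair of charts and some neighborhood; this is the independence
  of that choice. Composition, passage to open submanifolds and the comparison with
  \<open>holomorphic_map\<close> rest on it.\<close>

lemma hol_near_charts: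
  assumes X: "charted X" and Y: "charted Y" and f: "hol_near X Y f x"
    and c: "c \<in> max_atlas X" "x \<in> fst c" and c': "c' \<in> max_atlas Y" "f x \<in> fst c'"
  obtains V where "openin (mtop X) V" "x \<in> V" "V \<subseteq> fst c" "f ` V \<subseteq> fst c'"
    "holo_vec_on (snd c ` V) (\<lambda>z. snd c' (f (chart_inv c z)))"
proof -
  obtain d d' V where d: "d \<in> max_atlas X" "d' \<in> max_atlas Y" and V: "openin (mtop X) V" "x \<in> V" "V \<subseteq> fst d"
    "f ` V \<subseteq> fst d'" and h: "holo_vec_on (snd d ` V) (\<lambda>z. snd d' (f (chart_inv d z)))"
    using f unfolding hol_near_def by blast
  have ch: "is_chart (mtop X) c" "is_chart (mtop Y) c'" "is_chart (mtop X) d" "is_chart (mtop Y) d'"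
    using c c' d max_atlas_is_chart by blast+
  let ?F = "\<lambda>z. snd d' (f (chart_inv d z))"
  \<comment> \<open>The overlap of the two target charts. The neighborhood is shrunk until the
    coordinate expression lands in it, so that the change of target chart can be applied.\<close>
  define T where "T = snd d' ` (fst d' \<inter> fst c')"
  have oT: "open T" unfolding T_def
    using chart_open_map[OF ch(4)] chart_open[OF ch(4)] chart_open[OF ch(2)] by (simp add: openin_Int)
  have oV: "open (snd d ` V)" using chart_open_map[OF ch(3) V(1,3)] .
  have "open (snd d ` V \<inter> ?F -` T)"
    using holo_vec_on_imp_continuous_on[OF h] oV oT continuous_open_preimage by blast
  from chart_continuous[OF ch(3) this]
  have "openin (mtop X) {x \<in> fst d. snd d x \<in> snd d ` V \<inter> ?F -` T}" .
  moreover define V' where "V' = {x \<in> fst d. snd d x \<in> snd d ` V \<inter> ?F -` T} \<inter> fst c"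
  ultimately have oV': "openin (mtop X) V'" using chart_open[OF ch(1)] by blast
  have V'V: "V' \<subseteq> V" "V' \<subseteq> fst c"
    using V(3) chart_inj[OF ch(3)] by (auto simp: V'_def inj_on_def) 
  have f': "f y \<in> fst c'" if "y \<in> V'" for y
  proof -
    have "y \<in> V" using V'V that by auto
    then have y: "f y \<in> fst d'" "chart_inv d (snd d y) = y" using V chart_inv_left[OF ch(3)] by auto
    have "snd d' (f y) \<in> T" using that y by (auto simp: V'_def)
    then obtain w where "w \<in> fst d'" "w \<in> fst c'" "snd d' (f y) = snd d' w" by (auto simp: T_def)
    then show ?thesis using chart_inj[OF ch(4)] y(1) by (auto simp: inj_on_def)
  qed
  have fx: "snd d' (f x) \<in> T" using V c' by (auto simp: T_def)
  have xV': "x \<in> V'" using V c fx chart_inv_left[OF ch(3)] by (auto simp: V'_def)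
  have "holo_vec_on (snd c ` V') (\<lambda>z. snd c' (chart_inv d' (?F (snd d (chart_inv c z)))))"
  proof (rule holo_vec_on_compose[where f="\<lambda>z. ?F (snd d (chart_inv c z))"])
    show "holo_vec_on T (\<lambda>z. snd c' (chart_inv d' z))"
      unfolding T_def by (rule max_atlas_compatible[OF Y d(2) c'(1)])
    show "holo_vec_on (snd c ` V') (\<lambda>z. ?F (snd d (chart_inv c z)))"
    proof (rule holo_vec_on_compose[OF h])
      show "holo_vec_on (snd c ` V') (\<lambda>z. snd d (chart_inv c z))"
        using max_atlas_compatible[OF X c(1) d(1)] by (rule holo_vec_on_subset) (use V'V V in auto)
      show "(\<lambda>z. snd d (chart_inv c z)) ` snd c ` V' \<subseteq> snd d ` V"
        unfolding image_image by (rule image_subsetI) (use V'V chart_inv_left[OF ch(1)] in \<open>simp add: subset_iff\<close>)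
    qed
    show "(\<lambda>z. ?F (snd d (chart_inv c z))) ` snd c ` V' \<subseteq> T"
    proof clarify
      fix y assume y: "y \<in> V'"
      then have "chart_inv c (snd c y) = y" using chart_inv_left[OF ch(1)] V'V by auto
      then show "?F (snd d (chart_inv c (snd c y))) \<in> T" using y by (auto simp: V'_def)
    qed
  qed
  then have "holo_vec_on (snd c ` V') (\<lambda>z. snd c' (f (chart_inv c z)))"
  proof (rule holo_vec_on_cong[rotated 2])
    show "open (snd c ` V')" by (rule chart_open_map[OF ch(1) oV' V'V(2)])
    fix z assume "z \<in> snd c ` V'"
    then obtain y where y: "y \<in> V'" "z = snd c y" by auto
    then have "chart_inv c z = y" "chart_inv d (snd d y) = y" "f y \<in> fst d'"
      using chart_inv_left[OF ch(1)] chart_inv_left[OF ch(3)] V'V V by (simp_all add: subset_iff image_subset_iff)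
    then show "snd c' (chart_inv d' (?F (snd d (chart_inv c z)))) = snd c' (f (chart_inv c z))"
      using chart_inv_left[OF ch(4)] by simp
  qed
  then show thesis using that[OF oV' xV' V'V(2)] f' by blast
qed

lemma hol_nearI:
  assumes "c \<in> max_atlas X" "c' \<in> max_atlas Y" "openin (mtop X) V" "x \<in> V" "V \<subseteq> fst c"
     "f ` V \<subseteq> fst c'" "holo_vec_on (snd c ` V) (\<lambda>z. snd c' (f (chart_inv c z)))"
  shows "hol_near X Y f x"
  using assms unfolding hol_near_def by blast

lemma hol_near_topspace:
  assumes "hol_near X Y f x"
  shows "x \<in> topspace (mtop X)" "f x \<in> topspace (mtop Y)"
  using assms openin_subset chart_open[OF max_atlas_is_chart] unfolding hol_near_def by blast+

lemma max_atlas_cover: "charted X \<Longrightarrow> x \<in> topspace (mtop X) \<Longrightarrow> \<exists>c\<in>max_atlas X. x \<in> fst c"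
  unfolding charted_def using atlas_subset_max_atlas[unfolded charted_def] by blast

text \<open>Shrinking the domain of a target chart to \<open>T\<close> turns continuity into an
  instance of chart independence.\<close>

lemma hol_near_continuous:
  assumes "charted X" "charted Y" "hol_near X Y f x" "openin (mtop Y) T" "f x \<in> T"
  obtains V where "openin (mtop X) V" "x \<in> V" "f ` V \<subseteq> T"
proof -
  obtain c where c: "c \<in> max_atlas X" "x \<in> fst c" using max_atlas_cover hol_near_topspace assms(1,3) by metis
  obtain c' where c': "c' \<in> max_atlas Y" "f x \<in> fst c'" using max_atlas_cover hol_near_topspace assms(2,3) by metis
  have "openin (mtop Y) (fst c' \<inter> T)" using chart_open[OF max_atlas_is_chart[OF c'(1)]] assms(4) by blast
  then have "(fst c' \<inter> T, snd c') \<in> max_atlas Y" by (intro max_atlas_restrict[OF assms(2) c'(1)]) auto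
  from hol_near_charts[OF assms(1,2,3) c this] show thesis
    using c' assms(5) that by (metis Int_iff fst_conv le_inf_iff)
qed

lemma hol_near_cong:
  assumes "charted X" "hol_near X Y f x" "openin (mtop X) W" "x \<in> W" "\<And>y. y \<in> W \<Longrightarrow> f y = g y"
  shows "hol_near X Y g x"
proof -
  obtain c c' V where c: "c \<in> max_atlas X" "c' \<in> max_atlas Y" and V: "openin (mtop X) V" "x \<in> V" "V \<subseteq> fst c"
    "f ` V \<subseteq> fst c'" and h: "holo_vec_on (snd c ` V) (\<lambda>z. snd c' (f (chart_inv c z)))"
    using assms(2) unfolding hol_near_def by blast
  have ch: "is_chart (mtop X) c" using c max_atlas_is_chart by blast
  show ?thesis
  proof (rule hol_nearI[OF c])
    show o: "openin (mtop X) (V \<inter> W)" using V assms by blast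
    have "holo_vec_on (snd c ` (V \<inter> W)) (\<lambda>z. snd c' (f (chart_inv c z)))"
      by (rule holo_vec_on_subset[OF h]) auto
    then show "holo_vec_on (snd c ` (V \<inter> W)) (\<lambda>z. snd c' (g (chart_inv c z)))"
      by (rule holo_vec_on_cong[rotated 2])
         (use assms(5) V chart_inv_left[OF ch] chart_open_map[OF ch o] in auto)
  qed (use V assms in auto)
qed

lemma hol_near_comp:
  assumes X: "charted X" and Y: "charted Y" and Z: "charted Z"
    and f: "hol_near X Y f x" and g: "hol_near Y Z g (f x)"
  shows "hol_near X Z (\<lambda>x. g (f x)) x"
proof -
  obtain c' c'' V' where c': "c' \<in> max_atlas Y" "c'' \<in> max_atlas Z" and V': "openin (mtop Y) V'" "f x \<in> V'" "V' \<subseteq> fst c'"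
    "g ` V' \<subseteq> fst c''" and hg: "holo_vec_on (snd c' ` V') (\<lambda>z. snd c'' (g (chart_inv c' z)))"
    using g unfolding hol_near_def by blast
  have r: "(V', snd c') \<in> max_atlas Y" by (rule max_atlas_restrict[OF Y c'(1) V'(1,3)]) simp
  obtain c where c: "c \<in> max_atlas X" "x \<in> fst c" using max_atlas_cover[OF X] hol_near_topspace[OF f] by blast
  obtain V where V: "openin (mtop X) V" "x \<in> V" "V \<subseteq> fst c" "f ` V \<subseteq> V'"
      and hf: "holo_vec_on (snd c ` V) (\<lambda>z. snd c' (f (chart_inv c z)))"
    using hol_near_charts[OF X Y f c r] V' by auto
  have ch: "is_chart (mtop X) c" "is_chart (mtop Y) c'" using c c' max_atlas_is_chart by blast+
  have "holo_vec_on (snd c ` V) (\<lambda>z. snd c'' (g (chart_inv c' (snd c' (f (chart_inv c z))))))"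
    by (rule holo_vec_on_compose[OF hg hf], rule chart_inv_image_subset[OF ch(1) V(3)]) (use V(4) in blast)
  then have "holo_vec_on (snd c ` V) (\<lambda>z. snd c'' (g (f (chart_inv c z))))"
  proof (rule holo_vec_on_cong[rotated 2])
    fix z assume "z \<in> snd c ` V"
    then have "f (chart_inv c z) \<in> fst c'"
      using chart_inv_image_subset[OF ch(1) V(3), of f V'] V(4) V'(3) by blast
    then show "snd c'' (g (chart_inv c' (snd c' (f (chart_inv c z))))) = snd c'' (g (f (chart_inv c z)))"
      using chart_inv_left[OF ch(2)] by simp
  qed (rule chart_open_map[OF ch(1) V(1,3)])
  moreover have "(\<lambda>x. g (f x)) ` V \<subseteq> fst c''" using V(4) V'(4) by blast
  ultimately show ?thesis by (intro hol_nearI[OF c(1) c'(2) V(1-3)])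
qed

text \<open>Coordinate space as a manifold, so that charts and vector-valued functions are holomorphic maps.\<close>

definition euc :: "(complex^'k, 'k) cmfd" where
  "euc = \<lparr>mtop = euclidean, atlas = {(UNIV, \<lambda>z. z)}\<rparr>"

lemma euc_simps [simp]: "mtop euc = euclidean" "atlas euc = {(UNIV, \<lambda>z. z)}"
  by (simp_all add: euc_def)

lemma charted_euc: "charted euc"
proof -
  have "is_chart euclidean (UNIV :: (complex^'a) set, \<lambda>z. z)"
    by (rule is_chartI) auto
  moreover have "compatible (UNIV :: (complex^'a) set, \<lambda>z. z) (UNIV, \<lambda>z. z)"
    by (simp add: compatible_def transition_def comp_def inv_into_f_f[of "\<lambda>z. z" UNIV] inj_on_def holo_vec_on_id)
  ultimately show ?thesis by (simp add: charted_def)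
qed

lemma euc_chart: "(UNIV, \<lambda>z. z) \<in> max_atlas euc"
  by (rule atlas_subset_max_atlas[OF charted_euc]) simp

lemma euc_chart_inv [simp]: "inv_into UNIV (\<lambda>z. z) = (\<lambda>z. z)"
  by (auto simp: fun_eq_iff intro!: inv_into_f_eq)

lemma hol_near_to_euc:
  assumes "charted X" "c \<in> max_atlas X" "x \<in> fst c"
  shows "hol_near X euc f x \<longleftrightarrow> (\<exists>V. openin (mtop X) V \<and> x \<in> V \<and> V \<subseteq> fst c \<and> holo_vec_on (snd c ` V) (\<lambda>z. f (chart_inv c z)))"
proof
  assume "hol_near X euc f x"
  from hol_near_charts[OF assms(1) charted_euc this assms(2,3) euc_chart]
  show "\<exists>V. openin (mtop X) V \<and> x \<in> V \<and> V \<subseteq> fst c \<and> holo_vec_on (snd c ` V) (\<lambda>z. f (chart_inv c z))"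
    by fastforce
next
  assume "\<exists>V. openin (mtop X) V \<and> x \<in> V \<and> V \<subseteq> fst c \<and> holo_vec_on (snd c ` V) (\<lambda>z. f (chart_inv c z))"
  then show "hol_near X euc f x" using hol_nearI[OF assms(2) euc_chart] by fastforce
qed

lemma hol_near_from_euc:
  assumes "charted Y" "c \<in> max_atlas Y" "f z \<in> fst c"
  shows "hol_near euc Y f z \<longleftrightarrow> (\<exists>V. open V \<and> z \<in> V \<and> f ` V \<subseteq> fst c \<and> holo_vec_on V (\<lambda>z. snd c (f z)))"
proof
  assume "hol_near euc Y f z"
  from hol_near_charts[OF charted_euc assms(1) this euc_chart _ assms(2,3)]
  show "\<exists>V. open V \<and> z \<in> V \<and> f ` V \<subseteq> fst c \<and> holo_vec_on V (\<lambda>z. snd c (f z))" by fastforce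
next
  assume "\<exists>V. open V \<and> z \<in> V \<and> f ` V \<subseteq> fst c \<and> holo_vec_on V (\<lambda>z. snd c (f z))"
  then show "hol_near euc Y f z" using hol_nearI[OF euc_chart assms(2)] by fastforce
qed

lemma hol_near_euc: "hol_near euc euc f z \<longleftrightarrow> (\<exists>V. open V \<and> z \<in> V \<and> holo_vec_on V f)"
  using hol_near_from_euc[OF charted_euc euc_chart, of f z] by simp

lemma hol_near_chart:
  assumes "charted X" "c \<in> max_atlas X" "x \<in> fst c"
  shows "hol_near X euc (snd c) x"
proof -
  have ch: "is_chart (mtop X) c" using assms max_atlas_is_chart by blast
  have "holo_vec_on (snd c ` fst c) (\<lambda>z. snd c (chart_inv c z))"
    using max_atlas_compatible[OF assms(1,2,2)] by simp
  then show ?thesis unfolding hol_near_to_euc[OF assms] using chart_open[OF ch] assms(3) by blast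
qed

lemma hol_near_chart_inv:
  assumes "charted X" "c \<in> max_atlas X" "z \<in> snd c ` fst c"
  shows "hol_near euc X (chart_inv c) z"
proof -
  have ch: "is_chart (mtop X) c" using assms max_atlas_is_chart by blast
  have "holo_vec_on (snd c ` fst c) (\<lambda>z. snd c (chart_inv c z))"
    using max_atlas_compatible[OF assms(1,2,2)] by simp
  then show ?thesis unfolding hol_near_from_euc[of X c "chart_inv c", OF assms(1,2) chart_inv_in[OF assms(3)]]
    using chart_image_open[OF ch] assms(3) by (intro exI[of _ "snd c ` fst c"]) (auto intro: inv_into_into)
qed

text \<open>Membership in the maximal atlas becomes holomorphy of the chart and of its inverse as
  maps to and from coordinate space. New charts of the fibre product and of \<open>M\<close> are
  recognized in this form.\<close>

lemma max_atlas_hol_nearI: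
  assumes X: "charted X" and ch: "is_chart (mtop X) c"
    and 1: "\<And>x. x \<in> fst c \<Longrightarrow> hol_near X euc (snd c) x"
    and 2: "\<And>z. z \<in> snd c ` fst c \<Longrightarrow> hol_near euc X (chart_inv c) z"
  shows "c \<in> max_atlas X"
proof (rule max_atlasI[OF X ch])
  fix x c' assume x: "x \<in> fst c" "c' \<in> atlas X" "x \<in> fst c'"
  have c': "c' \<in> max_atlas X" using x X atlas_subset_max_atlas by blast
  have ch': "is_chart (mtop X) c'" using c' max_atlas_is_chart by blast
  have "hol_near euc euc (\<lambda>z. snd c' (chart_inv c z)) (snd c x)"
    by (rule hol_near_comp[OF charted_euc X charted_euc 2]) (use x chart_inv_left[OF ch] hol_near_chart[OF X c'] in auto)
  moreover have "hol_near euc euc (\<lambda>z. snd c (chart_inv c' z)) (snd c' x)"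
    by (rule hol_near_comp[OF charted_euc X charted_euc hol_near_chart_inv[OF X c']])
       (use x chart_inv_left[OF ch'] 1 in auto)
  ultimately show "(\<exists>T. snd c x \<in> T \<and> holo_vec_on T (\<lambda>z. snd c' (chart_inv c z))) \<and>
       (\<exists>T. snd c' x \<in> T \<and> holo_vec_on T (\<lambda>z. snd c (chart_inv c' z)))"
    unfolding hol_near_euc by blast
qed

lemma hol_near_id:
  assumes "charted X" "x \<in> topspace (mtop X)"
  shows "hol_near X X (\<lambda>x. x) x"
proof -
  obtain c where c: "c \<in> max_atlas X" "x \<in> fst c" using max_atlas_cover[OF assms] by blast
  have ch: "is_chart (mtop X) c" using c max_atlas_is_chart by blast
  show ?thesis
    by (rule hol_nearI[OF c(1) c(1) chart_open[OF ch] c(2)])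
       (use max_atlas_compatible[OF assms(1) c(1) c(1)] in auto)
qed

lemma hol_near_preimage_open:
  assumes X: "charted X" and Y: "charted Y" and V: "openin (mtop X) V"
    and f: "\<And>x. x \<in> V \<Longrightarrow> hol_near X Y f x" and T: "openin (mtop Y) T"
  shows "openin (mtop X) {x \<in> V. f x \<in> T}"
proof (subst openin_subopen, rule ballI)
  fix y assume y: "y \<in> {x \<in> V. f x \<in> T}"
  then have "hol_near X Y f y" "f y \<in> T" using f by auto
  from hol_near_continuous[OF X Y this(1) T this(2)]
  obtain U where "openin (mtop X) U" "y \<in> U" "f ` U \<subseteq> T" .
  then show "\<exists>S. openin (mtop X) S \<and> y \<in> S \<and> S \<subseteq> {x \<in> V. f x \<in> T}"
    using V y by (intro exI[of _ "U \<inter> V"]) (auto intro: openin_Int)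
qed

section \<open>Open submanifolds\<close>

lemma open_submfd_simps [simp]:
  "mtop (open_submfd X W) = subtopology (mtop X) W"
  "atlas (open_submfd X W) = (\<lambda>c. (fst c \<inter> W, snd c)) ` atlas X"
  by (simp_all add: open_submfd_def)

lemma max_atlas_open: "c \<in> max_atlas X \<Longrightarrow> openin (mtop X) (fst c)"
  by (rule chart_open[OF max_atlas_is_chart])

lemma is_chart_subtopology:
  assumes "openin X W"
  shows "is_chart (subtopology X W) c \<longleftrightarrow> is_chart X c \<and> fst c \<subseteq> W"
proof
  assume c: "is_chart (subtopology X W) c"
  have o: "openin X (fst c)" "fst c \<subseteq> W"
    using chart_open[OF c] assms by (simp_all add: openin_open_subtopology)
  have "is_chart X c"
  proof (rule is_chartI[OF o(1) chart_inj[OF c]])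
    show "open (snd c ` V)" if "openin X V" "V \<subseteq> fst c" for V
      using chart_open_map[OF c, of V] that o assms by (auto simp: openin_open_subtopology)
    show "openin X {x \<in> fst c. snd c x \<in> T}" if "open T" for T
      using chart_continuous[OF c that] assms by (simp add: openin_open_subtopology)
  qed
  with o show "is_chart X c \<and> fst c \<subseteq> W" by blast
next
  assume c: "is_chart X c \<and> fst c \<subseteq> W"
  show "is_chart (subtopology X W) c"
  proof (rule is_chartI)
    show "openin (subtopology X W) (fst c)" using chart_open[of X c] c assms by (simp add: openin_open_subtopology)
    show "inj_on (snd c) (fst c)" using chart_inj c by blast
    show "open (snd c ` V)" if "openin (subtopology X W) V" "V \<subseteq> fst c" for V
      using chart_open_map[of X c V] that c assms by (auto simp: openin_open_subtopology)
    show "openin (subtopology X W) {x \<in> fst c. snd c x \<in> T}" if "open T" for T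
      using chart_continuous[of X c T] that c assms by (auto simp: openin_open_subtopology)
  qed
qed

lemma charted_open_submfd:
  assumes X: "charted X" and W: "openin (mtop X) W"
  shows "charted (open_submfd X W)"
  unfolding charted_def
proof (intro conjI ballI)
  have r: "(fst c \<inter> W, snd c) \<in> max_atlas X" if "c \<in> atlas X" for c
    by (rule max_atlas_restrict[OF X atlas_subset_max_atlas[OF X that]])
       (use W max_atlas_open[OF atlas_subset_max_atlas[OF X that]] in \<open>simp_all add: openin_Int\<close>)
  show "is_chart (mtop (open_submfd X W)) c" if "c \<in> atlas (open_submfd X W)" for c
    using that r max_atlas_is_chart is_chart_subtopology[OF W] by fastforce
  show "\<Union> (fst ` atlas (open_submfd X W)) = topspace (mtop (open_submfd X W))"
    using X by (auto simp: charted_def)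
  show "compatible c c'" if c: "c \<in> atlas (open_submfd X W)" "c' \<in> atlas (open_submfd X W)" for c c'
  proof -
    have "c \<in> max_atlas X" "c' \<in> max_atlas X" using c r by auto
    then show ?thesis using max_atlas_compatible[OF X]
      unfolding compatible_def transition_def comp_def by (metis Int_commute)
  qed
qed

lemma max_atlas_open_submfd:
  assumes X: "charted X" and W: "openin (mtop X) W"
  shows "max_atlas (open_submfd X W) = {c \<in> max_atlas X. fst c \<subseteq> W}"
proof safe
  fix D :: "'a set" and \<phi> :: "'a \<Rightarrow> complex^'b" 
  let ?c = "(D, \<phi>)"
  assume c: "?c \<in> max_atlas (open_submfd X W)"
  then have ch: "is_chart (mtop X) ?c" and DW: "D \<subseteq> W"
    using max_atlas_is_chart[OF c] is_chart_subtopology[OF W, of ?c] by simp_all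
  show "\<And>x. x \<in> fst ?c \<Longrightarrow> x \<in> W" using DW by auto
  show "?c \<in> max_atlas X"
  proof (rule max_atlasI[OF X ch])
    fix x c' assume x: "x \<in> fst ?c" "c' \<in> atlas X" "x \<in> fst c'"
    let ?r = "(fst c' \<inter> W, snd c')"
    have ch': "is_chart (mtop X) c'" using x X by (auto simp: charted_def)
    have chr: "is_chart (mtop X) ?r"
      by (rule is_chart_restrict[OF ch']) (use W chart_open[OF ch'] in auto)
    have "compatible ?c ?r" using c x(2) by (auto simp: max_atlas_def)
    then have co: "holo_vec_on (\<phi> ` (D \<inter> fst c')) (\<lambda>z. snd c' (chart_inv ?c z))"
       "holo_vec_on (snd c' ` (D \<inter> fst c')) (\<lambda>z. \<phi> (chart_inv ?r z))"
      using DW by (simp_all add: compatible_def transition_def comp_def Int_absorb2 inf_assoc[symmetric] Int_commute[of _ W])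
       (simp_all add: Int_absorb1 Int_absorb2 inf_commute inf_left_commute)
    have oo: "open (snd c' ` (D \<inter> fst c'))"
      using chart_open[OF ch] chart_open[OF ch'] by (intro chart_open_map[OF ch']) auto
    have "holo_vec_on (snd c' ` (D \<inter> fst c')) (\<lambda>z. \<phi> (chart_inv c' z))"
    proof (rule holo_vec_on_cong[OF oo _ co(2)])
      fix z assume "z \<in> snd c' ` (D \<inter> fst c')"
      then obtain y where y: "y \<in> D" "y \<in> fst c'" "z = snd c' y" by blast
      then show "\<phi> (chart_inv ?r z) = \<phi> (chart_inv c' z)"
        using chart_inv_left[OF chr, of y] chart_inv_left[OF ch', of y] DW by auto
    qed
    then show "(\<exists>T. snd ?c x \<in> T \<and> holo_vec_on T (\<lambda>z. snd c' (chart_inv ?c z))) \<and>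
       (\<exists>T. snd c' x \<in> T \<and> holo_vec_on T (\<lambda>z. snd ?c (chart_inv c' z)))"
      using co(1) x by (intro conjI exI) auto
  qed
next
  fix D :: "'a set" and \<phi> :: "'a \<Rightarrow> complex^'b" 
  let ?c = "(D, \<phi>)"
  assume c: "?c \<in> max_atlas X" and DW: "fst ?c \<subseteq> W"
  have ch: "is_chart (subtopology (mtop X) W) ?c" using max_atlas_is_chart[OF c] DW is_chart_subtopology[OF W, of ?c] by simp
  show "?c \<in> max_atlas (open_submfd X W)"
  proof (rule max_atlasI[OF charted_open_submfd[OF X W]])
    fix x c' assume x: "x \<in> fst ?c" "c' \<in> atlas (open_submfd X W)" "x \<in> fst c'"
    obtain d where d: "d \<in> atlas X" "c' = (fst d \<inter> W, snd d)" using x(2) by auto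
    have "c' \<in> max_atlas X"
      unfolding d(2)
      by (rule max_atlas_restrict[OF X atlas_subset_max_atlas[OF X d(1)]])
         (use W max_atlas_open[OF atlas_subset_max_atlas[OF X d(1)]] in \<open>simp_all add: openin_Int\<close>)
    then show "(\<exists>T. snd ?c x \<in> T \<and> holo_vec_on T (\<lambda>z. snd c' (chart_inv ?c z))) \<and>
       (\<exists>T. snd c' x \<in> T \<and> holo_vec_on T (\<lambda>z. snd ?c (chart_inv c' z)))"
      using max_atlas_compatible[OF X c, of c'] max_atlas_compatible[OF X _ c, of c'] x
      by (intro conjI exI[of _ "snd ?c ` (fst ?c \<inter> fst c')"] exI[of _ "snd c' ` (fst c' \<inter> fst ?c)"]) simp_all
  qed (use ch in simp)
qed

lemma hol_near_open_submfd:
  assumes X: "charted X" and W: "openin (mtop X) W" and Y: "charted Y" and W': "openin (mtop Y) W'"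
  shows "hol_near (open_submfd X W) (open_submfd Y W') f x \<longleftrightarrow> hol_near X Y f x \<and> x \<in> W \<and> f x \<in> W'"
proof (intro iffI conjI)
  assume h: "hol_near (open_submfd X W) (open_submfd Y W') f x"
  then obtain c c' V where c0: "c \<in> max_atlas (open_submfd X W)" "c' \<in> max_atlas (open_submfd Y W')"
    and V: "openin (mtop (open_submfd X W)) V" "x \<in> V" "V \<subseteq> fst c" "f ` V \<subseteq> fst c'"
      "holo_vec_on (snd c ` V) (\<lambda>z. snd c' (f (chart_inv c z)))"
    unfolding hol_near_def by blast
  have "c \<in> max_atlas X" "c' \<in> max_atlas Y" "openin (mtop X) V"
    using c0 V(1) W by (simp_all add: max_atlas_open_submfd[OF X W] max_atlas_open_submfd[OF Y W'] openin_open_subtopology)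
  then show "hol_near X Y f x" using V by (intro hol_nearI[of c _ c' _ V])
  show "x \<in> W" "f x \<in> W'" using hol_near_topspace[OF h] by auto
next
  assume h: "hol_near X Y f x \<and> x \<in> W \<and> f x \<in> W'"
  then obtain c c' where c: "c \<in> max_atlas X" "x \<in> fst c" and c': "c' \<in> max_atlas Y" "f x \<in> fst c'"
    using max_atlas_cover[OF X] max_atlas_cover[OF Y] hol_near_topspace by metis
  have r: "(fst c \<inter> W, snd c) \<in> max_atlas X" "(fst c' \<inter> W', snd c') \<in> max_atlas Y"
    using max_atlas_restrict[OF X c(1), of "fst c \<inter> W" "snd c"] max_atlas_open[OF c(1)]
      max_atlas_restrict[OF Y c'(1), of "fst c' \<inter> W'" "snd c'"] max_atlas_open[OF c'(1)] W W'
    by (simp_all add: openin_Int)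
  obtain V where V: "openin (mtop X) V" "x \<in> V" "V \<subseteq> fst c \<inter> W" "f ` V \<subseteq> fst c' \<inter> W'"
    "holo_vec_on (snd c ` V) (\<lambda>z. snd c' (f (chart_inv (fst c \<inter> W, snd c) z)))"
    using hol_near_charts[OF X Y _ r(1) _ r(2)] h c c' by auto
  show "hol_near (open_submfd X W) (open_submfd Y W') f x"
  proof (rule hol_nearI[where V=V])
    show "(fst c \<inter> W, snd c) \<in> max_atlas (open_submfd X W)" "(fst c' \<inter> W', snd c') \<in> max_atlas (open_submfd Y W')"
      unfolding max_atlas_open_submfd[OF X W] max_atlas_open_submfd[OF Y W'] using r by auto
    show "openin (mtop (open_submfd X W)) V" using V W by (auto simp: openin_open_subtopology)
  qed (use V in auto)
qed

text \<open>The bridge from the global definition, which quantifies over all pairs of charts, to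
  germs; afterwards holomorphy is handled point by point.\<close>

lemma holomorphic_map_iff:
  assumes X: "charted X" and Y: "charted Y"
  shows "holomorphic_map X Y f \<longleftrightarrow> (\<forall>x\<in>topspace (mtop X). hol_near X Y f x)"
proof
  assume h: "holomorphic_map X Y f"
  show "\<forall>x\<in>topspace (mtop X). hol_near X Y f x"
  proof
    fix x assume x: "x \<in> topspace (mtop X)"
    then have "f x \<in> topspace (mtop Y)" using h by (auto simp: holomorphic_map_def continuous_map_def)
    then obtain c c' where c: "c \<in> atlas X" "x \<in> fst c" and c': "c' \<in> atlas Y" "f x \<in> fst c'"
      using x X Y unfolding charted_def by blast
    have ch: "is_chart (mtop X) c" "is_chart (mtop Y) c'" using c c' X Y by (auto simp: charted_def)
    let ?V = "{y \<in> fst c. f y \<in> fst c'}"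
    have "openin (mtop X) {y \<in> topspace (mtop X). f y \<in> fst c'}"
      using h chart_open[OF ch(2)] by (auto simp: holomorphic_map_def continuous_map_def)
    moreover have "?V = fst c \<inter> {y \<in> topspace (mtop X). f y \<in> fst c'}"
      using openin_subset[OF chart_open[OF ch(1)]] by auto
    ultimately have "openin (mtop X) ?V" using chart_open[OF ch(1)] by (simp add: openin_Int)
    moreover have "holo_vec_on (snd c ` ?V) (\<lambda>z. snd c' (f (chart_inv c z)))"
      using h c c' by (auto simp: holomorphic_map_def local_dom_def local_rep_def comp_def)
    ultimately show "hol_near X Y f x"
      using c c' atlas_subset_max_atlas[OF X c(1)] atlas_subset_max_atlas[OF Y c'(1)]
      by (intro hol_nearI[where V="?V"]) auto
  qed
next
  assume h: "\<forall>x\<in>topspace (mtop X). hol_near X Y f x"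
  show "holomorphic_map X Y f"
    unfolding holomorphic_map_def
  proof (intro conjI ballI)
    show "continuous_map (mtop X) (mtop Y) f"
      unfolding continuous_map_def
    proof (intro conjI allI impI)
      show "f \<in> topspace (mtop X) \<rightarrow> topspace (mtop Y)" using h hol_near_topspace(2)[of X Y f] by (simp add: Pi_iff)
      fix U assume U: "openin (mtop Y) U"
      show "openin (mtop X) {x \<in> topspace (mtop X). f x \<in> U}"
        by (rule hol_near_preimage_open[OF X Y openin_topspace _ U]) (use h in blast)
    qed
    fix c c' assume c: "c \<in> atlas X" and c': "c' \<in> atlas Y"
    show "holo_vec_on (local_dom f c c') (local_rep f c c')"
    proof (rule holo_vec_on_local)
      fix z assume "z \<in> local_dom f c c'"
      then obtain x where x: "z = snd c x" "x \<in> fst c" "f x \<in> fst c'" by (auto simp: local_dom_def)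
      have c2: "c \<in> max_atlas X" "c' \<in> max_atlas Y" using c c' X Y atlas_subset_max_atlas by blast+
      have "x \<in> topspace (mtop X)" using x openin_subset[OF chart_open[OF max_atlas_is_chart[OF c2(1)]]] by blast
      then have hx: "hol_near X Y f x" using h by blast
      show "\<exists>T. z \<in> T \<and> holo_vec_on T (local_rep f c c')"
      proof (rule hol_near_charts[OF X Y hx c2(1) x(2) c2(2) x(3)])
        fix V assume "x \<in> V" "holo_vec_on (snd c ` V) (\<lambda>z. snd c' (f (chart_inv c z)))"
        then show ?thesis unfolding local_rep_def comp_def x(1) by (intro exI[of _ "snd c ` V"] conjI imageI)
      qed
    qed
  qed
qed

lemma hol_near_euc_rep:
  assumes "charted X" "charted Y" "hol_near X Y f x" "c \<in> max_atlas X" "x \<in> fst c" "c' \<in> max_atlas Y" "f x \<in> fst c'"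
  shows "hol_near euc euc (\<lambda>z. snd c' (f (chart_inv c z))) (snd c x)"
proof -
  have "chart_inv c (snd c x) = x" using chart_inv_left[OF max_atlas_is_chart[OF assms(4)] assms(5)] .
  then have "hol_near euc Y (\<lambda>z. f (chart_inv c z)) (snd c x)"
    using hol_near_comp[OF charted_euc assms(1,2) hol_near_chart_inv[OF assms(1,4)], of "snd c x" f] assms by auto
  from hol_near_comp[OF charted_euc assms(2) charted_euc this]
  show ?thesis using hol_near_chart[OF assms(2,6,7)] \<open>chart_inv c (snd c x) = x\<close> by auto
qed

section \<open>Local biholomorphisms and the inverse function theorem on manifolds\<close>

definition local_biholo :: "('a, 'k::finite) cmfd \<Rightarrow> ('b, 'l::finite) cmfd \<Rightarrow> ('a \<Rightarrow> 'b) \<Rightarrow> 'a \<Rightarrow> bool" where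
  "local_biholo X Y f x \<longleftrightarrow> (\<exists>V V' g. openin (mtop X) V \<and> x \<in> V \<and> openin (mtop Y) V' \<and> f ` V \<subseteq> V' \<and> g ` V' \<subseteq> V \<and>
     (\<forall>x\<in>V. g (f x) = x \<and> hol_near X Y f x) \<and> (\<forall>y\<in>V'. f (g y) = y \<and> hol_near Y X g y))"

lemma local_biholo_ev:
  assumes "local_biholo X Y f x"
  obtains V where "openin (mtop X) V" "x \<in> V" "\<And>y. y \<in> V \<Longrightarrow> local_biholo X Y f y"
  using assms unfolding local_biholo_def by metis

lemma local_biholo_hol_near: "local_biholo X Y f x \<Longrightarrow> hol_near X Y f x"
  unfolding local_biholo_def by blast

text \<open>The source shrinks to its intersection with \<open>W\<close> and the target to the
  preimage of \<open>W\<close> under the inverse, so the same \<open>g\<close> remains an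
  inverse.\<close>

lemma local_biholo_small:
  assumes X: "charted X" and Y: "charted Y" and l: "local_biholo X Y f x" and W: "openin (mtop X) W" "x \<in> W"
  shows "\<exists>V V' g. openin (mtop X) V \<and> x \<in> V \<and> V \<subseteq> W \<and> openin (mtop Y) V' \<and> f ` V \<subseteq> V' \<and> g ` V' \<subseteq> V \<and>
    (\<forall>x\<in>V. g (f x) = x \<and> hol_near X Y f x) \<and> (\<forall>y\<in>V'. f (g y) = y \<and> hol_near Y X g y)"
proof -
  obtain V V' g where V: "openin (mtop X) V" "x \<in> V" "openin (mtop Y) V'" "f ` V \<subseteq> V'" "g ` V' \<subseteq> V"
    "\<forall>x\<in>V. g (f x) = x \<and> hol_near X Y f x" "\<forall>y\<in>V'. f (g y) = y \<and> hol_near Y X g y"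
    using l unfolding local_biholo_def by blast
  let ?V = "V \<inter> W" and ?V' = "{y \<in> V'. g y \<in> W}"
  have "openin (mtop Y) ?V'"
    by (rule hol_near_preimage_open[OF Y X V(3) _ W(1)]) (use V(7) in blast)
  moreover have "openin (mtop X) ?V" using V(1) W(1) by (rule openin_Int)
  moreover have "f ` ?V \<subseteq> ?V'" "g ` ?V' \<subseteq> ?V" using V(4-6) by auto
  ultimately show ?thesis using V W by (intro exI[of _ ?V] exI[of _ ?V'] exI[of _ g]) simp
qed

lemma local_biholo_comp:
  assumes X: "charted X" and Y: "charted Y" and Z: "charted Z" and f: "local_biholo X Y f x" and h: "local_biholo Y Z h (f x)"
  shows "local_biholo X Z (\<lambda>x. h (f x)) x"
proof -
  obtain V V' g where V: "openin (mtop X) V" "x \<in> V" "openin (mtop Y) V'" "f ` V \<subseteq> V'" "g ` V' \<subseteq> V"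
    "\<forall>x\<in>V. g (f x) = x \<and> hol_near X Y f x" "\<forall>y\<in>V'. f (g y) = y \<and> hol_near Y X g y"
    using f unfolding local_biholo_def by blast
  have fx: "f x \<in> V'" using V by blast
  obtain U U' k where U: "openin (mtop Y) U" "f x \<in> U" "U \<subseteq> V'" "openin (mtop Z) U'" "h ` U \<subseteq> U'" "k ` U' \<subseteq> U"
    "\<forall>x\<in>U. k (h x) = x \<and> hol_near Y Z h x" "\<forall>y\<in>U'. h (k y) = y \<and> hol_near Z Y k y"
    using local_biholo_small[OF Y Z h V(3) fx] by blast
  let ?V = "{x \<in> V. f x \<in> U}"
  have o: "openin (mtop X) ?V"
    by (rule hol_near_preimage_open[OF X Y V(1) _ U(1)]) (use V(6) in blast)
  have k: "k y \<in> U" "k y \<in> V'" "g (k y) \<in> V" "f (g (k y)) = k y" if "y \<in> U'" for y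
    using that U(3,6) V(5,7) by blast+
  show ?thesis unfolding local_biholo_def
  proof (intro exI[of _ ?V] exI[of _ U'] exI[of _ "\<lambda>y. g (k y)"] conjI ballI)
    fix y assume y: "y \<in> ?V"
    show "hol_near X Z (\<lambda>x. h (f x)) y"
      by (rule hol_near_comp[OF X Y Z]) (use y V(6) U(7) in auto)
    show "g (k (h (f y))) = y" using y V(6) U(7) by auto
  next
    fix y assume y: "y \<in> U'"
    show "hol_near Z X (\<lambda>y. g (k y)) y"
      by (rule hol_near_comp[OF Z Y X]) (use y k V(7) U(8) in auto)
    show "h (f (g (k y))) = y" using y k U(8) by simp
  qed (use o V(2) U fx k in auto)
qed

lemma local_biholo_cong:
  assumes X: "charted X" and Y: "charted Y" and l: "local_biholo X Y f x" and W: "openin (mtop X) W" "x \<in> W"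
    and eq: "\<And>y. y \<in> W \<Longrightarrow> f y = f' y"
  shows "local_biholo X Y f' x"
proof -
  obtain V V' g where V: "openin (mtop X) V" "x \<in> V" "V \<subseteq> W" "openin (mtop Y) V'" "f ` V \<subseteq> V'" "g ` V' \<subseteq> V"
    "\<forall>x\<in>V. g (f x) = x \<and> hol_near X Y f x" "\<forall>y\<in>V'. f (g y) = y \<and> hol_near Y X g y"
    using local_biholo_small[OF X Y l W] by blast
  have f': "f' y = f y" if "y \<in> V" for y using that V(3) eq by auto
  have "hol_near X Y f' y" if y: "y \<in> V" for y
    by (rule hol_near_cong[OF X _ V(1) y]) (use V(7) y f' in auto)
  moreover have "f' (g y) = y" if y: "y \<in> V'" for y
    using V(6,8) f' y by (metis image_subset_iff)
  ultimately show ?thesis unfolding local_biholo_def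
    using V f' by (intro exI[of _ V] exI[of _ V'] exI[of _ g]) (simp add: image_subset_iff)
qed

text \<open>Injectivity makes every local inverse agree with \<open>inv_into U f\<close>, which is
  therefore holomorphic; the open domains of the local inverses show that the image is open.\<close>

lemma biholomorphism_glue:
  assumes X: "charted X" and Y: "charted Y" and U: "openin (mtop X) U"
    and inj: "inj_on f U" and l: "\<And>x. x \<in> U \<Longrightarrow> local_biholo X Y f x"
  shows "openin (mtop Y) (f ` U)" "biholomorphism (open_submfd X U) (open_submfd Y (f ` U)) f"
proof -
  have loc: "\<exists>V'. openin (mtop Y) V' \<and> f x \<in> V' \<and> V' \<subseteq> f ` U \<and> (\<forall>y\<in>V'. hol_near Y X (inv_into U f) y)"
    if x: "x \<in> U" for x
  proof -
    obtain V V' g where V: "openin (mtop X) V" "x \<in> V" "V \<subseteq> U" "openin (mtop Y) V'" "f ` V \<subseteq> V'" "g ` V' \<subseteq> V"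
      "\<forall>x\<in>V. g (f x) = x \<and> hol_near X Y f x" "\<forall>y\<in>V'. f (g y) = y \<and> hol_near Y X g y"
      using local_biholo_small[OF X Y l[OF x] U x] by blast
    have 1: "g y \<in> U" "f (g y) = y" if "y \<in> V'" for y using that V by blast+
    then have 2: "g y = inv_into U f y" if "y \<in> V'" for y using that inj by (metis inv_into_f_f)
    have "V' \<subseteq> f ` U" using 1 by (metis image_eqI subsetI)
    moreover have "hol_near Y X (inv_into U f) y" if y: "y \<in> V'" for y
      by (rule hol_near_cong[OF Y _ V(4) y 2]) (use V(8) y in auto)
    ultimately show ?thesis using V by blast
  qed
  show o: "openin (mtop Y) (f ` U)"
  proof (subst openin_subopen, rule ballI)
    fix y assume "y \<in> f ` U"
    then show "\<exists>T. openin (mtop Y) T \<and> y \<in> T \<and> T \<subseteq> f ` U" using loc by (metis imageE)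
  qed
  have "hol_near Y X (inv_into U f) y" if "y \<in> f ` U" for y
    using that loc by (metis imageE)
  then have "holomorphic_map (open_submfd Y (f ` U)) (open_submfd X U) (inv_into U f)"
    using openin_subset[OF o]
    by (subst holomorphic_map_iff[OF charted_open_submfd[OF Y o] charted_open_submfd[OF X U]])
       (auto simp: hol_near_open_submfd[OF Y o X U] inj inv_into_into)
  moreover have "holomorphic_map (open_submfd X U) (open_submfd Y (f ` U)) f"
    using openin_subset[OF U] local_biholo_hol_near[OF l]
    by (subst holomorphic_map_iff[OF charted_open_submfd[OF X U] charted_open_submfd[OF Y o]])
       (auto simp: hol_near_open_submfd[OF X U Y o])
  ultimately show "biholomorphism (open_submfd X U) (open_submfd Y (f ` U)) f"
    unfolding biholomorphism_def using inj by (auto intro!: exI[of _ "inv_into U f"] simp: inv_into_f_f f_inv_into_f)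
qed

lemma local_biholo_chart:
  assumes "charted X" "c \<in> max_atlas X" "x \<in> fst c"
  shows "local_biholo X euc (snd c) x"
proof -
  have ch: "is_chart (mtop X) c" using assms max_atlas_is_chart by blast
  show ?thesis unfolding local_biholo_def
    by (intro exI[of _ "fst c"] exI[of _ "snd c ` fst c"] exI[of _ "chart_inv c"])
       (use assms hol_near_chart[OF assms(1,2)] hol_near_chart_inv[OF assms(1,2)] chart_open[OF ch]
         chart_image_open[OF ch] chart_inv_left[OF ch] chart_inv_right[of _ c] in \<open>auto intro: inv_into_into\<close>)
qed

text \<open>Injectivity of the derivative in one pair of charts suffices, since equality of
  dimensions is built into the common coordinate type.\<close>

lemma local_biholo_inverse_function:
  fixes X :: "('a, 'k::finite) cmfd" and Y :: "('b, 'k) cmfd"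
  assumes X: "charted X" and Y: "charted Y" and f: "hol_near X Y f x"
    and c: "c \<in> max_atlas X" "x \<in> fst c" and c': "c' \<in> max_atlas Y" "f x \<in> fst c'"
    and inj: "\<And>v. vder (\<lambda>z. snd c' (f (chart_inv c z))) (snd c x) v = 0 \<Longrightarrow> v = 0"
  shows "local_biholo X Y f x"
proof -
  let ?F = "\<lambda>z. snd c' (f (chart_inv c z))"
  have ch: "is_chart (mtop X) c" "is_chart (mtop Y) c'" using c c' max_atlas_is_chart by blast+
  obtain V where V: "openin (mtop X) V" "x \<in> V" "V \<subseteq> fst c" "f ` V \<subseteq> fst c'" "holo_vec_on (snd c ` V) ?F"
    using hol_near_charts[OF X Y f c c'] by blast
  have oV: "open (snd c ` V)" "snd c x \<in> snd c ` V" using chart_open_map[OF ch(1)] V by auto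
  have "\<exists>S T G. open S \<and> S \<subseteq> snd c ` V \<and> snd c x \<in> S \<and> open T \<and> ?F ` S = T \<and> G ` T = S \<and>
    (\<forall>x\<in>S. G (?F x) = x) \<and> (\<forall>y\<in>T. ?F (G y) = y) \<and> holo_vec_on T G"
  proof (rule holo_inverse_function[OF oV(1) V(5) oV(2) inj])
    fix S T G assume "open S" "S \<subseteq> snd c ` V" "snd c x \<in> S" "open T" "?F ` S = T" "G ` T = S"
      "\<And>x. x \<in> S \<Longrightarrow> G (?F x) = x" "\<And>y. y \<in> T \<Longrightarrow> ?F (G y) = y" "holo_vec_on T G"
    then show ?thesis by (intro exI[of _ S] exI[of _ T] exI[of _ G] conjI ballI)
  qed
  then obtain S T G where S: "open S" "S \<subseteq> snd c ` V" "snd c x \<in> S" "open T" "?F ` S = T" "G ` T = S"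
    "\<forall>x\<in>S. G (?F x) = x" "\<forall>y\<in>T. ?F (G y) = y" "holo_vec_on T G" by blast
  have "local_biholo euc euc ?F (snd c x)"
    unfolding local_biholo_def hol_near_euc
    by (rule exI[of _ S], rule exI[of _ T], rule exI[of _ G])
       (use S holo_vec_on_subset[OF V(5) S(2)] in \<open>simp, blast\<close>)
  from local_biholo_comp[OF X charted_euc charted_euc local_biholo_chart[OF X c] this]
  have 1: "local_biholo X euc (\<lambda>x. ?F (snd c x)) x" .
  have 2: "local_biholo X euc (\<lambda>x. snd c' (f x)) x"
    by (rule local_biholo_cong[OF X charted_euc 1 V(1,2)]) (use chart_inv_left[OF ch(1)] V in auto)
  have e: "local_biholo euc Y (chart_inv c') (snd c' (f x))"
    unfolding local_biholo_def
    by (intro exI[of _ "snd c' ` fst c'"] exI[of _ "fst c'"] exI[of _ "snd c'"])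
       (use c' hol_near_chart[OF Y c'(1)] hol_near_chart_inv[OF Y c'(1)] chart_open[OF ch(2)]
         chart_image_open[OF ch(2)] chart_inv_left[OF ch(2)] chart_inv_right[of _ c'] in \<open>auto intro: inv_into_into\<close>)
  have 3: "local_biholo X Y (\<lambda>x. chart_inv c' (snd c' (f x))) x"
    by (rule local_biholo_comp[OF X charted_euc Y 2 e])
  show ?thesis
    by (rule local_biholo_cong[OF X Y 3 V(1,2)]) (use chart_inv_left[OF ch(2)] V in auto)
qed

section \<open>Total spaces of bundles\<close>

text \<open>The generated topology might have too many open sets, so every open set has to be shown
  to have open image in each chart. This passes through intersections by injectivity and through
  unions; for the generators it is continuity of a transition map.\<close>

lemma charted_generated:
  fixes A :: "('a, 'k::finite) chart set"
  defines "T \<equiv> topology_generated_by {{e \<in> fst t. snd t e \<in> S} | t S. t \<in> A \<and> open S}"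
  assumes inj: "\<And>t. t \<in> A \<Longrightarrow> inj_on (snd t) (fst t)"
    and op: "\<And>t t'. t \<in> A \<Longrightarrow> t' \<in> A \<Longrightarrow> open (snd t ` (fst t \<inter> fst t'))"
    and hol: "\<And>t t'. t \<in> A \<Longrightarrow> t' \<in> A \<Longrightarrow> holo_vec_on (snd t ` (fst t \<inter> fst t')) (\<lambda>z. snd t' (chart_inv t z))"
  shows "charted \<lparr>mtop = T, atlas = A\<rparr>" "topspace T = (\<Union>t\<in>A. fst t)"
proof -
  have gen: "open (snd t ` (U \<inter> fst t))"
    if "generate_topology_on {{e \<in> fst t. snd t e \<in> S} | t S. t \<in> A \<and> open S} U" "t \<in> A" for t U
    using that
  proof (induction rule: generate_topology_on.induct)
    case (Int a b)
    have "snd t ` ((a \<inter> b) \<inter> fst t) = snd t ` (a \<inter> fst t) \<inter> snd t ` (b \<inter> fst t)"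
      using inj[OF Int.prems] by (auto simp: inj_on_def)
    then show ?case using Int by auto
  next
    case (UN K)
    have "snd t ` (\<Union>K \<inter> fst t) = (\<Union>k\<in>K. snd t ` (k \<inter> fst t))" by auto
    then show ?case using UN by auto
  next
    case (Basis U)
    then obtain t' S where t': "t' \<in> A" "open S" "U = {e \<in> fst t'. snd t' e \<in> S}" by blast
    have inv: "chart_inv t (snd t e) = e" if "e \<in> fst t" for e
      using inj[OF Basis.prems] that by (simp add: inv_into_f_f)
    have "snd t ` (U \<inter> fst t) = snd t ` (fst t \<inter> fst t') \<inter> (\<lambda>z. snd t' (chart_inv t z)) -` S"
      unfolding t'(3) by (auto simp: inv)
    moreover have "open \<dots>"
      using continuous_open_preimage[OF holo_vec_on_imp_continuous_on[OF hol[OF Basis.prems t'(1)]] op[OF Basis.prems t'(1)] t'(2)] .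
    ultimately show ?case by simp
  qed simp
  have cont: "openin T {e \<in> fst t. snd t e \<in> S}" if "t \<in> A" "open S" for t S
    unfolding T_def by (rule topology_generated_by_Basis) (use that in blast)
  have fst_open: "openin T (fst t)" if "t \<in> A" for t
    using cont[OF that open_UNIV] by simp
  show ts: "topspace T = (\<Union>t\<in>A. fst t)"
  proof
    show "topspace T \<subseteq> (\<Union>t\<in>A. fst t)" unfolding T_def topology_generated_by_topspace by blast
    show "(\<Union>t\<in>A. fst t) \<subseteq> topspace T" using fst_open openin_subset by blast
  qed
  have ch: "is_chart T t" if "t \<in> A" for t
  proof (rule is_chartI[OF fst_open[OF that] inj[OF that]])
    fix V assume V: "openin T V" "V \<subseteq> fst t"
    then have "open (snd t ` (V \<inter> fst t))"
      unfolding T_def openin_topology_generated_by_iff using gen that by blast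
    then show "open (snd t ` V)" using V(2) by (simp add: Int_absorb2)
  qed (use cont that in blast)
  show "charted \<lparr>mtop = T, atlas = A\<rparr>"
    unfolding charted_def
  proof (intro conjI ballI)
    fix c c' assume "c \<in> atlas \<lparr>mtop = T, atlas = A\<rparr>" "c' \<in> atlas \<lparr>mtop = T, atlas = A\<rparr>"
    then show "compatible c c'"
      using hol[of c c'] hol[of c' c] by (simp add: compatible_def transition_def comp_def Int_commute)
  qed (use ch ts in auto)
qed

lemma charted_cover: "charted X \<Longrightarrow> x \<in> topspace (mtop X) \<Longrightarrow> \<exists>c\<in>atlas X. x \<in> fst c"
  unfolding charted_def by blast

lemma hol_near_smult:
  assumes X: "charted X" and f: "hol_near X euc (f :: _ \<Rightarrow> complex^'k) x" and g: "hol_near X euc (g :: _ \<Rightarrow> complex^'l) x"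
  shows "hol_near X euc (\<lambda>x. (f x $ k) *s g x) x"
proof -
  obtain c where c: "c \<in> max_atlas X" "x \<in> fst c" using max_atlas_cover[OF X] hol_near_topspace[OF f] by blast
  obtain V where V: "openin (mtop X) V" "x \<in> V" "V \<subseteq> fst c" "holo_vec_on (snd c ` V) (\<lambda>z. f (chart_inv c z))"
    using f unfolding hol_near_to_euc[OF X c] by blast
  obtain W where W: "openin (mtop X) W" "x \<in> W" "W \<subseteq> fst c" "holo_vec_on (snd c ` W) (\<lambda>z. g (chart_inv c z))"
    using g unfolding hol_near_to_euc[OF X c] by blast
  have "holo_vec_on (snd c ` (V \<inter> W)) (\<lambda>z. f (chart_inv c z))" "holo_vec_on (snd c ` (V \<inter> W)) (\<lambda>z. g (chart_inv c z))"
    by (rule holo_vec_on_subset[OF V(4)], blast) (rule holo_vec_on_subset[OF W(4)], blast)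
  then have "holo_vec_on (snd c ` (V \<inter> W)) (\<lambda>z. (f (chart_inv c z) $ k) *s g (chart_inv c z))"
    by (auto simp: holo_vec_on_def intro: holo_on_mult)
  then show ?thesis unfolding hol_near_to_euc[OF X c]
    using V W by (intro exI[of _ "V \<inter> W"]) (auto intro: openin_Int)
qed

lemma hol_near_add:
  assumes X: "charted X" and f: "hol_near X euc (f :: _ \<Rightarrow> complex^'l) x" and g: "hol_near X euc g x"
  shows "hol_near X euc (\<lambda>x. f x + g x) x"
proof -
  obtain c where c: "c \<in> max_atlas X" "x \<in> fst c" using max_atlas_cover[OF X] hol_near_topspace[OF f] by blast
  obtain V where V: "openin (mtop X) V" "x \<in> V" "V \<subseteq> fst c" "holo_vec_on (snd c ` V) (\<lambda>z. f (chart_inv c z))"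
    using f unfolding hol_near_to_euc[OF X c] by blast
  obtain W where W: "openin (mtop X) W" "x \<in> W" "W \<subseteq> fst c" "holo_vec_on (snd c ` W) (\<lambda>z. g (chart_inv c z))"
    using g unfolding hol_near_to_euc[OF X c] by blast
  have "holo_vec_on (snd c ` (V \<inter> W)) (\<lambda>z. f (chart_inv c z))" "holo_vec_on (snd c ` (V \<inter> W)) (\<lambda>z. g (chart_inv c z))"
    by (rule holo_vec_on_subset[OF V(4)], blast) (rule holo_vec_on_subset[OF W(4)], blast)
  then have "holo_vec_on (snd c ` (V \<inter> W)) (\<lambda>z. f (chart_inv c z) + g (chart_inv c z))"
    by (auto simp: holo_vec_on_def intro: holo_on_add)
  then show ?thesis unfolding hol_near_to_euc[OF X c]
    using V W by (intro exI[of _ "V \<inter> W"]) (auto intro: openin_Int)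
qed

lemma hol_near_const:
  assumes "charted X" "x \<in> topspace (mtop X)"
  shows "hol_near X euc (\<lambda>x. a) x"
proof -
  obtain c where c: "c \<in> max_atlas X" "x \<in> fst c" using max_atlas_cover[OF assms] by blast
  have "holo_vec_on (snd c ` fst c) (\<lambda>z. a)" by (simp add: holo_vec_on_def holo_on_const)
  then show ?thesis unfolding hol_near_to_euc[OF assms(1) c]
    using max_atlas_open[OF c(1)] c(2) by blast
qed

lemma hol_near_sum:
  assumes "charted X" "x \<in> topspace (mtop X)" "\<And>i. i \<in> A \<Longrightarrow> hol_near X euc (f i) x"
  shows "hol_near X euc (\<lambda>x. \<Sum>i\<in>A. f i x) x"
  using assms(3) by (induction A rule: infinite_finite_induct) (auto intro: hol_near_const hol_near_add assms)

lemma hol_near_holo: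
  assumes "charted X" "hol_near X euc f x" "holo_vec_on S F" "open S" "f x \<in> S"
  shows "hol_near X euc (\<lambda>x. F (f x)) x"
  by (rule hol_near_comp[OF assms(1) charted_euc charted_euc assms(2)])
     (use assms in \<open>auto simp: hol_near_euc\<close>)

text \<open>The cocycle identities are stated through the action on vectors: for the normal bundle
  it is this action that is computed from derivatives.\<close>

definition holo_bundle :: "('c, 'k::finite) cmfd \<Rightarrow> ('c, 'i, 'r::finite) vbundle \<Rightarrow> bool" where
  "holo_bundle X E \<longleftrightarrow> (\<forall>i\<in>bindex E. openin (mtop X) (bdom E i)) \<and>
     (\<forall>x. \<forall>i\<in>bat E x. \<forall>v. btrans E i i x *v v = v) \<and>
     (\<forall>x. \<forall>i\<in>bat E x. \<forall>j\<in>bat E x. \<forall>k\<in>bat E x. \<forall>v. btrans E i j x *v (btrans E j k x *v v) = btrans E i k x *v v) \<and>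
     (\<forall>x. \<forall>i\<in>bat E x. \<forall>j\<in>bat E x. \<forall>v. hol_near X euc (\<lambda>x. btrans E i j x *v v) x)"

text \<open>Inverse of the evaluation of fibre vectors at the index \<open>i\<close>.\<close>

definition fvec :: "('c, 'i, 'r::finite) vbundle \<Rightarrow> 'i \<Rightarrow> 'c \<Rightarrow> complex^'r \<Rightarrow> 'i \<Rightarrow> complex^'r" where
  "fvec E i x w = (\<lambda>k. if k \<in> bat E x then btrans E k i x *v w else 0)"

text \<open>Separates a varying matrix applied to a varying vector into scalar coordinates times
  images of fixed vectors, because holomorphy of \<open>btrans\<close> is recorded for fixed
  vectors.\<close>

lemma matrix_expand: "(A :: complex^'k^'l) *v v = (\<Sum>k\<in>UNIV. (v $ k) *s (A *v axis k 1))"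
  by (subst vec_expand[of v]) (simp add: matrix_vector_mult_def vec_eq_iff sum_distrib_left axis_def
      if_distrib cong: if_cong, simp add: mult.commute)

lemma holo_bundle_hol_near:
  assumes X: "charted X" and B: "charted B" and E: "holo_bundle B E" and f: "hol_near X B f x"
    and i: "i \<in> bat E (f x)" "j \<in> bat E (f x)" and w: "hol_near X euc w x"
  shows "hol_near X euc (\<lambda>x. btrans E i j (f x) *v w x) x"
proof -
  have "hol_near X euc (\<lambda>x. \<Sum>k\<in>UNIV. (w x $ k) *s (btrans E i j (f x) *v axis k 1)) x"
    by (intro hol_near_sum X hol_near_topspace(1)[OF f] hol_near_smult w hol_near_comp[OF X B charted_euc f])
       (use E i in \<open>simp add: holo_bundle_def\<close>)
  moreover have "(\<lambda>x. btrans E i j (f x) *v w x) = (\<lambda>x. \<Sum>k\<in>UNIV. (w x $ k) *s (btrans E i j (f x) *v axis k 1))"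
    by (rule ext) (rule matrix_expand)
  ultimately show ?thesis by simp
qed

lemma fibre_trans: "v \<in> fibre E x \<Longrightarrow> i \<in> bat E x \<Longrightarrow> j \<in> bat E x \<Longrightarrow> v i = btrans E i j x *v v j"
  unfolding fibre_def by blast

lemma fibre_outside: "v \<in> fibre E x \<Longrightarrow> i \<notin> bat E x \<Longrightarrow> v i = 0"
  unfolding fibre_def by blast

lemma fibre_fvec:
  assumes "holo_bundle X E" "i \<in> bat E x"
  shows "fvec E i x w \<in> fibre E x" "fvec E i x w i = w" "v \<in> fibre E x \<Longrightarrow> v = fvec E i x (v i)"
proof -
  have 1: "btrans E i i x *v w = w" for w using assms by (simp add: holo_bundle_def)
  have 2: "btrans E k j x *v (btrans E j i x *v w) = btrans E k i x *v w" if "k \<in> bat E x" "j \<in> bat E x" for j k w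
    using assms that by (simp add: holo_bundle_def)
  show "fvec E i x w \<in> fibre E x" unfolding fibre_def fvec_def using 2 by simp
  show "fvec E i x w i = w" using 1 assms(2) by (simp add: fvec_def)
  assume v: "v \<in> fibre E x"
  show "v = fvec E i x (v i)"
  proof
    fix k show "v k = fvec E i x (v i) k"
      using fibre_trans[OF v, of k i] fibre_outside[OF v, of k] assms(2) by (simp add: fvec_def)
  qed
qed

lemma fibre_eqI:
  assumes "v \<in> fibre E x" "w \<in> fibre E x" "i \<in> bat E x" "v i = w i"
  shows "v = w"
proof
  fix k show "v k = w k"
  proof (cases "k \<in> bat E x")
    case True
    then show ?thesis using fibre_trans[OF assms(1) True assms(3)] fibre_trans[OF assms(2) True assms(3)] assms(4) by simp
  next
    case False
    then show ?thesis using fibre_outside[OF assms(1)] fibre_outside[OF assms(2)] by simp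
  qed
qed

lemma total_chart_simps:
  "fst (total_chart E c i) = {(x, v). x \<in> fst c \<inter> bdom E i \<and> v \<in> fibre E x}"
  "snd (total_chart E c i) (x, v) = inl (snd c x) + inr (v i)"
  by (auto simp: total_chart_def vec_sum_eq_iff)

lemma total_space_simps [simp]: "atlas (total_space X E) = {total_chart E c i | c i. c \<in> atlas X \<and> i \<in> bindex E}"
  by (simp add: total_space_def Let_def)

text \<open>A transition map is the one of the base on the first block and the linear map
  \<open>btrans\<close> on the second. A point outside all trivializing sets lies in no chart,
  whence the condition on \<open>bat\<close> in the second claim.\<close>

lemma total_space_charted:
  assumes X: "charted X" and E: "holo_bundle X E"
  shows "charted (total_space X E)"
    "topspace (mtop (total_space X E)) = {(x, v). x \<in> topspace (mtop X) \<and> bat E x \<noteq> {} \<and> v \<in> fibre E x}"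
proof -
  let ?A = "{total_chart E c i | c i. c \<in> atlas X \<and> i \<in> bindex E}"
  have inj: "inj_on (snd t) (fst t)" if tA: "t \<in> ?A" for t
  proof (rule inj_onI)
    fix e e' assume e: "e \<in> fst t" "e' \<in> fst t" "snd t e = snd t e'"
    obtain c i where ci: "t = total_chart E c i" "c \<in> atlas X" "i \<in> bindex E" using tA by blast
    obtain x v x' v' where xv: "e = (x, v)" "e' = (x', v')" by (metis surj_pair)
    have ch: "is_chart (mtop X) c" using X ci by (auto simp: charted_def)
    have m: "x \<in> fst c" "x' \<in> fst c" "x \<in> bdom E i" "v \<in> fibre E x" "v' \<in> fibre E x'"
      using e(1,2) unfolding ci xv total_chart_simps by auto
    have eq: "inl (snd c x) + inr (v i) = inl (snd c x') + inr (v' i)"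
      using e(3) unfolding ci xv total_chart_simps .
    have "prl (inl (snd c x) + inr (v i)) = snd c x" "prl (inl (snd c x') + inr (v' i)) = snd c x'"
      "prr (inl (snd c x) + inr (v i)) = v i" "prr (inl (snd c x') + inr (v' i)) = v' i" by simp_all
    then have "snd c x = snd c x'" "v i = v' i" using eq by metis+
    then have "x = x'" using chart_inj[OF ch] m by (auto simp: inj_on_def)
    moreover have "i \<in> bat E x" using m ci by (simp add: bat_def)
    ultimately show "e = e'" using fibre_eqI[of v E x v' i] m \<open>v i = v' i\<close> xv by auto
  qed
  \<comment> \<open>The fibre direction is unrestricted: every fibre coordinate is attained through
    \<open>fvec\<close>, so the image is a cylinder over a set of base coordinates.\<close>
  have img: "snd t ` (fst t \<inter> fst t') = {z. prl z \<in> snd c ` (fst c \<inter> fst c' \<inter> bdom E i \<inter> bdom E i')}"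
    if t: "t = total_chart E c i" "t' = total_chart E c' i'" "c \<in> atlas X" "c' \<in> atlas X" "i \<in> bindex E" "i' \<in> bindex E" for t t' c c' i i'
  proof (intro equalityI subsetI)
    fix z assume "z \<in> snd t ` (fst t \<inter> fst t')"
    then obtain x v where "z = snd t (x, v)" "(x, v) \<in> fst t" "(x, v) \<in> fst t'" by auto
    then show "z \<in> {z. prl z \<in> snd c ` (fst c \<inter> fst c' \<inter> bdom E i \<inter> bdom E i')}"
      unfolding t total_chart_simps by auto
  next
    fix z :: "complex^('b + 'd)" assume "z \<in> {z. prl z \<in> snd c ` (fst c \<inter> fst c' \<inter> bdom E i \<inter> bdom E i')}"
    then obtain x where x: "prl z = snd c x" "x \<in> fst c" "x \<in> fst c'" "x \<in> bdom E i" "x \<in> bdom E i'" by auto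
    have i: "i \<in> bat E x" using x t by (simp add: bat_def)
    let ?e = "(x, fvec E i x (prr z))"
    have "?e \<in> fst t \<inter> fst t'" unfolding t total_chart_simps using x fibre_fvec[OF E i] by auto
    moreover have "snd t ?e = z" unfolding t total_chart_simps using fibre_fvec[OF E i] by (simp flip: x(1))
    ultimately show "z \<in> snd t ` (fst t \<inter> fst t')" by (metis imageI)
  qed
  have opn: "open (snd t ` (fst t \<inter> fst t'))" if tA: "t \<in> ?A" "t' \<in> ?A" for t t'
  proof -
    obtain c i c' i' where t: "t = total_chart E c i" "t' = total_chart E c' i'" "c \<in> atlas X" "c' \<in> atlas X"
      "i \<in> bindex E" "i' \<in> bindex E" using tA by blast
    have ch: "is_chart (mtop X) c" "is_chart (mtop X) c'" using X t by (auto simp: charted_def)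
    have "openin (mtop X) (fst c \<inter> fst c' \<inter> bdom E i \<inter> bdom E i')"
      using chart_open[OF ch(1)] chart_open[OF ch(2)] E t by (auto simp: holo_bundle_def intro!: openin_Int)
    then have "open (snd c ` (fst c \<inter> fst c' \<inter> bdom E i \<inter> bdom E i'))"
      by (rule chart_open_map[OF ch(1)]) auto
    then have "open ((prl :: complex^('b + 'd) \<Rightarrow> _) -` (snd c ` (fst c \<inter> fst c' \<inter> bdom E i \<inter> bdom E i')))"
      using open_vimage linear_continuous_on[OF block_bounded_linear(3)] by blast
    then show ?thesis unfolding img[OF t] vimage_def .
  qed
  have hol: "holo_vec_on (snd t ` (fst t \<inter> fst t')) (\<lambda>z. snd t' (chart_inv t z))" if tA: "t \<in> ?A" "t' \<in> ?A" for t t'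
  proof (rule holo_vec_on_local)
    obtain c i c' i' where t: "t = total_chart E c i" "t' = total_chart E c' i'" "c \<in> atlas X" "c' \<in> atlas X"
      "i \<in> bindex E" "i' \<in> bindex E" using tA by blast
    have ch: "is_chart (mtop X) c" "is_chart (mtop X) c'" using X t by (auto simp: charted_def)
    have cm: "c \<in> max_atlas X" "c' \<in> max_atlas X" using atlas_subset_max_atlas[OF X] t by blast+
    fix z assume z: "z \<in> snd t ` (fst t \<inter> fst t')"
    have form: "snd t' (chart_inv t z) = inl (snd c' (chart_inv c (prl z))) +
        inr (btrans E i' i (chart_inv c (prl z)) *v prr z)" if z: "z \<in> snd t ` (fst t \<inter> fst t')" for z
    proof -
      obtain x where x: "prl z = snd c x" "x \<in> fst c" "x \<in> fst c'" "x \<in> bdom E i" "x \<in> bdom E i'"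
        using z unfolding img[OF t] by auto
      have i: "i \<in> bat E x" "i' \<in> bat E x" using x t by (simp_all add: bat_def)
      let ?e = "(x, fvec E i x (prr z))"
      have e: "?e \<in> fst t \<inter> fst t'" unfolding t total_chart_simps using x fibre_fvec[OF E i(1)] by auto
      have "snd t ?e = z" unfolding t total_chart_simps using fibre_fvec[OF E i(1)] by (simp flip: x(1))
      then have "chart_inv t z = ?e" using inv_into_f_f[OF inj[OF tA(1)], of ?e] e by auto
      then show ?thesis using chart_inv_left[OF ch(1) x(2)] i
        by (simp add: t total_chart_simps x(1) fvec_def)
    qed
    obtain x where x: "prl z = snd c x" "x \<in> fst c" "x \<in> fst c'" "x \<in> bdom E i" "x \<in> bdom E i'"
      using z unfolding img[OF t] by auto
    have cx: "chart_inv c (prl z) = x" using chart_inv_left[OF ch(1) x(2)] x(1) by simp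
    have i: "i \<in> bat E x" "i' \<in> bat E x" using x t by (simp_all add: bat_def)
    have z_id: "hol_near euc euc (\<lambda>z. z) z" by (rule hol_near_id[OF charted_euc]) simp
    have prl: "hol_near euc euc prl z" and prr: "hol_near euc euc prr z"
      using hol_near_holo[OF charted_euc z_id block_holo(3) open_UNIV] hol_near_holo[OF charted_euc z_id block_holo(4) open_UNIV] by auto
    have b: "hol_near euc X (\<lambda>z. chart_inv c (prl z)) z"
      by (rule hol_near_comp[OF charted_euc charted_euc X prl]) (use hol_near_chart_inv[OF X cm(1)] x in auto)
    have 1: "hol_near euc euc (\<lambda>z. snd c' (chart_inv c (prl z))) z"
      by (rule hol_near_comp[OF charted_euc X charted_euc b]) (use hol_near_chart[OF X cm(2)] x cx in auto)
    have 2: "hol_near euc euc (\<lambda>z. btrans E i' i (chart_inv c (prl z)) *v prr z) z"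
      by (rule holo_bundle_hol_near[OF charted_euc X E b _ _ prr]) (use i cx in auto)
    have "hol_near euc euc (\<lambda>z. inl (snd c' (chart_inv c (prl z))) +
        inr (btrans E i' i (chart_inv c (prl z)) *v prr z)) z"
      using hol_near_add[OF charted_euc hol_near_holo[OF charted_euc 1 block_holo(1) open_UNIV]
          hol_near_holo[OF charted_euc 2 block_holo(2) open_UNIV]] by simp
    then have "hol_near euc euc (\<lambda>z. snd t' (chart_inv t z)) z"
      by (rule hol_near_cong[OF charted_euc, where W="snd t ` (fst t \<inter> fst t')"])
         (use opn[OF tA] z form in simp_all)
    then show "\<exists>T. z \<in> T \<and> holo_vec_on T (\<lambda>z. snd t' (chart_inv t z))"
      unfolding hol_near_euc by blast
  qed
  have eq: "total_space X E = \<lparr>mtop = topology_generated_by {{e \<in> fst t. snd t e \<in> S} | t S. t \<in> ?A \<and> open S}, atlas = ?A\<rparr>"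
    by (simp add: total_space_def Let_def)
  show "charted (total_space X E)"
    unfolding eq by (rule charted_generated(1)[OF inj opn hol])
  have "topspace (mtop (total_space X E)) = (\<Union>t\<in>?A. fst t)"
    unfolding eq cmfd.select_convs by (rule charted_generated(2)[OF inj opn hol])
  also have "\<dots> = {(x, v). x \<in> topspace (mtop X) \<and> bat E x \<noteq> {} \<and> v \<in> fibre E x}"
  proof (intro equalityI subsetI)
    fix e assume "e \<in> (\<Union>t\<in>?A. fst t)"
    then obtain c i where ci: "c \<in> atlas X" "i \<in> bindex E" "e \<in> fst (total_chart E c i)" by blast
    moreover have "fst c \<subseteq> topspace (mtop X)" using X ci by (auto simp: charted_def)
    ultimately show "e \<in> {(x, v). x \<in> topspace (mtop X) \<and> bat E x \<noteq> {} \<and> v \<in> fibre E x}"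
      unfolding total_chart_simps by (auto simp: bat_def)
  next
    fix e assume "e \<in> {(x, v). x \<in> topspace (mtop X) \<and> bat E x \<noteq> {} \<and> v \<in> fibre E x}"
    then obtain x v i where e: "e = (x, v)" "x \<in> topspace (mtop X)" "i \<in> bat E x" "v \<in> fibre E x" by auto
    then obtain c where "c \<in> atlas X" "x \<in> fst c" using X unfolding charted_def by blast
    then have "e \<in> fst (total_chart E c i)"
      unfolding total_chart_simps using e by (auto simp: bat_def)
    moreover have "total_chart E c i \<in> ?A"
      using \<open>c \<in> atlas X\<close> e(3) unfolding bat_def by blast
    ultimately show "e \<in> (\<Union>t\<in>?A. fst t)" by blast
  qed
  finally show "topspace (mtop (total_space X E)) = {(x, v). x \<in> topspace (mtop X) \<and> bat E x \<noteq> {} \<and> v \<in> fibre E x}" .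
qed

lemma total_chart_in_atlas:
  assumes "charted X" "holo_bundle X E" "c \<in> atlas X" "i \<in> bindex E"
  shows "total_chart E c i \<in> max_atlas (total_space X E)"
  by (rule atlas_subset_max_atlas[OF total_space_charted(1)[OF assms(1,2)]])
     (unfold total_space_simps, use assms in blast)

text \<open>Both maps are blocks of a chart of the total space; the base point is recovered by
  applying \<open>chart_inv c\<close> to the first block.\<close>

lemma hol_near_total_fst:
  assumes X: "charted X" and E: "holo_bundle X E" and e: "e \<in> topspace (mtop (total_space X E))"
  shows "hol_near (total_space X E) X fst e"
    "i \<in> bat E (fst e) \<Longrightarrow> hol_near (total_space X E) euc (\<lambda>e. snd e i) e"
proof -
  note T = total_space_charted(1)[OF X E]
  have main: "hol_near (total_space X E) X fst e \<and> hol_near (total_space X E) euc (\<lambda>e. snd e i) e" if i: "i \<in> bat E (fst e)" for i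
  proof -
    obtain c where c: "c \<in> atlas X" "fst e \<in> fst c" using charted_cover[OF X] e unfolding total_space_charted(2)[OF X E] by (metis (no_types, lifting) case_prodE fst_conv mem_Collect_eq)
    have cm: "c \<in> max_atlas X" using atlas_subset_max_atlas[OF X c(1)] .
    have ch: "is_chart (mtop X) c" using max_atlas_is_chart[OF cm] .
    let ?t = "total_chart E c i"
    have t: "?t \<in> max_atlas (total_space X E)" using total_chart_in_atlas[OF X E c(1)] i by (auto simp: bat_def)
    have et: "e \<in> fst ?t" using e i c unfolding total_space_charted(2)[OF X E] total_chart_simps by (auto simp: bat_def)
    have o: "openin (mtop (total_space X E)) (fst ?t)" by (rule max_atlas_open[OF t])
    note th = hol_near_chart[OF T t et]
    have prl: "hol_near (total_space X E) euc (\<lambda>e. prl (snd ?t e)) e" and prr: "hol_near (total_space X E) euc (\<lambda>e. prr (snd ?t e)) e"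
      using hol_near_holo[OF T th block_holo(3) open_UNIV] hol_near_holo[OF T th block_holo(4) open_UNIV] by auto
    have p: "prl (snd ?t e') = snd c (fst e')" "prr (snd ?t e') = snd e' i" for e'
      by (cases e'; simp add: total_chart_simps)+
    have "hol_near (total_space X E) X (\<lambda>e. chart_inv c (prl (snd ?t e))) e"
      by (rule hol_near_comp[OF T charted_euc X prl]) (use hol_near_chart_inv[OF X cm] c p in auto)
    then have "hol_near (total_space X E) X fst e"
      by (rule hol_near_cong[OF T _ o et])
         (use chart_inv_left[OF ch] in \<open>auto simp: total_chart_simps p\<close>)
    then show ?thesis using prr by (simp add: p)
  qed
  then show "i \<in> bat E (fst e) \<Longrightarrow> hol_near (total_space X E) euc (\<lambda>e. snd e i) e" by blast
  show "hol_near (total_space X E) X fst e" using main e unfolding total_space_charted(2)[OF X E] by auto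
qed

text \<open>One coordinate determines a vector of the fibre, so holomorphy is checked for the single
  index \<open>i\<close>.\<close>

lemma hol_near_into_total:
  assumes Y: "charted Y" and X: "charted X" and E: "holo_bundle X E" and f: "hol_near Y X f y"
    and i: "i \<in> bat E (f y)" and g: "hol_near Y euc (\<lambda>y. g y i) y"
    and W: "openin (mtop Y) W" "y \<in> W" "\<And>y. y \<in> W \<Longrightarrow> g y \<in> fibre E (f y)"
  shows "hol_near Y (total_space X E) (\<lambda>y. (f y, g y)) y"
proof -
  note T = total_space_charted(1)[OF X E]
  have fy: "f y \<in> topspace (mtop X)" using hol_near_topspace[OF f] by simp
  obtain c where c: "c \<in> atlas X" "f y \<in> fst c" using X fy unfolding charted_def by blast
  have cm: "c \<in> max_atlas X" using atlas_subset_max_atlas[OF X c(1)] .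
  have ch: "is_chart (mtop X) c" using max_atlas_is_chart[OF cm] .
  let ?t = "total_chart E c i"
  have t: "?t \<in> max_atlas (total_space X E)" using total_chart_in_atlas[OF X E c(1)] i by (auto simp: bat_def)
  have ei: "openin (mtop X) (bdom E i)" "f y \<in> bdom E i" using E i by (auto simp: holo_bundle_def bat_def)
  have "openin (mtop X) (fst c \<inter> bdom E i)" using ei chart_open[OF ch] by (simp add: openin_Int)
  then obtain V where V: "openin (mtop Y) V" "y \<in> V" "f ` V \<subseteq> fst c \<inter> bdom E i"
    using hol_near_continuous[OF Y X f] c ei by (metis IntI)
  have c1: "hol_near Y euc (\<lambda>y. snd c (f y)) y"
    by (rule hol_near_comp[OF Y X charted_euc f hol_near_chart[OF X cm c(2)]])
  have F: "hol_near Y euc (\<lambda>y. inl (snd c (f y)) + inr (g y i)) y"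
    using hol_near_add[OF Y hol_near_holo[OF Y c1 block_holo(1) open_UNIV] hol_near_holo[OF Y g block_holo(2) open_UNIV]] by simp
  have et: "(f y', g y') \<in> fst ?t" if "y' \<in> V \<inter> W" for y'
    using that V W unfolding total_chart_simps by auto
  have eq: "inl (snd c (f y')) + inr (g y' i) = snd ?t (f y', g y')" for y' by (simp add: total_chart_simps)
  have "hol_near Y (total_space X E) (\<lambda>y. chart_inv ?t (snd ?t (f y, g y))) y"
    using F unfolding eq
    by (rule hol_near_comp[OF Y charted_euc T]) (use hol_near_chart_inv[OF T t] et V W in auto)
  then show ?thesis
    by (rule hol_near_cong[OF Y, where W="V \<inter> W"])
       (use V W et chart_inv_left[OF max_atlas_is_chart[OF t]] in \<open>auto intro: openin_Int\<close>)
qed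

section \<open>Normal bundles and leading terms\<close>

lemma sum_UNIV_sum_type:
  "(\<Sum>k\<in>(UNIV :: ('a::finite + 'b::finite) set). f k) = (\<Sum>k\<in>UNIV. f (Inl k)) + (\<Sum>k\<in>UNIV. f (Inr k))"
  using sum.Plus[of "UNIV :: 'a set" "UNIV :: 'b set" f] by (simp add: comp_def)

text \<open>\<open>matrix\<close> records values on the standard basis over the complex numbers
  only; complex linearity is what lets them determine the real linear map \<open>D\<close>.\<close>

lemma matrix_works_complex:
  fixes D :: "complex^'k \<Rightarrow> complex^'l"
  assumes "linear D" "\<And>c v. D (c *s v) = c *s D v"
  shows "matrix D *v v = D v"
proof -
  have "D v = (\<Sum>k\<in>UNIV. D ((v $ k) *s axis k 1))"
    by (subst vec_expand[of v]) (rule linear_sum[OF assms(1)])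
  then show ?thesis
    by (simp add: assms(2) vec_eq_iff matrix_def matrix_vector_mult_def mult.commute)
qed

abbreviation trans_map :: "('m, 'k::finite) chart \<Rightarrow> ('m, 'k) chart \<Rightarrow> complex^'k \<Rightarrow> complex^'k" where
  "trans_map i j \<equiv> \<lambda>z. snd i (chart_inv j z)"

lemma jacobian_vder:
  assumes "holo_vec_on S F" "z \<in> S"
  shows "complex_jacobian F z *v v = vder F z v"
proof -
  have "frechet_derivative F (at z) = vder F z"
    using holo_vec_on_has_derivative[OF assms] frechet_derivative_at by metis
  then show ?thesis unfolding complex_jacobian_def
    using matrix_works_complex[of "vder F z"] vder_linear[OF assms] bounded_linear.linear vder_smult[OF assms] by metis
qed

lemma holo_vec_on_vder:
  assumes "open S" "holo_vec_on S F"
  shows "holo_vec_on S (\<lambda>z. vder F z v)"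
  using assms holo_on_ddir unfolding holo_vec_on_def vder_def by auto

lemma holo_prr: "holo_vec_on S F \<Longrightarrow> holo_vec_on S (\<lambda>z. prr (F z))"
  by (rule holo_vec_on_compose[OF block_holo(4)[of UNIV]]) auto

lemma vder_compose:
  assumes "holo_vec_on T G" "holo_vec_on S F" "z \<in> S" "F z \<in> T"
  shows "vder (\<lambda>z. G (F z)) z v = vder G (F z) (vder F z v)"
proof -
  have "((\<lambda>z. G (F z)) has_derivative (\<lambda>v. vder G (F z) (vder F z v))) (at z)"
    by (rule has_derivative_compose[OF holo_vec_on_has_derivative[OF assms(2,3)] holo_vec_on_has_derivative[OF assms(1,4)]])
  from vder_unique[OF this] show ?thesis by (rule fun_cong)
qed

lemma vder_cong:
  assumes "open S" "z \<in> S" "\<And>x. x \<in> S \<Longrightarrow> F x = G x"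
  shows "vder F z = vder G z"
proof -
  have "ddir v (\<lambda>x. F x $ i) z = ddir v (\<lambda>x. G x $ i) z" for v i
    by (rule ddir_cong[OF assms(1,2)]) (simp add: assms(3))
  then show ?thesis unfolding vder_def by (simp only:)
qed

lemma vder_slice_tendsto:
  assumes "holo_vec_on S F" "z \<in> S"
  shows "((\<lambda>t. inverse t *s (F (z + t *s e) - F z)) \<longlongrightarrow> vder F z e) (at 0)"
proof (rule vec_tendstoI)
  fix i
  have "((\<lambda>t. F (z + t *s e) $ i) has_field_derivative ddir e (\<lambda>z. F z $ i) (z + 0 *s e)) (at 0)"
    by (rule has_field_derivative_slice[of S]) (use assms in \<open>auto simp: holo_vec_on_def\<close>)
  then show "((\<lambda>t. (inverse t *s (F (z + t *s e) - F z)) $ i) \<longlongrightarrow> vder F z e $ i) (at 0)"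
    by (simp add: DERIV_def vder_def divide_inverse mult.commute right_diff_distrib)
qed

lemma eventually_slice:
  assumes "open S" "z \<in> S"
  shows "\<forall>\<^sub>F t in at 0. z + t *s (e :: complex^'k) \<in> S"
proof -
  have "((\<lambda>t. z + t *s e) \<longlongrightarrow> z + 0 *s e) (at 0)" by (intro tendsto_intros)
  then show ?thesis using topological_tendstoD assms by fastforce
qed

text \<open>Interpreted twice, for \<open>C\<close> in \<open>M\<close> and for \<open>Chat\<close>
  in the induced neighborhood, so that both normal bundles are treated alike.\<close>

locale embedded =
  fixes C :: "('c, 'n::finite) cmfd" and M :: "('m, 'n + 'd::finite) cmfd" and \<iota> :: "'c \<Rightarrow> 'm"
  assumes C: "charted C" and M: "charted M"
    and \<iota>: "\<And>x. x \<in> topspace (mtop C) \<Longrightarrow> hol_near C M \<iota> x"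
begin

abbreviation N where "N \<equiv> normal_bundle C M \<iota>"

lemma N_simps [simp]:
  "bindex N = adapted_charts C M \<iota>" "bdom N c = {x \<in> topspace (mtop C). \<iota> x \<in> fst c}"
  by (simp_all add: normal_bundle_def)

lemma bat_N: "c \<in> bat N x \<longleftrightarrow> c \<in> adapted_charts C M \<iota> \<and> x \<in> topspace (mtop C) \<and> \<iota> x \<in> fst c"
  by (simp add: bat_def)

lemma adapted_max: "c \<in> adapted_charts C M \<iota> \<Longrightarrow> c \<in> max_atlas M"
  by (simp add: adapted_charts_def)

lemma adapted_is_chart: "c \<in> adapted_charts C M \<iota> \<Longrightarrow> is_chart (mtop M) c"
  by (rule max_atlas_is_chart[OF adapted_max])

lemma adapted_slice:
  "c \<in> adapted_charts C M \<iota> \<Longrightarrow> m \<in> fst c \<Longrightarrow> m \<in> \<iota> ` topspace (mtop C) \<longleftrightarrow> prr (snd c m) = 0"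
  by (simp add: adapted_charts_def vec_eq_iff)

lemma N_trans_open: "i \<in> bat N x \<Longrightarrow> j \<in> bat N x \<Longrightarrow> open (snd j ` (fst j \<inter> fst i))"
  using chart_open_map[OF max_atlas_is_chart] max_atlas_open adapted_max
  by (metis bat_N inf.cobounded1 openin_Int)

lemma N_trans_holo: "i \<in> bat N x \<Longrightarrow> j \<in> bat N x \<Longrightarrow> holo_vec_on (snd j ` (fst j \<inter> fst i)) (trans_map i j)"
  using max_atlas_compatible[OF M] adapted_max by (simp add: bat_N)

lemma N_btrans:
  assumes "i \<in> bat N x" "j \<in> bat N x"
  shows "btrans N i j x *v v = prr (vder (trans_map i j) (snd j (\<iota> x)) (inr v))"
proof -
  have "complex_jacobian (trans_map i j) (snd j (\<iota> x)) *v inr v = vder (trans_map i j) (snd j (\<iota> x)) (inr v)"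
    by (rule jacobian_vder[OF N_trans_holo[OF assms]]) (use assms in \<open>auto simp: bat_N\<close>)
  moreover have "(btrans N i j x *v v) $ a = (complex_jacobian (trans_map i j) (snd j (\<iota> x)) *v inr v) $ Inr a" for a
    by (simp add: normal_bundle_def transition_def comp_def matrix_vector_mult_def sum_UNIV_sum_type)
  ultimately show ?thesis by (simp add: vec_eq_iff)
qed

text \<open>A transition map between adapted charts preserves the slice where the normal coordinates
  vanish, since both slices describe the image of \<open>C\<close>. Its derivative is therefore
  block triangular, which makes the diagonal block a cocycle.\<close>

lemma N_slice_tangent:
  assumes "i \<in> bat N x" "j \<in> bat N x"
  shows "prr (vder (trans_map i j) (snd j (\<iota> x)) (inl w)) = 0"
proof -
  let ?z = "snd j (\<iota> x)" and ?S = "snd j ` (fst j \<inter> fst i)"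
  have z: "?z \<in> ?S" "prr ?z = 0" using assms adapted_slice[of j "\<iota> x"] by (auto simp: bat_N)
  have lim: "((\<lambda>t. prr (inverse t *s (trans_map i j (?z + t *s inl w) - trans_map i j ?z))) \<longlongrightarrow> prr (vder (trans_map i j) ?z (inl w))) (at 0)"
    by (intro bounded_linear.tendsto[OF block_bounded_linear(4)] vder_slice_tendsto[OF N_trans_holo[OF assms] z(1)])
  have zero: "prr (trans_map i j z') = 0" if z': "z' \<in> ?S" "prr z' = 0" for z'
  proof -
    obtain m where m: "z' = snd j m" "m \<in> fst j" "m \<in> fst i" using z' by blast
    have "chart_inv j z' = m" using chart_inv_left[OF max_atlas_is_chart[OF adapted_max]] assms m by (auto simp: bat_N)
    then show ?thesis using adapted_slice[of j m] adapted_slice[of i m] assms m z' by (auto simp: bat_N)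
  qed
  have "\<forall>\<^sub>F t in at 0. prr (inverse t *s (trans_map i j (?z + t *s inl w) - trans_map i j ?z)) = 0"
    using eventually_slice[OF N_trans_open[OF assms] z(1), of "inl w"]
    by eventually_elim (use zero z in simp)
  then have "((\<lambda>t :: complex. 0) \<longlongrightarrow> prr (vder (trans_map i j) ?z (inl w))) (at 0)"
    by (rule Lim_transform_eventually[OF lim])
  from tendsto_unique[OF trivial_limit_at this tendsto_const] show ?thesis .
qed

lemma bdom_N_open: "i \<in> adapted_charts C M \<iota> \<Longrightarrow> openin (mtop C) (bdom N i)"
  unfolding N_simps
  by (rule hol_near_preimage_open[OF C M openin_topspace \<iota> max_atlas_open[OF adapted_max]])

lemma N_holo_bundle: "holo_bundle C N"
  unfolding holo_bundle_def
proof (intro conjI ballI allI)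
  show "openin (mtop C) (bdom N i)" if "i \<in> bindex N" for i
    using bdom_N_open that by simp
next
  fix x i v assume i: "i \<in> bat N x"
  have "vder (trans_map i i) (snd i (\<iota> x)) = vder (\<lambda>z. z) (snd i (\<iota> x))"
    by (rule vder_cong[OF N_trans_open[OF i i]])
       (use i chart_inv_right[of _ i] in \<open>auto simp: bat_N\<close>)
  moreover have "vder (\<lambda>z. z) (snd i (\<iota> x)) = (\<lambda>v. v)" by (rule vder_unique) (rule has_derivative_ident)
  ultimately show "btrans N i i x *v v = v" by (simp add: N_btrans[OF i i])
next
  fix x i j k v assume i: "i \<in> bat N x" and j: "j \<in> bat N x" and k: "k \<in> bat N x"
  let ?z = "snd k (\<iota> x)"
  have ch: "is_chart (mtop M) j" "is_chart (mtop M) k" using j k adapted_is_chart by (simp_all add: bat_N)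
  have xz: "\<iota> x \<in> fst i" "\<iota> x \<in> fst j" "\<iota> x \<in> fst k" using i j k by (auto simp: bat_N)
  have inv: "chart_inv k ?z = \<iota> x" using chart_inv_left[OF ch(2) xz(3)] .
  have "btrans N i j x *v (btrans N j k x *v v) =
      prr (vder (trans_map i j) (snd j (\<iota> x)) (inr (prr (vder (trans_map j k) ?z (inr v)))))"
    by (simp add: N_btrans i j k)
  \<comment> \<open>The projection in the middle discards only a tangential vector, which the next
    derivative keeps tangential.\<close>
  also have "\<dots> = prr (vder (trans_map i j) (snd j (\<iota> x)) (vder (trans_map j k) ?z (inr v)))"
  proof -
    let ?w = "vder (trans_map j k) ?z (inr v)" and ?D = "vder (trans_map i j) (snd j (\<iota> x))"
    have "linear ?D" using vder_linear[OF N_trans_holo[OF i j]] xz bounded_linear.linear by blast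
    then have "?D ?w = ?D (inl (prl ?w)) + ?D (inr (prr ?w))"
      using linear_add[of ?D "inl (prl ?w)" "inr (prr ?w)"] by simp
    then show ?thesis by (simp add: N_slice_tangent[OF i j])
  qed
  also have "vder (trans_map i j) (snd j (\<iota> x)) (vder (trans_map j k) ?z (inr v)) = vder (\<lambda>z. trans_map i j (trans_map j k z)) ?z (inr v)"
    using vder_compose[OF N_trans_holo[OF i j] N_trans_holo[OF j k], of ?z "inr v"] xz inv by auto
  also have "vder (\<lambda>z. trans_map i j (trans_map j k z)) ?z = vder (trans_map i k) ?z"
  proof (rule vder_cong)
    have "openin (mtop M) (fst k \<inter> fst j \<inter> fst i)"
      using i j k max_atlas_open[OF adapted_max] by (intro openin_Int) (simp_all add: bat_N)
    then show "open (snd k ` (fst k \<inter> fst j \<inter> fst i))" by (rule chart_open_map[OF ch(2)]) blast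
    fix z assume "z \<in> snd k ` (fst k \<inter> fst j \<inter> fst i)"
    then obtain m where "m \<in> fst k" "m \<in> fst j" "z = snd k m" by blast
    then show "trans_map i j (trans_map j k z) = trans_map i k z"
      using chart_inv_left[OF ch(1), of m] chart_inv_left[OF ch(2), of m] by simp
  qed (use xz in blast)
  finally show "btrans N i j x *v (btrans N j k x *v v) = btrans N i k x *v v"
    by (simp add: N_btrans i k)
next
  fix x i j v assume i: "i \<in> bat N x" and j: "j \<in> bat N x"
  let ?S = "snd j ` (fst j \<inter> fst i)"
  have x: "x \<in> topspace (mtop C)" using i by (simp add: bat_N)
  have jm: "j \<in> max_atlas M" "\<iota> x \<in> fst j" using j adapted_max by (auto simp: bat_N)
  have "hol_near C euc (\<lambda>x. snd j (\<iota> x)) x"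
    by (rule hol_near_comp[OF C M charted_euc \<iota>[OF x] hol_near_chart[OF M jm]])
  then have "hol_near C euc (\<lambda>x. prr (vder (trans_map i j) (snd j (\<iota> x)) (inr v))) x"
    by (rule hol_near_holo[OF C _ holo_prr[OF holo_vec_on_vder[OF N_trans_open[OF i j] N_trans_holo[OF i j]]] N_trans_open[OF i j]])
       (use i j in \<open>auto simp: bat_N\<close>)
  moreover have "openin (mtop C) (bdom N i \<inter> bdom N j)"
    using bdom_N_open i j by (intro openin_Int) (simp_all add: bat_N)
  ultimately show "hol_near C euc (\<lambda>x. btrans N i j x *v v) x"
  proof (rule hol_near_cong[OF C])
    show "x \<in> bdom N i \<inter> bdom N j" using i j by (simp add: bat_N)
    fix y assume "y \<in> bdom N i \<inter> bdom N j"
    then have "i \<in> bat N y" "j \<in> bat N y" using i j by (auto simp: bat_N)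
    then show "prr (vder (trans_map i j) (snd j (\<iota> y)) (inr v)) = btrans N i j y *v v" by (simp add: N_btrans)
  qed
qed

section \<open>Orders of vanishing and leading terms along curves\<close>

definition approaches :: "(complex \<Rightarrow> 'm) \<Rightarrow> 'c \<Rightarrow> bool" where
  "approaches m y \<longleftrightarrow> (\<forall>W. openin (mtop M) W \<and> \<iota> y \<in> W \<longrightarrow> (\<forall>\<^sub>F t in at 0. m t \<in> W))"

lemma approachesD: "approaches m y \<Longrightarrow> openin (mtop M) W \<Longrightarrow> \<iota> y \<in> W \<Longrightarrow> \<forall>\<^sub>F t in at 0. m t \<in> W"
  unfolding approaches_def by blast

lemma approaches_tendsto:
  assumes "approaches m y" "hol_near M euc f (\<iota> y)"
  shows "((\<lambda>t. f (m t)) \<longlongrightarrow> f (\<iota> y)) (at 0)"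
proof (rule topological_tendstoI)
  fix T assume T: "open T" "f (\<iota> y) \<in> T"
  obtain V where "openin (mtop M) V" "\<iota> y \<in> V" "f ` V \<subseteq> T"
    using hol_near_continuous[OF M charted_euc assms(2), of T] T by auto
  then show "\<forall>\<^sub>F t in at 0. f (m t) \<in> T"
    using approachesD[OF assms(1), of V] by (auto elim!: eventually_mono)
qed

text \<open>These curves are straight in the chart \<open>j\<close> but not in the other adapted
  charts; evaluating along them is how coefficients taken in different charts are compared.\<close>

lemma approaches_ray:
  assumes "j \<in> bat N y"
  shows "approaches (\<lambda>t. chart_inv j (snd j (\<iota> y) + t *s e)) y"
  unfolding approaches_def
proof (intro allI impI)
  fix W assume W: "openin (mtop M) W \<and> \<iota> y \<in> W"
  have jm: "j \<in> max_atlas M" "\<iota> y \<in> fst j" using assms adapted_max by (auto simp: bat_N)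
  have ch: "is_chart (mtop M) j" using jm max_atlas_is_chart by blast
  have "open (snd j ` (fst j \<inter> W))" using chart_open_map[OF ch] W max_atlas_open[OF jm(1)] by (simp add: openin_Int)
  then have "\<forall>\<^sub>F t in at 0. snd j (\<iota> y) + t *s e \<in> snd j ` (fst j \<inter> W)"
    by (rule eventually_slice) (use W jm in blast)
  then show "\<forall>\<^sub>F t in at 0. chart_inv j (snd j (\<iota> y) + t *s e) \<in> W"
    by eventually_elim (use chart_inv_left[OF ch] in auto)
qed

text \<open>Order of vanishing along all of \<open>C\<close>, tested in normal directions of adapted
  charts. Since the condition is imposed at every point of \<open>C\<close>, base points may be
  moved along \<open>C\<close>.\<close>

definition vanishing :: "('c, 'i, 'r::finite) vbundle \<Rightarrow> ('i \<Rightarrow> 'm \<Rightarrow> complex^'r) \<Rightarrow> nat \<Rightarrow> bool" where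
  "vanishing E u l \<longleftrightarrow> (\<forall>y\<in>topspace (mtop C). \<forall>i\<in>bat E y. \<forall>j\<in>bat N y. \<forall>v a. \<forall>k<l.
     iter_ddir k (inr v) (\<lambda>z. u i (chart_inv j z) $ a) (snd j (\<iota> y)) = 0)"

text \<open>The term of degree \<open>l\<close> in the Taylor expansion along \<open>C\<close>, as a
  polynomial in the normal vector \<open>v\<close>.\<close>

definition leading :: "('i \<Rightarrow> 'm \<Rightarrow> complex^'r) \<Rightarrow> nat \<Rightarrow> 'c \<Rightarrow> 'i \<Rightarrow> ('m, 'n + 'd) chart \<Rightarrow> complex^'d \<Rightarrow> complex^'r" where
  "leading u l y i j v = (\<chi> a. iter_ddir l (inr v) (\<lambda>z. u i (chart_inv j z) $ a) (snd j (\<iota> y)) / fact l)"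

end

text \<open>The data \<open>u\<close> stand for a difference of two maps from \<open>M\<close> near \<open>C\<close>, written in the
  trivializations of \<open>E\<close>; only the coefficient of lowest order along \<open>C\<close> transforms like a section
  of \<open>E\<close> tensored with a symmetric power of the conormal bundle.\<close>

locale deviation = embedded C M \<iota>
  for C :: "('c, 'n::finite) cmfd" and M :: "('m, 'n + 'd::finite) cmfd" and \<iota> :: "'c \<Rightarrow> 'm" +
  fixes E :: "('c, 'i, 'r::finite) vbundle" and D :: "'i \<Rightarrow> 'm set" and u :: "'i \<Rightarrow> 'm \<Rightarrow> complex^'r"
  assumes E_open: "\<And>i. i \<in> bindex E \<Longrightarrow> openin (mtop C) (bdom E i)"
    and D_open: "\<And>i. i \<in> bindex E \<Longrightarrow> openin (mtop M) (D i)"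
    and D_iff: "\<And>i y. i \<in> bindex E \<Longrightarrow> y \<in> topspace (mtop C) \<Longrightarrow> \<iota> y \<in> D i \<longleftrightarrow> y \<in> bdom E i"
    and u_hol: "\<And>i m. i \<in> bindex E \<Longrightarrow> m \<in> D i \<Longrightarrow> hol_near M euc (u i) m"
begin

lemma D_bat: "i \<in> bat E y \<Longrightarrow> y \<in> topspace (mtop C) \<Longrightarrow> \<iota> y \<in> D i"
  using D_iff by (simp add: bat_def)

lemma rep_open: "i \<in> bindex E \<Longrightarrow> j \<in> adapted_charts C M \<iota> \<Longrightarrow> open (snd j ` (fst j \<inter> D i))"
  using chart_open_map[OF max_atlas_is_chart[OF adapted_max]] max_atlas_open[OF adapted_max] D_open
  by (simp add: openin_Int)

lemma rep_holo:
  assumes "i \<in> bindex E" "j \<in> adapted_charts C M \<iota>"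
  shows "holo_vec_on (snd j ` (fst j \<inter> D i)) (\<lambda>z. u i (chart_inv j z))"
proof (rule holo_vec_on_local)
  fix z assume "z \<in> snd j ` (fst j \<inter> D i)"
  then obtain m where m: "z = snd j m" "m \<in> fst j" "m \<in> D i" by blast
  have "hol_near euc euc (\<lambda>z. u i (chart_inv j z)) (snd j m)"
    using hol_near_euc_rep[OF M charted_euc u_hol[OF assms(1) m(3)] adapted_max[OF assms(2)] m(2) euc_chart] by simp
  then show "\<exists>T. z \<in> T \<and> holo_vec_on T (\<lambda>z. u i (chart_inv j z))" unfolding hol_near_euc m(1) by blast
qed

lemma rep_holo_component:
  assumes "i \<in> bindex E" "j \<in> adapted_charts C M \<iota>"
  shows "holo_on (snd j ` (fst j \<inter> D i)) (\<lambda>z. u i (chart_inv j z) $ a)"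
  using rep_holo[OF assms] by (simp add: holo_vec_on_def)

text \<open>The curve is split into a foot point on \<open>C\<close> plus \<open>t\<close> times a
  normal vector converging to \<open>v\<close>; \<open>taylor_limit\<close> allows both to move.
  Only the first order normal behaviour of the curve enters, so the coefficient transforms like a
  polynomial on the normal bundle.\<close>

lemma leading_limit:
  assumes van: "vanishing E u l" and y: "y \<in> topspace (mtop C)" and i: "i \<in> bat E y" and j: "j \<in> bat N y"
    and m: "approaches m y" and v: "((\<lambda>t. inverse t *s prr (snd j (m t))) \<longlongrightarrow> v) (at 0)"
  shows "((\<lambda>t. inverse (t ^ l) *s u i (m t)) \<longlongrightarrow> leading u l y i j v) (at 0)"
proof (rule vec_tendstoI)
  fix a
  let ?f = "\<lambda>z. u i (chart_inv j z) $ a" and ?z = "snd j (\<iota> y)" and ?S = "snd j ` (fst j \<inter> D i)"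
  have ii: "i \<in> bindex E" using i by (simp add: bat_def)
  have jj: "j \<in> adapted_charts C M \<iota>" "\<iota> y \<in> fst j" using j by (auto simp: bat_N)
  have ch: "is_chart (mtop M) j" using jj adapted_max max_atlas_is_chart by blast
  have z: "?z \<in> ?S" "prr ?z = 0" using jj D_bat[OF i y] adapted_slice[OF jj] y by auto
  have lim: "((\<lambda>t. snd j (m t)) \<longlongrightarrow> ?z) (at 0)"
    by (rule approaches_tendsto[OF m hol_near_chart[OF M adapted_max[OF jj(1)] jj(2)]])
  have "((\<lambda>t. inl (prl (snd j (m t))) :: complex^('n + 'd)) \<longlongrightarrow> inl (prl ?z)) (at 0)"
    by (intro bounded_linear.tendsto[OF block_bounded_linear(1)] bounded_linear.tendsto[OF block_bounded_linear(3)] lim)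
  moreover have "inl (prl ?z) = ?z" using z(2) by (simp add: vec_sum_eq_iff vec_eq_iff)
  ultimately have l1: "((\<lambda>t. inl (prl (snd j (m t)))) \<longlongrightarrow> ?z) (at 0)" by simp
  have l2: "((\<lambda>t. inr (inverse t *s prr (snd j (m t)))) \<longlongrightarrow> inr v) (at 0)"
    by (intro bounded_linear.tendsto[OF block_bounded_linear(2)] v)
  \<comment> \<open>The foot points vary, so the vanishing of the lower coefficients is needed at
    all points of the slice and not only at \<open>y\<close>.\<close>
  have van': "iter_ddir k (inr w) ?f z = 0" if zS: "z \<in> ?S" "prr z = 0" and k: "k < l" for z w k
  proof -
    obtain m' where m': "z = snd j m'" "m' \<in> fst j" "m' \<in> D i" using zS by blast
    then obtain y' where y': "y' \<in> topspace (mtop C)" "m' = \<iota> y'" using adapted_slice[OF jj(1) m'(2)] zS by auto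
    have "i \<in> bat E y'" using D_iff[OF ii y'(1)] m' y' ii by (simp add: bat_def)
    moreover have "j \<in> bat N y'" using jj m' y' by (simp add: bat_N)
    ultimately show ?thesis using van y' m' k by (simp add: vanishing_def)
  qed
  have "\<forall>\<^sub>F t in at 0. inl (prl (snd j (m t))) \<in> ?S"
    using topological_tendstoD[OF l1 rep_open[OF ii jj(1)] z(1)] .
  then have ev: "\<forall>\<^sub>F t in at 0. \<forall>k<l. iter_ddir k (inr (inverse t *s prr (snd j (m t)))) ?f (inl (prl (snd j (m t)))) = 0"
    by eventually_elim (intro allI impI van'; simp)
  have "((\<lambda>t. ?f (inl (prl (snd j (m t))) + t *s inr (inverse t *s prr (snd j (m t)))) / t ^ l)
      \<longlongrightarrow> iter_ddir l (inr v) ?f ?z / fact l) (at 0)"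
    by (rule taylor_limit[OF rep_open[OF ii jj(1)] rep_holo_component[OF ii jj(1)] z(1) l1 l2 tendsto_ident_at _ ev])
       (use van' z in \<open>auto simp: eventually_at_filter\<close>)
  moreover have "\<forall>\<^sub>F t in at 0. ?f (inl (prl (snd j (m t))) + t *s inr (inverse t *s prr (snd j (m t)))) / t ^ l
      = (inverse (t ^ l) *s u i (m t)) $ a"
    using approachesD[OF m max_atlas_open[OF adapted_max[OF jj(1)]] jj(2)] eventually_neq_at_within[of 0 0 UNIV]
  proof eventually_elim
    fix t :: complex assume t: "m t \<in> fst j" "t \<noteq> 0"
    have "(t *s inr (inverse t *s prr (snd j (m t))) :: complex^('n + 'd)) = inr (prr (snd j (m t)))"
      using t(2) by (simp add: vec_sum_eq_iff)
    then have "inl (prl (snd j (m t))) + t *s inr (inverse t *s prr (snd j (m t))) = snd j (m t)"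
      by (simp only: block_simps2(5))
    then show "?f (inl (prl (snd j (m t))) + t *s inr (inverse t *s prr (snd j (m t)))) / t ^ l
      = (inverse (t ^ l) *s u i (m t)) $ a"
      using chart_inv_left[OF ch t(1)] by (simp add: field_simps)
  qed
  ultimately show "((\<lambda>t. (inverse (t ^ l) *s u i (m t)) $ a) \<longlongrightarrow> leading u l y i j v $ a) (at 0)"
    unfolding leading_def vec_lambda_beta by (rule Lim_transform_eventually)
qed

lemma leading_ray:
  assumes "vanishing E u l" "y \<in> topspace (mtop C)" "i \<in> bat E y" "j \<in> bat N y"
  shows "((\<lambda>t. inverse (t ^ l) *s u i (chart_inv j (snd j (\<iota> y) + t *s inr v))) \<longlongrightarrow> leading u l y i j v) (at 0)"
proof (rule leading_limit[OF assms approaches_ray[OF assms(4)]])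
  have jj: "j \<in> adapted_charts C M \<iota>" "\<iota> y \<in> fst j" using assms(4) by (auto simp: bat_N)
  have ch: "is_chart (mtop M) j" using jj adapted_max max_atlas_is_chart by blast
  have "\<forall>\<^sub>F t in at 0. snd j (\<iota> y) + t *s inr v \<in> snd j ` fst j"
    by (rule eventually_slice[OF chart_image_open[OF ch]]) (use jj in blast)
  then have "\<forall>\<^sub>F t in at 0. v = inverse t *s prr (snd j (chart_inv j (snd j (\<iota> y) + t *s inr v)))"
    using eventually_neq_at_within[of 0 0 UNIV]
  proof eventually_elim
    fix t :: complex assume t: "snd j (\<iota> y) + t *s inr v \<in> snd j ` fst j" "t \<noteq> 0"
    have "prr (snd j (\<iota> y)) = 0" using adapted_slice[OF jj] assms(2) by blast
    then show "v = inverse t *s prr (snd j (chart_inv j (snd j (\<iota> y) + t *s inr v)))"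
      using t by (simp add: chart_inv_right[OF t(1)] vec_eq_iff)
  qed
  then show "((\<lambda>t. inverse t *s prr (snd j (chart_inv j (snd j (\<iota> y) + t *s inr v)))) \<longlongrightarrow> v) (at 0)"
    by (rule Lim_transform_eventually[OF tendsto_const])
qed

text \<open>The hypothesis \<open>trans\<close> carries all information on how \<open>u\<close>
  depends on the trivialization of \<open>E\<close>. It makes the coefficients of order
  \<open>l\<close> a global section, and the vanishing of the sections raises the order by
  one.\<close>

lemma order_step:
  assumes van: "vanishing E u l"
    and trans: "\<And>y i i' m L. y \<in> topspace (mtop C) \<Longrightarrow> i \<in> bat E y \<Longrightarrow> i' \<in> bat E y \<Longrightarrow> approaches m y \<Longrightarrow>
      ((\<lambda>t. inverse (t ^ l) *s u i (m t)) \<longlongrightarrow> L) (at 0) \<Longrightarrow>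
      ((\<lambda>t. inverse (t ^ l) *s u i' (m t)) \<longlongrightarrow> btrans E i' i y *v L) (at 0)"
    and H0: "H0_vanishes (mtop C) (sym_sections C E N l)"
  shows "vanishing E u (Suc l)"
proof -
  define s where "s y i j = (if y \<in> topspace (mtop C) \<and> i \<in> bat E y \<and> j \<in> bat N y then leading u l y i j else 0)" for y i j
  have sec: "s \<in> sym_sections C E N l (topspace (mtop C))"
    unfolding sym_sections_def
  proof (intro CollectI conjI ballI allI impI)
    fix y assume "y \<notin> topspace (mtop C)"
    then show "s y = 0" by (simp add: s_def fun_eq_iff)
  next
    fix y assume y: "y \<in> topspace (mtop C)"
    show "s y \<in> sym_fibre E N l y"
      unfolding sym_fibre_def
    proof (intro CollectI conjI allI ballI impI)
      fix i j assume "i \<notin> bat E y \<or> j \<notin> bat N y"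
      then show "s y i j = 0" by (auto simp: s_def)
    next
      fix i j assume i: "i \<in> bat E y" and j: "j \<in> bat N y"
      have ii: "i \<in> bindex E" using i by (simp add: bat_def)
      have jj: "j \<in> adapted_charts C M \<iota>" "\<iota> y \<in> fst j" using j by (auto simp: bat_N)
      have "scalar_poly l (\<lambda>v. iter_ddir l (inr v) (\<lambda>z. u i (chart_inv j z) $ a) (snd j (\<iota> y)) * (1 / fact l))" for a
        by (intro scalar_poly_mult_const scalar_poly_iter_ddir_inr[OF rep_open[OF ii jj(1)] rep_holo_component[OF ii jj(1)]])
           (use D_bat[OF i y] jj in blast)
      then show "homogeneous_poly l (s y i j)"
        using i j y by (intro homogeneous_polyI) (simp add: s_def leading_def)
    next
      fix i i' j j' v assume i: "i \<in> bat E y" "i' \<in> bat E y" and j: "j \<in> bat N y" "j' \<in> bat N y"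
      \<comment> \<open>Straight in \<open>j'\<close>; seen in \<open>j\<close> this curve has
        normal velocity \<open>btrans N j j' y *v v\<close>. Both \<open>u i\<close> and
        \<open>u i'\<close> are measured along it.\<close>
      let ?m = "\<lambda>t. chart_inv j' (snd j' (\<iota> y) + t *s inr v)"
      have jj: "\<iota> y \<in> fst j" "\<iota> y \<in> fst j'" "prr (snd j (\<iota> y)) = 0"
        using j adapted_slice[of j "\<iota> y"] y by (auto simp: bat_N)
      have ch': "is_chart (mtop M) j'" using j adapted_is_chart by (simp add: bat_N)
      have "((\<lambda>t. prr (inverse t *s (trans_map j j' (snd j' (\<iota> y) + t *s inr v) - trans_map j j' (snd j' (\<iota> y)))))
          \<longlongrightarrow> prr (vder (trans_map j j') (snd j' (\<iota> y)) (inr v))) (at 0)"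
        by (intro bounded_linear.tendsto[OF block_bounded_linear(4)] vder_slice_tendsto[OF N_trans_holo[OF j]])
           (use jj in blast)
      then have "((\<lambda>t. inverse t *s prr (snd j (?m t))) \<longlongrightarrow> btrans N j j' y *v v) (at 0)"
        using jj(3) chart_inv_left[OF ch' jj(2)] by (simp add: N_btrans[OF j])
      then have "((\<lambda>t. inverse (t ^ l) *s u i (?m t)) \<longlongrightarrow> leading u l y i j (btrans N j j' y *v v)) (at 0)"
        by (rule leading_limit[OF van y i(1) j(1) approaches_ray[OF j(2)]])
      from trans[OF y i approaches_ray[OF j(2)] this]
      have "((\<lambda>t. inverse (t ^ l) *s u i' (?m t)) \<longlongrightarrow> btrans E i' i y *v leading u l y i j (btrans N j j' y *v v)) (at 0)" .
      with leading_ray[OF van y i(2) j(2), of v]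
      have "leading u l y i' j' v = btrans E i' i y *v leading u l y i j (btrans N j j' y *v v)"
        using tendsto_unique[OF trivial_limit_at] by blast
      then show "s y i' j' v = btrans E i' i y *v s y i j (btrans N j j' y *v v)"
        using i j y by (simp add: s_def)
    qed
  next
    fix i j v a assume ii: "i \<in> bindex E" and "j \<in> bindex N"
    then have jj: "j \<in> adapted_charts C M \<iota>" by simp
    let ?W = "topspace (mtop C) \<inter> bdom E i \<inter> bdom N j" and ?S = "snd j ` (fst j \<inter> D i)"
    have W: "openin (mtop C) ?W" using E_open[OF ii] bdom_N_open[OF jj] by (intro openin_Int) auto
    \<comment> \<open>For a fixed direction the coefficient is defined and holomorphic on an open
      set of chart coordinates, so holomorphy on \<open>C\<close> follows by composing with
      \<open>\<iota>\<close>.\<close>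
    let ?G = "\<lambda>z. \<chi> a. iter_ddir l (inr v) (\<lambda>z. u i (chart_inv j z) $ a) z * (1 / fact l)"
    have G: "holo_vec_on ?S ?G"
      unfolding holo_vec_on_def
      by (rule allI, unfold vec_lambda_beta)
         (intro holo_on_mult holo_on_const holo_on_iter_ddir rep_open[OF ii jj] rep_holo_component[OF ii jj])
    have hol: "hol_near C euc (\<lambda>x. s x i j v) x" if x: "x \<in> ?W" for x
    proof -
      have x': "x \<in> topspace (mtop C)" "\<iota> x \<in> fst j" "\<iota> x \<in> D i" using x D_iff[OF ii] by auto
      have "hol_near C euc (\<lambda>x. snd j (\<iota> x)) x"
        by (rule hol_near_comp[OF C M charted_euc \<iota>[OF x'(1)] hol_near_chart[OF M adapted_max[OF jj] x'(2)]])
      then have "hol_near C euc (\<lambda>x. ?G (snd j (\<iota> x))) x"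
        by (rule hol_near_holo[OF C _ G rep_open[OF ii jj]]) (use x' in blast)
      then show ?thesis
        by (rule hol_near_cong[OF C _ W x]) (use ii jj in \<open>auto simp: s_def bat_def leading_def\<close>)
    qed
    show "holomorphic_fun C ?W (\<lambda>x. s x i j v $ a)"
      unfolding holomorphic_fun_def holo_on_def
    proof (intro ballI)
      fix c z assume c: "c \<in> atlas C" and "z \<in> snd c ` (fst c \<inter> ?W)"
      then obtain x where x: "z = snd c x" "x \<in> fst c" "x \<in> ?W" by blast
      have "\<exists>V. openin (mtop C) V \<and> x \<in> V \<and> V \<subseteq> fst c \<and> holo_vec_on (snd c ` V) (\<lambda>z. s (chart_inv c z) i j v)"
        using hol[OF x(3)] unfolding hol_near_to_euc[OF C atlas_subset_max_atlas[OF C c] x(2)] .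
      then obtain V where "x \<in> V" "holo_vec_on (snd c ` V) (\<lambda>z. s (chart_inv c z) i j v)" by (elim exE conjE) (rule that)
      then show "\<exists>F. (((\<lambda>x. s x i j v $ a) \<circ> chart_inv c) has_derivative F) (at z) \<and> (\<forall>c v. F (c *s v) = c * F v)"
        unfolding holo_vec_on_def holo_on_def comp_def x(1) by blast
    qed
  qed
  then have "s = 0" using H0 unfolding H0_vanishes_def by blast
  show ?thesis
    unfolding vanishing_def
  proof (intro ballI allI impI)
    fix y i j v a k assume y: "y \<in> topspace (mtop C)" "i \<in> bat E y" "j \<in> bat N y" and k: "k < Suc l"
    show "iter_ddir k (inr v) (\<lambda>z. u i (chart_inv j z) $ a) (snd j (\<iota> y)) = 0"
    proof (cases "k < l")
      case True
      then show ?thesis using van y by (simp add: vanishing_def)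
    next
      case False
      then have "k = l" using k by simp
      have "leading u l y i j v = s y i j v" using y by (simp add: s_def)
      also have "\<dots> = 0" using \<open>s = 0\<close> by simp
      finally show ?thesis unfolding \<open>k = l\<close> leading_def by (simp add: vec_eq_iff)
    qed
  qed
qed

text \<open>A point near \<open>C\<close> lies on a normal complex disc through a foot point on
  \<open>C\<close>, and along that disc all derivatives at the foot point vanish.\<close>

lemma vanishing_all:
  assumes van: "\<And>l. vanishing E u l" and y: "y \<in> topspace (mtop C)" and i: "i \<in> bat E y" and j: "j \<in> bat N y"
  shows "\<exists>V. openin (mtop M) V \<and> \<iota> y \<in> V \<and> V \<subseteq> D i \<and> (\<forall>m\<in>V. u i m = 0)"
proof -
  have ii: "i \<in> bindex E" using i by (simp add: bat_def)
  have jj: "j \<in> adapted_charts C M \<iota>" "\<iota> y \<in> fst j" using j by (auto simp: bat_N)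
  have ch: "is_chart (mtop M) j" using jj adapted_max max_atlas_is_chart by blast
  let ?z = "snd j (\<iota> y)" and ?S = "snd j ` (fst j \<inter> D i)"
  have zS: "?z \<in> ?S" "prr ?z = 0" using jj D_bat[OF i y] adapted_slice[OF jj] y by auto
  obtain \<delta> where \<delta>: "\<delta> > 0" "ball ?z \<delta> \<subseteq> ?S" using rep_open[OF ii jj(1)] zS(1) openE by blast
  \<comment> \<open>The disc has radius 2 for \<open>vanishing_ray\<close>, so the tangential part
    contributes the distance to \<open>?z\<close> at most once and the normal part at most twice; a
    third of \<delta> keeps the disc inside the ball.\<close>
  define V where "V = {m \<in> fst j \<inter> D i. snd j m \<in> ball ?z (\<delta>/3)}"
  have "openin (mtop M) ({m \<in> fst j. snd j m \<in> ball ?z (\<delta>/3)} \<inter> D i)"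
    using chart_continuous[OF ch open_ball] D_open[OF ii] by (intro openin_Int)
  moreover have "{m \<in> fst j. snd j m \<in> ball ?z (\<delta>/3)} \<inter> D i = V" by (auto simp: V_def)
  ultimately have oV: "openin (mtop M) V" by simp
  have "u i m = 0" if m: "m \<in> V" for m
  proof -
    let ?w = "snd j m"
    have w: "norm (?w - ?z) < \<delta> / 3" using m by (simp add: V_def dist_norm norm_minus_commute)
    have in_ball: "inl (prl ?w) + t *s inr (prr ?w) \<in> ?S" if t: "cmod t < 2" for t
    proof -
      have "inl (prl ?w) + t *s inr (prr ?w) - ?z = inl (prl (?w - ?z)) + t *s inr (prr (?w - ?z))"
        using zS(2) by (simp add: vec_sum_eq_iff) (simp add: vec_eq_iff)
      also have "norm \<dots> \<le> norm (inl (prl (?w - ?z)) :: complex^('n + 'd)) + cmod t * norm (inr (prr (?w - ?z)) :: complex^('n + 'd))"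
        using norm_triangle_ineq[of "inl (prl (?w - ?z))" "t *s inr (prr (?w - ?z))"] by (simp only: norm_smult_vec)
      also have "\<dots> \<le> norm (?w - ?z) + 2 * norm (?w - ?z)"
        using t norm_block[of "?w - ?z"] by (intro add_mono mult_mono) auto
      also have "\<dots> < \<delta>" using w by simp
      finally show ?thesis using \<delta>(2) by (auto simp: dist_norm norm_minus_commute)
    qed
    have bS: "inl (prl ?w) \<in> ?S" using in_ball[of 0] by simp
    then obtain m' where m': "inl (prl ?w) = snd j m'" "m' \<in> fst j" "m' \<in> D i" by blast
    have "prr (snd j m') = 0" using m'(1)[symmetric] by simp
    then obtain y' where y': "y' \<in> topspace (mtop C)" "m' = \<iota> y'" using adapted_slice[OF jj(1) m'(2)] by auto
    have bats: "i \<in> bat E y'" "j \<in> bat N y'"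
      using D_iff[OF ii y'(1)] m' y' ii jj by (simp_all add: bat_def bat_N)
    have "u i (chart_inv j (inl (prl ?w) + inr (prr ?w))) $ a = 0" for a
    proof (rule vanishing_ray[OF rep_open[OF ii jj(1)] rep_holo_component[OF ii jj(1)] in_ball])
      fix k show "iter_ddir k (inr (prr ?w)) (\<lambda>z. u i (chart_inv j z) $ a) (inl (prl ?w)) = 0"
        using van[of "Suc k"] bats y' m'(1) by (simp add: vanishing_def)
    qed
    then show ?thesis using chart_inv_left[OF ch, of m] m by (simp add: V_def vec_eq_iff)
  qed
  then show ?thesis using oV D_bat[OF i y] jj \<delta> by (intro exI[of _ V]) (auto simp: V_def)
qed

end

section \<open>Uniqueness of normalized linearizations\<close>

lemma hol_near_diff:
  assumes X: "charted X" and f: "hol_near X euc (f :: _ \<Rightarrow> complex^'l) x" and g: "hol_near X euc g x"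
  shows "hol_near X euc (\<lambda>x. f x - g x) x"
proof -
  have "holo_vec_on UNIV (\<lambda>z :: complex^'l. - z)"
    unfolding holo_vec_on_def using holo_on_diff[OF holo_on_const[of "UNIV :: (complex^'l) set" 0] holo_on_nth] by simp
  from hol_near_add[OF X f hol_near_holo[OF X g this]] show ?thesis by simp
qed

text \<open>A chain rule for the difference of two moving points scaled by an arbitrary factor such
  as \<open>inverse (t ^ l)\<close>. It carries a limit of order \<open>l\<close> through a change
  of chart with the first derivative only.\<close>

lemma strict_limit:
  fixes F :: "complex^'k \<Rightarrow> complex^'l" and c :: "'x \<Rightarrow> complex"
  assumes S: "open S" "holo_vec_on S F" "z0 \<in> S" and p: "(p \<longlongrightarrow> z0) G" "(p' \<longlongrightarrow> z0) G"
    and L: "((\<lambda>t. c t *s (p t - p' t)) \<longlongrightarrow> L) G"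
  shows "((\<lambda>t. c t *s (F (p t) - F (p' t))) \<longlongrightarrow> vder F z0 L) G"
proof -
  let ?R = "\<lambda>t. F (p t) - F (p' t) - vder F z0 (p t - p' t)"
  have "((\<lambda>t. c t *s ?R t) \<longlongrightarrow> 0) G"
  proof (rule tendstoI)
    fix e :: real assume e: "e > 0"
    \<comment> \<open>An eventual bound for the scaled difference that is positive even for
      \<open>L = 0\<close>; the tolerance \<open>e / (2 * B)\<close> then keeps the error strictly
      below \<open>e\<close>.\<close>
    define B where "B = norm L + 1"
    have B: "B > 0" using norm_ge_zero[of L] unfolding B_def by linarith
    then have "e / (2 * B) > 0" using e by simp
    then obtain \<delta> where \<delta>: "\<delta> > 0" "ball z0 \<delta> \<subseteq> S"
      "\<And>x y. x \<in> ball z0 \<delta> \<Longrightarrow> y \<in> ball z0 \<delta> \<Longrightarrow> norm (F y - F x - vder F z0 (y - x)) \<le> e / (2 * B) * norm (y - x)"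
      using strict_derivative[OF S] by metis
    have "\<forall>\<^sub>F t in G. p t \<in> ball z0 \<delta>" "\<forall>\<^sub>F t in G. p' t \<in> ball z0 \<delta>"
      using p \<delta>(1) topological_tendstoD[of _ z0 G "ball z0 \<delta>"] by auto
    moreover have "\<forall>\<^sub>F t in G. norm (c t *s (p t - p' t)) < B"
      using order_tendstoD(2)[OF tendsto_norm[OF L], of B] by (simp add: B_def)
    ultimately show "\<forall>\<^sub>F t in G. dist (c t *s ?R t) 0 < e"
    proof eventually_elim
      fix t assume t: "p t \<in> ball z0 \<delta>" "p' t \<in> ball z0 \<delta>" "norm (c t *s (p t - p' t)) < B"
      have "norm (c t *s ?R t) \<le> cmod (c t) * (e / (2 * B) * norm (p t - p' t))"
        unfolding norm_smult_vec by (rule mult_left_mono[OF \<delta>(3)[OF t(2,1)]]) simp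
      also have "\<dots> = e / (2 * B) * norm (c t *s (p t - p' t))" by (simp only: norm_smult_vec mult_ac)
      also have "\<dots> \<le> e / (2 * B) * B"
        using t(3) \<open>e / (2 * B) > 0\<close> by (intro mult_left_mono) auto
      also have "\<dots> < e" using B e by simp
      finally show "dist (c t *s ?R t) 0 < e" by simp
    qed
  qed
  moreover have "((\<lambda>t. vder F z0 (c t *s (p t - p' t))) \<longlongrightarrow> vder F z0 L) G"
    by (rule bounded_linear.tendsto[OF vder_linear[OF S(2,3)] L])
  ultimately have "((\<lambda>t. c t *s ?R t + vder F z0 (c t *s (p t - p' t))) \<longlongrightarrow> 0 + vder F z0 L) G"
    by (rule tendsto_add)
  moreover have "c t *s ?R t + vder F z0 (c t *s (p t - p' t)) = c t *s (F (p t) - F (p' t))" for t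
    unfolding vder_smult[OF S(2,3)] by (simp add: vec_eq_iff algebra_simps)
  ultimately show ?thesis by simp
qed

context embedded
begin

text \<open>The normalized pairs of the overview. The condition on rays states that the normal
  derivative is the identity, with the same adapted chart used for the ray and for the coordinates
  of \<open>w\<close>.\<close>

definition linearization :: "'m set \<Rightarrow> ('m \<Rightarrow> 'c) \<Rightarrow> ('m \<Rightarrow> ('m, 'n + 'd) chart \<Rightarrow> complex^'d) \<Rightarrow> bool" where
  "linearization U \<rho> w \<longleftrightarrow> openin (mtop M) U \<and> \<iota> ` topspace (mtop C) \<subseteq> U \<and>
     (\<forall>m\<in>U. hol_near M C \<rho> m) \<and> (\<forall>y\<in>topspace (mtop C). \<rho> (\<iota> y) = y) \<and>
     (\<forall>m\<in>U. w m \<in> fibre N (\<rho> m)) \<and>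
     (\<forall>m\<in>U. \<forall>i\<in>bat N (\<rho> m). hol_near M euc (\<lambda>m. w m i) m) \<and>
     (\<forall>y\<in>topspace (mtop C). \<forall>i\<in>bat N y. w (\<iota> y) i = 0 \<and>
        (\<forall>v. ((\<lambda>t. inverse t *s w (chart_inv i (snd i (\<iota> y) + t *s inr v)) i) \<longlongrightarrow> v) (at 0)))"

lemma linearizationD:
  assumes "linearization U \<rho> w"
  shows "openin (mtop M) U" "y \<in> topspace (mtop C) \<Longrightarrow> \<iota> y \<in> U"
    "m \<in> U \<Longrightarrow> hol_near M C \<rho> m" "y \<in> topspace (mtop C) \<Longrightarrow> \<rho> (\<iota> y) = y"
    "m \<in> U \<Longrightarrow> w m \<in> fibre N (\<rho> m)"
    "m \<in> U \<Longrightarrow> i \<in> bat N (\<rho> m) \<Longrightarrow> hol_near M euc (\<lambda>m. w m i) m"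
    "y \<in> topspace (mtop C) \<Longrightarrow> i \<in> bat N y \<Longrightarrow> w (\<iota> y) i = 0"
    "y \<in> topspace (mtop C) \<Longrightarrow> i \<in> bat N y \<Longrightarrow>
      ((\<lambda>t. inverse t *s w (chart_inv i (snd i (\<iota> y) + t *s inr v)) i) \<longlongrightarrow> v) (at 0)"
  using assms unfolding linearization_def by blast+

lemma vanishing_induct:
  assumes "vanishing E u l0" "\<And>l. l \<ge> l0 \<Longrightarrow> vanishing E u l \<Longrightarrow> vanishing E u (Suc l)"
  shows "vanishing E u l"
proof (cases "l \<ge> l0")
  case True
  then show ?thesis
    by (induction l rule: dec_induct) (use assms in blast)+
next
  case False
  then show ?thesis using assms(1) unfolding vanishing_def by (meson less_trans not_le)
qed

text \<open>Here \<open>E\<close> is the tangent bundle and \<open>u i\<close> is the difference of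
  the retractions in the chart \<open>i\<close> of \<open>C\<close>, considered where both land in
  that chart. The order is at least 1 to begin with because both restrict to the identity on
  \<open>C\<close>.\<close>

lemma retraction_unique:
  assumes l: "linearization U \<rho> w" "linearization U' \<rho>' w'" and ne: "\<And>y. y \<in> topspace (mtop C) \<Longrightarrow> bat N y \<noteq> {}"
    and H0: "\<And>l. l \<ge> 1 \<Longrightarrow> H0_vanishes (mtop C) (sym_sections C (tangent_bundle C) N l)"
    and y: "y \<in> topspace (mtop C)"
  shows "\<exists>V. openin (mtop M) V \<and> \<iota> y \<in> V \<and> V \<subseteq> U \<inter> U' \<and> (\<forall>m\<in>V. \<rho> m = \<rho>' m)"
proof -
  let ?T = "tangent_bundle C"
  define D where "D i = {m \<in> {m \<in> U \<inter> U'. \<rho> m \<in> fst i}. \<rho>' m \<in> fst i}" for i :: "('c, 'n) chart"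
  define u where "u i m = snd i (\<rho> m) - snd i (\<rho>' m)" for i :: "('c, 'n) chart" and m
  have T: "bindex ?T = max_atlas C" "bdom ?T i = fst i" "bat ?T y = {i \<in> max_atlas C. y \<in> fst i}" for i y
    by (simp_all add: tangent_bundle_def bat_def)
  have D_open: "openin (mtop M) (D i)" if i: "i \<in> max_atlas C" for i
  proof -
    have "openin (mtop M) (U \<inter> U')" using linearizationD(1)[OF l(1)] linearizationD(1)[OF l(2)] by (rule openin_Int)
    then have "openin (mtop M) {m \<in> U \<inter> U'. \<rho> m \<in> fst i}"
      by (rule hol_near_preimage_open[OF M C _ _ max_atlas_open[OF i]]) (use linearizationD(3)[OF l(1)] in blast)
    then show ?thesis unfolding D_def
      by (rule hol_near_preimage_open[OF M C _ _ max_atlas_open[OF i]]) (use linearizationD(3)[OF l(2)] in blast)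
  qed
  interpret dev: deviation C M \<iota> ?T D u
  proof unfold_locales
    fix i assume "i \<in> bindex ?T"
    then have i: "i \<in> max_atlas C" by (simp add: T)
    show "openin (mtop C) (bdom ?T i)" using max_atlas_open[OF i] by (simp add: T)
    show "openin (mtop M) (D i)" by (rule D_open[OF i])
    show "\<iota> y \<in> D i \<longleftrightarrow> y \<in> bdom ?T i" if "y \<in> topspace (mtop C)" for y
      using linearizationD(2,4)[OF l(1)] linearizationD(2,4)[OF l(2)] that by (simp add: D_def T)
    show "hol_near M euc (u i) m" if m: "m \<in> D i" for m
      unfolding u_def
    proof (rule hol_near_diff[OF M])
      show "hol_near M euc (\<lambda>x. snd i (\<rho> x)) m"
        by (rule hol_near_comp[OF M C charted_euc]) (use m linearizationD(3)[OF l(1)] hol_near_chart[OF C i] in \<open>simp_all add: D_def\<close>)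
      show "hol_near M euc (\<lambda>x. snd i (\<rho>' x)) m"
        by (rule hol_near_comp[OF M C charted_euc]) (use m linearizationD(3)[OF l(2)] hol_near_chart[OF C i] in \<open>simp_all add: D_def\<close>)
    qed
  qed
  have 1: "vanishing ?T u 1"
    unfolding vanishing_def
  proof (intro ballI allI impI)
    fix y i j v a and k :: nat assume y: "y \<in> topspace (mtop C)" "i \<in> bat ?T y" "j \<in> bat N y" and "k < 1"
    have "chart_inv j (snd j (\<iota> y)) = \<iota> y"
      using y(3) chart_inv_left[OF adapted_is_chart] by (simp add: bat_N)
    then show "iter_ddir k (inr v) (\<lambda>z. u i (chart_inv j z) $ a) (snd j (\<iota> y)) = 0"
      using \<open>k < 1\<close> linearizationD(4)[OF l(1) y(1)] linearizationD(4)[OF l(2) y(1)] by (simp add: u_def)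
  qed
  have step: "vanishing ?T u (Suc l)" if l1: "l \<ge> 1" and van: "vanishing ?T u l" for l
  proof (rule dev.order_step[OF van _ H0[OF l1]])
    fix y i i' m L
    assume y: "y \<in> topspace (mtop C)" and i: "i \<in> bat ?T y" "i' \<in> bat ?T y" and m: "approaches m y"
      and L: "((\<lambda>t. inverse (t ^ l) *s u i (m t)) \<longlongrightarrow> L) (at 0)"
    have im: "i \<in> max_atlas C" "y \<in> fst i" "i' \<in> max_atlas C" "y \<in> fst i'" using i by (simp_all add: T)
    let ?S = "snd i ` (fst i \<inter> fst i')" and ?F = "trans_map i' i"
    have ch: "is_chart (mtop C) i" by (rule max_atlas_is_chart[OF im(1)])
    have oS: "open ?S"
      using chart_open_map[OF ch] max_atlas_open[OF im(1)] max_atlas_open[OF im(3)] by (simp add: openin_Int)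
    have hF: "holo_vec_on ?S ?F" by (rule max_atlas_compatible[OF C im(1,3)])
    have zS: "snd i y \<in> ?S" using im by blast
    have yU: "\<iota> y \<in> U" "\<iota> y \<in> U'" "\<rho> (\<iota> y) = y" "\<rho>' (\<iota> y) = y"
      using linearizationD(2,4)[OF l(1) y] linearizationD(2,4)[OF l(2) y] by simp_all
    have "hol_near M euc (\<lambda>m. snd i (\<rho> m)) (\<iota> y)"
      by (rule hol_near_comp[OF M C charted_euc]) (use yU linearizationD(3)[OF l(1)] hol_near_chart[OF C im(1,2)] in simp_all)
    from approaches_tendsto[OF m this] have p: "((\<lambda>t. snd i (\<rho> (m t))) \<longlongrightarrow> snd i y) (at 0)" using yU by simp
    have "hol_near M euc (\<lambda>m. snd i (\<rho>' m)) (\<iota> y)"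
      by (rule hol_near_comp[OF M C charted_euc]) (use yU linearizationD(3)[OF l(2)] hol_near_chart[OF C im(1,2)] in simp_all)
    from approaches_tendsto[OF m this] have p': "((\<lambda>t. snd i (\<rho>' (m t))) \<longlongrightarrow> snd i y) (at 0)" using yU by simp
    \<comment> \<open>\<open>u i'\<close> is the difference of two values of the change of chart
      \<open>?F\<close>, at points that both tend to \<open>snd i y\<close>; the derivative of
      \<open>?F\<close> there is the Jacobian that defines the tangent bundle.\<close>
    have lim: "((\<lambda>t. inverse (t ^ l) *s (?F (snd i (\<rho> (m t))) - ?F (snd i (\<rho>' (m t))))) \<longlongrightarrow> vder ?F (snd i y) L) (at 0)"
      by (rule strict_limit[OF oS hF zS p p']) (use L in \<open>simp add: u_def\<close>)
    have "\<forall>\<^sub>F t in at 0. m t \<in> D i"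
      by (rule approachesD[OF m D_open[OF im(1)]]) (use yU im in \<open>simp add: D_def\<close>)
    then have "\<forall>\<^sub>F t in at 0. inverse (t ^ l) *s (?F (snd i (\<rho> (m t))) - ?F (snd i (\<rho>' (m t)))) = inverse (t ^ l) *s u i' (m t)"
      by eventually_elim (use chart_inv_left[OF ch] in \<open>simp add: u_def D_def\<close>)
    then have "((\<lambda>t. inverse (t ^ l) *s u i' (m t)) \<longlongrightarrow> vder ?F (snd i y) L) (at 0)"
      by (rule Lim_transform_eventually[OF lim])
    moreover have "btrans ?T i' i y *v L = vder ?F (snd i y) L"
      using jacobian_vder[OF hF zS] by (simp add: tangent_bundle_def transition_def comp_def)
    ultimately show "((\<lambda>t. inverse (t ^ l) *s u i' (m t)) \<longlongrightarrow> btrans ?T i' i y *v L) (at 0)" by simp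
  qed
  have all: "vanishing ?T u l" for l
    by (rule vanishing_induct[OF 1 step])
  obtain i where i: "i \<in> max_atlas C" "y \<in> fst i" using max_atlas_cover[OF C y] by blast
  obtain j where j: "j \<in> bat N y" using ne[OF y] by blast
  obtain V where V: "openin (mtop M) V" "\<iota> y \<in> V" "V \<subseteq> D i" "\<forall>m\<in>V. u i m = 0"
    using dev.vanishing_all[OF all y _ j, of i] i by (auto simp: T)
  have "\<rho> m = \<rho>' m" if m: "m \<in> V" for m
  proof -
    have "m \<in> D i" "u i m = 0" using V m by blast+
    then show ?thesis using chart_inj[OF max_atlas_is_chart[OF i(1)]] by (simp add: D_def u_def inj_on_def)
  qed
  then show ?thesis using V by (intro exI[of _ V]) (auto simp: D_def)
qed

text \<open>Coordinates of \<open>w\<close> at \<open>m t\<close> change by the matrix at the moving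
  base point \<open>\<rho> (m t)\<close>; in the limit it is replaced by the matrix at
  \<open>y\<close>.\<close>

lemma btrans_tendsto:
  assumes m: "approaches m y" and \<rho>: "hol_near M C \<rho> (\<iota> y)" "\<rho> (\<iota> y) = y" and i: "i \<in> bat N y" "j \<in> bat N y"
    and X: "(X \<longlongrightarrow> L) (at 0)"
  shows "((\<lambda>t. btrans N i j (\<rho> (m t)) *v X t) \<longlongrightarrow> btrans N i j y *v L) (at 0)"
proof -
  have "((\<lambda>t. btrans N i j (\<rho> (m t)) *v axis k 1) \<longlongrightarrow> btrans N i j y *v axis k 1) (at 0)" for k
  proof -
    have "hol_near M euc (\<lambda>m. btrans N i j (\<rho> m) *v axis k 1) (\<iota> y)"
      by (rule holo_bundle_hol_near[OF M C N_holo_bundle \<rho>(1) _ _ hol_near_const[OF M]])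
         (use \<rho> i hol_near_topspace[OF \<rho>(1)] in simp_all)
    from approaches_tendsto[OF m this] show ?thesis using \<rho>(2) by simp
  qed
  then have "((\<lambda>t. \<Sum>k\<in>UNIV. (X t $ k) *s (btrans N i j (\<rho> (m t)) *v axis k 1)) \<longlongrightarrow>
      (\<Sum>k\<in>UNIV. (L $ k) *s (btrans N i j y *v axis k 1))) (at 0)"
    by (intro tendsto_sum tendsto_smult tendsto_vec_nth X)
  then show ?thesis by (simp only: matrix_expand[symmetric])
qed

lemma linearization_unique:
  assumes l: "linearization U \<rho> w" "linearization U' \<rho>' w'" and ne: "\<And>y. y \<in> topspace (mtop C) \<Longrightarrow> bat N y \<noteq> {}"
    and H0T: "\<And>l. l \<ge> 1 \<Longrightarrow> H0_vanishes (mtop C) (sym_sections C (tangent_bundle C) N l)"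
    and H0N: "\<And>l. l \<ge> 2 \<Longrightarrow> H0_vanishes (mtop C) (sym_sections C N N l)"
    and y: "y \<in> topspace (mtop C)"
  shows "\<exists>V. openin (mtop M) V \<and> \<iota> y \<in> V \<and> V \<subseteq> U \<inter> U' \<and> (\<forall>m\<in>V. \<rho> m = \<rho>' m \<and> w m = w' m)"
proof -
  \<comment> \<open>On this set \<open>w m\<close> and \<open>w' m\<close> lie in the same fibre and
    can be subtracted. It contains the image of \<open>C\<close> by
    \<open>retraction_unique\<close>.\<close>
  define W where "W = \<Union>{V. openin (mtop M) V \<and> V \<subseteq> U \<inter> U' \<and> (\<forall>m\<in>V. \<rho> m = \<rho>' m)}"
  have oW: "openin (mtop M) W" unfolding W_def by (rule openin_Union) blast
  have WU: "W \<subseteq> U \<inter> U'" "\<And>m. m \<in> W \<Longrightarrow> \<rho> m = \<rho>' m" unfolding W_def by blast+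
  have yW: "\<iota> y \<in> W" if "y \<in> topspace (mtop C)" for y
    using retraction_unique[OF l ne H0T that] unfolding W_def by blast
  define D where "D i = {m \<in> W. \<rho> m \<in> bdom N i}" for i
  define u where "u i m = w m i - w' m i" for i m
  have D_open: "openin (mtop M) (D i)" if i: "i \<in> adapted_charts C M \<iota>" for i
    unfolding D_def
    by (rule hol_near_preimage_open[OF M C oW _ bdom_N_open[OF i]]) (use linearizationD(3)[OF l(1)] WU in blast)
  have D_bat: "m \<in> U" "m \<in> U'" "\<rho> m = \<rho>' m" "i \<in> bat N (\<rho> m)" if "i \<in> adapted_charts C M \<iota>" "m \<in> D i" for i m
    using that WU by (auto simp: D_def bat_N)
  interpret dev: deviation C M \<iota> N D u
  proof unfold_locales
    fix i assume "i \<in> bindex N"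
    then have i: "i \<in> adapted_charts C M \<iota>" by simp
    show "openin (mtop C) (bdom N i)" by (rule bdom_N_open[OF i])
    show "openin (mtop M) (D i)" by (rule D_open[OF i])
    show "\<iota> y \<in> D i \<longleftrightarrow> y \<in> bdom N i" if "y \<in> topspace (mtop C)" for y
      using linearizationD(4)[OF l(1) that] yW[OF that] by (simp add: D_def)
    show "hol_near M euc (u i) m" if m: "m \<in> D i" for m
      unfolding u_def using D_bat[OF i m] linearizationD(6)[OF l(1)] linearizationD(6)[OF l(2)] by (intro hol_near_diff[OF M]) auto
  qed
  have u0: "u i (\<iota> y) = 0" if "y \<in> topspace (mtop C)" "i \<in> bat N y" for i y
    using linearizationD(7)[OF l(1) that] linearizationD(7)[OF l(2) that] by (simp add: u_def)
  have 1: "vanishing N u 1"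
    unfolding vanishing_def
  proof (intro ballI allI impI)
    fix y i j v a and k :: nat assume y: "y \<in> topspace (mtop C)" "i \<in> bat N y" "j \<in> bat N y" and "k < 1"
    have "chart_inv j (snd j (\<iota> y)) = \<iota> y"
      using y(3) chart_inv_left[OF adapted_is_chart] by (simp add: bat_N)
    then show "iter_ddir k (inr v) (\<lambda>z. u i (chart_inv j z) $ a) (snd j (\<iota> y)) = 0"
      using \<open>k < 1\<close> u0[OF y(1,2)] by simp
  qed
  have trans: "((\<lambda>t. inverse (t ^ l) *s u i' (m t)) \<longlongrightarrow> btrans N i' i y *v L) (at 0)"
    if y: "y \<in> topspace (mtop C)" and i: "i \<in> bat N y" "i' \<in> bat N y" and m: "approaches m y"
      and L: "((\<lambda>t. inverse (t ^ l) *s u i (m t)) \<longlongrightarrow> L) (at 0)" for y i i' m L l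
  proof -
    have ia: "i \<in> adapted_charts C M \<iota>" "i' \<in> adapted_charts C M \<iota>" using i by (simp_all add: bat_N)
    have \<rho>y: "hol_near M C \<rho> (\<iota> y)" "\<rho> (\<iota> y) = y" using linearizationD(2,3,4)[OF l(1)] y by blast+
    have lim: "((\<lambda>t. btrans N i' i (\<rho> (m t)) *v (inverse (t ^ l) *s u i (m t))) \<longlongrightarrow> btrans N i' i y *v L) (at 0)"
      by (rule btrans_tendsto[OF m \<rho>y i(2,1) L])
    have yD: "\<iota> y \<in> D i" "\<iota> y \<in> D i'" using i yW[OF y] \<rho>y(2) by (simp_all add: D_def bat_N)
    have "\<forall>\<^sub>F t in at 0. m t \<in> D i" "\<forall>\<^sub>F t in at 0. m t \<in> D i'"
      by (rule approachesD[OF m D_open[OF ia(1)] yD(1)], rule approachesD[OF m D_open[OF ia(2)] yD(2)])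
    then have "\<forall>\<^sub>F t in at 0. btrans N i' i (\<rho> (m t)) *v (inverse (t ^ l) *s u i (m t)) = inverse (t ^ l) *s u i' (m t)"
    proof eventually_elim
      fix t assume t: "m t \<in> D i" "m t \<in> D i'"
      note b = D_bat[OF ia(1) t(1)] D_bat[OF ia(2) t(2)]
      have "w (m t) i' = btrans N i' i (\<rho> (m t)) *v w (m t) i" "w' (m t) i' = btrans N i' i (\<rho> (m t)) *v w' (m t) i"
        using fibre_trans[OF linearizationD(5)[OF l(1) b(1)] b(8,4)]
          fibre_trans[OF linearizationD(5)[OF l(2) b(2), folded b(3)] b(8,4)] by blast+
      then have "u i' (m t) = btrans N i' i (\<rho> (m t)) *v u i (m t)"
        by (simp only: u_def matrix_vector_mult_diff_distrib)
      then show "btrans N i' i (\<rho> (m t)) *v (inverse (t ^ l) *s u i (m t)) = inverse (t ^ l) *s u i' (m t)"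
        by (simp add: vector_scalar_commute)
    qed
    then show ?thesis by (rule Lim_transform_eventually[OF lim])
  qed
  \<comment> \<open>The linear term vanishes by the normalization, which is stated for a ray and its
    own chart \<open>j\<close>; \<open>trans\<close> carries this to the other trivializations
    \<open>i\<close>.\<close>
  have 2: "vanishing N u 2"
    unfolding vanishing_def
  proof (intro ballI allI impI)
    fix y i j v a and k :: nat assume y: "y \<in> topspace (mtop C)" "i \<in> bat N y" "j \<in> bat N y" and k: "k < 2"
    let ?m = "\<lambda>t. chart_inv j (snd j (\<iota> y) + t *s inr v)"
    have "((\<lambda>t. inverse t *s w (?m t) j - inverse t *s w' (?m t) j) \<longlongrightarrow> v - v) (at 0)"
      by (intro tendsto_diff linearizationD(8)[OF l(1) y(1,3)] linearizationD(8)[OF l(2) y(1,3)])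
    moreover have "inverse t *s w (?m t) j - inverse t *s w' (?m t) j = inverse (t ^ 1) *s u j (?m t)" for t
      by (simp add: u_def vec_eq_iff algebra_simps)
    ultimately have "((\<lambda>t. inverse (t ^ 1) *s u j (?m t)) \<longlongrightarrow> 0) (at 0)" by simp
    from trans[OF y(1,3,2) approaches_ray[OF y(3)] this]
    have z: "((\<lambda>t. inverse (t ^ 1) *s u i (?m t)) \<longlongrightarrow> btrans N i j y *v 0) (at 0)" .
    have "leading u 1 y i j v = btrans N i j y *v 0"
      by (rule tendsto_unique[OF trivial_limit_at dev.leading_ray[OF 1 y] z])
    then have "leading u 1 y i j v = 0" by simp
    then have "iter_ddir 1 (inr v) (\<lambda>z. u i (chart_inv j z) $ a) (snd j (\<iota> y)) = 0"
      by (simp add: leading_def vec_eq_iff)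
    moreover have "iter_ddir 0 (inr v) (\<lambda>z. u i (chart_inv j z) $ a) (snd j (\<iota> y)) = 0"
      using 1 y unfolding vanishing_def by blast
    moreover have "k = 0 \<or> k = 1" using k by auto
    ultimately show "iter_ddir k (inr v) (\<lambda>z. u i (chart_inv j z) $ a) (snd j (\<iota> y)) = 0" by metis
  qed
  have step: "vanishing N u (Suc l)" if l2: "l \<ge> 2" and van: "vanishing N u l" for l
    by (rule dev.order_step[OF van trans H0N[OF l2]])
  have all: "vanishing N u l" for l
    by (rule vanishing_induct[OF 2 step])
  obtain j where j: "j \<in> bat N y" using ne[OF y] by blast
  then have ja: "j \<in> adapted_charts C M \<iota>" by (simp add: bat_N)
  obtain V where V: "openin (mtop M) V" "\<iota> y \<in> V" "V \<subseteq> D j" "\<forall>m\<in>V. u j m = 0"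
    using dev.vanishing_all[OF all y j j] by blast
  have "\<rho> m = \<rho>' m \<and> w m = w' m" if m: "m \<in> V" for m
  proof -
    have mD: "m \<in> D j" using V(3) m by blast
    note b = D_bat[OF ja mD]
    have "w m j = w' m j" using V(4) m by (simp add: u_def)
    moreover have "w' m \<in> fibre N (\<rho> m)" using linearizationD(5)[OF l(2) b(2)] b(3) by simp
    ultimately show ?thesis using fibre_eqI[OF linearizationD(5)[OF l(1) b(1)] _ b(4)] b(3) by simp
  qed
  moreover have "V \<subseteq> U \<inter> U'" using V(3) WU(1) unfolding D_def by blast
  ultimately show ?thesis using V by blast
qed

end

section \<open>Normalizing a linearization\<close>

locale linearized = embedded C M \<iota>
  for C :: "('c, 'n::finite) cmfd" and M :: "('m, 'n + 'd::finite) cmfd" and \<iota> :: "'c \<Rightarrow> 'm" +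
  fixes U :: "'m set" and U' :: "('c \<times> (('m, 'n + 'd) chart \<Rightarrow> complex^'d)) set"
    and \<Phi> :: "'m \<Rightarrow> 'c \<times> (('m, 'n + 'd) chart \<Rightarrow> complex^'d)" and g
  assumes U: "openin (mtop M) U" "\<And>y. y \<in> topspace (mtop C) \<Longrightarrow> \<iota> y \<in> U"
    and U': "openin (mtop (total_space C N)) U'"
    and \<Phi>: "\<And>m. m \<in> U \<Longrightarrow> hol_near M (total_space C N) \<Phi> m" "\<And>m. m \<in> U \<Longrightarrow> \<Phi> m \<in> U'"
    and g: "\<And>e. e \<in> U' \<Longrightarrow> hol_near (total_space C N) M g e"
    and inv: "\<And>m. m \<in> U \<Longrightarrow> g (\<Phi> m) = m"
    and zero: "\<And>y. y \<in> topspace (mtop C) \<Longrightarrow> \<Phi> (\<iota> y) = zero_section y"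
begin

abbreviation T where "T \<equiv> total_space C N"

lemmas T_charted = total_space_charted(1)[OF C N_holo_bundle]
lemmas T_topspace = total_space_charted(2)[OF C N_holo_bundle]

abbreviation \<rho> where "\<rho> m \<equiv> fst (\<Phi> m)"

lemma g_zero: "y \<in> topspace (mtop C) \<Longrightarrow> zero_section y \<in> U' \<and> g (zero_section y) = \<iota> y"
  using inv[OF U(2)] \<Phi>(2)[OF U(2)] zero by metis

lemma \<Phi>_top: "m \<in> U \<Longrightarrow> \<rho> m \<in> topspace (mtop C)" "m \<in> U \<Longrightarrow> snd (\<Phi> m) \<in> fibre N (\<rho> m)"
  "m \<in> U \<Longrightarrow> bat N (\<rho> m) \<noteq> {}"
  using hol_near_topspace(2)[OF \<Phi>(1), of m] unfolding T_topspace by auto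

text \<open>A point of the total space must lie in a chart, so the zero vector over \<open>y\<close>
  being a value of \<open>\<Phi>\<close> already provides an adapted chart at
  \<open>\<iota> y\<close>.\<close>

lemma bat_nonempty: "y \<in> topspace (mtop C) \<Longrightarrow> bat N y \<noteq> {}"
  using \<Phi>_top(3)[OF U(2)] zero by (simp add: zero_section_def)

lemma \<rho>_hol: "m \<in> U \<Longrightarrow> hol_near M C \<rho> m"
  by (rule hol_near_comp[OF M T_charted C \<Phi>(1) hol_near_total_fst(1)[OF C N_holo_bundle]])
     (use hol_near_topspace(2)[OF \<Phi>(1)] in auto)

lemma w0_hol: "m \<in> U \<Longrightarrow> i \<in> bat N (\<rho> m) \<Longrightarrow> hol_near M euc (\<lambda>m. snd (\<Phi> m) i) m"
  by (rule hol_near_comp[OF M T_charted charted_euc \<Phi>(1) hol_near_total_fst(2)[OF C N_holo_bundle]])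
     (use hol_near_topspace(2)[OF \<Phi>(1)] in auto)

definition rep where "rep c i z = snd i (g (chart_inv (total_chart N c i) z))"

definition repdom where "repdom c i = snd (total_chart N c i) ` {e \<in> fst (total_chart N c i) \<inter> U'. g e \<in> fst i}"

lemma total_chart_max: "c \<in> atlas C \<Longrightarrow> i \<in> adapted_charts C M \<iota> \<Longrightarrow> total_chart N c i \<in> max_atlas T"
  by (rule total_chart_in_atlas[OF C N_holo_bundle]) simp_all

lemma repdom_open:
  assumes "c \<in> atlas C" "i \<in> adapted_charts C M \<iota>"
  shows "open (repdom c i)"
proof -
  have t: "total_chart N c i \<in> max_atlas T" by (rule total_chart_max[OF assms])
  have "openin (mtop T) (fst (total_chart N c i) \<inter> U')" using max_atlas_open[OF t] U' by (rule openin_Int)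
  then have "openin (mtop T) {e \<in> fst (total_chart N c i) \<inter> U'. g e \<in> fst i}"
    by (rule hol_near_preimage_open[OF T_charted M _ _ max_atlas_open[OF adapted_max[OF assms(2)]]]) (use g in blast)
  then show ?thesis unfolding repdom_def by (rule chart_open_map[OF max_atlas_is_chart[OF t]]) blast
qed

lemma rep_holo:
  assumes "c \<in> atlas C" "i \<in> adapted_charts C M \<iota>"
  shows "holo_vec_on (repdom c i) (rep c i)"
proof (rule holo_vec_on_local)
  fix z assume "z \<in> repdom c i"
  then obtain e where e: "z = snd (total_chart N c i) e" "e \<in> fst (total_chart N c i)" "e \<in> U'" "g e \<in> fst i"
    unfolding repdom_def by blast
  have "hol_near euc euc (\<lambda>z. snd i (g (chart_inv (total_chart N c i) z))) (snd (total_chart N c i) e)"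
    by (rule hol_near_euc_rep[OF T_charted M g[OF e(3)] total_chart_max[OF assms] e(2) adapted_max[OF assms(2)] e(4)])
  then show "\<exists>S. z \<in> S \<and> holo_vec_on S (rep c i)"
    unfolding hol_near_euc rep_def[abs_def] e(1) by blast
qed

lemma chart_inv_total:
  assumes "c \<in> atlas C" "i \<in> adapted_charts C M \<iota>" "y \<in> fst c" "v \<in> fibre N y" "i \<in> bat N y"
  shows "chart_inv (total_chart N c i) (inl (snd c y) + inr (v i)) = (y, v)"
    "(y, v) \<in> fst (total_chart N c i)"
proof -
  show m: "(y, v) \<in> fst (total_chart N c i)" unfolding total_chart_simps using assms by (simp add: bat_N)
  show "chart_inv (total_chart N c i) (inl (snd c y) + inr (v i)) = (y, v)"
    using chart_inv_left[OF max_atlas_is_chart[OF total_chart_max[OF assms(1,2)]] m]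
    by (simp only: total_chart_simps)
qed

lemma zero_fibre: "(\<lambda>i. 0) \<in> fibre N y"
  by (simp add: fibre_def)

lemma smult_fibre:
  assumes v: "v \<in> fibre N y"
  shows "(\<lambda>k. s *s v k) \<in> fibre N y"
  unfolding fibre_def
proof (intro CollectI conjI allI ballI impI)
  fix i j assume "i \<in> bat N y" "j \<in> bat N y"
  then show "s *s v i = btrans N i j y *v (s *s v j)"
    using fibre_trans[OF v, of i j] by (metis vector_scalar_commute)
next
  fix i assume "i \<notin> bat N y"
  then show "s *s v i = 0" using fibre_outside[OF v] by simp
qed

lemma rep_zero:
  assumes "c \<in> atlas C" "y \<in> fst c" "i \<in> bat N y"
  shows "inl (snd c y) \<in> repdom c i" "rep c i (inl (snd c y)) = snd i (\<iota> y)"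
proof -
  have i: "i \<in> adapted_charts C M \<iota>" "y \<in> topspace (mtop C)" "\<iota> y \<in> fst i" using assms(3) by (simp_all add: bat_N)
  note ci = chart_inv_total[OF assms(1) i(1) assms(2) zero_fibre assms(3)]
  have gz: "(y, \<lambda>i. 0) \<in> U'" "g (y, \<lambda>i. 0) = \<iota> y" using g_zero[OF i(2)] by (simp_all add: zero_section_def)
  have "(y, \<lambda>i. 0) \<in> {e \<in> fst (total_chart N c i) \<inter> U'. g e \<in> fst i}" using ci(2) gz i by simp
  moreover have "snd (total_chart N c i) (y, \<lambda>i. 0) = inl (snd c y)" by (simp add: total_chart_simps)
  ultimately show "inl (snd c y) \<in> repdom c i" unfolding repdom_def by (intro image_eqI) simp_all
  have "inl (snd c y) + inr 0 = (inl (snd c y) :: complex^('n + 'd))" by simp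
  then show "rep c i (inl (snd c y)) = snd i (\<iota> y)" unfolding rep_def using ci(1) gz(2) by metis
qed

text \<open>The velocity at \<open>0\<close> of the image in \<open>M\<close> of the ray \<open>s v\<close>; modulo \<open>TC\<close> it is a vector of the normal
  bundle, and replacing \<open>v\<close> by it normalizes the linearization \<open>\<Phi>\<close>.\<close>

definition velocity where
  "velocity i y v = Lim (at 0) (\<lambda>s. inverse s *s (snd i (g (y, \<lambda>k. s *s v k)) - snd i (\<iota> y)))"

text \<open>The limit defining \<open>velocity\<close> does not mention a chart of \<open>C\<close>.
  The second equation computes it in any such chart and exhibits it as linear in the coordinate of
  \<open>v\<close>.\<close>

lemma velocity:
  assumes "c \<in> atlas C" "y \<in> fst c" "i \<in> bat N y" "v \<in> fibre N y"
  shows "((\<lambda>s. inverse s *s (snd i (g (y, \<lambda>k. s *s v k)) - snd i (\<iota> y))) \<longlongrightarrow> velocity i y v) (at 0)"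
    "velocity i y v = vder (rep c i) (inl (snd c y)) (inr (v i))"
proof -
  have i: "i \<in> adapted_charts C M \<iota>" using assms(3) by (simp add: bat_N)
  have "rep c i (inl (snd c y) + s *s inr (v i)) = snd i (g (y, \<lambda>k. s *s v k))" for s
    using chart_inv_total(1)[OF assms(1) i assms(2) smult_fibre[OF assms(4)] assms(3), of s]
    by (simp add: rep_def)
  then have *: "((\<lambda>s. inverse s *s (snd i (g (y, \<lambda>k. s *s v k)) - snd i (\<iota> y))) \<longlongrightarrow> vder (rep c i) (inl (snd c y)) (inr (v i))) (at 0)"
    using vder_slice_tendsto[OF rep_holo[OF assms(1) i] rep_zero(1)[OF assms(1-3)], of "inr (v i)"] rep_zero(2)[OF assms(1-3)]
    by simp
  then show eq: "velocity i y v = vder (rep c i) (inl (snd c y)) (inr (v i))"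
    unfolding velocity_def by (intro tendsto_Lim) simp_all
  show "((\<lambda>s. inverse s *s (snd i (g (y, \<lambda>k. s *s v k)) - snd i (\<iota> y))) \<longlongrightarrow> velocity i y v) (at 0)"
    using * unfolding eq .
qed

definition w where "w m i = (if i \<in> bat N (\<rho> m) then prr (velocity i (\<rho> m) (snd (\<Phi> m))) else 0)"

lemma C_cover: "y \<in> topspace (mtop C) \<Longrightarrow> \<exists>c\<in>atlas C. y \<in> fst c"
  by (rule charted_cover[OF C])

text \<open>One curve seen in two adapted charts has velocities related by the full derivative of
  the transition map; modulo \<open>TC\<close> only the transition matrix of \<open>N\<close>
  remains.\<close>

lemma velocity_trans:
  assumes y: "y \<in> topspace (mtop C)" and i: "i \<in> bat N y" "j \<in> bat N y" and v: "v \<in> fibre N y"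
  shows "prr (velocity i y v) = btrans N i j y *v prr (velocity j y v)"
proof -
  obtain c where c: "c \<in> atlas C" "y \<in> fst c" using C_cover[OF y] by blast
  have ia: "i \<in> adapted_charts C M \<iota>" "\<iota> y \<in> fst i" "j \<in> adapted_charts C M \<iota>" "\<iota> y \<in> fst j"
    using i by (simp_all add: bat_N)
  let ?z = "snd j (\<iota> y)" and ?S = "snd j ` (fst j \<inter> fst i)"
  let ?\<gamma> = "\<lambda>s. g (y, \<lambda>k. s *s v k)"
  let ?V = "velocity j y v"
  have zS: "?z \<in> ?S" using ia by blast
  have lj: "((\<lambda>s. inverse s *s (snd j (?\<gamma> s) - ?z)) \<longlongrightarrow> ?V) (at 0)" by (rule velocity(1)[OF c i(2) v])
  have \<gamma>0: "g (y, \<lambda>k. 0 *s v k) = \<iota> y" using g_zero[OF y] by (simp add: zero_section_def)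
  \<comment> \<open>The scaled vectors form a straight line in a chart of the total space, and
    \<open>g\<close> carries it to a curve ending at \<open>\<iota> y\<close>.\<close>
  have app: "approaches ?\<gamma> y"
    unfolding approaches_def
  proof (intro allI impI)
    fix W assume W: "openin (mtop M) W \<and> \<iota> y \<in> W"
    have t: "total_chart N c j \<in> max_atlas T" by (rule total_chart_max[OF c(1) ia(3)])
    note ct = chart_inv_total[OF c(1) ia(3) c(2) smult_fibre[OF v] i(2)]
    let ?W = "{e \<in> fst (total_chart N c j) \<inter> U'. g e \<in> W}"
    have "openin (mtop T) ?W"
      by (rule hol_near_preimage_open[OF T_charted M openin_Int[OF max_atlas_open[OF t] U']]) (use g W in blast)+
    then have o: "open (snd (total_chart N c j) ` ?W)" by (rule chart_open_map[OF max_atlas_is_chart[OF t]]) blast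
    have "(y, \<lambda>k. 0 *s v k) \<in> ?W" using ct(2)[of 0] g_zero[OF y] W \<gamma>0 by (simp add: zero_section_def)
    then have "snd (total_chart N c j) (y, \<lambda>k. 0 *s v k) \<in> snd (total_chart N c j) ` ?W" by (rule imageI)
    then have m0: "inl (snd c y) \<in> snd (total_chart N c j) ` ?W" by (simp add: total_chart_simps)
    have "\<forall>\<^sub>F s in at 0. inl (snd c y) + s *s inr (v j) \<in> snd (total_chart N c j) ` ?W"
      by (rule eventually_slice[OF o m0])
    then show "\<forall>\<^sub>F s in at 0. ?\<gamma> s \<in> W"
    proof eventually_elim
      fix s assume "inl (snd c y) + s *s inr (v j) \<in> snd (total_chart N c j) ` ?W"
      then obtain e where e: "e \<in> ?W" "inl (snd c y) + s *s inr (v j) = snd (total_chart N c j) e" by blast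
      have "e = chart_inv (total_chart N c j) (snd (total_chart N c j) e)"
        using chart_inv_left[OF max_atlas_is_chart[OF t], of e] e(1) by simp
      also have "\<dots> = (y, \<lambda>k. s *s v k)" unfolding e(2)[symmetric] using ct(1)[of s] by simp
      finally show "?\<gamma> s \<in> W" using e(1) by simp
    qed
  qed
  have lim: "((\<lambda>s. snd j (?\<gamma> s)) \<longlongrightarrow> ?z) (at 0)"
    by (rule approaches_tendsto[OF app hol_near_chart[OF M adapted_max[OF ia(3)] ia(4)]])
  have "((\<lambda>s. inverse s *s (trans_map i j (snd j (?\<gamma> s)) - trans_map i j ?z)) \<longlongrightarrow> vder (trans_map i j) ?z ?V) (at 0)"
    by (rule strict_limit[OF N_trans_open[OF i] N_trans_holo[OF i] zS lim tendsto_const lj])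
  moreover have "\<forall>\<^sub>F s in at 0. ?\<gamma> s \<in> fst j"
    by (rule approachesD[OF app max_atlas_open[OF adapted_max[OF ia(3)]] ia(4)])
  then have "\<forall>\<^sub>F s in at 0. inverse s *s (trans_map i j (snd j (?\<gamma> s)) - trans_map i j ?z) = inverse s *s (snd i (?\<gamma> s) - snd i (\<iota> y))"
  proof eventually_elim
    fix s assume "?\<gamma> s \<in> fst j"
    then show "inverse s *s (trans_map i j (snd j (?\<gamma> s)) - trans_map i j ?z) = inverse s *s (snd i (?\<gamma> s) - snd i (\<iota> y))"
      using chart_inv_left[OF adapted_is_chart[OF ia(3)]] ia(4) by simp
  qed
  ultimately have "((\<lambda>s. inverse s *s (snd i (?\<gamma> s) - snd i (\<iota> y))) \<longlongrightarrow> vder (trans_map i j) ?z ?V) (at 0)"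
    by (rule Lim_transform_eventually)
  from tendsto_unique[OF trivial_limit_at velocity(1)[OF c i(1) v] this]
  have "velocity i y v = vder (trans_map i j) ?z ?V" .
  also have "\<dots> = vder (trans_map i j) ?z (inl (prl ?V)) + vder (trans_map i j) ?z (inr (prr ?V))"
    using linear_add[OF bounded_linear.linear[OF vder_linear[OF N_trans_holo[OF i] zS]], of "inl (prl ?V)" "inr (prr ?V)"]
    by (simp only: block_simps2(5))
  finally show ?thesis by (simp add: N_slice_tangent[OF i] N_btrans[OF i])
qed

lemma w_fibre:
  assumes m: "m \<in> U"
  shows "w m \<in> fibre N (\<rho> m)"
  unfolding fibre_def
proof (intro CollectI conjI allI ballI impI)
  fix i j assume ij: "i \<in> bat N (\<rho> m)" "j \<in> bat N (\<rho> m)"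
  show "w m i = btrans N i j (\<rho> m) *v w m j"
    unfolding w_def if_P[OF ij(1)] if_P[OF ij(2)] by (rule velocity_trans[OF \<Phi>_top(1)[OF m] ij \<Phi>_top(2)[OF m]])
qed (simp add: w_def)

lemma vder_expand:
  assumes "holo_vec_on S F" "z \<in> S"
  shows "vder F z (inr v) = (\<Sum>k\<in>UNIV. (v $ k) *s vder F z (inr (axis k 1)))"
proof -
  have "vder F z (inr v) = vder F z (\<Sum>k\<in>UNIV. (v $ k) *s inr (axis k 1))" by (subst inr_expand) simp
  also have "\<dots> = (\<Sum>k\<in>UNIV. vder F z ((v $ k) *s inr (axis k 1)))"
    by (rule linear_sum[OF bounded_linear.linear[OF vder_linear[OF assms]]])
  finally show ?thesis by (simp add: vder_smult[OF assms])
qed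

lemma w_local:
  assumes m: "m \<in> U" and i: "i \<in> bat N (\<rho> m)" and c: "c \<in> atlas C" "\<rho> m \<in> fst c"
  shows "w m i = prr (vder (rep c i) (inl (snd c (\<rho> m))) (inr (snd (\<Phi> m) i)))"
  using velocity(2)[OF c i \<Phi>_top(2)[OF m]] i by (simp add: w_def)

lemma w_dom_open:
  assumes "i \<in> adapted_charts C M \<iota>" "c \<in> atlas C"
  shows "openin (mtop M) {m \<in> {m \<in> U. \<rho> m \<in> bdom N i}. \<rho> m \<in> fst c}"
proof (rule hol_near_preimage_open[OF M C])
  show "openin (mtop M) {m \<in> U. \<rho> m \<in> bdom N i}"
    by (rule hol_near_preimage_open[OF M C U(1) \<rho>_hol bdom_N_open[OF assms(1)]])
  show "openin (mtop C) (fst c)" using max_atlas_open[OF atlas_subset_max_atlas[OF C assms(2)]] .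
qed (use \<rho>_hol in blast)

text \<open>Base point and vector both vary in the velocity; expanding the vector in a basis leaves
  holomorphic coefficients times derivatives in fixed directions.\<close>

lemma w_hol:
  assumes m: "m \<in> U" and i: "i \<in> bat N (\<rho> m)"
  shows "hol_near M euc (\<lambda>m. w m i) m"
proof -
  obtain c where c: "c \<in> atlas C" "\<rho> m \<in> fst c" using C_cover[OF \<Phi>_top(1)[OF m]] by blast
  have ia: "i \<in> adapted_charts C M \<iota>" using i by (simp add: bat_N)
  let ?z = "\<lambda>m. inl (snd c (\<rho> m)) :: complex^('n + 'd)"
  have "hol_near M euc (\<lambda>m. snd c (\<rho> m)) m"
    by (rule hol_near_comp[OF M C charted_euc \<rho>_hol[OF m] hol_near_chart[OF C atlas_subset_max_atlas[OF C c(1)] c(2)]])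
  from hol_near_holo[OF M this block_holo(1) open_UNIV UNIV_I]
  have z: "hol_near M euc ?z m" .
  have zm: "?z m \<in> repdom c i" by (rule rep_zero(1)[OF c i])
  have "hol_near M euc (\<lambda>m. vder (rep c i) (?z m) (inr (axis k 1))) m" for k
    by (rule hol_near_holo[OF M z holo_vec_on_vder[OF repdom_open[OF c(1) ia] rep_holo[OF c(1) ia]] repdom_open[OF c(1) ia] zm])
  then have "hol_near M euc (\<lambda>m. \<Sum>k\<in>UNIV. (snd (\<Phi> m) i $ k) *s vder (rep c i) (?z m) (inr (axis k 1))) m"
    by (intro hol_near_sum[OF M hol_near_topspace(1)[OF z]] hol_near_smult[OF M w0_hol[OF m i]])
  from hol_near_holo[OF M this block_holo(4) open_UNIV UNIV_I]
  have "hol_near M euc (\<lambda>m. prr (\<Sum>k\<in>UNIV. (snd (\<Phi> m) i $ k) *s vder (rep c i) (?z m) (inr (axis k 1)))) m" .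
  then show ?thesis
  proof (rule hol_near_cong[OF M _ w_dom_open[OF ia c(1)]])
    show "m \<in> {m \<in> {m \<in> U. \<rho> m \<in> bdom N i}. \<rho> m \<in> fst c}" using m c i by (simp add: bat_N)
    fix m' assume "m' \<in> {m \<in> {m \<in> U. \<rho> m \<in> bdom N i}. \<rho> m \<in> fst c}"
    then have m': "m' \<in> U" "i \<in> bat N (\<rho> m')" "\<rho> m' \<in> fst c" using ia by (simp_all add: bat_N)
    show "prr (\<Sum>k\<in>UNIV. (snd (\<Phi> m') i $ k) *s vder (rep c i) (?z m') (inr (axis k 1))) = w m' i"
      by (subst w_local[OF m'(1,2) c(1) m'(3)], subst vder_expand[OF rep_holo[OF c(1) ia] rep_zero(1)[OF c(1) m'(3,2)]]) simp
  qed
qed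

text \<open>\<open>g\<close> takes the zero section to the image of \<open>C\<close>, so its
  derivative along the base has no normal component.\<close>

lemma rep_slice_tangent:
  assumes c: "c \<in> atlas C" "y \<in> fst c" and i: "i \<in> bat N y"
  shows "prr (vder (rep c i) (inl (snd c y)) (inl b)) = 0"
proof -
  have ia: "i \<in> adapted_charts C M \<iota>" using i by (simp add: bat_N)
  let ?z = "inl (snd c y)"
  have lim: "((\<lambda>t. prr (inverse t *s (rep c i (?z + t *s inl b) - rep c i ?z))) \<longlongrightarrow> prr (vder (rep c i) ?z (inl b))) (at 0)"
    by (intro bounded_linear.tendsto[OF block_bounded_linear(4)] vder_slice_tendsto[OF rep_holo[OF c(1) ia] rep_zero(1)[OF c i]])
  have zero: "prr (rep c i z') = 0" if z': "z' \<in> repdom c i" "prr z' = 0" for z'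
  proof -
    obtain e where e: "z' = snd (total_chart N c i) e" "e \<in> fst (total_chart N c i)" using z' unfolding repdom_def by blast
    obtain y' v where yv: "e = (y', v)" by (cases e)
    have y': "y' \<in> fst c" "y' \<in> bdom N i" "v \<in> fibre N y'" using e(2) unfolding yv total_chart_simps by auto
    have "prr z' = v i" unfolding e(1) yv total_chart_simps by simp
    then have "z' = inl (snd c y')" using z'(2) unfolding e(1) yv total_chart_simps by simp
    moreover have iy': "i \<in> bat N y'" using y' ia by (simp add: bat_N)
    ultimately have "rep c i z' = snd i (\<iota> y')" using rep_zero(2)[OF c(1) y'(1) iy'] by simp
    then show ?thesis using adapted_slice[OF ia, of "\<iota> y'"] iy' by (simp add: bat_N)
  qed
  have "\<forall>\<^sub>F t in at 0. prr (inverse t *s (rep c i (?z + t *s inl b) - rep c i ?z)) = 0"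
    using eventually_slice[OF repdom_open[OF c(1) ia] rep_zero(1)[OF c i], of "inl b"]
    by eventually_elim (use zero[of ?z] zero rep_zero(1)[OF c i] in simp)
  then have "((\<lambda>t :: complex. 0) \<longlongrightarrow> prr (vder (rep c i) ?z (inl b))) (at 0)"
    by (rule Lim_transform_eventually[OF lim])
  from tendsto_unique[OF trivial_limit_at this tendsto_const] show ?thesis .
qed

lemma ray_derivative:
  assumes y: "y \<in> topspace (mtop C)" and i: "i \<in> bat N y" and f: "hol_near M euc f (\<iota> y)"
  shows "\<exists>A. ((\<lambda>t. inverse t *s (f (chart_inv i (snd i (\<iota> y) + t *s e)) - f (\<iota> y))) \<longlongrightarrow> A) (at 0)"
proof -
  have ia: "i \<in> adapted_charts C M \<iota>" "\<iota> y \<in> fst i" using i by (simp_all add: bat_N)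
  have "hol_near euc euc (\<lambda>z. f (chart_inv i z)) (snd i (\<iota> y))"
    using hol_near_euc_rep[OF M charted_euc f adapted_max[OF ia(1)] ia(2) euc_chart] by simp
  then obtain S where S: "snd i (\<iota> y) \<in> S" "holo_vec_on S (\<lambda>z. f (chart_inv i z))"
    unfolding hol_near_euc by (elim exE conjE) (rule that)
  from vder_slice_tendsto[OF S(2,1)] show ?thesis
    using chart_inv_left[OF adapted_is_chart[OF ia(1)] ia(2)] by auto
qed

text \<open>The identity \<open>g (\<Phi> m) = m\<close> is differentiated along the normal ray: if
  \<open>b\<close> and \<open>A\<close> are the base and fibre velocities of \<open>\<Phi>\<close>,
  the derivative of \<open>rep\<close> sends them to \<open>inr v\<close>, and modulo
  \<open>TC\<close> the part \<open>b\<close> drops out. So \<open>A\<close> is a preimage of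
  \<open>v\<close> under the linear map that defines \<open>w\<close>. The first conclusion is kept
  for the surjectivity behind \<open>w_inj\<close>.\<close>

lemma w_ray:
  assumes y: "y \<in> topspace (mtop C)" and i: "i \<in> bat N y" and c: "c \<in> atlas C" "y \<in> fst c"
  obtains A where "prr (vder (rep c i) (inl (snd c y)) (inr A)) = v"
    "((\<lambda>t. inverse t *s w (chart_inv i (snd i (\<iota> y) + t *s inr v)) i) \<longlongrightarrow> v) (at 0)"
proof -
  have ia: "i \<in> adapted_charts C M \<iota>" "\<iota> y \<in> fst i" using i by (simp_all add: bat_N)
  have cm: "c \<in> max_atlas C" by (rule atlas_subset_max_atlas[OF C c(1)])
  have ch: "is_chart (mtop M) i" by (rule adapted_is_chart[OF ia(1)])
  let ?m = "\<lambda>t. chart_inv i (snd i (\<iota> y) + t *s inr v)"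
  let ?w0 = "\<lambda>m. snd (\<Phi> m) i"
  let ?S = "repdom c i" and ?z = "inl (snd c y) :: complex^('n + 'd)"
  have yU: "\<iota> y \<in> U" "\<rho> (\<iota> y) = y" "?w0 (\<iota> y) = 0" using U(2)[OF y] zero[OF y] by (simp_all add: zero_section_def)
  have app: "approaches ?m y" by (rule approaches_ray[OF i])
  have bhol: "hol_near M euc (\<lambda>m. snd c (\<rho> m)) (\<iota> y)"
    by (rule hol_near_comp[OF M C charted_euc \<rho>_hol[OF yU(1)]]) (use hol_near_chart[OF C cm] yU c in simp)
  have whol: "hol_near M euc ?w0 (\<iota> y)" by (rule w0_hol[OF yU(1)]) (use yU i in simp)
  obtain A where A: "((\<lambda>t. inverse t *s ?w0 (?m t)) \<longlongrightarrow> A) (at 0)"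
    using ray_derivative[OF y i whol, of "inr v"] yU(3) by auto
  obtain b where b: "((\<lambda>t. inverse t *s (snd c (\<rho> (?m t)) - snd c y)) \<longlongrightarrow> b) (at 0)"
    using ray_derivative[OF y i bhol, of "inr v"] yU(2) by auto
  have blim: "((\<lambda>t. snd c (\<rho> (?m t))) \<longlongrightarrow> snd c y) (at 0)"
    using approaches_tendsto[OF app bhol] yU(2) by simp
  have wlim: "((\<lambda>t. ?w0 (?m t)) \<longlongrightarrow> 0) (at 0)"
    using approaches_tendsto[OF app whol] yU(3) by simp
  let ?h = "\<lambda>t. inl (snd c (\<rho> (?m t))) + inr (?w0 (?m t)) :: complex^('n + 'd)"
  have "(?h \<longlongrightarrow> ?z + inr 0) (at 0)"
    by (intro tendsto_add bounded_linear.tendsto[OF block_bounded_linear(1)] bounded_linear.tendsto[OF block_bounded_linear(2)] blim wlim)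
  then have hlim: "(?h \<longlongrightarrow> ?z) (at 0)" by simp
  have "((\<lambda>t. inl (inverse t *s (snd c (\<rho> (?m t)) - snd c y)) + inr (inverse t *s ?w0 (?m t)) :: complex^('n + 'd)) \<longlongrightarrow> inl b + inr A) (at 0)"
    by (intro tendsto_add bounded_linear.tendsto[OF block_bounded_linear(1)] bounded_linear.tendsto[OF block_bounded_linear(2)] A b)
  moreover have "(inl (inverse t *s (snd c (\<rho> (?m t)) - snd c y)) + inr (inverse t *s ?w0 (?m t)) :: complex^('n + 'd)) = inverse t *s (?h t - ?z)" for t
    by (simp add: vec_sum_eq_iff)
  ultimately have dh: "((\<lambda>t. inverse t *s (?h t - ?z)) \<longlongrightarrow> inl b + inr A) (at 0)" by (simp only:)
  have zS: "?z \<in> ?S" by (rule rep_zero(1)[OF c i])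
  have lim: "((\<lambda>t. inverse t *s (rep c i (?h t) - rep c i ?z)) \<longlongrightarrow> vder (rep c i) ?z (inl b + inr A)) (at 0)"
    by (rule strict_limit[OF repdom_open[OF c(1) ia(1)] rep_holo[OF c(1) ia(1)] zS hlim tendsto_const dh])
  let ?W = "{m \<in> {m \<in> U. \<rho> m \<in> bdom N i}. \<rho> m \<in> fst c}"
  have "\<forall>\<^sub>F t in at 0. ?m t \<in> ?W"
    by (rule approachesD[OF app w_dom_open[OF ia(1) c(1)]]) (use yU c i y ia in simp)
  then have ev: "\<forall>\<^sub>F t in at 0. ?m t \<in> U \<and> i \<in> bat N (\<rho> (?m t)) \<and> \<rho> (?m t) \<in> fst c"
    by eventually_elim (use ia in \<open>simp add: bat_N\<close>)
  have "\<forall>\<^sub>F t in at 0. snd i (\<iota> y) + t *s inr v \<in> snd i ` fst i"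
    by (rule eventually_slice[OF chart_image_open[OF ch]]) (use ia in blast)
  then have "\<forall>\<^sub>F t in at 0. inverse t *s (rep c i (?h t) - rep c i ?z) = inr v"
    using ev eventually_neq_at_within[of 0 0 UNIV]
  proof eventually_elim
    fix t :: complex assume t: "snd i (\<iota> y) + t *s inr v \<in> snd i ` fst i"
      and m: "?m t \<in> U \<and> i \<in> bat N (\<rho> (?m t)) \<and> \<rho> (?m t) \<in> fst c" and t0: "t \<noteq> 0"
    have "chart_inv (total_chart N c i) (?h t) = (\<rho> (?m t), snd (\<Phi> (?m t)))"
      by (rule chart_inv_total(1)[OF c(1) ia(1)]) (use m \<Phi>_top(2) in simp_all)
    then have "rep c i (?h t) = snd i (?m t)" using inv m by (simp add: rep_def)
    also have "\<dots> = snd i (\<iota> y) + t *s inr v" by (rule chart_inv_right[OF t])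
    finally show "inverse t *s (rep c i (?h t) - rep c i ?z) = inr v"
      using rep_zero(2)[OF c i] t0 by simp
  qed
  then have "((\<lambda>t :: complex. inr v) \<longlongrightarrow> vder (rep c i) ?z (inl b + inr A)) (at 0)"
    by (rule Lim_transform_eventually[OF lim])
  from tendsto_unique[OF trivial_limit_at this tendsto_const]
  have "vder (rep c i) ?z (inl b + inr A) = inr v" .
  then have "vder (rep c i) ?z (inl b) + vder (rep c i) ?z (inr A) = inr v"
    using linear_add[OF bounded_linear.linear[OF vder_linear[OF rep_holo[OF c(1) ia(1)] zS]], of "inl b" "inr A"] by simp
  then have "prr (vder (rep c i) ?z (inl b)) + prr (vder (rep c i) ?z (inr A)) = prr (inr v :: complex^('n + 'd))"
    by (simp flip: block_linear)
  then have 1: "prr (vder (rep c i) ?z (inr A)) = v" by (simp add: rep_slice_tangent[OF c i])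
  let ?zt = "\<lambda>t. inl (snd c (\<rho> (?m t))) :: complex^('n + 'd)"
  have zt: "(?zt \<longlongrightarrow> ?z) (at 0)" by (rule bounded_linear.tendsto[OF block_bounded_linear(1) blim])
  have "((\<lambda>t. vder (rep c i) (?zt t) (inr (axis k 1))) \<longlongrightarrow> vder (rep c i) ?z (inr (axis k 1))) (at 0)" for k
  proof -
    have "isCont (\<lambda>z. vder (rep c i) z (inr (axis k 1))) ?z"
      using holo_vec_on_imp_continuous_on[OF holo_vec_on_vder[OF repdom_open[OF c(1) ia(1)] rep_holo[OF c(1) ia(1)]]]
        repdom_open[OF c(1) ia(1)] zS continuous_on_eq_continuous_at by blast
    from isCont_tendsto_compose[OF this zt] show ?thesis .
  qed
  \<comment> \<open>\<open>w\<close> uses the linear map at the moving base point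
    \<open>?zt t\<close>; its columns converge, and \<open>?w0\<close> divided by \<open>t\<close>
    converges to \<open>A\<close>.\<close>
  then have "((\<lambda>t. prr (\<Sum>k\<in>UNIV. ((inverse t *s ?w0 (?m t)) $ k) *s vder (rep c i) (?zt t) (inr (axis k 1)))) \<longlongrightarrow>
      prr (\<Sum>k\<in>UNIV. (A $ k) *s vder (rep c i) ?z (inr (axis k 1)))) (at 0)"
    by (intro bounded_linear.tendsto[OF block_bounded_linear(4)] tendsto_sum tendsto_smult tendsto_vec_nth A)
  then have "((\<lambda>t. prr (\<Sum>k\<in>UNIV. ((inverse t *s ?w0 (?m t)) $ k) *s vder (rep c i) (?zt t) (inr (axis k 1)))) \<longlongrightarrow> v) (at 0)"
    unfolding vder_expand[OF rep_holo[OF c(1) ia(1)] zS, symmetric] 1 .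
  moreover have "\<forall>\<^sub>F t in at 0. prr (\<Sum>k\<in>UNIV. ((inverse t *s ?w0 (?m t)) $ k) *s vder (rep c i) (?zt t) (inr (axis k 1)))
      = inverse t *s w (?m t) i"
    using ev
  proof eventually_elim
    fix t assume m: "?m t \<in> U \<and> i \<in> bat N (\<rho> (?m t)) \<and> \<rho> (?m t) \<in> fst c"
    then have ztS: "?zt t \<in> ?S" using rep_zero(1)[OF c(1), of "\<rho> (?m t)" i] by blast
    have "w (?m t) i = prr (vder (rep c i) (?zt t) (inr (?w0 (?m t))))" using w_local[OF _ _ c(1)] m by blast
    then have "inverse t *s w (?m t) i = prr (vder (rep c i) (?zt t) (inr (inverse t *s ?w0 (?m t))))"
      using vder_smult[OF rep_holo[OF c(1) ia(1)] ztS] by simp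
    then show "prr (\<Sum>k\<in>UNIV. ((inverse t *s ?w0 (?m t)) $ k) *s vder (rep c i) (?zt t) (inr (axis k 1)))
      = inverse t *s w (?m t) i"
      unfolding vder_expand[OF rep_holo[OF c(1) ia(1)] ztS, symmetric] by simp
  qed
  ultimately have "((\<lambda>t. inverse t *s w (?m t) i) \<longlongrightarrow> v) (at 0)" by (rule Lim_transform_eventually)
  with 1 show thesis by (rule that)
qed

lemma w_linearization: "linearization U \<rho> w"
  unfolding linearization_def
proof (intro conjI ballI allI)
  fix y i v assume y: "y \<in> topspace (mtop C)" and i: "i \<in> bat N y"
  obtain c where c: "c \<in> atlas C" "y \<in> fst c" using C_cover[OF y] by blast
  show "((\<lambda>t. inverse t *s w (chart_inv i (snd i (\<iota> y) + t *s inr v)) i) \<longlongrightarrow> v) (at 0)"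
    by (rule w_ray[OF y i c, of v])
  have ia: "i \<in> adapted_charts C M \<iota>" using i by (simp add: bat_N)
  have "w (\<iota> y) i = prr (vder (rep c i) (inl (snd c y)) (inr 0))"
    using w_local[OF U(2)[OF y], of i c] zero[OF y] i c by (simp add: zero_section_def)
  also have "\<dots> = 0"
    using linear_0[OF bounded_linear.linear[OF vder_linear[OF rep_holo[OF c(1) ia] rep_zero(1)[OF c i]]]] by simp
  finally show "w (\<iota> y) i = 0" .
qed (use U \<rho>_hol zero w_fibre w_hol in \<open>auto simp: zero_section_def\<close>)

text \<open>The linear map taking the fibre component of \<open>\<Phi>\<close> to \<open>w\<close>
  is onto by \<open>w_ray\<close>, hence injective by equality of dimensions. So
  \<open>\<rho>\<close> and \<open>w\<close> determine \<open>\<Phi> m\<close>, and \<open>g\<close>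
  recovers \<open>m\<close>.\<close>

lemma w_inj:
  assumes m: "m \<in> U" "m' \<in> U" and eq: "\<rho> m = \<rho> m'" "w m = w m'"
  shows "m = m'"
proof -
  let ?y = "\<rho> m"
  have y: "?y \<in> topspace (mtop C)" by (rule \<Phi>_top(1)[OF m(1)])
  obtain i where i: "i \<in> bat N ?y" using \<Phi>_top(3)[OF m(1)] by blast
  have ia: "i \<in> adapted_charts C M \<iota>" using i by (simp add: bat_N)
  obtain c where c: "c \<in> atlas C" "?y \<in> fst c" using C_cover[OF y] by blast
  let ?B = "\<lambda>v. prr (vder (rep c i) (inl (snd c ?y)) (inr v))"
  have "bounded_linear ?B"
    by (rule bounded_linear_compose[OF block_bounded_linear(4) bounded_linear_compose[OF vder_linear[OF rep_holo[OF c(1) ia] rep_zero(1)[OF c i]] block_bounded_linear(2)]])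
  then have "linear ?B" by (rule bounded_linear.linear)
  moreover have "surj ?B" unfolding surj_def by (metis w_ray[OF y i c])
  ultimately have "inj ?B" by (rule linear_surjective_imp_injective) (rule refl)
  moreover have "?B (snd (\<Phi> m) i) = ?B (snd (\<Phi> m') i)"
    using w_local[OF m(1) i c] w_local[OF m(2), of i c] i c eq by simp
  ultimately have "snd (\<Phi> m) i = snd (\<Phi> m') i" by (simp add: inj_def)
  then have "snd (\<Phi> m) = snd (\<Phi> m')"
    using fibre_eqI[OF \<Phi>_top(2)[OF m(1)] _ i] \<Phi>_top(2)[OF m(2)] eq by simp
  then have "\<Phi> m = \<Phi> m'" using eq by (simp add: prod_eq_iff)
  then show ?thesis using inv m by metis
qed

end

lemma (in embedded) linearization_exists:
  assumes b: "biholomorphic_nbhds C M \<iota> (total_space C N) zero_section"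
  obtains U \<rho> w where "linearization U \<rho> w" "\<And>m m'. m \<in> U \<Longrightarrow> m' \<in> U \<Longrightarrow> \<rho> m = \<rho> m' \<Longrightarrow> w m = w m' \<Longrightarrow> m = m'"
    "\<And>y. y \<in> topspace (mtop C) \<Longrightarrow> bat N y \<noteq> {}"
proof -
  let ?T = "total_space C N"
  note T = total_space_charted(1)[OF C N_holo_bundle]
  obtain U U' \<Phi> g where U: "openin (mtop M) U" "\<iota> ` topspace (mtop C) \<subseteq> U" and U': "openin (mtop ?T) U'"
    and h: "holomorphic_map (open_submfd M U) (open_submfd ?T U') \<Phi>" "holomorphic_map (open_submfd ?T U') (open_submfd M U) g"
    and inv: "\<forall>x\<in>topspace (mtop (open_submfd M U)). g (\<Phi> x) = x"
    and z: "\<forall>x\<in>topspace (mtop C). \<Phi> (\<iota> x) = zero_section x"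
    using b unfolding biholomorphic_nbhds_def biholomorphism_def by (elim exE conjE) (rule that)
  have ts: "topspace (mtop (open_submfd M U)) = U" "topspace (mtop (open_submfd ?T U')) = U'"
    using openin_subset[OF U(1)] openin_subset[OF U'] by auto
  have h1: "hol_near M ?T \<Phi> m \<and> m \<in> U \<and> \<Phi> m \<in> U'" if "m \<in> U" for m
    using h(1) that unfolding holomorphic_map_iff[OF charted_open_submfd[OF M U(1)] charted_open_submfd[OF T U']] ts
      hol_near_open_submfd[OF M U(1) T U'] by blast
  have h2: "hol_near ?T M g e" if "e \<in> U'" for e
    using h(2) that unfolding holomorphic_map_iff[OF charted_open_submfd[OF T U'] charted_open_submfd[OF M U(1)]] ts
      hol_near_open_submfd[OF T U' M U(1)] by blast
  interpret L: linearized C M \<iota> U U' \<Phi> g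
    by unfold_locales (use U U' h1 h2 inv z ts in blast)+
  show thesis by (rule that[OF L.w_linearization L.w_inj L.bat_nonempty])
qed

section \<open>The induced neighborhood\<close>

locale covering =
  fixes C :: "('c, 'n::finite) cmfd" and M :: "('m, 'n + 'd::finite) cmfd" and \<iota> :: "'c \<Rightarrow> 'm"
    and Chat :: "('h, 'n) cmfd" and p :: "'h \<Rightarrow> 'c" and M' :: "'m set" and \<pi> :: "'m \<Rightarrow> 'c"
  assumes C: "charted C" and M: "charted M" and \<iota>_map: "holomorphic_map C M \<iota>"
    and Chat: "charted Chat" and conn: "connected_space (mtop Chat)" and galois: "finite_galois_cover Chat C p"
    and M': "openin (mtop M) M'" and \<iota>_M': "\<iota> ` topspace (mtop C) \<subseteq> M'"
    and retr: "smooth_retraction C (open_submfd M M') \<iota> \<pi>"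
begin

definition Mh where "Mh = induced_nbhd (open_submfd M M') Chat \<pi> p"
definition ih where "ih = induced_embedding \<iota> p"

sublocale base: embedded C M \<iota>
  using holomorphic_map_iff[OF C M] \<iota>_map by unfold_locales (auto simp: C M)

lemma ih_simp: "ih y = (\<iota> (p y), y)"
  by (simp add: ih_def induced_embedding_def)

lemma \<pi>_cont: "continuous_map (subtopology (mtop M) M') (mtop C) \<pi>"
  and \<pi>_\<iota>: "x \<in> topspace (mtop C) \<Longrightarrow> \<pi> (\<iota> x) = x"
  using retr unfolding smooth_retraction_def smooth_map_def by simp_all

lemma \<pi>_open: "openin (mtop C) E \<Longrightarrow> openin (mtop M) {m \<in> M'. \<pi> m \<in> E}"
proof -
  assume E: "openin (mtop C) E"
  have "openin (subtopology (mtop M) M') {m \<in> topspace (subtopology (mtop M) M'). \<pi> m \<in> E}"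
    by (rule openin_continuous_map_preimage[OF \<pi>_cont E])
  moreover have "topspace (subtopology (mtop M) M') = M'" using openin_subset[OF M'] by auto
  ultimately show ?thesis using M' by (simp only: openin_open_subtopology)
qed

lemma etale: "finite_etale_cover Chat C p"
  using galois by (simp add: finite_galois_cover_def)

lemma p_hol: "y \<in> topspace (mtop Chat) \<Longrightarrow> hol_near Chat C p y"
  using etale holomorphic_map_iff[OF Chat C] unfolding finite_etale_cover_def by blast

lemma p_top: "y \<in> topspace (mtop Chat) \<Longrightarrow> p y \<in> topspace (mtop C)"
  and p_surj: "x \<in> topspace (mtop C) \<Longrightarrow> \<exists>y\<in>topspace (mtop Chat). p y = x"
proof -
  have "p ` topspace (mtop Chat) = topspace (mtop C)" using etale unfolding finite_etale_cover_def by blast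
  then show "y \<in> topspace (mtop Chat) \<Longrightarrow> p y \<in> topspace (mtop C)"
    "x \<in> topspace (mtop C) \<Longrightarrow> \<exists>y\<in>topspace (mtop Chat). p y = x" by (blast, metis imageE)
qed

text \<open>Turns a biholomorphism of open submanifolds into a local inverse whose germs live on the
  ambient manifolds.\<close>

lemma sheet_inverse:
  assumes E: "openin (mtop C) E" and W: "openin (mtop Chat) W"
    and b: "biholomorphism (open_submfd Chat W) (open_submfd C E) p"
  shows "\<exists>q. (\<forall>x\<in>E. hol_near C Chat q x \<and> q x \<in> W \<and> p (q x) = x) \<and> (\<forall>y\<in>W. p y \<in> E \<and> q (p y) = y)"
proof -
  obtain q where p: "holomorphic_map (open_submfd Chat W) (open_submfd C E) p"
    and q: "holomorphic_map (open_submfd C E) (open_submfd Chat W) q"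
      "\<forall>y\<in>topspace (mtop (open_submfd Chat W)). q (p y) = y" "\<forall>x\<in>topspace (mtop (open_submfd C E)). p (q x) = x"
    using b unfolding biholomorphism_def by blast
  have ts: "topspace (mtop (open_submfd Chat W)) = W" "topspace (mtop (open_submfd C E)) = E"
    using openin_subset[OF W] openin_subset[OF E] by auto
  have "\<forall>x\<in>E. hol_near C Chat q x \<and> x \<in> E \<and> q x \<in> W"
    using q(1) unfolding holomorphic_map_iff[OF charted_open_submfd[OF C E] charted_open_submfd[OF Chat W]] ts
      hol_near_open_submfd[OF C E Chat W] .
  moreover have "\<forall>y\<in>W. hol_near Chat C p y \<and> y \<in> W \<and> p y \<in> E"
    using p unfolding holomorphic_map_iff[OF charted_open_submfd[OF Chat W] charted_open_submfd[OF C E]] ts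
      hol_near_open_submfd[OF Chat W C E] .
  moreover have "\<forall>y\<in>W. q (p y) = y" "\<forall>x\<in>E. p (q x) = x" using q(2,3) unfolding ts .
  ultimately show ?thesis by (intro exI[of _ q]) simp
qed

lemma sheet:
  assumes "y \<in> topspace (mtop Chat)"
  shows "\<exists>E W q. openin (mtop C) E \<and> openin (mtop Chat) W \<and> y \<in> W \<and>
    (\<forall>x\<in>E. hol_near C Chat q x \<and> q x \<in> W \<and> p (q x) = x) \<and> (\<forall>y\<in>W. p y \<in> E \<and> q (p y) = y)"
proof -
  obtain E \<W> where E: "openin (mtop C) E" "p y \<in> E" "\<Union>\<W> = {y \<in> topspace (mtop Chat). p y \<in> E}"
    "\<forall>W\<in>\<W>. openin (mtop Chat) W \<and> biholomorphism (open_submfd Chat W) (open_submfd C E) p"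
    using etale p_top[OF assms] unfolding finite_etale_cover_def by meson
  have "y \<in> \<Union>\<W>" unfolding E(3) using E(2) assms by simp
  then obtain W where "W \<in> \<W>" "y \<in> W" by blast
  then have W: "openin (mtop Chat) W" "biholomorphism (open_submfd Chat W) (open_submfd C E) p" "y \<in> W"
    using E(4) by blast+
  obtain q where "(\<forall>x\<in>E. hol_near C Chat q x \<and> q x \<in> W \<and> p (q x) = x) \<and> (\<forall>y\<in>W. p y \<in> E \<and> q (p y) = y)"
    using sheet_inverse[OF E(1) W(1,2)] by (elim exE)
  then show ?thesis by (intro exI[of _ E] exI[of _ W] exI[of _ q] conjI E(1) W) blast+
qed

lemma Mh_simps:
  "mtop Mh = fibre_product (subtopology (mtop M) M') (mtop Chat) \<pi> p"
  "atlas Mh = {(V, snd c \<circ> fst) | V c. c \<in> atlas (open_submfd M M') \<and> openin (mtop Mh) V \<and>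
     fst ` V \<subseteq> fst c \<and> openin (subtopology (mtop M) M') (fst ` V) \<and>
     homeomorphic_map (subtopology (mtop Mh) V) (subtopology (subtopology (mtop M) M') (fst ` V)) fst}"
  by (simp_all add: Mh_def induced_nbhd_def Let_def del: open_submfd_simps(2))

lemma Mh_topspace: "topspace (mtop Mh) = {(m, y). m \<in> M' \<and> y \<in> topspace (mtop Chat) \<and> \<pi> m = p y}"
  using openin_subset[OF M'] by (auto simp: Mh_simps fibre_product_def)

lemma Mh_openin_box:
  assumes "openin (mtop M) A" "openin (mtop Chat) B"
  shows "openin (mtop Mh) {e \<in> topspace (mtop Mh). fst e \<in> A \<and> snd e \<in> B}"
proof -
  have "openin (prod_topology (subtopology (mtop M) M') (mtop Chat)) ((A \<inter> M') \<times> B)"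
    unfolding openin_prod_Times_iff using assms M' by (auto simp: openin_open_subtopology intro: openin_Int)
  then have "openin (mtop Mh) (((A \<inter> M') \<times> B) \<inter> {(m, y). \<pi> m = p y})"
    unfolding Mh_simps fibre_product_def openin_subtopology by blast
  moreover have "((A \<inter> M') \<times> B) \<inter> {(m, y). \<pi> m = p y} = {e \<in> topspace (mtop Mh). fst e \<in> A \<and> snd e \<in> B}"
    using openin_subset[OF assms(2)] unfolding Mh_topspace by auto
  ultimately show ?thesis by simp
qed

lemma Mh_fst_cont: "continuous_map (mtop Mh) (subtopology (mtop M) M') fst"
  unfolding Mh_simps fibre_product_def
  by (rule continuous_map_from_subtopology, simp add: continuous_map_fst)

section \<open>Local branches of the projection from the induced neighborhood\<close>

definition is_section :: "'m set \<Rightarrow> 'h set \<Rightarrow> ('m \<Rightarrow> 'h) \<Rightarrow> bool" where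
  "is_section Q W s \<longleftrightarrow> openin (mtop M) Q \<and> Q \<subseteq> M' \<and> openin (mtop Chat) W \<and>
    (\<forall>m\<in>Q. s m \<in> W \<and> (m, s m) \<in> topspace (mtop Mh)) \<and>
    (\<forall>e\<in>topspace (mtop Mh). fst e \<in> Q \<longrightarrow> snd e \<in> W \<longrightarrow> e = (fst e, s (fst e))) \<and>
    (\<forall>T. openin (mtop Chat) T \<longrightarrow> openin (mtop M) {m \<in> Q. s m \<in> T})"

lemma is_sectionD:
  assumes "is_section Q W s"
  shows "openin (mtop M) Q" "Q \<subseteq> M'" "openin (mtop Chat) W" "m \<in> Q \<Longrightarrow> s m \<in> W"
    "m \<in> Q \<Longrightarrow> (m, s m) \<in> topspace (mtop Mh)"
    "e \<in> topspace (mtop Mh) \<Longrightarrow> fst e \<in> Q \<Longrightarrow> snd e \<in> W \<Longrightarrow> e = (fst e, s (fst e))"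
    "openin (mtop Chat) T \<Longrightarrow> openin (mtop M) {m \<in> Q. s m \<in> T}"
  using assms unfolding is_section_def by blast+

text \<open>The branch is the inverse of \<open>p\<close> on a sheet composed with
  \<open>\<pi>\<close>, and the sheet \<open>W\<close> pins down which preimage is meant. Only
  continuity is recorded for it, since \<open>\<pi>\<close> is just smooth.\<close>

lemma ex_section:
  assumes e: "e \<in> topspace (mtop Mh)"
  shows "\<exists>Q W s. is_section Q W s \<and> fst e \<in> Q \<and> snd e \<in> W \<and> (fst e, s (fst e)) = e"
proof -
  obtain m0 y0 where e0: "e = (m0, y0)" "m0 \<in> M'" "y0 \<in> topspace (mtop Chat)" "\<pi> m0 = p y0"
    using e unfolding Mh_topspace by auto
  obtain E W q where E: "openin (mtop C) E" "openin (mtop Chat) W" "y0 \<in> W"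
    and q: "\<forall>x\<in>E. hol_near C Chat q x \<and> q x \<in> W \<and> p (q x) = x" "\<forall>y\<in>W. p y \<in> E \<and> q (p y) = y"
    using sheet[OF e0(3)] by blast
  let ?Q = "{m \<in> M'. \<pi> m \<in> E}" and ?s = "\<lambda>m. q (\<pi> m)"
  have "openin (mtop M) {m \<in> ?Q. ?s m \<in> T}" if T: "openin (mtop Chat) T" for T
  proof -
    have "openin (mtop C) {x \<in> E. q x \<in> T}"
      by (rule hol_near_preimage_open[OF C Chat E(1) _ T]) (use q in blast)
    then have "openin (mtop M) {m \<in> M'. \<pi> m \<in> {x \<in> E. q x \<in> T}}" by (rule \<pi>_open)
    then show ?thesis by (simp add: conj_assoc)
  qed
  moreover have "?s m \<in> W \<and> (m, ?s m) \<in> topspace (mtop Mh)" if "m \<in> ?Q" for m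
    using that q(1) openin_subset[OF E(2)] unfolding Mh_topspace by auto
  moreover have "e' = (fst e', ?s (fst e'))" if "e' \<in> topspace (mtop Mh)" "fst e' \<in> ?Q" "snd e' \<in> W" for e'
    using that q(2) unfolding Mh_topspace by auto
  ultimately have "is_section ?Q W ?s"
    unfolding is_section_def using \<pi>_open[OF E(1)] E(2) by blast
  moreover have "fst e \<in> ?Q" "snd e \<in> W" "(fst e, ?s (fst e)) = e" using e0 E q by auto
  ultimately show ?thesis by blast
qed

definition graph_on :: "('m \<Rightarrow> 'h) \<Rightarrow> 'm set \<Rightarrow> ('m \<times> 'h) set" where
  "graph_on s A = (\<lambda>m. (m, s m)) ` A"

lemma graph_on_fst [simp]: "fst ` graph_on s A = A"
  by (auto simp: graph_on_def image_image)

lemma graph_on_inj: "inj_on fst (graph_on s A)"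
  by (auto simp: graph_on_def inj_on_def)

text \<open>Over \<open>A\<close> the graph is cut out of the fibre product by a box, because
  \<open>W\<close> meets the fibre over each point of \<open>Q\<close> exactly once.\<close>

lemma graph_on_open:
  assumes s: "is_section Q W s" and A: "openin (mtop M) A" "A \<subseteq> Q"
  shows "openin (mtop Mh) (graph_on s A)"
proof -
  have "graph_on s A = {e \<in> topspace (mtop Mh). fst e \<in> A \<and> snd e \<in> W}"
  proof (intro equalityI subsetI)
    fix e assume "e \<in> graph_on s A"
    then show "e \<in> {e \<in> topspace (mtop Mh). fst e \<in> A \<and> snd e \<in> W}"
      using is_sectionD(4,5)[OF s] A by (auto simp: graph_on_def)
  next
    fix e assume "e \<in> {e \<in> topspace (mtop Mh). fst e \<in> A \<and> snd e \<in> W}"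
    then show "e \<in> graph_on s A" using is_sectionD(6)[OF s, of e] A by (auto simp: graph_on_def)
  qed
  then show ?thesis using Mh_openin_box[OF A(1) is_sectionD(3)[OF s]] by simp
qed

lemma section_cont:
  assumes s: "is_section Q W s" and V: "openin (mtop Mh) V"
  shows "openin (mtop M) {m \<in> Q. (m, s m) \<in> V}"
proof (subst openin_subopen, rule ballI)
  fix m assume m: "m \<in> {m \<in> Q. (m, s m) \<in> V}"
  obtain P where P: "openin (prod_topology (subtopology (mtop M) M') (mtop Chat)) P" "V = P \<inter> {(m, y). \<pi> m = p y}"
    using V unfolding Mh_simps fibre_product_def openin_subtopology by blast
  then have "(m, s m) \<in> P" using m by blast
  then obtain A B where AB: "openin (subtopology (mtop M) M') A" "openin (mtop Chat) B" "m \<in> A" "s m \<in> B" "A \<times> B \<subseteq> P"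
    using P(1) unfolding openin_prod_topology_alt by meson
  have "openin (mtop M) A" using AB(1) M' by (simp add: openin_open_subtopology)
  then have "openin (mtop M) (A \<inter> {m \<in> Q. s m \<in> B})" using is_sectionD(7)[OF s AB(2)] by (rule openin_Int)
  moreover have "A \<inter> {m \<in> Q. s m \<in> B} \<subseteq> {m \<in> Q. (m, s m) \<in> V}"
  proof
    fix m' assume m': "m' \<in> A \<inter> {m \<in> Q. s m \<in> B}"
    then have "(m', s m') \<in> topspace (mtop Mh)" using is_sectionD(5)[OF s] by blast
    then show "m' \<in> {m \<in> Q. (m, s m) \<in> V}" using m' AB(5) P(2) unfolding Mh_topspace by auto
  qed
  ultimately show "\<exists>T. openin (mtop M) T \<and> m \<in> T \<and> T \<subseteq> {m \<in> Q. (m, s m) \<in> V}" using m AB by blast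
qed

lemma graph_on_homeo:
  assumes s: "is_section Q W s" and A: "openin (mtop M) A" "A \<subseteq> Q"
  shows "homeomorphic_map (subtopology (mtop Mh) (graph_on s A)) (subtopology (subtopology (mtop M) M') A) fst"
proof (rule bijective_open_imp_homeomorphic_map)
  have AM: "A \<subseteq> M'" using A is_sectionD(2)[OF s] by blast
  note o = graph_on_open[OF s A]
  have ts: "topspace (subtopology (mtop Mh) (graph_on s A)) = graph_on s A"
    using openin_subset[OF o] by auto
  have ts2: "topspace (subtopology (subtopology (mtop M) M') A) = A"
    using openin_subset[OF A(1)] AM by auto
  show "continuous_map (subtopology (mtop Mh) (graph_on s A)) (subtopology (subtopology (mtop M) M') A) fst"
    by (intro continuous_map_into_subtopology continuous_map_from_subtopology Mh_fst_cont)
       (auto simp: graph_on_def)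
  show "open_map (subtopology (mtop Mh) (graph_on s A)) (subtopology (subtopology (mtop M) M') A) fst"
    unfolding open_map_def
  proof (intro allI impI)
    fix V assume "openin (subtopology (mtop Mh) (graph_on s A)) V"
    then have V: "openin (mtop Mh) V" "V \<subseteq> graph_on s A" using o by (simp_all add: openin_open_subtopology)
    have "fst ` V = A \<inter> {m \<in> Q. (m, s m) \<in> V}"
      using V(2) A(2) by (force simp: graph_on_def)
    then have "openin (mtop M) (fst ` V)" using section_cont[OF s V(1)] A(1) by (simp add: openin_Int)
    moreover have "fst ` V \<subseteq> A" using V(2) by (auto simp: graph_on_def)
    moreover have "openin (subtopology (mtop M) M') A" using A(1) AM M' by (simp add: openin_open_subtopology)
    ultimately show "openin (subtopology (subtopology (mtop M) M') A) (fst ` V)"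
      using AM M' by (auto simp: openin_open_subtopology)
  qed
  show "fst ` topspace (subtopology (mtop Mh) (graph_on s A)) = topspace (subtopology (subtopology (mtop M) M') A)"
    unfolding ts ts2 by simp
  show "inj_on fst (topspace (subtopology (mtop Mh) (graph_on s A)))"
    unfolding ts by (rule graph_on_inj)
qed

lemmas M'_charted = charted_open_submfd[OF M M']

lemma Mh_chart:
  assumes c: "is_chart (mtop M) c" and V: "openin (mtop Mh) V" "fst ` V \<subseteq> fst c"
    and h: "homeomorphic_map (subtopology (mtop Mh) V) (subtopology (subtopology (mtop M) M') (fst ` V)) fst"
    and o: "openin (subtopology (mtop M) M') (fst ` V)"
  shows "is_chart (mtop Mh) (V, snd c \<circ> fst)" "inj_on fst V"
proof -
  have ts: "topspace (subtopology (mtop Mh) V) = V" using openin_subset[OF V(1)] by auto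
  show inj: "inj_on fst V" using homeomorphic_imp_injective_map[OF h] ts by simp
  have om: "openin (mtop M) (fst ` V')" if "openin (mtop Mh) V'" "V' \<subseteq> V" for V'
  proof -
    have "openin (subtopology (mtop Mh) V) V'" using that V(1) by (simp add: openin_open_subtopology)
    then have "openin (subtopology (subtopology (mtop M) M') (fst ` V)) (fst ` V')"
      using homeomorphic_imp_open_map[OF h] by (simp add: open_map_def)
    then show ?thesis using o M' by (simp add: openin_open_subtopology)
  qed
  show "is_chart (mtop Mh) (V, snd c \<circ> fst)"
  proof (rule is_chartI)
    show "inj_on (snd (V, snd c \<circ> fst)) (fst (V, snd c \<circ> fst))"
      using comp_inj_on[OF inj inj_on_subset[OF chart_inj[OF c] V(2)]] by simp
    show "open (snd (V, snd c \<circ> fst) ` V')" if V': "openin (mtop Mh) V'" "V' \<subseteq> fst (V, snd c \<circ> fst)" for V'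
    proof -
      have "open (snd c ` fst ` V')" by (rule chart_open_map[OF c om]) (use V' V(2) in auto)
      then show ?thesis by (simp add: image_comp)
    qed
    show "openin (mtop Mh) {x \<in> fst (V, snd c \<circ> fst). snd (V, snd c \<circ> fst) x \<in> T}" if "open T" for T
    proof -
      have "openin (mtop M) {m \<in> fst c. snd c m \<in> T}" by (rule chart_continuous[OF c that])
      then have "openin (mtop Mh) (V \<inter> {e \<in> topspace (mtop Mh). fst e \<in> {m \<in> fst c. snd c m \<in> T} \<and> snd e \<in> topspace (mtop Chat)})"
        by (intro openin_Int V(1) Mh_openin_box) simp_all
      moreover have "V \<inter> {e \<in> topspace (mtop Mh). fst e \<in> {m \<in> fst c. snd c m \<in> T} \<and> snd e \<in> topspace (mtop Chat)} =
          {x \<in> V. snd c (fst x) \<in> T}"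
        using V openin_subset[OF V(1)] unfolding Mh_topspace by auto
      ultimately show ?thesis by simp
    qed
  qed (use V in simp)
qed

text \<open>The coordinate maps factor through the projection to \<open>M\<close>, so transition
  maps are restrictions of those of \<open>M\<close>. Graphs of local branches supply the
  domains.\<close>

lemma Mh_charted: "charted Mh"
  unfolding charted_def
proof (intro conjI ballI)
  fix d assume "d \<in> atlas Mh"
  then obtain V c where d: "d = (V, snd c \<circ> fst)" "c \<in> atlas (open_submfd M M')" "openin (mtop Mh) V" "fst ` V \<subseteq> fst c"
     "openin (subtopology (mtop M) M') (fst ` V)"
     "homeomorphic_map (subtopology (mtop Mh) V) (subtopology (subtopology (mtop M) M') (fst ` V)) fst"
    unfolding Mh_simps(2) by blast
  have cm: "c \<in> max_atlas (open_submfd M M')" using d(2) atlas_subset_max_atlas[OF M'_charted] by blast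
  then have c: "is_chart (mtop M) c" using max_atlas_open_submfd[OF M M'] max_atlas_is_chart by blast
  show "is_chart (mtop Mh) d" unfolding d(1) by (rule Mh_chart(1)[OF c d(3,4,6,5)])
  fix d' assume "d' \<in> atlas Mh"
  then obtain V' c' where d': "d' = (V', snd c' \<circ> fst)" "c' \<in> atlas (open_submfd M M')" "openin (mtop Mh) V'" "fst ` V' \<subseteq> fst c'"
     "openin (subtopology (mtop M) M') (fst ` V')"
     "homeomorphic_map (subtopology (mtop Mh) V') (subtopology (subtopology (mtop M) M') (fst ` V')) fst"
    unfolding Mh_simps(2) by blast
  have cm': "c' \<in> max_atlas (open_submfd M M')" using d'(2) atlas_subset_max_atlas[OF M'_charted] by blast
  then have c': "is_chart (mtop M) c'" using max_atlas_open_submfd[OF M M'] max_atlas_is_chart by blast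
  have half: "holo_vec_on (snd d ` (fst d \<inter> fst d')) (transition d d')"
    if d: "d = (V, snd c \<circ> fst)" "fst ` V \<subseteq> fst c" "is_chart (mtop Mh) d" "is_chart (mtop M) c" "openin (mtop Mh) V"
      and d': "d' = (V', snd c' \<circ> fst)" "fst ` V' \<subseteq> fst c'" "openin (mtop Mh) V'"
      and cm: "c \<in> max_atlas (open_submfd M M')" "c' \<in> max_atlas (open_submfd M M')" for d d' V V' c c'
  proof -
    have "holo_vec_on (snd d ` (fst d \<inter> fst d')) (\<lambda>z. snd c' (chart_inv c z))"
      by (rule holo_vec_on_subset[OF max_atlas_compatible[OF M'_charted cm]]) (use d(2) d'(2) in \<open>auto simp: d(1) d'(1)\<close>)
    moreover have "open (snd d ` (fst d \<inter> fst d'))"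
      by (rule chart_open_map[OF d(3)]) (use d(5) d'(3) in \<open>simp_all add: d(1) d'(1) openin_Int\<close>)
    ultimately show ?thesis
    proof (rule holo_vec_on_cong[rotated 2])
      fix z assume "z \<in> snd d ` (fst d \<inter> fst d')"
      then obtain e where e: "e \<in> V" "e \<in> V'" "z = snd d e" by (auto simp: d(1) d'(1))
      have "chart_inv d z = e" using chart_inv_left[OF d(3), of e] e by (simp add: d(1))
      moreover have "chart_inv c z = fst e" using chart_inv_left[OF d(4), of "fst e"] e d(2) by (auto simp: d(1))
      ultimately show "snd c' (chart_inv c z) = transition d d' z" by (simp add: transition_def d'(1))
    qed
  qed
  show "compatible d d'"
    unfolding compatible_def
    using half[OF d(1,4) Mh_chart(1)[OF c d(3,4,6,5), folded d(1)] c d(3) d'(1,4,3) cm cm']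
      half[OF d'(1,4) Mh_chart(1)[OF c' d'(3,4,6,5), folded d'(1)] c' d'(3) d(1,4,3) cm' cm]
    by (simp add: Int_commute)
next
  show "(\<Union>c\<in>atlas Mh. fst c) = topspace (mtop Mh)"
  proof (intro equalityI subsetI)
    fix e assume "e \<in> (\<Union>c\<in>atlas Mh. fst c)"
    then obtain V where "openin (mtop Mh) V" "e \<in> V" unfolding Mh_simps(2) by auto
    then show "e \<in> topspace (mtop Mh)" using openin_subset by blast
  next
    fix e assume e: "e \<in> topspace (mtop Mh)"
    obtain Q W s where s: "is_section Q W s" "fst e \<in> Q" "(fst e, s (fst e)) = e" using ex_section[OF e] by blast
    have "fst e \<in> topspace (mtop (open_submfd M M'))"
      using is_sectionD(1,2)[OF s(1)] s(2) openin_subset by auto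
    then obtain c where c: "c \<in> atlas (open_submfd M M')" "fst e \<in> fst c" using charted_cover[OF M'_charted] by blast
    have "openin (mtop (open_submfd M M')) (fst c)"
      using max_atlas_open atlas_subset_max_atlas[OF M'_charted c(1)] by blast
    then have co: "openin (mtop M) (fst c)" using M' by (simp add: openin_open_subtopology)
    let ?A = "Q \<inter> fst c"
    have A: "openin (mtop M) ?A" "?A \<subseteq> Q" using is_sectionD(1)[OF s(1)] co by (auto intro: openin_Int)
    have "openin (subtopology (mtop M) M') ?A"
      using A is_sectionD(2)[OF s(1)] M' by (auto simp: openin_open_subtopology)
    then have "(graph_on s ?A, snd c \<circ> fst) \<in> atlas Mh"
      unfolding Mh_simps(2) using graph_on_open[OF s(1) A] graph_on_homeo[OF s(1) A] c(1)
      by (intro CollectI exI[of _ "graph_on s ?A"] exI[of _ c]) (simp del: open_submfd_simps(2))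
    moreover have "e \<in> graph_on s ?A" unfolding graph_on_def using s c by force
    ultimately show "e \<in> (\<Union>c\<in>atlas Mh. fst c)" by (metis UN_iff fst_conv)
  qed
qed

text \<open>Although \<open>s\<close> is known only to be continuous, the map to its graph is the
  identity in suitable charts, because charts of the fibre product are charts of \<open>M\<close>
  after projection.\<close>

lemma section_hol:
  assumes s: "is_section Q W s" and m: "m \<in> Q"
  shows "hol_near M Mh (\<lambda>m. (m, s m)) m" "hol_near Mh M fst (m, s m)"
proof -
  have mM: "m \<in> topspace (mtop M)" using is_sectionD(1)[OF s] m openin_subset by blast
  have "m \<in> topspace (mtop (open_submfd M M'))" using mM m is_sectionD(2)[OF s] by auto
  then obtain c where c: "c \<in> atlas (open_submfd M M')" "m \<in> fst c" using charted_cover[OF M'_charted] by blast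
  have cmM: "c \<in> max_atlas M"
    using atlas_subset_max_atlas[OF M'_charted c(1)] unfolding max_atlas_open_submfd[OF M M'] by blast
  have co: "openin (mtop M) (fst c)" by (rule max_atlas_open[OF cmM])
  have ch: "is_chart (mtop M) c" by (rule max_atlas_is_chart[OF cmM])
  let ?A = "Q \<inter> fst c"
  have A: "openin (mtop M) ?A" "?A \<subseteq> Q" using is_sectionD(1)[OF s] co by (auto intro: openin_Int)
  have "openin (subtopology (mtop M) M') ?A"
    using A is_sectionD(2)[OF s] M' by (auto simp: openin_open_subtopology)
  then have "(graph_on s ?A, snd c \<circ> fst) \<in> atlas Mh"
    unfolding Mh_simps(2) using graph_on_open[OF s A] graph_on_homeo[OF s A] c(1)
    by (intro CollectI exI[of _ "graph_on s ?A"] exI[of _ c]) (simp del: open_submfd_simps(2))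
  then have d: "(graph_on s ?A, snd c \<circ> fst) \<in> max_atlas Mh" by (rule atlas_subset_max_atlas[OF Mh_charted])
  have dch: "is_chart (mtop Mh) (graph_on s ?A, snd c \<circ> fst)" by (rule max_atlas_is_chart[OF d])
  have oA: "open (snd c ` ?A)" by (rule chart_open_map[OF ch A(1)]) blast
  show "hol_near M Mh (\<lambda>m. (m, s m)) m"
  proof (rule hol_nearI[OF cmM d A(1)])
    have "holo_vec_on (snd c ` ?A) (\<lambda>z. z)" by (rule holo_vec_on_id)
    then show "holo_vec_on (snd c ` ?A) (\<lambda>z. snd (graph_on s ?A, snd c \<circ> fst) (chart_inv c z, s (chart_inv c z)))"
      by (rule holo_vec_on_cong[OF oA, rotated]) (use chart_inv_left[OF ch] in auto)
  qed (use c m in \<open>auto simp: graph_on_def\<close>)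
  show "hol_near Mh M fst (m, s m)"
  proof (rule hol_nearI[OF d cmM graph_on_open[OF s A]])
    have eq: "snd (graph_on s ?A, snd c \<circ> fst) ` graph_on s ?A = snd c ` ?A"
      unfolding snd_conv image_comp[symmetric] graph_on_fst ..
    show "holo_vec_on (snd (graph_on s ?A, snd c \<circ> fst) ` graph_on s ?A)
        (\<lambda>z. snd c (fst (chart_inv (graph_on s ?A, snd c \<circ> fst) z)))"
      unfolding eq
    proof (rule holo_vec_on_cong[OF oA _ holo_vec_on_id])
      fix z assume "z \<in> snd c ` ?A"
      then obtain m' where m': "m' \<in> ?A" "z = snd c m'" by blast
      have "(m', s m') \<in> graph_on s ?A" using m' by (auto simp: graph_on_def)
      then have "chart_inv (graph_on s ?A, snd c \<circ> fst) z = (m', s m')"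
        using chart_inv_left[OF dch, of "(m', s m')"] m' by simp
      then show "z = snd c (fst (chart_inv (graph_on s ?A, snd c \<circ> fst) z))" using m' by simp
    qed
  qed (use c m in \<open>auto simp: graph_on_def\<close>)
qed

lemma section_local_biholo:
  assumes s: "is_section Q W s" and m: "m \<in> Q"
  shows "local_biholo M Mh (\<lambda>m. (m, s m)) m"
  unfolding local_biholo_def
proof (rule exI[of _ Q], rule exI[of _ "graph_on s Q"], rule exI[of _ fst], intro conjI ballI)
  show "openin (mtop Mh) (graph_on s Q)" by (rule graph_on_open[OF s is_sectionD(1)[OF s]]) simp
qed (use m section_hol[OF s] is_sectionD(1)[OF s] in \<open>auto simp: graph_on_def\<close>)

lemma fst_hol: "e \<in> topspace (mtop Mh) \<Longrightarrow> hol_near Mh M fst e"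
  using ex_section[of e] section_hol(2) by metis

lemma ih_top: "y \<in> topspace (mtop Chat) \<Longrightarrow> ih y \<in> topspace (mtop Mh)"
  using \<iota>_M' p_top \<pi>_\<iota> by (auto simp: ih_simp Mh_topspace)

text \<open>Near \<open>y\<close> the embedding is the branch through \<open>ih y\<close> applied to
  \<open>\<iota> (p y)\<close>; uniqueness within the sheet \<open>W\<close> identifies the
  two.\<close>

lemma ih_hol:
  assumes y: "y \<in> topspace (mtop Chat)"
  shows "hol_near Chat Mh ih y"
proof -
  obtain Q W s where s: "is_section Q W s" "\<iota> (p y) \<in> Q" "y \<in> W" "(\<iota> (p y), s (\<iota> (p y))) = ih y"
    using ex_section[OF ih_top[OF y]] by (auto simp: ih_simp)
  have \<iota>p: "hol_near Chat M (\<lambda>y. \<iota> (p y)) y" if "y \<in> topspace (mtop Chat)" for y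
    by (rule hol_near_comp[OF Chat C M p_hol base.\<iota>]) (use that p_top in auto)
  have sp: "hol_near Chat Mh (\<lambda>y. (\<iota> (p y), s (\<iota> (p y)))) y"
    by (rule hol_near_comp[OF Chat M Mh_charted \<iota>p[OF y] section_hol(1)[OF s(1,2)]])
  show ?thesis
  proof (rule hol_near_cong[OF Chat sp])
    show "openin (mtop Chat) {y \<in> W. \<iota> (p y) \<in> Q}"
      by (rule hol_near_preimage_open[OF Chat M is_sectionD(3)[OF s(1)] _ is_sectionD(1)[OF s(1)]])
         (use \<iota>p openin_subset[OF is_sectionD(3)[OF s(1)]] in blast)
    fix y' assume y': "y' \<in> {y \<in> W. \<iota> (p y) \<in> Q}"
    then have "y' \<in> topspace (mtop Chat)" using openin_subset[OF is_sectionD(3)[OF s(1)]] by blast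
    from is_sectionD(6)[OF s(1) ih_top[OF this]] y'
    show "(\<iota> (p y'), s (\<iota> (p y'))) = ih y'" by (simp add: ih_simp)
  qed (use s in simp)
qed

sublocale hat: embedded Chat Mh ih
  by unfold_locales (use Chat Mh_charted ih_hol in auto)

text \<open>A point over \<open>\<iota> x\<close> has its second component over
  \<open>\<pi> (\<iota> x) = x\<close>, so the preimage of \<open>C\<close> is the image of
  \<open>Chat\<close>. This is why adapted charts correspond under the projection.\<close>

lemma ih_image_iff:
  assumes "e \<in> topspace (mtop Mh)"
  shows "e \<in> ih ` topspace (mtop Chat) \<longleftrightarrow> fst e \<in> \<iota> ` topspace (mtop C)"
proof
  assume "e \<in> ih ` topspace (mtop Chat)"
  then show "fst e \<in> \<iota> ` topspace (mtop C)" using p_top by (auto simp: ih_simp)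
next
  assume "fst e \<in> \<iota> ` topspace (mtop C)"
  then obtain x where x: "x \<in> topspace (mtop C)" "fst e = \<iota> x" by blast
  then have "e = ih (snd e)" "snd e \<in> topspace (mtop Chat)"
    using assms \<pi>_\<iota>[OF x(1)] unfolding Mh_topspace by (auto simp: ih_simp)
  then show "e \<in> ih ` topspace (mtop Chat)" by blast
qed

lemma lift_max_atlas:
  assumes s: "is_section Q W s" and c: "c \<in> max_atlas M" and A: "openin (mtop M) A" "A \<subseteq> Q" "A \<subseteq> fst c"
  shows "(graph_on s A, snd c \<circ> fst) \<in> max_atlas Mh"
proof (rule max_atlas_hol_nearI[OF Mh_charted])
  have ch: "is_chart (mtop M) c" by (rule max_atlas_is_chart[OF c])
  have AM: "openin (subtopology (mtop M) M') A" using A is_sectionD(2)[OF s] M' by (auto simp: openin_open_subtopology)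
  show dch: "is_chart (mtop Mh) (graph_on s A, snd c \<circ> fst)"
    by (rule Mh_chart(1)[OF ch graph_on_open[OF s A(1,2)]]) (use A AM graph_on_homeo[OF s A(1,2)] in simp_all)
  show "hol_near Mh euc (snd (graph_on s A, snd c \<circ> fst)) e" if e: "e \<in> fst (graph_on s A, snd c \<circ> fst)" for e
  proof -
    have "e \<in> topspace (mtop Mh)" "fst e \<in> fst c"
      using e openin_subset[OF graph_on_open[OF s A(1,2)]] A(3) by (auto simp: graph_on_def)
    then show ?thesis
      using hol_near_comp[OF Mh_charted M charted_euc fst_hol hol_near_chart[OF M c], of e] by (simp add: comp_def)
  qed
  show "hol_near euc Mh (chart_inv (graph_on s A, snd c \<circ> fst)) z"
    if z: "z \<in> snd (graph_on s A, snd c \<circ> fst) ` fst (graph_on s A, snd c \<circ> fst)" for z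
  proof -
    have zA: "z \<in> snd c ` A" using z by (auto simp: graph_on_def)
    then have zc: "z \<in> snd c ` fst c" using A(3) by blast
    have inv: "chart_inv c z' \<in> A \<and> snd c (chart_inv c z') = z'" if "z' \<in> snd c ` A" for z'
      using that chart_inv_left[OF ch] A(3) by auto
    have "hol_near euc Mh (\<lambda>z. (chart_inv c z, s (chart_inv c z))) z"
      by (rule hol_near_comp[OF charted_euc M Mh_charted hol_near_chart_inv[OF M c zc] section_hol(1)[OF s]])
         (use inv[OF zA] A(2) in blast)
    then show ?thesis
    proof (rule hol_near_cong[OF charted_euc])
      show "openin (mtop euc) (snd c ` A)" using chart_open_map[OF ch A(1,3)] by simp
      fix z' assume z': "z' \<in> snd c ` A"
      have "(chart_inv c z', s (chart_inv c z')) \<in> graph_on s A" using inv[OF z'] by (auto simp: graph_on_def)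
      then show "(chart_inv c z', s (chart_inv c z')) = chart_inv (graph_on s A, snd c \<circ> fst) z'"
        using chart_inv_left[OF dch, of "(chart_inv c z', s (chart_inv c z'))"] inv[OF z'] by simp
    qed (rule zA)
  qed
qed

lemma lift_exists:
  assumes y: "y \<in> topspace (mtop Chat)" and c: "c \<in> bat base.N (p y)"
  shows "\<exists>V. (V, snd c \<circ> fst) \<in> bat hat.N y"
proof -
  obtain Q W s where s: "is_section Q W s" "\<iota> (p y) \<in> Q" "(\<iota> (p y), s (\<iota> (p y))) = ih y"
    using ex_section[OF ih_top[OF y]] by (auto simp: ih_simp)
  have ca: "c \<in> adapted_charts C M \<iota>" "\<iota> (p y) \<in> fst c" using c by (simp_all add: base.bat_N)
  let ?A = "Q \<inter> fst c"
  have A: "openin (mtop M) ?A" "?A \<subseteq> Q" "?A \<subseteq> fst c"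
    using is_sectionD(1)[OF s(1)] max_atlas_open[OF base.adapted_max[OF ca(1)]] by (auto intro: openin_Int)
  have d: "(graph_on s ?A, snd c \<circ> fst) \<in> max_atlas Mh" by (rule lift_max_atlas[OF s(1) base.adapted_max[OF ca(1)] A])
  have "(graph_on s ?A, snd c \<circ> fst) \<in> adapted_charts Chat Mh ih"
    unfolding adapted_charts_def
  proof (intro CollectI conjI ballI d)
    fix e assume "e \<in> fst (graph_on s ?A, snd c \<circ> fst)"
    then have e: "e \<in> topspace (mtop Mh)" "fst e \<in> fst c"
      using openin_subset[OF graph_on_open[OF s(1) A(1,2)]] by (auto simp: graph_on_def)
    show "e \<in> ih ` topspace (mtop Chat) \<longleftrightarrow> (\<forall>j. snd (graph_on s ?A, snd c \<circ> fst) e $ Inr j = 0)"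
      unfolding ih_image_iff[OF e(1)] using base.adapted_slice[OF ca(1) e(2)] by (simp add: vec_eq_iff)
  qed
  moreover have "ih y \<in> graph_on s ?A" unfolding graph_on_def using s ca by force
  ultimately show ?thesis using y by (intro exI[of _ "graph_on s ?A"]) (simp add: hat.bat_N)
qed

text \<open>Converse of lifting: an adapted chart upstairs is read along a local branch. It shows
  that the trivializing sets of the normal bundle cover \<open>C\<close>, so that its total space
  contains the whole zero section.\<close>

lemma push_exists:
  assumes y: "y \<in> topspace (mtop Chat)" and i: "i \<in> bat hat.N y"
  shows "bat base.N (p y) \<noteq> {}"
proof -
  obtain Q W s where s: "is_section Q W s" "\<iota> (p y) \<in> Q" "(\<iota> (p y), s (\<iota> (p y))) = ih y"
    using ex_section[OF ih_top[OF y]] by (auto simp: ih_simp)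
  have ia: "i \<in> adapted_charts Chat Mh ih" "ih y \<in> fst i" using i by (simp_all add: hat.bat_N)
  have im: "i \<in> max_atlas Mh" by (rule hat.adapted_max[OF ia(1)])
  have ich: "is_chart (mtop Mh) i" by (rule max_atlas_is_chart[OF im])
  let ?A = "{m \<in> Q. (m, s m) \<in> fst i}" and ?f = "\<lambda>m. snd i (m, s m)"
  have A: "openin (mtop M) ?A" "?A \<subseteq> Q" by (rule section_cont[OF s(1) max_atlas_open[OF im]]) blast
  have cch: "is_chart (mtop M) (?A, ?f)"
  proof (rule is_chartI)
    show "inj_on (snd (?A, ?f)) (fst (?A, ?f))"
    proof (rule inj_onI)
      fix a b assume ab: "a \<in> fst (?A, ?f)" "b \<in> fst (?A, ?f)" "snd (?A, ?f) a = snd (?A, ?f) b"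
      then have "(a, s a) = (b, s b)" using inj_onD[OF chart_inj[OF ich], of "(a, s a)" "(b, s b)"] by simp
      then show "a = b" by simp
    qed
    show "open (snd (?A, ?f) ` B)" if B: "openin (mtop M) B" "B \<subseteq> fst (?A, ?f)" for B
    proof -
      have "open (snd i ` graph_on s B)"
        by (rule chart_open_map[OF ich graph_on_open[OF s(1) B(1)]]) (use B(2) in \<open>auto simp: graph_on_def\<close>)
      moreover have "snd i ` graph_on s B = snd (?A, ?f) ` B" by (simp add: graph_on_def image_image)
      ultimately show ?thesis by simp
    qed
    show "openin (mtop M) {x \<in> fst (?A, ?f). snd (?A, ?f) x \<in> T}" if "open T" for T
    proof -
      have "openin (mtop M) {m \<in> Q. (m, s m) \<in> {e \<in> fst i. snd i e \<in> T}}"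
        by (rule section_cont[OF s(1) chart_continuous[OF ich that]])
      then show ?thesis by (simp add: conj_assoc)
    qed
  qed (use A in simp)
  have cm: "(?A, ?f) \<in> max_atlas M"
  proof (rule max_atlas_hol_nearI[OF M cch])
    show "hol_near M euc (snd (?A, ?f)) m" if "m \<in> fst (?A, ?f)" for m
      using hol_near_comp[OF M Mh_charted charted_euc section_hol(1)[OF s(1)] hol_near_chart[OF Mh_charted im], of m] that by simp
    show "hol_near euc M (chart_inv (?A, ?f)) z" if z: "z \<in> snd (?A, ?f) ` fst (?A, ?f)" for z
    proof -
      have zi: "z' \<in> snd i ` fst i" if "z' \<in> ?f ` ?A" for z' using that by blast
      have zz: "z \<in> ?f ` ?A" using z by simp
      have top: "chart_inv i z \<in> topspace (mtop Mh)"
        using chart_inv_in[OF zi[OF zz]] openin_subset[OF max_atlas_open[OF im]] by blast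
      have "hol_near euc M (\<lambda>z. fst (chart_inv i z)) z"
        by (rule hol_near_comp[OF charted_euc Mh_charted M hol_near_chart_inv[OF Mh_charted im zi[OF zz]] fst_hol[OF top]])
      then show ?thesis
      proof (rule hol_near_cong[OF charted_euc])
        show "openin (mtop euc) (?f ` ?A)" using chart_image_open[OF cch] by simp
        fix z' assume "z' \<in> ?f ` ?A"
        then obtain m where m: "m \<in> ?A" "z' = ?f m" by blast
        have "chart_inv i z' = (m, s m)" using chart_inv_left[OF ich, of "(m, s m)"] m by simp
        moreover have "chart_inv (?A, ?f) z' = m" using chart_inv_left[OF cch, of m] m by simp
        ultimately show "fst (chart_inv i z') = chart_inv (?A, ?f) z'" by simp
      qed (rule zz)
    qed
  qed
  have "(?A, ?f) \<in> adapted_charts C M \<iota>"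
    unfolding adapted_charts_def
  proof (intro CollectI conjI ballI cm)
    fix m assume "m \<in> fst (?A, ?f)"
    then have m: "(m, s m) \<in> fst i" "(m, s m) \<in> topspace (mtop Mh)" using is_sectionD(5)[OF s(1)] by auto
    show "m \<in> \<iota> ` topspace (mtop C) \<longleftrightarrow> (\<forall>j. snd (?A, ?f) m $ Inr j = 0)"
      using ih_image_iff[OF m(2)] hat.adapted_slice[OF ia(1) m(1)] by (simp add: vec_eq_iff)
  qed
  moreover have "\<iota> (p y) \<in> ?A" using s ia by simp
  ultimately have "(?A, ?f) \<in> bat base.N (p y)" using p_top[OF y] by (simp add: base.bat_N)
  then show ?thesis by blast
qed

section \<open>Deck transformations\<close>

lemma deck_facts:
  assumes "deck_transformation Chat p \<sigma>"
  shows "y \<in> topspace (mtop Chat) \<Longrightarrow> hol_near Chat Chat \<sigma> y" "y \<in> topspace (mtop Chat) \<Longrightarrow> p (\<sigma> y) = p y"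
    "y \<in> topspace (mtop Chat) \<Longrightarrow> \<sigma> y \<in> topspace (mtop Chat)"
proof -
  have h: "\<forall>y\<in>topspace (mtop Chat). hol_near Chat Chat \<sigma> y" and e: "\<forall>y\<in>topspace (mtop Chat). p (\<sigma> y) = p y"
    using assms unfolding deck_transformation_def biholomorphism_def holomorphic_map_iff[OF Chat Chat] by simp_all
  show "hol_near Chat Chat \<sigma> y" if "y \<in> topspace (mtop Chat)" using h that by (rule bspec)
  then show "\<sigma> y \<in> topspace (mtop Chat)" if "y \<in> topspace (mtop Chat)" using that hol_near_topspace(2)[of Chat Chat \<sigma> y] by simp
  show "p (\<sigma> y) = p y" if "y \<in> topspace (mtop Chat)" using e that by (rule bspec)
qed

lemma deck_inverse:
  assumes d: "deck_transformation Chat p \<sigma>"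
  obtains \<tau> where "deck_transformation Chat p \<tau>" "\<And>y. y \<in> topspace (mtop Chat) \<Longrightarrow> \<tau> (\<sigma> y) = y"
    "\<And>y. y \<in> topspace (mtop Chat) \<Longrightarrow> \<sigma> (\<tau> y) = y"
proof -
  obtain \<tau> where t: "holomorphic_map Chat Chat \<tau>" "\<forall>y\<in>topspace (mtop Chat). \<tau> (\<sigma> y) = y" "\<forall>y\<in>topspace (mtop Chat). \<sigma> (\<tau> y) = y"
    using d unfolding deck_transformation_def biholomorphism_def by blast
  have top: "\<tau> y \<in> topspace (mtop Chat)" if "y \<in> topspace (mtop Chat)" for y
    using t(1) that hol_near_topspace(2)[of Chat Chat \<tau> y] unfolding holomorphic_map_iff[OF Chat Chat] by simp
  have "p (\<tau> y) = p y" if "y \<in> topspace (mtop Chat)" for y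
    using deck_facts(2)[OF d top[OF that]] t(3) that by simp
  moreover have "biholomorphism Chat Chat \<tau>"
    unfolding biholomorphism_def using t d unfolding deck_transformation_def biholomorphism_def by blast
  ultimately have "deck_transformation Chat p \<tau>" unfolding deck_transformation_def by blast
  then show thesis using that t by blast
qed

text \<open>As \<open>p\<close> is injective on each sheet, distinct points of a fibre lie in
  distinct and hence disjoint sheets.\<close>

lemma sheets_separate:
  assumes y: "y \<in> topspace (mtop Chat)" "y' \<in> topspace (mtop Chat)" and eq: "p y = p y'" "y \<noteq> y'"
  shows "\<exists>W W'. openin (mtop Chat) W \<and> openin (mtop Chat) W' \<and> y \<in> W \<and> y' \<in> W' \<and> W \<inter> W' = {}"
proof -
  obtain E \<W> where E: "openin (mtop C) E" "p y \<in> E" "disjoint \<W>" "\<Union>\<W> = {y \<in> topspace (mtop Chat). p y \<in> E}"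
    "\<forall>W\<in>\<W>. openin (mtop Chat) W \<and> biholomorphism (open_submfd Chat W) (open_submfd C E) p"
    using etale p_top[OF y(1)] unfolding finite_etale_cover_def by meson
  have "y \<in> \<Union>\<W>" "y' \<in> \<Union>\<W>" unfolding E(4) using E(2) y eq by simp_all
  then obtain W W' where W: "W \<in> \<W>" "y \<in> W" "W' \<in> \<W>" "y' \<in> W'" by blast
  have "W \<noteq> W'"
  proof
    assume "W = W'"
    moreover have "openin (mtop Chat) W" "biholomorphism (open_submfd Chat W) (open_submfd C E) p" using E(5) W by blast+
    from sheet_inverse[OF E(1) this] obtain q where "\<forall>y\<in>W. p y \<in> E \<and> q (p y) = y" by (elim exE conjE) (rule that)
    ultimately show False using W eq by metis
  qed
  then have "W \<inter> W' = {}" using E(3) W unfolding disjoint_def by blast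
  then show ?thesis using E(5) W by blast
qed

text \<open>Each of the finitely many sheets meets the fibre at most once.\<close>

lemma fibre_finite:
  assumes "x \<in> topspace (mtop C)"
  shows "finite {y \<in> topspace (mtop Chat). p y = x}"
proof -
  obtain E \<W> where E: "openin (mtop C) E" "x \<in> E" "finite \<W>" "\<Union>\<W> = {y \<in> topspace (mtop Chat). p y \<in> E}"
    "\<forall>W\<in>\<W>. openin (mtop Chat) W \<and> biholomorphism (open_submfd Chat W) (open_submfd C E) p"
    using etale assms unfolding finite_etale_cover_def by meson
  have "finite {y \<in> W. p y = x}" if W: "W \<in> \<W>" for W
  proof -
    have "openin (mtop Chat) W" "biholomorphism (open_submfd Chat W) (open_submfd C E) p" using E(5) W by blast+
    from sheet_inverse[OF E(1) this] obtain q where "\<forall>y\<in>W. p y \<in> E \<and> q (p y) = y" by (elim exE conjE) (rule that)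
    then have "{y \<in> W. p y = x} \<subseteq> {q x}" by auto
    then show ?thesis by (rule finite_subset) simp
  qed
  then have "finite (\<Union>W\<in>\<W>. {y \<in> W. p y = x})" using E(3) by blast
  moreover have "{y \<in> topspace (mtop Chat). p y = x} \<subseteq> (\<Union>W\<in>\<W>. {y \<in> W. p y = x})" using E(2,4) by blast
  ultimately show ?thesis by (rule finite_subset[rotated])
qed

text \<open>The set of agreement is open because nearby values lie in one sheet, and its complement
  is open because they lie in disjoint sheets; connectedness concludes.\<close>

lemma deck_unique:
  assumes s: "deck_transformation Chat p \<sigma>" "deck_transformation Chat p \<sigma>'"
    and y0: "y0 \<in> topspace (mtop Chat)" "\<sigma> y0 = \<sigma>' y0" and y: "y \<in> topspace (mtop Chat)"
  shows "\<sigma> y = \<sigma>' y"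
proof -
  let ?S = "{y \<in> topspace (mtop Chat). \<sigma> y = \<sigma>' y}" and ?D = "{y \<in> topspace (mtop Chat). \<sigma> y \<noteq> \<sigma>' y}"
  have pre: "openin (mtop Chat) {y \<in> topspace (mtop Chat). \<tau> y \<in> W}" if "deck_transformation Chat p \<tau>" "openin (mtop Chat) W" for \<tau> W
    by (rule hol_near_preimage_open[OF Chat Chat openin_topspace _ that(2)]) (use deck_facts(1)[OF that(1)] in blast)
  have "openin (mtop Chat) ?S"
  proof (subst openin_subopen, rule ballI)
    fix y assume y: "y \<in> ?S"
    then have "\<sigma> y \<in> topspace (mtop Chat)" using deck_facts(3)[OF s(1)] by blast
    from sheet[OF this] obtain W E q where W: "openin (mtop Chat) W" "\<sigma> y \<in> W" "\<forall>y\<in>W. p y \<in> E \<and> q (p y) = y"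
      by (elim exE conjE) (rule that)
    let ?T = "{y \<in> topspace (mtop Chat). \<sigma> y \<in> W} \<inter> {y \<in> topspace (mtop Chat). \<sigma>' y \<in> W}"
    have "openin (mtop Chat) ?T" by (rule openin_Int[OF pre[OF s(1) W(1)] pre[OF s(2) W(1)]])
    moreover have "?T \<subseteq> ?S"
    proof
      fix y assume "y \<in> ?T"
      then have "\<sigma> y = q (p y)" "\<sigma>' y = q (p y)" "y \<in> topspace (mtop Chat)"
        using W(3) deck_facts(2)[OF s(1), of y] deck_facts(2)[OF s(2), of y] by (metis (no_types, lifting) IntD1 IntD2 mem_Collect_eq)+
      then show "y \<in> ?S" by simp
    qed
    moreover have "y \<in> ?T" using y W by auto
    ultimately show "\<exists>T. openin (mtop Chat) T \<and> y \<in> T \<and> T \<subseteq> ?S" by blast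
  qed
  moreover have "openin (mtop Chat) ?D"
  proof (subst openin_subopen, rule ballI)
    fix y assume y: "y \<in> ?D"
    then have "\<sigma> y \<in> topspace (mtop Chat)" "\<sigma>' y \<in> topspace (mtop Chat)" "p (\<sigma> y) = p (\<sigma>' y)" "\<sigma> y \<noteq> \<sigma>' y"
      using deck_facts(2,3)[OF s(1)] deck_facts(2,3)[OF s(2)] by auto
    from sheets_separate[OF this] obtain W W' where W: "openin (mtop Chat) W" "openin (mtop Chat) W'" "\<sigma> y \<in> W" "\<sigma>' y \<in> W'" "W \<inter> W' = {}"
      by blast
    let ?T = "{y \<in> topspace (mtop Chat). \<sigma> y \<in> W} \<inter> {y \<in> topspace (mtop Chat). \<sigma>' y \<in> W'}"
    have "openin (mtop Chat) ?T" by (rule openin_Int[OF pre[OF s(1) W(1)] pre[OF s(2) W(2)]])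
    moreover have "?T \<subseteq> ?D" using W(5) by auto
    moreover have "y \<in> ?T" using y W by auto
    ultimately show "\<exists>T. openin (mtop Chat) T \<and> y \<in> T \<and> T \<subseteq> ?D" by blast
  qed
  then have "closedin (mtop Chat) ?S"
  proof -
    have "topspace (mtop Chat) - ?S = ?D" by blast
    then show ?thesis using \<open>openin (mtop Chat) ?D\<close> by (simp add: closedin_def Collect_restrict)
  qed
  ultimately have "?S = {} \<or> ?S = topspace (mtop Chat)"
    using conn unfolding connected_space_clopen_in by blast
  then show ?thesis using y0 y by blast
qed

text \<open>One transformation is chosen for each point of a single fibre. By uniqueness on the
  connected cover every other one agrees with a chosen one on the whole space, so the finite set is
  transitive on all fibres.\<close>

lemma deck_group:
  obtains G where "finite G" "\<And>\<sigma>. \<sigma> \<in> G \<Longrightarrow> deck_transformation Chat p \<sigma>"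
    "\<And>y y'. y \<in> topspace (mtop Chat) \<Longrightarrow> y' \<in> topspace (mtop Chat) \<Longrightarrow> p y = p y' \<Longrightarrow> \<exists>\<sigma>\<in>G. \<sigma> y = y'"
proof (cases "topspace (mtop Chat) = {}")
  case True
  show ?thesis by (rule that[of "{}"]) (use True in auto)
next
  case False
  then obtain y0 where y0: "y0 \<in> topspace (mtop Chat)" by blast
  let ?F = "{y \<in> topspace (mtop Chat). p y = p y0}"
  have ex: "\<exists>\<sigma>. deck_transformation Chat p \<sigma> \<and> \<sigma> y = y'"
    if "y \<in> topspace (mtop Chat)" "y' \<in> topspace (mtop Chat)" "p y = p y'" for y y'
    using galois that unfolding finite_galois_cover_def by blast
  define \<gamma> where "\<gamma> y' = (SOME \<sigma>. deck_transformation Chat p \<sigma> \<and> \<sigma> y0 = y')" for y'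
  have \<gamma>: "deck_transformation Chat p (\<gamma> y') \<and> \<gamma> y' y0 = y'" if "y' \<in> ?F" for y'
    unfolding \<gamma>_def by (rule someI_ex[OF ex[OF y0]]) (use that in auto)
  show ?thesis
  proof (rule that[of "\<gamma> ` ?F"])
    show "finite (\<gamma> ` ?F)" using fibre_finite[OF p_top[OF y0]] by blast
    show "deck_transformation Chat p \<sigma>" if "\<sigma> \<in> \<gamma> ` ?F" for \<sigma> using that \<gamma> by blast
    fix y y' assume y: "y \<in> topspace (mtop Chat)" "y' \<in> topspace (mtop Chat)" "p y = p y'"
    obtain \<sigma> where s: "deck_transformation Chat p \<sigma>" "\<sigma> y = y'" using ex[OF y] by blast
    have F: "\<sigma> y0 \<in> ?F" using deck_facts(2,3)[OF s(1) y0] by simp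
    have "\<gamma> (\<sigma> y0) y = \<sigma> y" by (rule deck_unique[OF _ s(1) y0 _ y(1)]) (use \<gamma>[OF F] in auto)
    then show "\<exists>\<sigma>\<in>\<gamma> ` ?F. \<sigma> y = y'" using F s(2) by auto
  qed
qed

end

section \<open>Descent\<close>

text \<open>Serves to compute one block of a derivative from difference quotients projected to that
  block.\<close>

lemma vder_by_limit:
  assumes "holo_vec_on S F" "z \<in> S" "bounded_linear L"
    and "((\<lambda>t. L (inverse t *s (F (z + t *s e) - F z))) \<longlongrightarrow> r) (at 0)"
  shows "L (vder F z e) = r"
  using tendsto_unique[OF trivial_limit_at bounded_linear.tendsto[OF assms(3) vder_slice_tendsto[OF assms(1,2)]] assms(4)] .

context covering
begin

definition deck_map :: "('h \<Rightarrow> 'h) \<Rightarrow> 'm \<times> 'h \<Rightarrow> 'm \<times> 'h" where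
  "deck_map \<sigma> e = (fst e, \<sigma> (snd e))"

lemma deck_map_top:
  assumes "deck_transformation Chat p \<sigma>" "e \<in> topspace (mtop Mh)"
  shows "deck_map \<sigma> e \<in> topspace (mtop Mh)"
  using assms(2) deck_facts(2,3)[OF assms(1)] unfolding Mh_topspace deck_map_def by auto

lemma deck_map_ih:
  assumes "deck_transformation Chat p \<sigma>" "y \<in> topspace (mtop Chat)"
  shows "deck_map \<sigma> (ih y) = ih (\<sigma> y)"
  using deck_facts(2)[OF assms] by (simp add: deck_map_def ih_simp)

text \<open>Near \<open>e\<close> the map is the branch through the image point composed with the
  projection to \<open>M\<close>, which deck maps leave unchanged.\<close>

lemma deck_map_hol:
  assumes d: "deck_transformation Chat p \<sigma>" and e: "e \<in> topspace (mtop Mh)"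
  shows "hol_near Mh Mh (deck_map \<sigma>) e"
proof -
  obtain Q W s where s: "is_section Q W s" "fst e \<in> Q" "\<sigma> (snd e) \<in> W"
    using ex_section[OF deck_map_top[OF d e]] by (auto simp: deck_map_def)
  have eC: "snd e \<in> topspace (mtop Chat)" using e unfolding Mh_topspace by auto
  have h: "hol_near Mh Mh (\<lambda>e. (fst e, s (fst e))) e"
    by (rule hol_near_comp[OF Mh_charted M Mh_charted fst_hol[OF e] section_hol(1)[OF s(1,2)]])
  have o: "openin (mtop Chat) {y \<in> topspace (mtop Chat). \<sigma> y \<in> W}"
    by (rule hol_near_preimage_open[OF Chat Chat openin_topspace deck_facts(1)[OF d] is_sectionD(3)[OF s(1)]])
  show ?thesis
  proof (rule hol_near_cong[OF Mh_charted h Mh_openin_box[OF is_sectionD(1)[OF s(1)] o]])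
    show "e \<in> {e \<in> topspace (mtop Mh). fst e \<in> Q \<and> snd e \<in> {y \<in> topspace (mtop Chat). \<sigma> y \<in> W}}"
      using e eC s by blast
    fix e' assume e': "e' \<in> {e \<in> topspace (mtop Mh). fst e \<in> Q \<and> snd e \<in> {y \<in> topspace (mtop Chat). \<sigma> y \<in> W}}"
    then have "deck_map \<sigma> e' \<in> topspace (mtop Mh)" using deck_map_top[OF d] by blast
    from is_sectionD(6)[OF s(1) this] e' show "(fst e', s (fst e')) = deck_map \<sigma> e'" by (simp add: deck_map_def)
  qed
qed

text \<open>With \<open>\<tau>\<close> inverse to a deck transformation \<open>\<sigma>\<close>, this is the chart \<open>i\<close> transported by \<open>\<sigma>\<close>.\<close>

definition deck_chart :: "('h \<Rightarrow> 'h) \<Rightarrow> ('m \<times> 'h, 'n + 'd) chart \<Rightarrow> ('m \<times> 'h, 'n + 'd) chart" where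
  "deck_chart \<tau> i = ({e \<in> topspace (mtop Mh). deck_map \<tau> e \<in> fst i}, \<lambda>e. snd i (deck_map \<tau> e))"

end

section \<open>Transport of linearizations by deck transformations\<close>

locale deck_pair = covering C M \<iota> Chat p M' \<pi>
  for C :: "('c, 'n::finite) cmfd" and M :: "('m, 'n + 'd::finite) cmfd" and \<iota> :: "'c \<Rightarrow> 'm"
    and Chat :: "('h, 'n) cmfd" and p :: "'h \<Rightarrow> 'c" and M' :: "'m set" and \<pi> :: "'m \<Rightarrow> 'c" +
  fixes \<sigma> \<tau> :: "'h \<Rightarrow> 'h"
  assumes \<sigma>: "deck_transformation Chat p \<sigma>" and \<tau>: "deck_transformation Chat p \<tau>"
    and \<tau>\<sigma>: "\<And>y. y \<in> topspace (mtop Chat) \<Longrightarrow> \<tau> (\<sigma> y) = y"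
    and \<sigma>\<tau>: "\<And>y. y \<in> topspace (mtop Chat) \<Longrightarrow> \<sigma> (\<tau> y) = y"
begin

lemma deck_map_inverse:
  assumes "e \<in> topspace (mtop Mh)"
  shows "deck_map \<tau> (deck_map \<sigma> e) = e" "deck_map \<sigma> (deck_map \<tau> e) = e"
  using assms \<tau>\<sigma> \<sigma>\<tau> unfolding Mh_topspace deck_map_def by auto

lemma deck_chart_facts:
  assumes i: "i \<in> adapted_charts Chat Mh ih"
  shows deck_chart_chart: "is_chart (mtop Mh) (deck_chart \<tau> i)"
    and deck_chart_image: "snd (deck_chart \<tau> i) ` fst (deck_chart \<tau> i) = snd i ` fst i"
    and deck_chart_inv: "z \<in> snd i ` fst i \<Longrightarrow> chart_inv (deck_chart \<tau> i) z = deck_map \<sigma> (chart_inv i z)"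
    and deck_chart_adapted: "deck_chart \<tau> i \<in> adapted_charts Chat Mh ih"
proof -
  have im: "i \<in> max_atlas Mh" by (rule hat.adapted_max[OF i])
  have ich: "is_chart (mtop Mh) i" by (rule max_atlas_is_chart[OF im])
  have itop: "fst i \<subseteq> topspace (mtop Mh)" by (rule openin_subset[OF max_atlas_open[OF im]])
  have pre: "openin (mtop Mh) {e \<in> topspace (mtop Mh). deck_map \<tau> e \<in> V}" if "openin (mtop Mh) V" for V
    by (rule hol_near_preimage_open[OF Mh_charted Mh_charted openin_topspace deck_map_hol[OF \<tau>] that])
  have pre': "openin (mtop Mh) {e \<in> topspace (mtop Mh). deck_map \<sigma> e \<in> V}" if "openin (mtop Mh) V" for V
    by (rule hol_near_preimage_open[OF Mh_charted Mh_charted openin_topspace deck_map_hol[OF \<sigma>] that])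
  show ch: "is_chart (mtop Mh) (deck_chart \<tau> i)"
  proof (rule is_chartI)
    show "openin (mtop Mh) (fst (deck_chart \<tau> i))" using pre[OF max_atlas_open[OF im]] by (simp add: deck_chart_def)
    show "inj_on (snd (deck_chart \<tau> i)) (fst (deck_chart \<tau> i))"
    proof (rule inj_onI)
      fix a b assume ab: "a \<in> fst (deck_chart \<tau> i)" "b \<in> fst (deck_chart \<tau> i)" "snd (deck_chart \<tau> i) a = snd (deck_chart \<tau> i) b"
      then have "deck_map \<tau> a = deck_map \<tau> b" using inj_onD[OF chart_inj[OF ich], of "deck_map \<tau> a" "deck_map \<tau> b"] by (simp add: deck_chart_def)
      then have "deck_map \<sigma> (deck_map \<tau> a) = deck_map \<sigma> (deck_map \<tau> b)" by (rule arg_cong)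
      moreover have "a \<in> topspace (mtop Mh)" "b \<in> topspace (mtop Mh)" using ab(1,2) by (simp_all add: deck_chart_def)
      ultimately show "a = b" by (simp only: deck_map_inverse(2))
    qed
    show "open (snd (deck_chart \<tau> i) ` B)" if B: "openin (mtop Mh) B" "B \<subseteq> fst (deck_chart \<tau> i)" for B
    proof -
      have Bt: "B \<subseteq> topspace (mtop Mh)" by (rule openin_subset[OF B(1)])
      have "deck_map \<tau> ` B = {e \<in> topspace (mtop Mh). deck_map \<sigma> e \<in> B}"
      proof (intro equalityI subsetI)
        fix e assume "e \<in> deck_map \<tau> ` B"
        then obtain b where b: "b \<in> B" "e = deck_map \<tau> b" by blast
        then have "b \<in> topspace (mtop Mh)" using Bt by blast
        then show "e \<in> {e \<in> topspace (mtop Mh). deck_map \<sigma> e \<in> B}"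
          using deck_map_inverse(2)[of b] deck_map_top[OF \<tau>, of b] b by simp
      next
        fix e assume "e \<in> {e \<in> topspace (mtop Mh). deck_map \<sigma> e \<in> B}"
        then have "e = deck_map \<tau> (deck_map \<sigma> e)" "deck_map \<sigma> e \<in> B" using deck_map_inverse(1)[of e] by simp_all
        then show "e \<in> deck_map \<tau> ` B" by (rule image_eqI)
      qed
      then have "openin (mtop Mh) (deck_map \<tau> ` B)" using pre'[OF B(1)] by simp
      moreover have "deck_map \<tau> ` B \<subseteq> fst i"
      proof (rule image_subsetI)
        fix b assume "b \<in> B"
        then have "b \<in> fst (deck_chart \<tau> i)" using B(2) by blast
        then show "deck_map \<tau> b \<in> fst i" by (simp add: deck_chart_def)
      qed
      ultimately have "open (snd i ` deck_map \<tau> ` B)" by (rule chart_open_map[OF ich])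
      then show ?thesis by (simp add: deck_chart_def image_image)
    qed
    show "openin (mtop Mh) {x \<in> fst (deck_chart \<tau> i). snd (deck_chart \<tau> i) x \<in> T}" if "open T" for T
      using pre[OF chart_continuous[OF ich that]] by (simp add: deck_chart_def conj_assoc)
  qed
  have img: "deck_map \<sigma> e \<in> fst (deck_chart \<tau> i)" "snd (deck_chart \<tau> i) (deck_map \<sigma> e) = snd i e" if "e \<in> fst i" for e
  proof -
    have e: "e \<in> topspace (mtop Mh)" using that itop by blast
    show "deck_map \<sigma> e \<in> fst (deck_chart \<tau> i)" "snd (deck_chart \<tau> i) (deck_map \<sigma> e) = snd i e"
      using that deck_map_inverse(1)[OF e] deck_map_top[OF \<sigma> e] by (simp_all add: deck_chart_def)
  qed
  show im_eq: "snd (deck_chart \<tau> i) ` fst (deck_chart \<tau> i) = snd i ` fst i"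
  proof (intro equalityI subsetI)
    fix z assume "z \<in> snd i ` fst i"
    then obtain e where "e \<in> fst i" "z = snd i e" by blast
    then show "z \<in> snd (deck_chart \<tau> i) ` fst (deck_chart \<tau> i)" using img by (metis imageI)
  qed (auto simp: deck_chart_def)
  show inv: "chart_inv (deck_chart \<tau> i) z = deck_map \<sigma> (chart_inv i z)" if z: "z \<in> snd i ` fst i" for z
    using chart_inv_left[OF ch img(1)[OF chart_inv_in[OF z]]] img(2)[OF chart_inv_in[OF z]] chart_inv_right[OF z] by simp
  have dm: "deck_chart \<tau> i \<in> max_atlas Mh"
  proof (rule max_atlas_hol_nearI[OF Mh_charted ch])
    show "hol_near Mh euc (snd (deck_chart \<tau> i)) e" if "e \<in> fst (deck_chart \<tau> i)" for e
      using hol_near_comp[OF Mh_charted Mh_charted charted_euc deck_map_hol[OF \<tau>] hol_near_chart[OF Mh_charted im], of e] that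
      by (simp add: deck_chart_def)
    show "hol_near euc Mh (chart_inv (deck_chart \<tau> i)) z" if z: "z \<in> snd (deck_chart \<tau> i) ` fst (deck_chart \<tau> i)" for z
    proof -
      have zi: "z \<in> snd i ` fst i" using z im_eq by simp
      have "hol_near euc Mh (\<lambda>z. deck_map \<sigma> (chart_inv i z)) z"
        by (rule hol_near_comp[OF charted_euc Mh_charted Mh_charted hol_near_chart_inv[OF Mh_charted im zi] deck_map_hol[OF \<sigma>]])
           (use chart_inv_in[OF zi] itop in blast)
      then show ?thesis
        by (rule hol_near_cong[OF charted_euc, where W="snd i ` fst i"]) (use zi inv chart_image_open[OF ich] in simp_all)
    qed
  qed
  show "deck_chart \<tau> i \<in> adapted_charts Chat Mh ih"
    unfolding adapted_charts_def
  proof (intro CollectI conjI ballI dm)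
    fix e assume "e \<in> fst (deck_chart \<tau> i)"
    then have e: "e \<in> topspace (mtop Mh)" "deck_map \<tau> e \<in> fst i" by (simp_all add: deck_chart_def)
    have "e \<in> ih ` topspace (mtop Chat) \<longleftrightarrow> deck_map \<tau> e \<in> ih ` topspace (mtop Chat)"
      unfolding ih_image_iff[OF e(1)] ih_image_iff[OF deck_map_top[OF \<tau> e(1)]] by (simp add: deck_map_def)
    then show "e \<in> ih ` topspace (mtop Chat) \<longleftrightarrow> (\<forall>j. snd (deck_chart \<tau> i) e $ Inr j = 0)"
      using hat.adapted_slice[OF i e(2)] by (simp add: deck_chart_def vec_eq_iff)
  qed
qed

lemma deck_chart_ih:
  assumes "y \<in> topspace (mtop Chat)"
  shows "snd (deck_chart \<tau> i) (ih (\<sigma> y)) = snd i (ih y)" "ih (\<sigma> y) \<in> fst (deck_chart \<tau> i) \<longleftrightarrow> ih y \<in> fst i"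
  using deck_map_ih[OF \<sigma> assms] deck_map_inverse(1)[OF ih_top[OF assms]] ih_top[OF deck_facts(3)[OF \<sigma> assms]]
  by (simp_all add: deck_chart_def flip: deck_map_ih[OF \<sigma> assms])

lemma deck_chart_bat:
  assumes "y \<in> topspace (mtop Chat)" "i \<in> bat hat.N y"
  shows "deck_chart \<tau> i \<in> bat hat.N (\<sigma> y)"
  using assms deck_chart_adapted[of i] deck_chart_ih(2)[OF assms(1), of i] deck_facts(3)[OF \<sigma> assms(1)]
  by (simp add: hat.bat_N)

text \<open>On the overlap, transported charts have the same transition map as the original ones, so
  the derivatives agree.\<close>

lemma deck_chart_btrans:
  assumes y: "y \<in> topspace (mtop Chat)" and i: "i \<in> bat hat.N y" "j \<in> bat hat.N y"
  shows "btrans hat.N (deck_chart \<tau> i) (deck_chart \<tau> j) (\<sigma> y) *v v = btrans hat.N i j y *v v"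
proof -
  have ia: "i \<in> adapted_charts Chat Mh ih" "j \<in> adapted_charts Chat Mh ih" "ih y \<in> fst i" "ih y \<in> fst j"
    using i by (simp_all add: hat.bat_N)
  have jch: "is_chart (mtop Mh) j" by (rule hat.adapted_is_chart[OF ia(2)])
  have "vder (trans_map (deck_chart \<tau> i) (deck_chart \<tau> j)) (snd j (ih y)) = vder (trans_map i j) (snd j (ih y))"
  proof (rule vder_cong[OF hat.N_trans_open[OF i]])
    fix z assume "z \<in> snd j ` (fst j \<inter> fst i)"
    then obtain e where e: "e \<in> fst j" "z = snd j e" by blast
    have "e \<in> topspace (mtop Mh)" using e(1) openin_subset[OF chart_open[OF jch]] by blast
    then have "deck_map \<tau> (deck_map \<sigma> (chart_inv j z)) = chart_inv j z"
      using deck_map_inverse(1) chart_inv_left[OF jch e(1)] e(2) by simp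
    moreover have "chart_inv (deck_chart \<tau> j) z = deck_map \<sigma> (chart_inv j z)" by (rule deck_chart_inv[OF ia(2)]) (use e in blast)
    ultimately show "trans_map (deck_chart \<tau> i) (deck_chart \<tau> j) z = trans_map i j z" by (simp add: deck_chart_def)
  qed (use ia in blast)
  then show ?thesis
    by (simp add: hat.N_btrans[OF deck_chart_bat[OF y i(1)] deck_chart_bat[OF y i(2)]] hat.N_btrans[OF i] deck_chart_ih(1)[OF y])
qed

text \<open>Conjugation by \<open>\<sigma>\<close>: pull back along the deck map, bring the base
  point back by \<open>\<tau>\<close>, and read the normal vector in transported charts. The
  normalization survives because the deck map sends a ray in \<open>i\<close> to the ray with the
  same coordinates in the transported chart. The value 0 off \<open>bat\<close> is the convention
  for elements of a fibre.\<close>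

lemma transport:
  assumes l: "hat.linearization U \<rho> w"
  shows "hat.linearization {e \<in> topspace (mtop Mh). deck_map \<sigma> e \<in> U} (\<lambda>e. \<tau> (\<rho> (deck_map \<sigma> e)))
    (\<lambda>e i. if i \<in> bat hat.N (\<tau> (\<rho> (deck_map \<sigma> e))) then w (deck_map \<sigma> e) (deck_chart \<tau> i) else 0)"
proof -
  let ?U = "{e \<in> topspace (mtop Mh). deck_map \<sigma> e \<in> U}" and ?\<rho> = "\<lambda>e. \<tau> (\<rho> (deck_map \<sigma> e))"
  have oU: "openin (mtop Mh) ?U"
    by (rule hol_near_preimage_open[OF Mh_charted Mh_charted openin_topspace deck_map_hol[OF \<sigma>] hat.linearizationD(1)[OF l]])
  have \<rho>top: "\<rho> (deck_map \<sigma> e) \<in> topspace (mtop Chat)" if "e \<in> ?U" for e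
    using hol_near_topspace(2)[OF hat.linearizationD(3)[OF l, of "deck_map \<sigma> e"]] that by blast
  have \<rho>hol: "hol_near Mh Chat ?\<rho> e" if e: "e \<in> ?U" for e
  proof -
    have "hol_near Mh Chat (\<lambda>e. \<rho> (deck_map \<sigma> e)) e"
      by (rule hol_near_comp[OF Mh_charted Mh_charted Chat deck_map_hol[OF \<sigma>] hat.linearizationD(3)[OF l]]) (use e in simp_all)
    from hol_near_comp[OF Mh_charted Chat Chat this deck_facts(1)[OF \<tau> \<rho>top[OF e]]] show ?thesis .
  qed
  have bat: "deck_chart \<tau> i \<in> bat hat.N (\<rho> (deck_map \<sigma> e))" if "e \<in> ?U" "i \<in> bat hat.N (?\<rho> e)" for e i
    using deck_chart_bat[OF deck_facts(3)[OF \<tau> \<rho>top[OF that(1)]] that(2)] \<sigma>\<tau>[OF \<rho>top[OF that(1)]] by simp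
  have \<rho>ih: "?\<rho> (ih y) = y" "deck_map \<sigma> (ih y) \<in> U" if y: "y \<in> topspace (mtop Chat)" for y
    using hat.linearizationD(2,4)[OF l deck_facts(3)[OF \<sigma> y]] deck_map_ih[OF \<sigma> y] \<tau>\<sigma>[OF y] by simp_all
  have near: "openin (mtop Mh) {e \<in> ?U. ?\<rho> e \<in> bdom hat.N i}" if "i \<in> adapted_charts Chat Mh ih" for i
    by (rule hol_near_preimage_open[OF Mh_charted Chat oU \<rho>hol hat.bdom_N_open[OF that]])
  show ?thesis
    unfolding hat.linearization_def
  proof (intro conjI ballI allI)
    show "openin (mtop Mh) ?U" by (rule oU)
    show "ih ` topspace (mtop Chat) \<subseteq> ?U" using \<rho>ih(2) ih_top by blast
    show "hol_near Mh Chat ?\<rho> e" if "e \<in> ?U" for e by (rule \<rho>hol[OF that])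
    show "?\<rho> (ih y) = y" if "y \<in> topspace (mtop Chat)" for y by (rule \<rho>ih(1)[OF that])
  next
    fix e assume e: "e \<in> ?U"
    let ?w = "\<lambda>i. if i \<in> bat hat.N (?\<rho> e) then w (deck_map \<sigma> e) (deck_chart \<tau> i) else 0"
    show "?w \<in> fibre hat.N (?\<rho> e)"
      unfolding fibre_def
    proof (intro CollectI conjI allI ballI impI)
      fix i j assume ij: "i \<in> bat hat.N (?\<rho> e)" "j \<in> bat hat.N (?\<rho> e)"
      have "w (deck_map \<sigma> e) (deck_chart \<tau> i) = btrans hat.N (deck_chart \<tau> i) (deck_chart \<tau> j) (\<rho> (deck_map \<sigma> e)) *v w (deck_map \<sigma> e) (deck_chart \<tau> j)"
        by (rule fibre_trans[OF hat.linearizationD(5)[OF l] bat[OF e ij(1)] bat[OF e ij(2)]]) (use e in blast)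
      also have "\<dots> = btrans hat.N i j (?\<rho> e) *v w (deck_map \<sigma> e) (deck_chart \<tau> j)"
        using deck_chart_btrans[OF deck_facts(3)[OF \<tau> \<rho>top[OF e]] ij] \<sigma>\<tau>[OF \<rho>top[OF e]] by simp
      finally show "?w i = btrans hat.N i j (?\<rho> e) *v ?w j" using ij by simp
    qed simp
  next
    fix e i assume e: "e \<in> ?U" and i: "i \<in> bat hat.N (?\<rho> e)"
    have ia: "i \<in> adapted_charts Chat Mh ih" using i by (simp add: hat.bat_N)
    have "hol_near Mh euc (\<lambda>e. w (deck_map \<sigma> e) (deck_chart \<tau> i)) e"
      by (rule hol_near_comp[OF Mh_charted Mh_charted charted_euc deck_map_hol[OF \<sigma>] hat.linearizationD(6)[OF l _ bat[OF e i]]]) (use e in simp_all)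
    then show "hol_near Mh euc (\<lambda>e. if i \<in> bat hat.N (?\<rho> e) then w (deck_map \<sigma> e) (deck_chart \<tau> i) else 0) e"
      by (rule hol_near_cong[OF Mh_charted _ near[OF ia]]) (use e i ia in \<open>simp_all add: hat.bat_N\<close>)
  next
    fix y i assume y: "y \<in> topspace (mtop Chat)" and i: "i \<in> bat hat.N y"
    note sy = deck_facts(3)[OF \<sigma> y]
    note di = deck_chart_bat[OF y i]
    have ia: "i \<in> adapted_charts Chat Mh ih" "ih y \<in> fst i" using i by (simp_all add: hat.bat_N)
    have ich: "is_chart (mtop Mh) i" by (rule hat.adapted_is_chart[OF ia(1)])
    show "(if i \<in> bat hat.N (?\<rho> (ih y)) then w (deck_map \<sigma> (ih y)) (deck_chart \<tau> i) else 0) = 0"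
      using hat.linearizationD(7)[OF l sy di] deck_map_ih[OF \<sigma> y] by simp
    fix v
    let ?z = "\<lambda>t. snd i (ih y) + t *s inr v"
    let ?m = "\<lambda>t. chart_inv i (?z t)"
    have lim: "((\<lambda>t. inverse t *s w (chart_inv (deck_chart \<tau> i) (snd (deck_chart \<tau> i) (ih (\<sigma> y)) + t *s inr v)) (deck_chart \<tau> i)) \<longlongrightarrow> v) (at 0)"
      by (rule hat.linearizationD(8)[OF l sy di])
    have "\<forall>\<^sub>F t in at 0. ?m t \<in> {e \<in> ?U. ?\<rho> e \<in> bdom hat.N i}"
    proof (rule hat.approachesD[OF hat.approaches_ray[OF i] near[OF ia(1)]])
      have "ih y \<in> ?U" using \<rho>ih(2)[OF y] ih_top[OF y] by blast
      moreover have "?\<rho> (ih y) \<in> bdom hat.N i" using \<rho>ih(1)[OF y] y ia by simp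
      ultimately show "ih y \<in> {e \<in> ?U. ?\<rho> e \<in> bdom hat.N i}" by blast
    qed
    moreover have "\<forall>\<^sub>F t in at 0. ?z t \<in> snd i ` fst i"
      by (rule eventually_slice[OF chart_image_open[OF ich]]) (use ia in blast)
    ultimately have "\<forall>\<^sub>F t in at 0. inverse t *s w (chart_inv (deck_chart \<tau> i) (snd (deck_chart \<tau> i) (ih (\<sigma> y)) + t *s inr v)) (deck_chart \<tau> i) =
        inverse t *s (if i \<in> bat hat.N (?\<rho> (?m t)) then w (deck_map \<sigma> (?m t)) (deck_chart \<tau> i) else 0)"
    proof eventually_elim
      fix t assume m: "?m t \<in> {e \<in> ?U. ?\<rho> e \<in> bdom hat.N i}" and z: "?z t \<in> snd i ` fst i"
      have "i \<in> bat hat.N (?\<rho> (?m t))" using m ia by (simp add: hat.bat_N)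
      moreover have "chart_inv (deck_chart \<tau> i) (?z t) = deck_map \<sigma> (?m t)" by (rule deck_chart_inv[OF ia(1) z])
      ultimately show "inverse t *s w (chart_inv (deck_chart \<tau> i) (snd (deck_chart \<tau> i) (ih (\<sigma> y)) + t *s inr v)) (deck_chart \<tau> i) =
        inverse t *s (if i \<in> bat hat.N (?\<rho> (?m t)) then w (deck_map \<sigma> (?m t)) (deck_chart \<tau> i) else 0)"
        by (simp add: deck_chart_ih(1)[OF y])
    qed
    then show "((\<lambda>t. inverse t *s (if i \<in> bat hat.N (?\<rho> (?m t)) then w (deck_map \<sigma> (?m t)) (deck_chart \<tau> i) else 0)) \<longlongrightarrow> v) (at 0)"
      by (rule Lim_transform_eventually[OF lim])
  qed
qed

end

section \<open>Descent of an equivariant linearization\<close>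

locale descent = covering C M \<iota> Chat p M' \<pi>
  for C :: "('c, 'n::finite) cmfd" and M :: "('m, 'n + 'd::finite) cmfd" and \<iota> :: "'c \<Rightarrow> 'm"
    and Chat :: "('h, 'n) cmfd" and p :: "'h \<Rightarrow> 'c" and M' :: "'m set" and \<pi> :: "'m \<Rightarrow> 'c" +
  fixes U \<rho> w
  assumes l: "hat.linearization U \<rho> w"
    and w_inj: "\<And>e e'. e \<in> U \<Longrightarrow> e' \<in> U \<Longrightarrow> \<rho> e = \<rho> e' \<Longrightarrow> w e = w e' \<Longrightarrow> e = e'"
    and ne: "\<And>y. y \<in> topspace (mtop Chat) \<Longrightarrow> bat hat.N y \<noteq> {}"
    and H0T: "\<And>l. l \<ge> 1 \<Longrightarrow> H0_vanishes (mtop Chat) (sym_sections Chat (tangent_bundle Chat) hat.N l)"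
    and H0N: "\<And>l. l \<ge> 2 \<Longrightarrow> H0_vanishes (mtop Chat) (sym_sections Chat hat.N hat.N l)"
begin

lemma U_top: "e \<in> U \<Longrightarrow> e \<in> topspace (mtop Mh)"
  using openin_subset[OF hat.linearizationD(1)[OF l]] by blast

lemma \<rho>_top: "e \<in> U \<Longrightarrow> \<rho> e \<in> topspace (mtop Chat)"
  using hol_near_topspace(2)[OF hat.linearizationD(3)[OF l]] .

lemma p\<rho>_hol: "e \<in> U \<Longrightarrow> hol_near Mh C (\<lambda>e. p (\<rho> e)) e"
  by (rule hol_near_comp[OF Mh_charted Chat C hat.linearizationD(3)[OF l] p_hol[OF \<rho>_top]])

text \<open>The domain of the lifted chart is arbitrary: by \<open>fibre_same_coordinates\<close> below, the
  coordinates of a normal vector depend only on the coordinate map.\<close>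

definition lift :: "('m, 'n + 'd) chart \<Rightarrow> 'h \<Rightarrow> ('m \<times> 'h, 'n + 'd) chart" where
  "lift c y = (SOME V. (V, snd c \<circ> fst) \<in> bat hat.N y, snd c \<circ> fst)"

lemma lift_bat: "y \<in> topspace (mtop Chat) \<Longrightarrow> c \<in> bat base.N (p y) \<Longrightarrow> lift c y \<in> bat hat.N y"
  unfolding lift_def by (rule someI_ex[OF lift_exists])

text \<open>Charts with the same coordinate map have the identity as transition map on the overlap,
  so their transition matrix is the identity.\<close>

lemma fibre_same_coordinates:
  assumes V: "(V, \<psi>) \<in> bat hat.N y" "(V', \<psi>) \<in> bat hat.N y" and v: "v \<in> fibre hat.N y"
  shows "v (V, \<psi>) = v (V', \<psi>)"
proof -
  have y: "ih y \<in> V" "ih y \<in> V'" using V by (simp_all add: hat.bat_N)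
  have "vder (trans_map (V, \<psi>) (V', \<psi>)) (\<psi> (ih y)) = vder (\<lambda>z. z) (\<psi> (ih y))"
    by (rule vder_cong[OF hat.N_trans_open[OF V]]) (use y chart_inv_right[of _ "(V', \<psi>)"] in auto)
  moreover have "vder (\<lambda>z. z) (\<psi> (ih y)) = (\<lambda>v. v)" by (rule vder_unique) (rule has_derivative_ident)
  ultimately show ?thesis
    using fibre_trans[OF v V] by (simp add: hat.N_btrans[OF V])
qed

text \<open>Near the point the transition maps between lifts are those of \<open>M\<close>. This is
  the identification of the normal bundle of \<open>Chat\<close> with the pullback of that of
  \<open>C\<close>.\<close>

lemma lift_btrans:
  assumes y: "y \<in> topspace (mtop Chat)" and c: "c \<in> bat base.N (p y)" "c' \<in> bat base.N (p y)"
  shows "btrans base.N c c' (p y) *v v = btrans hat.N (lift c y) (lift c' y) y *v v"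
proof -
  obtain V V' where V: "lift c y = (V, snd c \<circ> fst)" "lift c' y = (V', snd c' \<circ> fst)" by (simp add: lift_def)
  have b: "(V, snd c \<circ> fst) \<in> bat hat.N y" "(V', snd c' \<circ> fst) \<in> bat hat.N y"
    using lift_bat[OF y c(1)] lift_bat[OF y c(2)] V by simp_all
  have ca: "c \<in> adapted_charts C M \<iota>" "c' \<in> adapted_charts C M \<iota>" "\<iota> (p y) \<in> fst c" "\<iota> (p y) \<in> fst c'"
    using c by (simp_all add: base.bat_N)
  have ba: "(V, snd c \<circ> fst) \<in> max_atlas Mh" "(V', snd c' \<circ> fst) \<in> max_atlas Mh" "ih y \<in> V" "ih y \<in> V'"
    using b hat.adapted_max by (simp_all add: hat.bat_N)
  have ch: "is_chart (mtop Mh) (V', snd c' \<circ> fst)" "is_chart (mtop M) c'"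
    using max_atlas_is_chart[OF ba(2)] base.adapted_is_chart[OF ca(2)] by blast+
  let ?B = "{e \<in> topspace (mtop Mh). fst e \<in> fst c \<inter> fst c' \<and> snd e \<in> topspace (mtop Chat)}"
  let ?S = "(snd c' \<circ> fst) ` (V' \<inter> (V \<inter> ?B))"
  have "openin (mtop Mh) (V' \<inter> (V \<inter> ?B))"
    using max_atlas_open[OF ba(1)] max_atlas_open[OF ba(2)]
    by (intro openin_Int Mh_openin_box openin_topspace max_atlas_open[OF base.adapted_max] ca) simp_all
  from chart_open_map[OF ch(1) this] have oS: "open ?S" by simp
  have "vder (trans_map (V, snd c \<circ> fst) (V', snd c' \<circ> fst)) (snd c' (\<iota> (p y))) = vder (trans_map c c') (snd c' (\<iota> (p y)))"
  proof (rule vder_cong[OF oS])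
    have "snd c' (\<iota> (p y)) = (snd c' \<circ> fst) (ih y)" by (simp add: ih_simp)
    moreover have "ih y \<in> V' \<inter> (V \<inter> ?B)" using ba ca ih_top[OF y] y by (simp add: ih_simp)
    ultimately show "snd c' (\<iota> (p y)) \<in> ?S" by (rule image_eqI)
    fix z assume "z \<in> ?S"
    then obtain e where e: "e \<in> V'" "fst e \<in> fst c'" "z = snd c' (fst e)" by auto
    have "chart_inv (V', snd c' \<circ> fst) z = e" using chart_inv_left[OF ch(1), of e] e by simp
    moreover have "chart_inv c' z = fst e" using chart_inv_left[OF ch(2) e(2)] e by simp
    ultimately show "trans_map (V, snd c \<circ> fst) (V', snd c' \<circ> fst) z = trans_map c c' z" by simp
  qed
  then show ?thesis
    unfolding V hat.N_btrans[OF b] base.N_btrans[OF c] by (simp add: ih_simp)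
qed

abbreviation T where "T \<equiv> total_space C base.N"

lemmas T_charted = total_space_charted(1)[OF C base.N_holo_bundle]

text \<open>The linearization upstairs followed by the natural map from the pulled back bundle to
  \<open>N\<close>; a vector is read in the chart \<open>c\<close> through a lift of
  \<open>c\<close> at \<open>\<rho> e\<close>.\<close>

definition descend where
  "descend e = (p (\<rho> e), \<lambda>c. if c \<in> bat base.N (p (\<rho> e)) then w e (lift c (\<rho> e)) else 0)"

lemma descend_fibre:
  assumes e: "e \<in> U"
  shows "snd (descend e) \<in> fibre base.N (p (\<rho> e))"
  unfolding fibre_def
proof (intro CollectI conjI allI ballI impI)
  fix c c' assume c: "c \<in> bat base.N (p (\<rho> e))" "c' \<in> bat base.N (p (\<rho> e))"
  note y = \<rho>_top[OF e]
  have "w e (lift c (\<rho> e)) = btrans hat.N (lift c (\<rho> e)) (lift c' (\<rho> e)) (\<rho> e) *v w e (lift c' (\<rho> e))"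
    by (rule fibre_trans[OF hat.linearizationD(5)[OF l e] lift_bat[OF y c(1)] lift_bat[OF y c(2)]])
  then show "snd (descend e) c = btrans base.N c c' (p (\<rho> e)) *v snd (descend e) c'"
    using c by (simp add: descend_def lift_btrans[OF y c])
qed (simp add: descend_def)

text \<open>The lift used in \<open>descend\<close> changes with the point. Near \<open>e\<close> it
  may be replaced by the one chosen at \<open>\<rho> e\<close>, so that holomorphy of
  \<open>w\<close> in a fixed trivialization applies.\<close>

lemma descend_local:
  assumes e: "e \<in> U" and c: "c \<in> bat base.N (p (\<rho> e))"
  shows "\<exists>V. openin (mtop Mh) V \<and> e \<in> V \<and> V \<subseteq> U \<and>
    (\<forall>e'\<in>V. lift c (\<rho> e) \<in> bat hat.N (\<rho> e') \<and> c \<in> bat base.N (p (\<rho> e')) \<and> snd (descend e') c = w e' (lift c (\<rho> e)))"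
proof -
  note y = \<rho>_top[OF e]
  let ?i = "lift c (\<rho> e)"
  have i: "?i \<in> bat hat.N (\<rho> e)" by (rule lift_bat[OF y c])
  have ia: "?i \<in> adapted_charts Chat Mh ih" and ca: "c \<in> adapted_charts C M \<iota>" using i c by (simp_all add: hat.bat_N base.bat_N)
  define V where "V = {e' \<in> {e' \<in> U. \<rho> e' \<in> bdom hat.N ?i}. p (\<rho> e') \<in> bdom base.N c}"
  have "openin (mtop Mh) V"
    unfolding V_def
  proof (rule hol_near_preimage_open[OF Mh_charted C _ _ base.bdom_N_open[OF ca]])
    show "openin (mtop Mh) {e' \<in> U. \<rho> e' \<in> bdom hat.N ?i}"
      by (rule hol_near_preimage_open[OF Mh_charted Chat hat.linearizationD(1,3)[OF l] hat.bdom_N_open[OF ia]])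
  qed (use p\<rho>_hol in blast)
  moreover have "e \<in> V" "V \<subseteq> U" using e i c unfolding V_def by (auto simp: hat.bat_N base.bat_N)
  moreover have "?i \<in> bat hat.N (\<rho> e') \<and> c \<in> bat base.N (p (\<rho> e')) \<and> snd (descend e') c = w e' ?i" if e': "e' \<in> V" for e'
  proof -
    have b: "?i \<in> bat hat.N (\<rho> e')" "c \<in> bat base.N (p (\<rho> e'))" "e' \<in> U"
      using e' ia ca unfolding V_def by (simp_all add: hat.bat_N base.bat_N)
    have "lift c (\<rho> e') \<in> bat hat.N (\<rho> e')" by (rule lift_bat[OF \<rho>_top[OF b(3)] b(2)])
    then have "w e' (lift c (\<rho> e')) = w e' ?i"
      using b(1) unfolding lift_def by (rule fibre_same_coordinates[OF _ _ hat.linearizationD(5)[OF l b(3)]])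
    then show ?thesis using b by (simp add: descend_def)
  qed
  ultimately show ?thesis by blast
qed

lemma base_bat: "x \<in> topspace (mtop C) \<Longrightarrow> bat base.N x \<noteq> {}"
  using p_surj ne push_exists by (metis all_not_in_conv)

lemma descend_hol:
  assumes e: "e \<in> U"
  shows "hol_near Mh T descend e"
proof -
  obtain c where c: "c \<in> bat base.N (p (\<rho> e))" using base_bat[OF p_top[OF \<rho>_top[OF e]]] by blast
  obtain V where V: "openin (mtop Mh) V" "e \<in> V" "V \<subseteq> U" "\<forall>e'\<in>V. snd (descend e') c = w e' (lift c (\<rho> e))"
    using descend_local[OF e c] by blast
  have "hol_near Mh euc (\<lambda>e'. w e' (lift c (\<rho> e))) e"
    by (rule hat.linearizationD(6)[OF l e lift_bat[OF \<rho>_top[OF e] c]])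
  then have g: "hol_near Mh euc (\<lambda>e. snd (descend e) c) e"
    by (rule hol_near_cong[OF Mh_charted _ V(1,2)]) (use V(4) in simp)
  have "hol_near Mh T (\<lambda>e. (p (\<rho> e), snd (descend e))) e"
    by (rule hol_near_into_total[OF Mh_charted C base.N_holo_bundle p\<rho>_hol[OF e] c g hat.linearizationD(1)[OF l] e descend_fibre])
  moreover have "(p (\<rho> e), snd (descend e)) = descend e" for e by (simp add: descend_def)
  ultimately show ?thesis by simp
qed

text \<open>Passing from \<open>\<rho> e\<close> to \<open>p (\<rho> e)\<close> loses only the
  position in a fibre of \<open>p\<close>; once that is fixed, injectivity is inherited from the
  linearization.\<close>

lemma descend_inj:
  assumes e: "e \<in> U" "e' \<in> U" "\<rho> e = \<rho> e'" "descend e = descend e'"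
  shows "e = e'"
proof -
  note y = \<rho>_top[OF e(1)]
  obtain c where c: "c \<in> bat base.N (p (\<rho> e))" using base_bat[OF p_top[OF y]] by blast
  have "snd (descend e) c = snd (descend e') c" using e(4) by simp
  then have "w e (lift c (\<rho> e)) = w e' (lift c (\<rho> e))" using c e(3) by (simp add: descend_def)
  then have "w e = w e'"
    using fibre_eqI[OF hat.linearizationD(5)[OF l e(1)] _ lift_bat[OF y c]] hat.linearizationD(5)[OF l e(2)] e(3) by simp
  then show ?thesis using w_inj e by blast
qed

text \<open>Uniqueness identifies the linearization with its transport near \<open>ih y\<close>. In
  the coordinates of \<open>N\<close> this becomes invariance, because deck transformations commute
  with the projection to \<open>M\<close>.\<close>

lemma descend_equivariant:
  assumes d: "deck_transformation Chat p \<sigma>" and y: "y \<in> topspace (mtop Chat)"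
  shows "\<exists>V. openin (mtop Mh) V \<and> ih y \<in> V \<and> V \<subseteq> U \<and> (\<forall>e\<in>V. deck_map \<sigma> e \<in> U \<and> \<rho> (deck_map \<sigma> e) = \<sigma> (\<rho> e) \<and> descend (deck_map \<sigma> e) = descend e)"
proof -
  obtain \<tau> where ti: "deck_transformation Chat p \<tau>" "\<And>y. y \<in> topspace (mtop Chat) \<Longrightarrow> \<tau> (\<sigma> y) = y"
    "\<And>y. y \<in> topspace (mtop Chat) \<Longrightarrow> \<sigma> (\<tau> y) = y" using deck_inverse[OF d] by blast
  interpret deck_pair C M \<iota> Chat p M' \<pi> \<sigma> \<tau> by unfold_locales (use d ti in blast)+
  have "\<exists>V. openin (mtop Mh) V \<and> ih y \<in> V \<and> V \<subseteq> U \<inter> {e \<in> topspace (mtop Mh). deck_map \<sigma> e \<in> U} \<and>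
    (\<forall>e\<in>V. \<rho> e = \<tau> (\<rho> (deck_map \<sigma> e)) \<and> w e = (\<lambda>i. if i \<in> bat hat.N (\<tau> (\<rho> (deck_map \<sigma> e))) then w (deck_map \<sigma> e) (deck_chart \<tau> i) else 0))"
    by (rule hat.linearization_unique[OF l transport[OF l] ne H0T H0N y])
  then obtain V where V: "openin (mtop Mh) V" "ih y \<in> V" "V \<subseteq> U \<inter> {e \<in> topspace (mtop Mh). deck_map \<sigma> e \<in> U}"
    "\<forall>e\<in>V. \<rho> e = \<tau> (\<rho> (deck_map \<sigma> e)) \<and> w e = (\<lambda>i. if i \<in> bat hat.N (\<tau> (\<rho> (deck_map \<sigma> e))) then w (deck_map \<sigma> e) (deck_chart \<tau> i) else 0)"
    by (elim exE conjE) (rule that)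
  have "deck_map \<sigma> e \<in> U \<and> \<rho> (deck_map \<sigma> e) = \<sigma> (\<rho> e) \<and> descend (deck_map \<sigma> e) = descend e" if e: "e \<in> V" for e
  proof -
    have eU: "e \<in> U" "deck_map \<sigma> e \<in> U" using V(3) e by blast+
    note ty = \<rho>_top[OF eU(1)] \<rho>_top[OF eU(2)]
    have 1: "\<rho> e = \<tau> (\<rho> (deck_map \<sigma> e))" using V(4) e by blast
    then have r: "\<rho> (deck_map \<sigma> e) = \<sigma> (\<rho> e)" using ti(3)[OF ty(2)] by simp
    have pr: "p (\<rho> (deck_map \<sigma> e)) = p (\<rho> e)" using deck_facts(2)[OF d ty(1)] r by simp
    have "w (deck_map \<sigma> e) (lift c (\<rho> (deck_map \<sigma> e))) = w e (lift c (\<rho> e))" if c: "c \<in> bat base.N (p (\<rho> e))" for c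
    proof -
      have lb: "lift c (\<rho> e) \<in> bat hat.N (\<rho> e)" by (rule lift_bat[OF ty(1) c])
      have "w e = (\<lambda>i. if i \<in> bat hat.N (\<rho> e) then w (deck_map \<sigma> e) (deck_chart \<tau> i) else 0)"
        using conjunct2[OF bspec[OF V(4) e]] unfolding 1[symmetric] .
      then have "w e (lift c (\<rho> e)) = (if lift c (\<rho> e) \<in> bat hat.N (\<rho> e) then w (deck_map \<sigma> e) (deck_chart \<tau> (lift c (\<rho> e))) else 0)"
        by (rule fun_cong)
      then have we: "w e (lift c (\<rho> e)) = w (deck_map \<sigma> e) (deck_chart \<tau> (lift c (\<rho> e)))" using lb by simp
      have b1: "deck_chart \<tau> (lift c (\<rho> e)) \<in> bat hat.N (\<rho> (deck_map \<sigma> e))" using deck_chart_bat[OF ty(1) lb] r by simp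
      have b2: "lift c (\<rho> (deck_map \<sigma> e)) \<in> bat hat.N (\<rho> (deck_map \<sigma> e))" by (rule lift_bat[OF ty(2)]) (use c pr in simp)
      \<comment> \<open>Deck maps leave the first component unchanged, so both charts have the
        coordinate map \<open>snd c \<circ> fst\<close> and can differ only in their
        domains.\<close>
      obtain V1 V2 where V12: "deck_chart \<tau> (lift c (\<rho> e)) = (V1, snd c \<circ> fst)" "lift c (\<rho> (deck_map \<sigma> e)) = (V2, snd c \<circ> fst)"
        by (simp add: deck_chart_def lift_def deck_map_def comp_def)
      have "w (deck_map \<sigma> e) (V1, snd c \<circ> fst) = w (deck_map \<sigma> e) (V2, snd c \<circ> fst)"
        by (rule fibre_same_coordinates[OF b1[unfolded V12] b2[unfolded V12] hat.linearizationD(5)[OF l eU(2)]])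
      then show ?thesis unfolding we V12 by simp
    qed
    then have "descend (deck_map \<sigma> e) = descend e" unfolding descend_def pr by (simp add: fun_eq_iff)
    then show ?thesis using r eU by blast
  qed
  then show ?thesis using V(1-3) by blast
qed

lemma descend_ih:
  assumes y: "y \<in> topspace (mtop Chat)"
  shows "descend (ih y) = zero_section (p y)"
proof -
  have "w (ih y) (lift c y) = 0" if "c \<in> bat base.N (p y)" for c
    by (rule hat.linearizationD(7)[OF l y lift_bat[OF y that]])
  then show ?thesis using hat.linearizationD(4)[OF l y] by (simp add: descend_def zero_section_def fun_eq_iff)
qed

text \<open>In the chosen charts the derivative is block triangular: its normal block is the
  identity by the normalization, tangential vectors get no normal component because
  \<open>Chat\<close> goes to the zero section, and the tangential block is onto because
  \<open>p\<close> is locally invertible. Such a map is injective.\<close>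

lemma descend_local_biholo:
  assumes y: "y \<in> topspace (mtop Chat)"
  shows "local_biholo Mh T descend (ih y)"
proof -
  let ?x = "p y"
  have x: "?x \<in> topspace (mtop C)" by (rule p_top[OF y])
  have yU: "ih y \<in> U" "\<rho> (ih y) = y" using hat.linearizationD(2,4)[OF l y] by simp_all
  obtain c where c: "c \<in> bat base.N ?x" using base_bat[OF x] by blast
  obtain c1 where c1: "c1 \<in> atlas C" "?x \<in> fst c1" using charted_cover[OF C x] by blast
  have c1m: "c1 \<in> max_atlas C" by (rule atlas_subset_max_atlas[OF C c1(1)])
  have c1ch: "is_chart (mtop C) c1" by (rule max_atlas_is_chart[OF c1m])
  let ?i = "lift c y"
  have i: "?i \<in> bat hat.N y" by (rule lift_bat[OF y c])
  have ia: "?i \<in> adapted_charts Chat Mh ih" "ih y \<in> fst ?i" using i by (simp_all add: hat.bat_N)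
  have im: "?i \<in> max_atlas Mh" by (rule hat.adapted_max[OF ia(1)])
  have ich: "is_chart (mtop Mh) ?i" by (rule max_atlas_is_chart[OF im])
  let ?t = "total_chart base.N c1 c"
  have ca: "c \<in> adapted_charts C M \<iota>" "\<iota> ?x \<in> fst c" using c by (simp_all add: base.bat_N)
  have t: "?t \<in> max_atlas T" using total_chart_in_atlas[OF C base.N_holo_bundle c1(1)] ca by simp
  have tT: "snd ?t e = inl (snd c1 (fst e)) + inr (snd e c)" for e by (cases e) (simp only: total_chart_simps fst_conv snd_conv)
  have Tt: "descend (ih y) \<in> fst ?t"
    using descend_fibre[OF yU(1)] yU(2) c1(2) ca x unfolding total_chart_simps by (auto simp: descend_def)
  let ?F = "\<lambda>z. snd ?t (descend (chart_inv ?i z))" and ?z = "snd ?i (ih y)"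
  have "hol_near euc euc ?F ?z"
    by (rule hol_near_euc_rep[OF Mh_charted T_charted descend_hol[OF yU(1)] im ia(2) t Tt])
  then obtain S where S: "open S" "?z \<in> S" "holo_vec_on S ?F" unfolding hol_near_euc by (elim exE conjE) (rule that)
  have iz: "chart_inv ?i ?z = ih y" by (rule chart_inv_left[OF ich ia(2)])
  obtain V where V: "openin (mtop Mh) V" "ih y \<in> V" "V \<subseteq> U"
    "\<forall>e\<in>V. ?i \<in> bat hat.N (\<rho> e) \<and> snd (descend e) c = w e ?i"
    using descend_local[OF yU(1), unfolded yU(2), OF c] by blast
  have F0: "prr (?F ?z) = 0" unfolding tT iz descend_ih[OF y] by (simp add: zero_section_def)
  have ray: "\<forall>\<^sub>F t in at 0. chart_inv ?i (?z + t *s e) \<in> V" for e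
    by (rule hat.approachesD[OF hat.approaches_ray[OF i] V(1,2)])
  have prrF: "prr (?F z) = w (chart_inv ?i z) ?i" if "chart_inv ?i z \<in> V" for z
    using V(4) that by (simp add: tT)
  have lin: "linear (vder ?F ?z)" using vder_linear[OF S(3,2)] bounded_linear.linear by blast
  have 1: "prr (vder ?F ?z (inr b)) = b" for b
  proof (rule vder_by_limit[OF S(3,2) block_bounded_linear(4)])
    have lim: "((\<lambda>t. inverse t *s w (chart_inv ?i (?z + t *s inr b)) ?i) \<longlongrightarrow> b) (at 0)"
      by (rule hat.linearizationD(8)[OF l y i])
    have "\<forall>\<^sub>F t in at 0. inverse t *s w (chart_inv ?i (?z + t *s inr b)) ?i = prr (inverse t *s (?F (?z + t *s inr b) - ?F ?z))"
      using ray[of "inr b"]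
    proof eventually_elim
      fix t assume "chart_inv ?i (?z + t *s inr b) \<in> V"
      from prrF[OF this] show "inverse t *s w (chart_inv ?i (?z + t *s inr b)) ?i = prr (inverse t *s (?F (?z + t *s inr b) - ?F ?z))"
        using F0 by (simp only: block_linear diff_zero)
    qed
    then show "((\<lambda>t. prr (inverse t *s (?F (?z + t *s inr b) - ?F ?z))) \<longlongrightarrow> b) (at 0)"
      by (rule Lim_transform_eventually[OF lim])
  qed
  \<comment> \<open>A small tangential displacement stays on the image of \<open>Chat\<close>, where
    \<open>w\<close> vanishes.\<close>
  have 2: "prr (vder ?F ?z (inl a)) = 0" for a
  proof (rule vder_by_limit[OF S(3,2) block_bounded_linear(4)])
    have "\<forall>\<^sub>F t in at 0. ?z + t *s inl a \<in> snd ?i ` fst ?i"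
      by (rule eventually_slice[OF chart_image_open[OF ich]]) (use ia in blast)
    then have "\<forall>\<^sub>F t in at 0. 0 = prr (inverse t *s (?F (?z + t *s inl a) - ?F ?z))"
      using ray[of "inl a"]
    proof eventually_elim
      fix t assume zt: "?z + t *s inl a \<in> snd ?i ` fst ?i" and mV: "chart_inv ?i (?z + t *s inl a) \<in> V"
      let ?m = "chart_inv ?i (?z + t *s inl a)"
      have "prr ?z = 0" using hat.adapted_slice[OF ia] y by blast
      then have "prr (snd ?i ?m) = 0" by (simp add: chart_inv_right[OF zt])
      then obtain y' where y': "y' \<in> topspace (mtop Chat)" "?m = ih y'"
        using hat.adapted_slice[OF ia(1) chart_inv_in[OF zt]] by blast
      have "?i \<in> bat hat.N (\<rho> ?m)" using V(4) mV by blast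
      then have "?i \<in> bat hat.N y'" using hat.linearizationD(4)[OF l y'(1)] y'(2) by simp
      then have "w ?m ?i = 0" using hat.linearizationD(7)[OF l y'(1)] y'(2) by simp
      then have "prr (?F (?z + t *s inl a)) = 0" using prrF[OF mV] by simp
      then show "0 = prr (inverse t *s (?F (?z + t *s inl a) - ?F ?z))"
        using F0 by (simp only: block_linear diff_zero vector_smult_rzero)
    qed
    then show "((\<lambda>t. prr (inverse t *s (?F (?z + t *s inl a) - ?F ?z))) \<longlongrightarrow> 0) (at 0)"
      by (rule Lim_transform_eventually[OF tendsto_const])
  qed
  \<comment> \<open>A local inverse \<open>q\<close> of \<open>p\<close> parametrizes
    \<open>Chat\<close> by base coordinates, and the composition with \<open>?F\<close> returns the
    parameter as base coordinate. Differentiating it gives a preimage of \<open>a\<close>, which is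
    tangential because the normal part of \<open>?k\<close> vanishes.\<close>
  have 3: "\<exists>a'. prl (vder ?F ?z (inl a')) = a" for a
  proof -
    obtain E W q where q: "openin (mtop Chat) W" "y \<in> W"
      "(\<forall>x\<in>E. hol_near C Chat q x \<and> q x \<in> W \<and> p (q x) = x) \<and> (\<forall>y\<in>W. p y \<in> E \<and> q (p y) = y)" and E: "openin (mtop C) E"
      using sheet[OF y] by (elim exE conjE) (rule that, (assumption | rule conjI)+)
    have xE: "?x \<in> E" "q ?x = y" using q(2,3) by blast+
    let ?\<zeta> = "snd c1 ?x"
    let ?q = "\<lambda>\<zeta>. ih (q (chart_inv c1 \<zeta>))"
    have ci: "chart_inv c1 ?\<zeta> = ?x" by (rule chart_inv_left[OF c1ch c1(2)])
    have h1: "hol_near euc Chat (\<lambda>\<zeta>. q (chart_inv c1 \<zeta>)) ?\<zeta>"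
      by (rule hol_near_comp[OF charted_euc C Chat hol_near_chart_inv[OF C c1m]]) (use c1(2) ci q(3) xE in auto)
    have h2: "hol_near euc Mh ?q ?\<zeta>"
      by (rule hol_near_comp[OF charted_euc Chat Mh_charted h1]) (use ci xE y ih_hol in simp)
    have q0: "?q ?\<zeta> = ih y" using ci xE by simp
    have "hol_near euc euc (\<lambda>\<zeta>. snd ?i (?q \<zeta>)) ?\<zeta>"
      by (rule hol_near_comp[OF charted_euc Mh_charted charted_euc h2]) (use q0 hol_near_chart[OF Mh_charted im ia(2)] in simp)
    then obtain R where R: "open R" "?\<zeta> \<in> R" "holo_vec_on R (\<lambda>\<zeta>. snd ?i (?q \<zeta>))"
      unfolding hol_near_euc by (elim exE conjE) (rule that)
    obtain P where P: "openin (mtop euc) P" "?\<zeta> \<in> P" "?q ` P \<subseteq> fst ?i"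
      using hol_near_continuous[OF charted_euc Mh_charted h2 max_atlas_open[OF im]] q0 ia(2) by metis
    have oE: "open (snd c1 ` (fst c1 \<inter> E))"
      by (rule chart_open_map[OF c1ch openin_Int[OF chart_open[OF c1ch] E]]) blast
    let ?P = "P \<inter> snd c1 ` (fst c1 \<inter> E)"
    have oP: "open ?P" "?\<zeta> \<in> ?P" using P oE c1(2) xE by auto
    have inP: "prr (snd ?i (?q \<zeta>)) = 0" "prl (?F (snd ?i (?q \<zeta>))) = \<zeta>" if \<zeta>: "\<zeta> \<in> ?P" for \<zeta>
    proof -
      obtain x' where x': "x' \<in> fst c1" "x' \<in> E" "\<zeta> = snd c1 x'" using \<zeta> by blast
      have cx: "chart_inv c1 \<zeta> = x'" using chart_inv_left[OF c1ch x'(1)] x'(3) by simp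
      have qx: "q x' \<in> topspace (mtop Chat)" "p (q x') = x'" using q(3) x'(2) openin_subset[OF q(1)] by blast+
      have iq: "ih (q x') \<in> fst ?i" using P(3) \<zeta> cx by (simp add: image_subset_iff) (metis IntD1)
      show "prr (snd ?i (?q \<zeta>)) = 0" using hat.adapted_slice[OF ia(1) iq] qx(1) cx by simp
      have "chart_inv ?i (snd ?i (?q \<zeta>)) = ih (q x')" using chart_inv_left[OF ich iq] cx by simp
      then show "prl (?F (snd ?i (?q \<zeta>))) = \<zeta>"
        using descend_ih[OF qx(1)] qx(2) x'(3) by (simp add: tT zero_section_def)
    qed
    let ?k = "\<lambda>\<zeta>. snd ?i (?q \<zeta>)"
    have k0: "?k ?\<zeta> = ?z" using q0 by simp
    have kz: "prr (vder ?k ?\<zeta> a) = 0"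
    proof (rule vder_by_limit[OF R(3,2) block_bounded_linear(4)])
      have "\<forall>\<^sub>F t in at 0. 0 = prr (inverse t *s (?k (?\<zeta> + t *s a) - ?k ?\<zeta>))"
        using eventually_slice[OF oP, of a]
      proof eventually_elim
        fix t assume "?\<zeta> + t *s a \<in> ?P"
        from inP(1)[OF this] inP(1)[OF oP(2)]
        show "0 = prr (inverse t *s (?k (?\<zeta> + t *s a) - ?k ?\<zeta>))" by (simp only: block_linear diff_zero vector_smult_rzero)
      qed
      then show "((\<lambda>t. prr (inverse t *s (?k (?\<zeta> + t *s a) - ?k ?\<zeta>))) \<longlongrightarrow> 0) (at 0)"
        by (rule Lim_transform_eventually[OF tendsto_const])
    qed
    let ?R = "R \<inter> ?k -` S"
    have oR: "open ?R" using continuous_open_preimage[OF holo_vec_on_imp_continuous_on[OF R(3)] R(1) S(1)] .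
    have zR: "?\<zeta> \<in> ?R" using R(2) S(2) k0 by simp
    have kR: "holo_vec_on ?R ?k" by (rule holo_vec_on_subset[OF R(3)]) blast
    have comp: "holo_vec_on ?R (\<lambda>\<zeta>. ?F (?k \<zeta>))" by (rule holo_vec_on_compose[OF S(3) kR]) blast
    have "prl (vder (\<lambda>\<zeta>. ?F (?k \<zeta>)) ?\<zeta> a) = a"
    proof (rule vder_by_limit[OF comp zR block_bounded_linear(3)])
      have "\<forall>\<^sub>F t in at 0. a = prl (inverse t *s (?F (?k (?\<zeta> + t *s a)) - ?F (?k ?\<zeta>)))"
        using eventually_slice[OF oP, of a] eventually_neq_at_within[of 0 0 UNIV]
      proof eventually_elim
        fix t :: complex assume "?\<zeta> + t *s a \<in> ?P" and t0: "t \<noteq> 0"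
        then have "prl (?F (?k (?\<zeta> + t *s a))) - prl (?F (?k ?\<zeta>)) = t *s a"
          using inP(2) oP(2) by (simp only: add_diff_cancel_left')
        then show "a = prl (inverse t *s (?F (?k (?\<zeta> + t *s a)) - ?F (?k ?\<zeta>)))"
          by (simp only: block_linear vector_smult_assoc left_inverse[OF t0] vector_smult_lid)
      qed
      then show "((\<lambda>t. prl (inverse t *s (?F (?k (?\<zeta> + t *s a)) - ?F (?k ?\<zeta>)))) \<longlongrightarrow> a) (at 0)"
        by (rule Lim_transform_eventually[OF tendsto_const])
    qed
    moreover have "vder (\<lambda>\<zeta>. ?F (?k \<zeta>)) ?\<zeta> a = vder ?F (?k ?\<zeta>) (vder ?k ?\<zeta> a)"
      by (rule vder_compose[OF S(3) kR zR]) (use zR in blast)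
    moreover have "vder ?k ?\<zeta> a = inl (prl (vder ?k ?\<zeta> a))"
      using block_simps2(5)[of "vder ?k ?\<zeta> a"] unfolding kz by simp
    ultimately show ?thesis unfolding k0 by metis
  qed
  let ?L = "\<lambda>a. prl (vder ?F ?z (inl a))"
  have "bounded_linear ?L"
    by (rule bounded_linear_compose[OF block_bounded_linear(3) bounded_linear_compose[OF vder_linear[OF S(3,2)] block_bounded_linear(1)]])
  then have Ll: "linear ?L" by (rule bounded_linear.linear)
  have "surj ?L" unfolding surj_def using 3 by metis
  then have Li: "inj ?L" by (rule linear_surjective_imp_injective[OF Ll]) (rule refl)
  show ?thesis
  proof (rule local_biholo_inverse_function[OF Mh_charted T_charted descend_hol[OF yU(1)] im ia(2) t Tt])
    fix v assume v: "vder ?F ?z v = 0"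
    have sum0: "vder ?F ?z (inl (prl v)) + vder ?F ?z (inr (prr v)) = 0"
      using linear_add[OF lin, of "inl (prl v)" "inr (prr v)"] v by (simp only: block_simps2(5))
    from sum0 have s: "vder ?F ?z (inl (prl v)) = - vder ?F ?z (inr (prr v))" by (rule eq_neg_iff_add_eq_0[THEN iffD2])
    have "prr (vder ?F ?z (inl (prl v))) + prr (vder ?F ?z (inr (prr v))) = 0"
      using arg_cong[OF sum0, of prr] by (simp only: block_linear(2) block_simps2(9))
    then have b0: "prr v = 0" unfolding 1 2 by simp
    then have "vder ?F ?z (inl (prl v)) = 0" using s linear_0[OF lin] by simp
    then have "?L (prl v) = ?L 0" using linear_0[OF lin] by simp
    then have "prl v = 0" by (rule injD[OF Li])
    then show "v = 0" using b0 block_simps2(5)[of v] by simp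
  qed
qed

lemma descends: "biholomorphic_nbhds C M \<iota> T zero_section"
proof -
  obtain G where G: "finite G" "\<And>\<sigma>. \<sigma> \<in> G \<Longrightarrow> deck_transformation Chat p \<sigma>"
    "\<And>y y'. y \<in> topspace (mtop Chat) \<Longrightarrow> y' \<in> topspace (mtop Chat) \<Longrightarrow> p y = p y' \<Longrightarrow> \<exists>\<sigma>\<in>G. \<sigma> y = y'"
    using deck_group by metis
  \<comment> \<open>This set and the next ones are unions of the neighborhoods found point by point,
    hence open sets containing the whole image of \<open>Chat\<close>.\<close>
  define L where "L = \<Union>{V. openin (mtop Mh) V \<and> V \<subseteq> U \<and> (\<forall>e\<in>V. local_biholo Mh T descend e)}"
  define O\<^sub>\<sigma> where "O\<^sub>\<sigma> \<sigma> = \<Union>{V. openin (mtop Mh) V \<and> V \<subseteq> U \<and> (\<forall>e\<in>V. deck_map \<sigma> e \<in> U \<and> \<rho> (deck_map \<sigma> e) = \<sigma> (\<rho> e) \<and> descend (deck_map \<sigma> e) = descend e)}" for \<sigma>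
  \<comment> \<open>Finiteness of \<open>G\<close> keeps the intersection open; the factor
    \<open>topspace (mtop Mh)\<close> covers the case of an empty \<open>G\<close>.\<close>
  define W where "W = ((\<Inter>\<sigma>\<in>G. O\<^sub>\<sigma> \<sigma>) \<inter> topspace (mtop Mh)) \<inter> L"
  have oL: "openin (mtop Mh) L" unfolding L_def by (rule openin_Union) blast
  have oO: "openin (mtop Mh) (O\<^sub>\<sigma> \<sigma>)" for \<sigma> unfolding O\<^sub>\<sigma>_def by (rule openin_Union) blast
  have oW: "openin (mtop Mh) W"
    unfolding W_def by (intro openin_Int[OF openin_INT[OF G(1)] oL] oO)
  have WL: "e \<in> U" "local_biholo Mh T descend e" if "e \<in> W" for e using that unfolding W_def L_def by blast+
  have WO: "deck_map \<sigma> e \<in> U" "\<rho> (deck_map \<sigma> e) = \<sigma> (\<rho> e)" "descend (deck_map \<sigma> e) = descend e" if "e \<in> W" "\<sigma> \<in> G" for e \<sigma>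
    using that unfolding W_def O\<^sub>\<sigma>_def by blast+
  have ihW: "ih y \<in> W" if y: "y \<in> topspace (mtop Chat)" for y
  proof -
    have "ih y \<in> O\<^sub>\<sigma> \<sigma>" if "\<sigma> \<in> G" for \<sigma>
      using descend_equivariant[OF G(2)[OF that] y] unfolding O\<^sub>\<sigma>_def by blast
    moreover have "ih y \<in> L"
    proof -
      obtain V where V: "openin (mtop Mh) V" "ih y \<in> V" "\<And>e. e \<in> V \<Longrightarrow> local_biholo Mh T descend e"
        using local_biholo_ev[OF descend_local_biholo[OF y]] by metis
      have "openin (mtop Mh) (V \<inter> U)" using V(1) hat.linearizationD(1)[OF l] by (rule openin_Int)
      then show ?thesis using V hat.linearizationD(2)[OF l y] unfolding L_def by blast
    qed
    ultimately show ?thesis using ih_top[OF y] unfolding W_def by blast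
  qed
  \<comment> \<open>Points of \<open>W\<close> over one point of \<open>M\<close> differ by an
    element of \<open>G\<close>, since the cover is Galois; invariance of \<open>descend\<close>
    makes the map on \<open>M\<close> well defined.\<close>
  have same: "descend e = descend e'" if e: "e \<in> W" "e' \<in> W" "fst e = fst e'" for e e'
  proof -
    have top: "e \<in> topspace (mtop Mh)" "e' \<in> topspace (mtop Mh)" using U_top[OF WL(1)] e by blast+
    then have "snd e \<in> topspace (mtop Chat)" "snd e' \<in> topspace (mtop Chat)" "p (snd e) = p (snd e')"
      using e(3) unfolding Mh_topspace by auto
    from G(3)[OF this] obtain \<sigma> where s: "\<sigma> \<in> G" "\<sigma> (snd e) = snd e'" by blast
    then have "deck_map \<sigma> e = e'" using e(3) by (simp add: deck_map_def prod_eq_iff)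
    then show ?thesis using WO(3)[OF e(1) s(1)] by simp
  qed
  \<comment> \<open>Equal values have base points in one fibre of \<open>p\<close>. An element of
    \<open>G\<close> moves \<open>\<rho> e\<close> to \<open>\<rho> e'\<close>, after which
    \<open>descend_inj\<close> applies; the two points then have the same projection to
    \<open>M\<close>.\<close>
  have inj: "fst e = fst e'" if e: "e \<in> W" "e' \<in> W" "descend e = descend e'" for e e'
  proof -
    have "p (\<rho> e) = p (\<rho> e')" using e(3) by (simp add: descend_def)
    from G(3)[OF \<rho>_top[OF WL(1)[OF e(1)]] \<rho>_top[OF WL(1)[OF e(2)]] this]
    obtain \<sigma> where s: "\<sigma> \<in> G" "\<sigma> (\<rho> e) = \<rho> e'" by blast
    have "deck_map \<sigma> e = e'"
      by (rule descend_inj[OF WO(1)[OF e(1) s(1)] WL(1)[OF e(2)]]) (use WO(2,3)[OF e(1) s(1)] s(2) e(3) in simp_all)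
    then show ?thesis by (auto simp: deck_map_def)
  qed
  define A where "A = fst ` W"
  \<comment> \<open>An arbitrary preimage in \<open>W\<close> is used; by \<open>same\<close> the
    choice does not matter.\<close>
  define \<Theta> where "\<Theta> m = descend (SOME e. e \<in> W \<and> fst e = m)" for m
  have \<Theta>: "\<Theta> (fst e) = descend e" if "e \<in> W" for e
  proof -
    have "(SOME e'. e' \<in> W \<and> fst e' = fst e) \<in> W \<and> fst (SOME e'. e' \<in> W \<and> fst e' = fst e) = fst e"
      by (rule someI[of _ e]) (use that in simp)
    then show ?thesis unfolding \<Theta>_def using same that by blast
  qed
  have sec: "\<exists>Q s W'. is_section Q W' s \<and> fst e \<in> Q \<and> (fst e, s (fst e)) = e \<and> openin (mtop M) {m \<in> Q. (m, s m) \<in> W}" if e: "e \<in> W" for e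
    using ex_section[OF U_top[OF WL(1)[OF e]]] section_cont[OF _ oW] by blast
  have oA: "openin (mtop M) A"
  proof (subst openin_subopen, rule ballI)
    fix m assume "m \<in> A"
    then obtain e where e: "e \<in> W" "m = fst e" unfolding A_def by blast
    obtain Q s W' where s: "is_section Q W' s" "fst e \<in> Q" "(fst e, s (fst e)) = e" "openin (mtop M) {m \<in> Q. (m, s m) \<in> W}"
      using sec[OF e(1)] by blast
    have "{m \<in> Q. (m, s m) \<in> W} \<subseteq> A" unfolding A_def by (auto intro: image_eqI[of _ fst "(_, _)"])
    then show "\<exists>T. openin (mtop M) T \<and> m \<in> T \<and> T \<subseteq> A" using s e by (intro exI[of _ "{m \<in> Q. (m, s m) \<in> W}"]) simp
  qed
  have \<Theta>_local_biholo: "local_biholo M T \<Theta> m" if m: "m \<in> A" for m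
  proof -
    obtain e where e: "e \<in> W" "m = fst e" using m unfolding A_def by blast
    obtain Q s W' where s: "is_section Q W' s" "fst e \<in> Q" "(fst e, s (fst e)) = e" "openin (mtop M) {m \<in> Q. (m, s m) \<in> W}"
      using sec[OF e(1)] by blast
    \<comment> \<open>Near \<open>m\<close> the map is \<open>descend\<close> along a local branch
      that stays in \<open>W\<close>, a composition of local biholomorphisms.\<close>
    have "local_biholo M T (\<lambda>m. descend (m, s m)) m"
      by (rule local_biholo_comp[OF M Mh_charted T_charted section_local_biholo[OF s(1)]]) (use s e WL(2)[OF e(1)] in simp_all)
    then show ?thesis
    proof (rule local_biholo_cong[OF M T_charted _ s(4)])
      show "m \<in> {m \<in> Q. (m, s m) \<in> W}" using s e by simp
      fix m' assume "m' \<in> {m \<in> Q. (m, s m) \<in> W}"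
      then show "descend (m', s m') = \<Theta> m'" using \<Theta>[of "(m', s m')"] by simp
    qed
  qed
  have "inj_on \<Theta> A"
  proof (rule inj_onI)
    fix m m' assume "m \<in> A" "m' \<in> A" and eq: "\<Theta> m = \<Theta> m'"
    then obtain e e' where e: "e \<in> W" "e' \<in> W" "m = fst e" "m' = fst e'" unfolding A_def by blast
    then have "descend e = descend e'" using eq \<Theta>[OF e(1)] \<Theta>[OF e(2)] by simp
    from inj[OF e(1,2) this] show "m = m'" using e(3,4) by simp
  qed
  note glue = biholomorphism_glue[OF M T_charted oA this \<Theta>_local_biholo]
  have \<iota>A: "\<iota> x \<in> A \<and> \<Theta> (\<iota> x) = zero_section x" if x: "x \<in> topspace (mtop C)" for x
  proof -
    obtain y where y: "y \<in> topspace (mtop Chat)" "p y = x" using p_surj[OF x] by blast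
    have "fst (ih y) = \<iota> x" using y by (simp add: ih_simp)
    then show ?thesis using \<Theta>[OF ihW[OF y(1)]] descend_ih[OF y(1)] ihW[OF y(1)] y(2) unfolding A_def by force
  qed
  show ?thesis
    unfolding biholomorphic_nbhds_def
  proof (intro exI conjI ballI)
    show "openin (mtop M) A" by (rule oA)
    show "openin (mtop T) (\<Theta> ` A)" by (rule glue(1))
    show "biholomorphism (open_submfd M A) (open_submfd T (\<Theta> ` A)) \<Theta>" by (rule glue(2))
    show "\<iota> ` topspace (mtop C) \<subseteq> A" using \<iota>A by blast
    show "zero_section ` topspace (mtop C) \<subseteq> \<Theta> ` A" using \<iota>A by (metis image_eqI image_subsetI)
    show "\<Theta> (\<iota> x) = zero_section x" if "x \<in> topspace (mtop C)" for x using \<iota>A[OF that] by blast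
  qed
qed

end

theorem theorem1p1:
  fixes C :: "('c, 'n::finite) cmfd" and M :: "('m, 'n + 'd::finite) cmfd"
    and \<iota> :: "'c \<Rightarrow> 'm"
    and Chat :: "('h, 'n) cmfd" and p :: "'h \<Rightarrow> 'c"
    and M' :: "'m set" and \<pi> :: "'m \<Rightarrow> 'c"
    and Mhat :: "('m \<times> 'h, 'n + 'd) cmfd" and \<iota>hat :: "'h \<Rightarrow> 'm \<times> 'h"
    and Nhat :: "('h, ('m \<times> 'h, 'n + 'd) chart, 'd) vbundle"
  assumes "complex_manifold C" and "connected_space (mtop C)"
    and "complex_manifold M" and "holomorphic_embedding C M \<iota>"
    and "hermitian_flat C (normal_bundle C M \<iota>)"
    and "complex_manifold Chat" and "connected_space (mtop Chat)"
    and "finite_galois_cover Chat C p"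
    and "openin (mtop M) M'" and "\<iota> ` topspace (mtop C) \<subseteq> M'"
    and "smooth_retraction C (open_submfd M M') \<iota> \<pi>"
    and "Mhat = induced_nbhd (open_submfd M M') Chat \<pi> p"
    and "\<iota>hat = induced_embedding \<iota> p"
    and "Nhat = normal_bundle Chat Mhat \<iota>hat"
    and "biholomorphic_nbhds Chat Mhat \<iota>hat (total_space Chat Nhat) zero_section"
    and "\<And>l. l \<ge> 1 \<Longrightarrow> H0_vanishes (mtop Chat) (sym_sections Chat (tangent_bundle Chat) Nhat l)"
    and "\<And>l. l \<ge> 1 \<Longrightarrow> H1_vanishes (mtop Chat) (sym_sections Chat (tangent_bundle Chat) Nhat l)"
    and "\<And>l. l \<ge> 2 \<Longrightarrow> H0_vanishes (mtop Chat) (sym_sections Chat Nhat Nhat l)"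
    and "\<And>l. l \<ge> 2 \<Longrightarrow> H1_vanishes (mtop Chat) (sym_sections Chat Nhat Nhat l)"
  shows "biholomorphic_nbhds C M \<iota> (total_space C (normal_bundle C M \<iota>)) zero_section"
proof -
  interpret cov: covering C M \<iota> Chat p M' \<pi>
    using assms(1,3,4,6-11) by unfold_locales
      (simp_all add: complex_manifold_charted holomorphic_embedding_def)
  have hats: "Mhat = cov.Mh" "\<iota>hat = cov.ih" "Nhat = cov.hat.N"
    using assms(12-14) by (simp_all add: cov.Mh_def cov.ih_def)
  obtain U \<rho> w where l: "cov.hat.linearization U \<rho> w"
      "\<And>m m'. m \<in> U \<Longrightarrow> m' \<in> U \<Longrightarrow> \<rho> m = \<rho> m' \<Longrightarrow> w m = w m' \<Longrightarrow> m = m'"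
      "\<And>y. y \<in> topspace (mtop Chat) \<Longrightarrow> bat cov.hat.N y \<noteq> {}"
    using cov.hat.linearization_exists[OF assms(15)[unfolded hats]] by blast
  interpret descent C M \<iota> Chat p M' \<pi> U \<rho> w
    using l assms(16,18) unfolding hats by unfold_locales
  show ?thesis by (rule descends)
qed

end
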